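(* Let $(\xi_k)_{k\in\mathbb{Z}}$ be a sequence of independent and identically distributed centered (integrable, mean zero) random variables with $\mathbb{E}(\xi_0^2)=\infty$. Let $H_0$, $H$ be the functions associated with $\xi_0$ in the context. For a real sequence $(a_j)_{j\in\mathbb{Z}}$ put $b_{nj}=a_{j+1}+\cdots+a_{j+n}$, $X_k=\sum_{j\in\mathbb{Z}}a_{k+j}\xi_j$, $S_n=\sum_{k=1}^nX_k=\sum_{j\in\mathbb{Z}}b_{nj}\xi_j$ and $$D_n=\inf\Big\{s\ge 1:\ \sum_{k\in\mathbb{Z}}\frac{b_{nk}^2}{s^2}H\Big(\frac{s}{|b_{nk}|}\Big)\le 1\Big\}.$$ Then the following three statements are equivalent: (1) $H_0(x)=\mathbb{E}(\xi_0^2I(|\xi_0|\le x))$ is a slowly varying function at $\infty$. (2) For any sequence of real constants $(a_j)_{j\in\mathbb{Z}}$ satisfying $\sum_{j\in\mathbb{Z}}a_j^2H(|a_j|^{-1})<\infty$ and $\sum_{k\in\mathbb{Z}}b_{nk}^2\to\infty$ as $n\to\infty$, one has $S_n/D_n\Rightarrow N(0,1)$ as $n\to\infty$. (3) For any sequence of real constants $(a_j)_{j\in\mathbb{Z}}$ satisfying $\sum_{j\in\mathbb{Z}}a_j^2H(|a_j|^{-1})<\infty$ and $\sum_{k\in\mathbb{Z}}b_{nk}^2\to\infty$ as $n\to\infty$, one has $$\frac{S_n}{\big(\sum_{k\in\mathbb{Z}}b_{nk}^2\xi_k^2\big)^{1/2}}\Rightarrow N(0,1)\quad\text{as } n\t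o\infty.$$
   Context: $I(A)$ is the indicator of $A$; $\Rightarrow$ denotes convergence in distribution. Set $H_0(x)=\mathbb{E}(\xi_0^2I(|\xi_0|\le x))$ for $x\ge 0$. Since $\mathbb{E}(\xi_0^2)=\infty$, $b=\inf\{x\ge0: H_0(x)>1\}$ is finite; define $H(x)=H_0(\max(x,b+1))$, so that $H(x)\ge 1$ for all $x\ge 0$ and $H(x)=H_0(x)$ for $x>b+1$. Convention on zero coefficients: a term $c^2H(|c|^{-1})$, or $\frac{c^2}{s^2}H(s/|c|)$, is interpreted as $0$ when $c=0$. A function $f$, positive for all large $x$, is slowly varying at $\infty$ if $f(tx)/f(x)\to1$ as $x\to\infty$ for every $t>0$. Almost sure convergence of the random series defining $S_n$ (as $\lim_{M,N\to\infty}\sum_{j=-M}^N$) and of $\sum_k b_{nk}^2\xi_k^2$, and finiteness of $D_n$, are understood to be part of the assertions in (2) and (3) where these quantities appear. *)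

theory Defs
  imports "HOL-Probability.Probability"
begin

definition slowly_varying :: "(real \<Rightarrow> real) \<Rightarrow> bool" where
  "slowly_varying f \<longleftrightarrow>
     (\<forall>\<^sub>F x in at_top. f x > 0) \<and>
     (\<forall>t>0. ((\<lambda>x. f (t * x) / f x) \<longlongrightarrow> 1) at_top)"

text \<open>Bilateral series, as limits of \<open>\<Sum>j=-M..N\<close> with \<open>M\<close> and \<open>N\<close> tending to infinity
  independently of each other.\<close>

definition bilateral_sums :: "(int \<Rightarrow> real) \<Rightarrow> real \<Rightarrow> bool" where
  "bilateral_sums f l \<longleftrightarrow>
     ((\<lambda>(M, N). \<Sum>j = - int M..int N. f j) \<longlongrightarrow> l) (sequentially \<times>\<^sub>F sequentially)"

definition bilateral_summable :: "(int \<Rightarrow> real) \<Rightarrow> bool" where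
  "bilateral_summable f \<longleftrightarrow> (\<exists>l. bilateral_sums f l)"

definition bilateral_sum :: "(int \<Rightarrow> real) \<Rightarrow> real" where
  "bilateral_sum f = (if bilateral_summable f then (THE l. bilateral_sums f l) else 0)"

definition trunc_moment :: "'a measure \<Rightarrow> ('a \<Rightarrow> real) \<Rightarrow> real \<Rightarrow> real" where
  "trunc_moment M Z x = (\<integral>\<omega>. (Z \<omega>)\<^sup>2 * indicator {\<omega>. \<bar>Z \<omega>\<bar> \<le> x} \<omega> \<partial>M)"

definition trunc_threshold :: "'a measure \<Rightarrow> ('a \<Rightarrow> real) \<Rightarrow> real" where
  "trunc_threshold M Z = Inf {x. x \<ge> 0 \<and> trunc_moment M Z x > 1}"

definition H_fun :: "'a measure \<Rightarrow> ('a \<Rightarrow> real) \<Rightarrow> real \<Rightarrow> real" where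
  "H_fun M Z x = trunc_moment M Z (max x (trunc_threshold M Z + 1))"

definition b_coeff :: "(int \<Rightarrow> real) \<Rightarrow> nat \<Rightarrow> int \<Rightarrow> real" where
  "b_coeff a n j = (\<Sum>i = 1..n. a (j + int i))"

text \<open>In the second condition the series is a genuine one: \<open>H \<ge> 1\<close>, so the first condition
  makes \<open>a\<close>, and hence each \<open>b_coeff a n\<close>, square summable.\<close>

definition admissible :: "(real \<Rightarrow> real) \<Rightarrow> (int \<Rightarrow> real) \<Rightarrow> bool" where
  "admissible H a \<longleftrightarrow>
     (\<lambda>j. if a j = 0 then 0 else (a j)\<^sup>2 * H (inverse \<bar>a j\<bar>)) summable_on UNIV \<and>
     filterlim (\<lambda>n. \<Sum>\<^sub>\<infinity>k. (b_coeff a n k)\<^sup>2) at_top sequentially"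

definition X_proc :: "(int \<Rightarrow> 'a \<Rightarrow> real) \<Rightarrow> (int \<Rightarrow> real) \<Rightarrow> nat \<Rightarrow> 'a \<Rightarrow> real" where
  "X_proc \<xi> a k \<omega> = bilateral_sum (\<lambda>j. a (int k + j) * \<xi> j \<omega>)"

definition S_proc :: "(int \<Rightarrow> 'a \<Rightarrow> real) \<Rightarrow> (int \<Rightarrow> real) \<Rightarrow> nat \<Rightarrow> 'a \<Rightarrow> real" where
  "S_proc \<xi> a n \<omega> = (\<Sum>k = 1..n. X_proc \<xi> a k \<omega>)"

text \<open>The series defining the \<open>X_proc\<close> converge almost surely, and \<open>S_proc \<xi> a n\<close> is almost surely
  the sum of the convergent series with coefficients \<open>b_coeff a n\<close>.\<close>

definition S_converges :: "'a measure \<Rightarrow> (int \<Rightarrow> 'a \<Rightarrow> real) \<Rightarrow> (int \<Rightarrow> real) \<Rightarrow> bool" where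
  "S_converges M \<xi> a \<longleftrightarrow>
     (\<forall>k\<ge>1. AE \<omega> in M. bilateral_summable (\<lambda>j. a (int k + j) * \<xi> j \<omega>)) \<and>
     (\<forall>n\<ge>1. AE \<omega> in M. bilateral_sums (\<lambda>j. b_coeff a n j * \<xi> j \<omega>) (S_proc \<xi> a n \<omega>))"

text \<open>Extended real, so that the infimum of the empty set is \<open>\<infinity>\<close>. A divergent series of
  nonnegative terms is not at most 1, but its \<open>infsum\<close> is 0, hence the summability conjunct.\<close>

definition D_norm :: "(real \<Rightarrow> real) \<Rightarrow> (int \<Rightarrow> real) \<Rightarrow> nat \<Rightarrow> ereal" where
  "D_norm H a n =
     (let t = (\<lambda>s k. if b_coeff a n k = 0 then 0
                     else (b_coeff a n k)\<^sup>2 / s\<^sup>2 * H (s / \<bar>b_coeff a n k\<bar>))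
      in Inf {ereal s | s. s \<ge> 1 \<and> t s summable_on UNIV \<and> (\<Sum>\<^sub>\<infinity>k. t s k) \<le> 1})"

definition V_norm :: "(int \<Rightarrow> 'a \<Rightarrow> real) \<Rightarrow> (int \<Rightarrow> real) \<Rightarrow> nat \<Rightarrow> 'a \<Rightarrow> real" where
  "V_norm \<xi> a n \<omega> = sqrt (\<Sum>\<^sub>\<infinity>k. (b_coeff a n k)\<^sup>2 * (\<xi> k \<omega>)\<^sup>2)"

definition converges_to_std_normal :: "'a measure \<Rightarrow> (nat \<Rightarrow> 'a \<Rightarrow> real) \<Rightarrow> bool" where
  "converges_to_std_normal M Y \<longleftrightarrow>
     weak_conv_m (\<lambda>n. distr M borel (Y n)) std_normal_distribution"

end

theory Submission
  imports Defs "HOL-Real_Asymp.Real_Asymp"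
begin

text \<open>Put \<open>q u = min (u\<^sup>2) \<bar>u\<bar>\<close> and \<open>g c = c\<^sup>2 H (1 / \<bar>c\<bar>)\<close>. A sum of independent centered variables \<open>X j\<close> is
  bounded in \<open>L\<^sup>1\<close> in terms of \<open>\<Sum> E (q (X j))\<close>, and Ottaviani's inequality turns this into almost sure
  convergence. If \<open>H\<^sub>0\<close> is slowly varying and \<open>f = O(q)\<close> with \<open>f u \<sim> \<kappa> u\<^sup>2\<close> at 0, then
  \<open>E (f (c \<xi>\<^sub>0)) \<sim> \<kappa> g c\<close> as \<open>c\<close> tends to 0. By definition of \<open>D\<^sub>n\<close> the weights \<open>c\<^sub>n\<^sub>k = b\<^sub>n\<^sub>k / D\<^sub>n\<close> satisfy
  \<open>\<Sum>\<^sub>k g (c\<^sub>n\<^sub>k) = 1\<close> for large \<open>n\<close>, and they are uniformly small. Hence the characteristic function of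
  \<open>S\<^sub>n / D\<^sub>n\<close> converges to the Gaussian one, and the Laplace transform of \<open>V\<^sub>n\<^sup>2 / D\<^sub>n\<^sup>2\<close> to that of the constant 1.

  Conversely, (2) for \<open>a = \<delta>\<^sub>0\<close> forces \<open>n P(\<bar>\<xi>\<^sub>0 - \<xi>\<^sub>1\<bar> \<ge> 12 D\<^sub>n)\<close> to tend to 0, hence
  \<open>x\<^sup>2 P(\<bar>\<xi>\<^sub>0\<bar> > x) = o(H\<^sub>0 x)\<close>, which is slow variation. For (3) take the \<open>a\<^sub>j\<close> whose partial sums are the
  harmonic numbers of \<open>\<bar>j\<bar>\<close>. This is an even function of \<open>j\<close>, so \<open>b\<^sub>n\<^sub>,\<^sub>-\<^sub>n\<^sub>-\<^sub>j = - b\<^sub>n\<^sub>j\<close>, and exchanging \<open>\<xi>\<^sub>j\<close> with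
  \<open>\<xi>\<^sub>-\<^sub>n\<^sub>-\<^sub>j\<close> changes one sign in \<open>S\<^sub>n\<close> and leaves \<open>V\<^sub>n\<close> fixed. Therefore \<open>E (cos (S\<^sub>n / V\<^sub>n)) = E (\<Prod> cos y\<^sub>j)\<close> with
  \<open>y\<^sub>j = b\<^sub>n\<^sub>j (\<xi>\<^sub>j - \<xi>\<^sub>-\<^sub>n\<^sub>-\<^sub>j) / V\<^sub>n\<close> and \<open>\<Sum> y\<^sub>j\<^sup>2\<close> tending to 1. The limit is at most \<open>exp (- 1 / 2)\<close>, with a uniform
  gap when some \<open>\<bar>y\<^sub>j\<bar>\<close> is bounded below with probability bounded below. If \<open>H\<^sub>0\<close> is not slowly varying,
  a single large \<open>b\<^sub>n\<^sub>j \<xi>\<^sub>j\<close> brings this about for infinitely many \<open>n\<close>.\<close>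

subsection \<open>Truncated moments of a variable with infinite variance\<close>

text \<open>With infinite variance there are no second moments to add up. The function
  \<open>qf\<close> is quadratic near 0, so it sees truncated second moments, and linear at
  infinity, so its expectation is finite for integrable variables. At scale 1/x this expectation is
  (\<open>H0 x + x * tail x\<close>)/x^2. Slow variation makes the second summand negligible; if
  slow variation fails, that summand dominates up to a constant along some sequence of x.

  In (3) the normalization depends on all the variables, so characteristic functions do not factor.
  Since (3) is assumed for every admissible sequence, a convenient one may be chosen. Antisymmetry
  of b_nj gives an exact symmetrization to which V_n is blind. The slow decay b_nj ~ n/j spreads the
  chance of one dominating term over all j \<ge> n: summing P(|\<xi>| > x j/n) over j gives about
  n/x times the first tail moment, which is the quantity that a failure of slow variation makes
  comparable with x \<open>Q (1 / x)\<close>. The price is coefficients of order 1/|j|, and these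
  are admissible for every integrable \<xi>.\<close>

definition qf :: "real \<Rightarrow> real" where
  "qf u = min (u\<^sup>2) \<bar>u\<bar>"

lemma qf_nonneg [simp]: "0 \<le> qf u"
  and qf_0 [simp]: "qf 0 = 0"
  and qf_minus [simp]: "qf (- u) = qf u"
  and qf_abs [simp]: "qf \<bar>u\<bar> = qf u"
  and qf_le_square: "qf u \<le> u\<^sup>2"
  and qf_le_abs: "qf u \<le> \<bar>u\<bar>"
  by (auto simp: qf_def)

lemma qf_measurable [measurable]: "qf \<in> borel_measurable borel"
  unfolding qf_def[abs_def] by measurable

lemma qf_mono: "\<bar>u\<bar> \<le> \<bar>v\<bar> \<Longrightarrow> qf u \<le> qf v"
  unfolding qf_def by (intro min.mono) (simp_all add: abs_le_square_iff)

lemma qf_eq_square: "\<bar>u\<bar> \<le> 1 \<Longrightarrow> qf u = u\<^sup>2"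
  unfolding qf_def by (simp add: min_def abs_square_le_1 power2_eq_square)
    (metis abs_ge_zero abs_mult_self_eq mult_left_le antisym)

lemma qf_eq_abs: "\<bar>u\<bar> \<ge> 1 \<Longrightarrow> qf u = \<bar>u\<bar>"
proof -
  assume "\<bar>u\<bar> \<ge> 1"
  then have "\<bar>u\<bar> * 1 \<le> \<bar>u\<bar> * \<bar>u\<bar>" by (intro mult_left_mono) auto
  then show ?thesis unfolding qf_def by (simp add: power2_eq_square)
qed

lemma qf_mult_le:
  assumes "l \<ge> 1" shows "qf (l * u) \<le> l\<^sup>2 * qf u"
proof -
  have "l * \<bar>u\<bar> \<le> l\<^sup>2 * \<bar>u\<bar>"
    using assms by (intro mult_right_mono) (auto simp: power2_eq_square)
  moreover have "l\<^sup>2 * qf u = min (l\<^sup>2 * u\<^sup>2) (l\<^sup>2 * \<bar>u\<bar>)"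
    unfolding qf_def by (rule min_mult_distrib_left[THEN trans]) simp
  ultimately show ?thesis
    using assms unfolding qf_def by (simp add: power_mult_distrib abs_mult)
qed

lemma qf_divide_le:
  assumes "s \<ge> 1" shows "qf (u / s) \<le> qf u / s"
proof -
  have "u\<^sup>2 / s\<^sup>2 \<le> u\<^sup>2 / s"
    using assms by (intro divide_left_mono) (auto simp: power2_eq_square)
  then show ?thesis
    using assms by (auto simp: qf_def min_def power_divide divide_right_mono)
qed

text \<open>The sum is at most \<open>card A\<close> times its term of largest modulus, and scaling
  by a factor at least 1 increases \<open>qf\<close> at most quadratically.\<close>

lemma qf_sum_le:
  assumes "finite A" shows "qf (\<Sum>i\<in>A. f i) \<le> (real (card A))\<^sup>2 * (\<Sum>i\<in>A. qf (f i))"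
proof (cases "A = {}")
  case False
  define m where "m = Max ((\<lambda>i. \<bar>f i\<bar>) ` A)"
  have "m \<in> (\<lambda>i. \<bar>f i\<bar>) ` A" unfolding m_def using assms False by (intro Max_in) auto
  then obtain i where i: "i \<in> A" "m = \<bar>f i\<bar>" by auto
  have "\<bar>\<Sum>i\<in>A. f i\<bar> \<le> (\<Sum>i\<in>A. \<bar>f i\<bar>)" by (rule sum_abs)
  also have "\<dots> \<le> (\<Sum>i\<in>A. m)"
    unfolding m_def using assms by (intro sum_mono Max_ge) auto
  also have "\<dots> = \<bar>real (card A) * f i\<bar>" using i by (simp add: abs_mult)
  finally have "qf (\<Sum>i\<in>A. f i) \<le> qf (real (card A) * f i)" by (rule qf_mono)
  also have "\<dots> \<le> (real (card A))\<^sup>2 * qf (f i)"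
    using assms False by (intro qf_mult_le) (simp add: Suc_le_eq card_gt_0_iff)
  also have "\<dots> \<le> (real (card A))\<^sup>2 * (\<Sum>i\<in>A. qf (f i))"
    using i assms by (intro mult_left_mono member_le_sum) auto
  finally show ?thesis .
qed simp

locale infinite_variance = prob_space M for M :: "'a measure" +
  fixes Z :: "'a \<Rightarrow> real"
  assumes integrable_Z: "integrable M Z"
    and second_moment_infinite: "(\<integral>\<^sup>+\<omega>. ennreal ((Z \<omega>)\<^sup>2) \<partial>M) = \<infinity>"
begin

abbreviation "H0 \<equiv> trunc_moment M Z"
abbreviation "H \<equiv> H_fun M Z"

definition Q :: "real \<Rightarrow> real" where
  "Q c = expectation (\<lambda>\<omega>. qf (c * Z \<omega>))"

text \<open>The common summand of the admissibility condition, taken at \<open>a j\<close>, and of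
  the series defining \<open>D_norm\<close>, taken at \<open>b_coeff a n k / s\<close>; the
  convention for zero coefficients is built in.\<close>

definition g :: "real \<Rightarrow> real" where
  "g c = (if c = 0 then 0 else c\<^sup>2 * H (inverse \<bar>c\<bar>))"

definition tail :: "real \<Rightarrow> real" where
  "tail x = expectation (\<lambda>\<omega>. \<bar>Z \<omega>\<bar> * indicator {\<omega>. \<bar>Z \<omega>\<bar> > x} \<omega>)"

lemma Z_measurable [measurable]: "Z \<in> borel_measurable M"
  using integrable_Z by auto

lemma integrable_trunc:
  "integrable M (\<lambda>\<omega>. (Z \<omega>)\<^sup>2 * indicator {\<omega>. \<bar>Z \<omega>\<bar> \<le> x} \<omega>)"
proof (rule integrable_const_bound[where B = "x\<^sup>2"])
  have "(Z \<omega>)\<^sup>2 \<le> x\<^sup>2" if "\<bar>Z \<omega>\<bar> \<le> x" for \<omega>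
    using that by (metis abs_ge_zero power2_abs power_mono)
  then show "AE \<omega> in M. norm ((Z \<omega>)\<^sup>2 * indicator {\<omega>. \<bar>Z \<omega>\<bar> \<le> x} \<omega>) \<le> x\<^sup>2"
    by (auto simp: indicator_def)
  show "(\<lambda>\<omega>. (Z \<omega>)\<^sup>2 * indicator {\<omega>. \<bar>Z \<omega>\<bar> \<le> x} \<omega>) \<in> borel_measurable M"
    by measurable
qed

lemma integrable_tail:
  "integrable M (\<lambda>\<omega>. \<bar>Z \<omega>\<bar> * indicator {\<omega>. \<bar>Z \<omega>\<bar> > x} \<omega>)"
  by (rule Bochner_Integration.integrable_bound[OF integrable_Z]) (auto simp: indicator_def)

lemma integrable_qf: "integrable M (\<lambda>\<omega>. qf (c * Z \<omega>))"
  by (rule Bochner_Integration.integrable_bound[OF integrable_mult_right[OF integrable_Z, of c]])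
    (auto simp: qf_le_abs)

lemma H0_nonneg: "0 \<le> H0 x"
  unfolding trunc_moment_def by (intro Bochner_Integration.integral_nonneg) simp

lemma tail_nonneg: "0 \<le> tail x"
  unfolding tail_def by (intro Bochner_Integration.integral_nonneg) simp

lemma H0_mono: "x \<le> y \<Longrightarrow> H0 x \<le> H0 y"
  unfolding trunc_moment_def
  by (intro integral_mono integrable_trunc) (auto simp: indicator_def)

text \<open>Monotone convergence over integer truncation levels: a bound on \<open>H0\<close> would
  bound the second moment.\<close>

lemma H0_filterlim: "filterlim H0 at_top at_top"
proof -
  have ex: "\<exists>n::nat. H0 (real n) \<ge> K" for K
  proof (rule ccontr)
    assume "\<not> ?thesis"
    then have le: "H0 (real n) \<le> \<bar>K\<bar>" for n :: nat
      by (metis abs_ge_self linear order_trans)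
    have "(\<integral>\<^sup>+\<omega>. ennreal ((Z \<omega>)\<^sup>2) \<partial>M)
        = (\<integral>\<^sup>+\<omega>. (SUP n. ennreal ((Z \<omega>)\<^sup>2 * indicator {\<omega>. \<bar>Z \<omega>\<bar> \<le> real n} \<omega>)) \<partial>M)"
    proof (intro nn_integral_cong antisym)
      fix \<omega>
      obtain n where "\<bar>Z \<omega>\<bar> \<le> real n" using real_arch_simple by blast
      then show "ennreal ((Z \<omega>)\<^sup>2) \<le> (SUP n. ennreal ((Z \<omega>)\<^sup>2 * indicator {\<omega>. \<bar>Z \<omega>\<bar> \<le> real n} \<omega>))"
        by (intro SUP_upper2[of n]) auto
      show "(SUP n. ennreal ((Z \<omega>)\<^sup>2 * indicator {\<omega>. \<bar>Z \<omega>\<bar> \<le> real n} \<omega>)) \<le> ennreal ((Z \<omega>)\<^sup>2)"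
        by (intro SUP_least) (auto simp: indicator_def)
    qed
    also have "\<dots> = (SUP n. \<integral>\<^sup>+\<omega>. ennreal ((Z \<omega>)\<^sup>2 * indicator {\<omega>. \<bar>Z \<omega>\<bar> \<le> real n} \<omega>) \<partial>M)"
      by (intro nn_integral_monotone_convergence_SUP)
        (auto simp: incseq_def le_fun_def indicator_def)
    also have "\<dots> = (SUP n. ennreal (H0 (real n)))"
      unfolding trunc_moment_def
      by (intro SUP_cong nn_integral_eq_integral integrable_trunc) auto
    also have "\<dots> \<le> ennreal \<bar>K\<bar>" by (intro SUP_least ennreal_leI le)
    finally show False using second_moment_infinite by (simp add: top_unique)
  qed
  show ?thesis
    unfolding filterlim_at_top
  proof
    fix K
    obtain n :: nat where "H0 (real n) \<ge> K" using ex by blast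
    then show "\<forall>\<^sub>F x in at_top. K \<le> H0 x"
      using H0_mono by (intro eventually_at_top_linorderI[of "real n"]) (meson order_trans)
  qed
qed

abbreviation "b0 \<equiv> trunc_threshold M Z"

text \<open>The infimum need not belong to its set, but some point of the set lies below
  \<open>b0 + 1\<close>; monotonicity of \<open>H0\<close> then applies.\<close>

lemma b0_nonneg: "0 \<le> b0" and H0_threshold: "H0 (b0 + 1) > 1"
proof -
  have "eventually (\<lambda>x. H0 x > 1 \<and> x \<ge> 0) at_top"
    using H0_filterlim by (intro eventually_conj) (auto simp: filterlim_at_top_dense eventually_ge_at_top)
  then obtain x where x: "x \<ge> 0" "H0 x > 1" by (auto simp: eventually_at_top_linorder)
  let ?A = "{x. x \<ge> 0 \<and> H0 x > 1}"
  have ne: "?A \<noteq> {}" using x by auto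
  have bb: "bdd_below ?A" by (rule bdd_belowI[of _ 0]) auto
  show "0 \<le> b0" unfolding trunc_threshold_def using ne by (intro cInf_greatest) auto
  have "Inf ?A < b0 + 1" unfolding trunc_threshold_def by simp
  then obtain y where "y \<in> ?A" "y < b0 + 1" using cInf_less_iff[OF ne bb] by blast
  then show "H0 (b0 + 1) > 1" using H0_mono[of y "b0 + 1"] by auto
qed

lemma H_ge_1: "H x \<ge> 1"
  unfolding H_fun_def using H0_threshold H0_mono[of "b0 + 1" "max x (b0 + 1)"] by simp

lemma H_eq_H0: "x \<ge> b0 + 1 \<Longrightarrow> H x = H0 x"
  unfolding H_fun_def by (simp add: max_def)

lemma H_le_H0: "H x \<le> H0 x + H0 (b0 + 1)"
  unfolding H_fun_def by (simp add: max_def H0_nonneg)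

lemma H_mono: "x \<le> y \<Longrightarrow> H x \<le> H y"
  unfolding H_fun_def by (intro H0_mono) auto

lemma H0_le: "x \<ge> 0 \<Longrightarrow> H0 x \<le> x * expectation (\<lambda>\<omega>. \<bar>Z \<omega>\<bar>)"
proof -
  assume x: "x \<ge> 0"
  have "H0 x \<le> expectation (\<lambda>\<omega>. x * \<bar>Z \<omega>\<bar>)"
    unfolding trunc_moment_def
  proof (intro integral_mono integrable_trunc)
    show "integrable M (\<lambda>\<omega>. x * \<bar>Z \<omega>\<bar>)" using integrable_Z by auto
    fix \<omega> show "(Z \<omega>)\<^sup>2 * indicator {\<omega>. \<bar>Z \<omega>\<bar> \<le> x} \<omega> \<le> x * \<bar>Z \<omega>\<bar>"
      using x mult_right_mono[of "\<bar>Z \<omega>\<bar>" x "\<bar>Z \<omega>\<bar>"]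
      by (auto simp: indicator_def power2_eq_square)
  qed
  then show ?thesis by simp
qed

lemma tail_tendsto: "(\<lambda>n. tail (X n)) \<longlonglongrightarrow> 0" if X: "filterlim X at_top sequentially" for X :: "nat \<Rightarrow> real"
proof -
  have "(\<lambda>n. tail (X n)) \<longlonglongrightarrow> expectation (\<lambda>\<omega>. 0)"
    unfolding tail_def
  proof (rule integral_dominated_convergence[where w = "\<lambda>\<omega>. \<bar>Z \<omega>\<bar>"])
    show "integrable M (\<lambda>\<omega>. \<bar>Z \<omega>\<bar>)" using integrable_Z by auto
    have "(\<lambda>n. \<bar>Z \<omega>\<bar> * indicator {\<omega>. \<bar>Z \<omega>\<bar> > X n} \<omega>) \<longlonglongrightarrow> 0" for \<omega>
    proof -
      have "\<forall>\<^sub>F n in sequentially. \<bar>Z \<omega>\<bar> \<le> X n"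
        using X unfolding filterlim_at_top by blast
      then have "\<forall>\<^sub>F n in sequentially. \<bar>Z \<omega>\<bar> * indicator {\<omega>. \<bar>Z \<omega>\<bar> > X n} \<omega> = 0"
        by eventually_elim (auto simp: indicator_def)
      then show ?thesis by (rule tendsto_eventually)
    qed
    then show "AE \<omega> in M. (\<lambda>n. \<bar>Z \<omega>\<bar> * indicator {\<omega>. \<bar>Z \<omega>\<bar> > X n} \<omega>) \<longlonglongrightarrow> 0" by simp
  qed (auto simp: indicator_def)
  then show ?thesis by simp
qed

lemma Q_nonneg: "0 \<le> Q c"
  unfolding Q_def by (intro Bochner_Integration.integral_nonneg) simp

lemma Q_0 [simp]: "Q 0 = 0" and Q_abs [simp]: "Q \<bar>c\<bar> = Q c"
  by (auto simp: Q_def abs_if)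

lemma Q_divide_le: "s \<ge> 1 \<Longrightarrow> Q (c / s) \<le> Q c / s"
proof -
  assume "s \<ge> 1"
  then have "Q (c / s) \<le> expectation (\<lambda>\<omega>. qf (c * Z \<omega>) / s)"
    unfolding Q_def using qf_divide_le[of s, of "c * Z _"] integrable_qf[of c] integrable_qf[of "c / s"]
    by (intro integral_mono) (auto simp: times_divide_eq_left)
  then show ?thesis by (simp add: Q_def)
qed

text \<open>At scale 1/x the two branches of \<open>qf\<close> meet exactly at |Z| = x. This is the
  bridge between \<open>Q\<close>, which controls random sums, and \<open>H0\<close>, which slow
  variation is about.\<close>

lemma Q_eq:
  assumes "x > 0"
  shows "x\<^sup>2 * Q (1 / x) = H0 x + x * tail x"
proof -
  have "qf (1 / x * Z \<omega>) = (Z \<omega>)\<^sup>2 * indicator {\<omega>. \<bar>Z \<omega>\<bar> \<le> x} \<omega> / x\<^sup>2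
      + \<bar>Z \<omega>\<bar> * indicator {\<omega>. \<bar>Z \<omega>\<bar> > x} \<omega> / x" for \<omega>
    using assms qf_eq_square[of "Z \<omega> / x"] qf_eq_abs[of "Z \<omega> / x"]
    by (cases "\<bar>Z \<omega>\<bar> \<le> x") (auto simp: indicator_def power_divide field_simps)
  then have "Q (1 / x) = expectation (\<lambda>\<omega>. (Z \<omega>)\<^sup>2 * indicator {\<omega>. \<bar>Z \<omega>\<bar> \<le> x} \<omega> / x\<^sup>2
      + \<bar>Z \<omega>\<bar> * indicator {\<omega>. \<bar>Z \<omega>\<bar> > x} \<omega> / x)" unfolding Q_def by simp
  also have "\<dots> = H0 x / x\<^sup>2 + tail x / x"
    unfolding trunc_moment_def tail_def
    using integrable_trunc[of x] integrable_tail[of x] by (subst Bochner_Integration.integral_add) auto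
  finally show ?thesis using assms by (simp add: field_simps power2_eq_square)
qed

lemma Q_eq_abs:
  assumes "c \<noteq> 0"
  shows "Q c = c\<^sup>2 * H0 (inverse \<bar>c\<bar>) + \<bar>c\<bar> * tail (inverse \<bar>c\<bar>)"
proof -
  have "(inverse \<bar>c\<bar>)\<^sup>2 * Q (1 / inverse \<bar>c\<bar>) = H0 (inverse \<bar>c\<bar>) + inverse \<bar>c\<bar> * tail (inverse \<bar>c\<bar>)"
    using assms by (intro Q_eq) auto
  then have "c\<^sup>2 * ((inverse \<bar>c\<bar>)\<^sup>2 * Q \<bar>c\<bar>) = c\<^sup>2 * (H0 (inverse \<bar>c\<bar>) + inverse \<bar>c\<bar> * tail (inverse \<bar>c\<bar>))"
    by (simp add: inverse_eq_divide)
  moreover have "c\<^sup>2 * ((inverse \<bar>c\<bar>)\<^sup>2 * Q \<bar>c\<bar>) = Q c" using assms by (simp add: field_simps)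
  moreover have "c\<^sup>2 * inverse \<bar>c\<bar> = \<bar>c\<bar>"
    by (metis abs_mult_self_eq assms abs_eq_0 mult.assoc power2_eq_square right_inverse mult.right_neutral)
  ultimately show ?thesis by (metis distrib_left mult.assoc)
qed

lemma g_nonneg: "0 \<le> g c"
  unfolding g_def using H_ge_1[of "inverse \<bar>c\<bar>"] by auto

lemma g_ge_square: "c\<^sup>2 \<le> g c"
  unfolding g_def using H_ge_1[of "inverse \<bar>c\<bar>"] mult_left_mono[of 1 _ "c\<^sup>2"] by auto

lemma g_0 [simp]: "g 0 = 0"
  by (simp add: g_def)

text \<open>\<open>H\<close> exceeds \<open>H0\<close> by at most the constant
  \<open>H0 (b0 + 1)\<close>, and the tail part of \<open>Q\<close> is nonnegative.\<close>

lemma g_le_Q: "g c \<le> Q c + H0 (b0 + 1) * c\<^sup>2"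
proof (cases "c = 0")
  case False
  have "g c \<le> c\<^sup>2 * (H0 (inverse \<bar>c\<bar>) + H0 (b0 + 1))"
    unfolding g_def using False H_le_H0 by (auto intro!: mult_left_mono)
  then show ?thesis
    using Q_eq_abs[OF False] tail_nonneg[of "inverse \<bar>c\<bar>"] by (simp add: algebra_simps)
       (smt (verit) mult_nonneg_nonneg abs_ge_zero)
qed (simp add: Q_nonneg)

text \<open>For t \<ge> 1 the increment \<open>H0 (t * x) - H0 x\<close> lives on x < |Z| \<le> t x,
  where the square is at most (t x)^2. The case t < 1 follows by substituting t x and inverting the
  ratio.\<close>

lemma slowly_varyingI:
  assumes lim: "((\<lambda>x. x\<^sup>2 * prob {\<omega>\<in>space M. \<bar>Z \<omega>\<bar> > x} / H0 x) \<longlongrightarrow> 0) at_top"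
  shows "slowly_varying H0"
proof -
  have pos: "\<forall>\<^sub>F x in at_top. H0 x > 0"
    using H0_filterlim by (auto simp: filterlim_at_top_dense)
  have gt1: "((\<lambda>x. H0 (t * x) / H0 x) \<longlongrightarrow> 1) at_top" if t: "t \<ge> 1" for t
  proof (rule real_tendsto_sandwich)
    show "\<forall>\<^sub>F x in at_top. 1 \<le> H0 (t * x) / H0 x"
      using pos eventually_ge_at_top[of 0]
    proof eventually_elim
      case (elim x)
      then have "H0 x \<le> H0 (t * x)" using t by (intro H0_mono) (simp add: mult_le_cancel_right1)
      then show ?case using elim by simp
    qed
    show "\<forall>\<^sub>F x in at_top. H0 (t * x) / H0 x \<le> 1 + t\<^sup>2 * (x\<^sup>2 * prob {\<omega>\<in>space M. \<bar>Z \<omega>\<bar> > x} / H0 x)"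
      using pos eventually_ge_at_top[of 0]
    proof eventually_elim
      case (elim x)
      have "H0 (t * x) \<le> expectation (\<lambda>\<omega>. (Z \<omega>)\<^sup>2 * indicator {\<omega>. \<bar>Z \<omega>\<bar> \<le> x} \<omega>
           + (t * x)\<^sup>2 * indicator {\<omega>\<in>space M. \<bar>Z \<omega>\<bar> > x} \<omega>)"
        unfolding trunc_moment_def
      proof (intro integral_mono integrable_trunc Bochner_Integration.integrable_add)
        fix \<omega> assume "\<omega> \<in> space M"
        moreover have "(Z \<omega>)\<^sup>2 \<le> (t * x)\<^sup>2" if "\<bar>Z \<omega>\<bar> \<le> t * x"
          using that by (metis abs_ge_zero power2_abs power_mono)
        ultimately show "(Z \<omega>)\<^sup>2 * indicator {\<omega>. \<bar>Z \<omega>\<bar> \<le> t * x} \<omega> \<le> (Z \<omega>)\<^sup>2 * indicator {\<omega>. \<bar>Z \<omega>\<bar> \<le> x} \<omega>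
           + (t * x)\<^sup>2 * indicator {\<omega>\<in>space M. \<bar>Z \<omega>\<bar> > x} \<omega>"
          by (auto simp: indicator_def)
      qed (auto intro!: integrable_mult_right simp: emeasure_finite less_top[symmetric])
      also have "\<dots> = H0 x + (t * x)\<^sup>2 * prob {\<omega>\<in>space M. \<bar>Z \<omega>\<bar> > x}"
        unfolding trunc_moment_def
        by (subst Bochner_Integration.integral_add[OF integrable_trunc]) (auto intro!: integrable_mult_right simp: emeasure_finite less_top[symmetric])
      finally show ?case using elim by (simp add: field_simps power_mult_distrib)
    qed
    have "((\<lambda>x. 1 + t\<^sup>2 * (x\<^sup>2 * prob {\<omega>\<in>space M. \<bar>Z \<omega>\<bar> > x} / H0 x)) \<longlongrightarrow> 1 + t\<^sup>2 * 0) at_top"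
      by (intro tendsto_intros lim)
    then show "((\<lambda>x. 1 + t\<^sup>2 * (x\<^sup>2 * prob {\<omega>\<in>space M. \<bar>Z \<omega>\<bar> > x} / H0 x)) \<longlongrightarrow> 1) at_top" by simp
  qed auto
  have "((\<lambda>x. H0 (t * x) / H0 x) \<longlongrightarrow> 1) at_top" if t: "t > 0" "t < 1" for t
  proof -
    have "filterlim (\<lambda>x. t * x) at_top at_top"
      using t by (intro filterlim_tendsto_pos_mult_at_top[OF tendsto_const]) (auto simp: filterlim_ident)
    from filterlim_compose[OF gt1[of "1 / t"] this]
    have "((\<lambda>x. H0 x / H0 (t * x)) \<longlongrightarrow> 1) at_top" using t by simp
    from tendsto_inverse[OF this] show ?thesis by simp
  qed
  with gt1 pos show ?thesis unfolding slowly_varying_def by (metis linorder_not_le)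
qed

text \<open>A Karamata-type estimate by dyadic iteration: each range between x and 2x contributes at
  most an increment of \<open>H0\<close>, and slow variation makes these increments small enough to
  sum as a geometric series.\<close>

lemma slowly_varying_tail:
  assumes sv: "slowly_varying H0"
  shows "((\<lambda>x. x * tail x / H0 x) \<longlongrightarrow> 0) at_top"
proof -
  \<comment> \<open>On x < |Z| \<le> 2x one has x |Z| \<le> Z^2; the rest is the same tail one
    dyadic scale higher, written with the factor 1/2 that drives the iteration.\<close>
  have step: "x * tail x \<le> (H0 (2 * x) - H0 x) + (2 * x) * tail (2 * x) / 2" if x: "x > 0" for x
  proof -
    have "expectation (\<lambda>\<omega>. x * (\<bar>Z \<omega>\<bar> * indicator {\<omega>. \<bar>Z \<omega>\<bar> > x} \<omega>)) \<le>
      expectation (\<lambda>\<omega>. ((Z \<omega>)\<^sup>2 * indicator {\<omega>. \<bar>Z \<omega>\<bar> \<le> 2 * x} \<omega> - (Z \<omega>)\<^sup>2 * indicator {\<omega>. \<bar>Z \<omega>\<bar> \<le> x} \<omega>)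
          + x * (\<bar>Z \<omega>\<bar> * indicator {\<omega>. \<bar>Z \<omega>\<bar> > 2 * x} \<omega>))"
    proof (intro integral_mono integrable_mult_right integrable_tail Bochner_Integration.integrable_add
        Bochner_Integration.integrable_diff integrable_trunc)
      fix \<omega>
      show "x * (\<bar>Z \<omega>\<bar> * indicator {\<omega>. \<bar>Z \<omega>\<bar> > x} \<omega>) \<le>
       ((Z \<omega>)\<^sup>2 * indicator {\<omega>. \<bar>Z \<omega>\<bar> \<le> 2 * x} \<omega> - (Z \<omega>)\<^sup>2 * indicator {\<omega>. \<bar>Z \<omega>\<bar> \<le> x} \<omega>)
          + x * (\<bar>Z \<omega>\<bar> * indicator {\<omega>. \<bar>Z \<omega>\<bar> > 2 * x} \<omega>)"
        using x mult_right_mono[of x "\<bar>Z \<omega>\<bar>" "\<bar>Z \<omega>\<bar>"]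
        by (auto simp: indicator_def power2_eq_square)
    qed
    also have "\<dots> = (H0 (2 * x) - H0 x) + x * tail (2 * x)"
      unfolding trunc_moment_def tail_def
      by (simp add: integrable_mult_right integrable_tail integrable_trunc)
    finally show ?thesis by (simp add: tail_def)
  qed
  show ?thesis
  proof (rule tendstoI)
    fix e :: real assume "e > 0"
    define d where "d = min (1/2) (e / 8)"
    have d: "d > 0" "d \<le> 1/2" "4 * d < e" using \<open>e > 0\<close> by (auto simp: d_def min_def)
    have "((\<lambda>x. H0 (2 * x) / H0 x) \<longlongrightarrow> 1) at_top" using sv by (auto simp: slowly_varying_def)
    then have "\<forall>\<^sub>F x in at_top. H0 (2 * x) / H0 x < 1 + d" using d by (intro order_tendstoD) auto
    moreover have "\<forall>\<^sub>F x in at_top. H0 x > 0" using sv by (auto simp: slowly_varying_def)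
    ultimately have "\<forall>\<^sub>F x in at_top. H0 (2 * x) / H0 x < 1 + d \<and> H0 x > 0 \<and> x > (0::real)"
      using eventually_gt_at_top[of 0] by eventually_elim auto
    then obtain X where X: "\<And>x. x \<ge> X \<Longrightarrow> H0 (2 * x) / H0 x < 1 + d \<and> H0 x > 0 \<and> x > 0"
      by (auto simp: eventually_at_top_linorder)
    then have X': "\<And>x. x \<ge> X \<Longrightarrow> H0 (2 * x) \<le> (1 + d) * H0 x" by (smt (verit) pos_less_divide_eq)
    \<comment> \<open>One doubling multiplies \<open>H0\<close> by at most 3/2 and the tail term by
      1/2, so the errors form a geometric series of ratio 3/4: d times its n-th partial sum is 4 d
      (1 - (3/4)^n).\<close>
    have iter: "x \<ge> X \<Longrightarrow> x * tail x \<le> 4 * d * (1 - (3/4)^n) * H0 x + x * tail (2^n * x)" for n x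
    proof (induction n arbitrary: x)
      case (Suc n)
      have x2: "2 * x \<ge> X" using X[OF Suc.prems] Suc.prems by linarith
      have c: "0 \<le> 4 * d * (1 - (3/4)^n)" using d by (auto simp: power_le_one)
      have h: "H0 (2 * x) \<le> 3 / 2 * H0 x" "H0 (2 * x) - H0 x \<le> d * H0 x"
      proof -
        have "d * H0 x \<le> 1/2 * H0 x" using d X[OF Suc.prems] by (intro mult_right_mono) auto
        then show "H0 (2 * x) \<le> 3 / 2 * H0 x" "H0 (2 * x) - H0 x \<le> d * H0 x"
          using X'[OF Suc.prems] by (simp_all add: distrib_right)
      qed
      have "x * tail x \<le> d * H0 x + (2 * x) * tail (2 * x) / 2"
        using step[of x] X[OF Suc.prems] h by auto
      also have "\<dots> \<le> d * H0 x + (4 * d * (1 - (3/4)^n) * H0 (2 * x) + 2 * x * tail (2^n * (2 * x))) / 2"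
        using Suc.IH[OF x2] by auto
      also have "\<dots> \<le> d * H0 x + (4 * d * (1 - (3/4)^n) * (3 / 2 * H0 x) + 2 * x * tail (2^n * (2 * x))) / 2"
        using mult_left_mono[OF h(1) c] by simp
      also have "\<dots> = 4 * d * (1 - (3/4)^Suc n) * H0 x + x * tail (2 ^ Suc n * x)"
        by (simp add: field_simps)
      finally show ?case .
    qed auto
    have bound: "x * tail x \<le> 4 * d * H0 x" if "x \<ge> X" for x
    proof (rule LIMSEQ_le_const)
      have xp: "x > 0" using X that by auto
      have pow2: "filterlim (\<lambda>n::nat. 2^n :: real) at_top sequentially"
        by (rule filterlim_at_top_mono[OF filterlim_real_sequentially]) (simp add: of_nat_less_two_power less_imp_le)
      have "filterlim (\<lambda>n::nat. 2^n * x) at_top sequentially"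
        using xp filterlim_tendsto_pos_mult_at_top[OF tendsto_const xp pow2] by (simp add: mult.commute)
      from tail_tendsto[OF this] have "(\<lambda>n. tail (2^n * x)) \<longlonglongrightarrow> 0" .
      then have "(\<lambda>n. 4 * d * (1 - (3/4)^n) * H0 x + x * tail (2^n * x)) \<longlonglongrightarrow> 4 * d * (1 - 0) * H0 x + x * 0"
        by (intro tendsto_intros LIMSEQ_power_zero) auto
      then show "(\<lambda>n. 4 * d * (1 - (3/4)^n) * H0 x + x * tail (2^n * x)) \<longlonglongrightarrow> 4 * d * H0 x" by simp
      show "\<exists>N. \<forall>n\<ge>N. x * tail x \<le> 4 * d * (1 - (3/4)^n) * H0 x + x * tail (2^n * x)"
        using iter[OF that] by auto
    qed
    show "\<forall>\<^sub>F x in at_top. dist (x * tail x / H0 x) 0 < e"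
    proof (rule eventually_at_top_linorderI[of X])
      fix x assume x: "x \<ge> X"
      have "x * tail x / H0 x \<le> 4 * d" using bound[OF x] X[OF x] by (simp add: field_simps)
      moreover have "0 \<le> x * tail x / H0 x" using X[OF x] tail_nonneg[of x] by simp
      ultimately show "dist (x * tail x / H0 x) 0 < e" using d by (simp add: dist_real_def)
    qed
  qed
qed

text \<open>With x = 1/|c| the range of |Z| is cut at d x and at x. Up to d x the function is close
  to \<kappa> u^2; between d x and x only an increment of \<open>H0\<close> enters, negligible by
  slow variation; beyond x the linear bound leaves the tail moment, negligible by
  \<open>slowly_varying_tail\<close>.\<close>

lemma expectation_approx_g:
  assumes sv: "slowly_varying H0" and meas [measurable]: "f \<in> borel_measurable borel"
    and f: "\<And>u. \<bar>f u\<bar> \<le> C * qf u" and lim: "((\<lambda>u. f u / u\<^sup>2) \<longlongrightarrow> \<kappa>) (at 0)" and e: "e > 0"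
  shows "\<exists>c0>0. \<forall>c. \<bar>c\<bar> \<le> c0 \<longrightarrow> \<bar>expectation (\<lambda>\<omega>. f (c * Z \<omega>)) - \<kappa> * g c\<bar> \<le> e * g c"
proof -
  have C: "C \<ge> 0" using f[of 1] by (simp add: qf_def)
  have f0: "f 0 = 0" using f[of 0] by simp
  define e1 where "e1 = e / 3"
  \<comment> \<open>The middle range enters with weight C + |\<kappa>| and the tail with weight C,
    so each of the two contributes at most e/3.\<close>
  define e2 where "e2 = e / (3 * (C + \<bar>\<kappa>\<bar> + 1))"
  have e1: "e1 > 0" and e2: "e2 > 0" using e C by (auto simp: e1_def e2_def intro!: divide_pos_pos)
  have e12: "e1 + (C + \<bar>\<kappa>\<bar>) * e2 + C * e2 \<le> e"
  proof -
    have "(C + \<bar>\<kappa>\<bar> + 1) * e2 = e / 3" using C by (simp add: e2_def field_simps add_nonneg_eq_0_iff)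
    moreover have "(C + \<bar>\<kappa>\<bar>) * e2 \<le> (C + \<bar>\<kappa>\<bar> + 1) * e2" "C * e2 \<le> (C + \<bar>\<kappa>\<bar> + 1) * e2"
      using e2 by (auto intro!: mult_right_mono)
    ultimately show ?thesis by (simp add: e1_def)
  qed
  have "\<forall>\<^sub>F u in at 0. dist (f u / u\<^sup>2) \<kappa> < e1" using lim e1 by (rule tendstoD)
  then obtain d0 where d0: "d0 > 0" "\<And>u. u \<noteq> 0 \<Longrightarrow> dist u 0 < d0 \<Longrightarrow> dist (f u / u\<^sup>2) \<kappa> < e1"
    unfolding eventually_at by auto
  define d where "d = min (d0 / 2) (1/2)"
  have d: "0 < d" "d < 1" "d < d0" using d0 by (auto simp: d_def)
  have near: "\<bar>f u - \<kappa> * u\<^sup>2\<bar> \<le> e1 * u\<^sup>2" if "\<bar>u\<bar> \<le> d" for u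
  proof (cases "u = 0")
    case False
    have "\<bar>f u / u\<^sup>2 - \<kappa>\<bar> \<le> e1" using d0(2)[OF False] that d by (auto simp: dist_real_def)
    then have "\<bar>f u / u\<^sup>2 - \<kappa>\<bar> * u\<^sup>2 \<le> e1 * u\<^sup>2" by (intro mult_right_mono) auto
    also have "\<bar>f u / u\<^sup>2 - \<kappa>\<bar> * u\<^sup>2 = \<bar>(f u / u\<^sup>2 - \<kappa>) * u\<^sup>2\<bar>" by (simp add: abs_mult)
    also have "\<dots> = \<bar>f u - \<kappa> * u\<^sup>2\<bar>" using False by (simp add: algebra_simps)
    finally show ?thesis .
  qed (simp add: f0)
  have "((\<lambda>x. H0 (d * x) / H0 x) \<longlongrightarrow> 1) at_top" using sv d by (auto simp: slowly_varying_def)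
  then have "\<forall>\<^sub>F x in at_top. H0 (d * x) / H0 x > 1 - e2" using e2 by (intro order_tendstoD) auto
  moreover have "\<forall>\<^sub>F x in at_top. x * tail x / H0 x < e2"
    using slowly_varying_tail[OF sv] e2 by (rule order_tendstoD)
  moreover have "\<forall>\<^sub>F x in at_top. H0 x > 0" using sv by (auto simp: slowly_varying_def)
  ultimately have "\<forall>\<^sub>F x in at_top. H0 x - H0 (d * x) \<le> e2 * H0 x \<and> x * tail x \<le> e2 * H0 x"
    by eventually_elim (auto simp: field_simps)
  then obtain X where X: "\<And>x. x \<ge> X \<Longrightarrow> H0 x - H0 (d * x) \<le> e2 * H0 x \<and> x * tail x \<le> e2 * H0 x"
    by (auto simp: eventually_at_top_linorder)
  \<comment> \<open>For |c| \<le> \<open>c0\<close> the scale x = 1/|c| is beyond X, where the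
    estimates hold, and beyond \<open>b0 + 1\<close>, where \<open>H\<close> and \<open>H0\<close>
    agree.\<close>
  define c0 where "c0 = inverse (max X (b0 + 1))"
  have c0: "c0 > 0" using b0_nonneg by (auto simp: c0_def max_def)
  have "\<bar>expectation (\<lambda>\<omega>. f (c * Z \<omega>)) - \<kappa> * g c\<bar> \<le> e * g c" if c: "\<bar>c\<bar> \<le> c0" for c
  proof (cases "c = 0")
    case True then show ?thesis by (simp add: f0)
  next
    case False
    define x where "x = inverse \<bar>c\<bar>"
    have x: "x > 0" using False by (simp add: x_def)
    have "inverse c0 \<le> x" unfolding x_def using False c by (intro le_imp_inverse_le) auto
    then have xX: "x \<ge> X" "x \<ge> b0 + 1" by (auto simp: c0_def)
    have cx: "\<bar>c\<bar> = inverse x" by (simp add: x_def)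
    have gc: "g c = c\<^sup>2 * H0 x" using False H_eq_H0[OF xX(2)] by (simp add: g_def x_def)
    let ?A = "\<lambda>\<omega>. (Z \<omega>)\<^sup>2 * indicator {\<omega>. \<bar>Z \<omega>\<bar> \<le> x} \<omega>"
    let ?B = "\<lambda>\<omega>. (Z \<omega>)\<^sup>2 * indicator {\<omega>. \<bar>Z \<omega>\<bar> \<le> d * x} \<omega>"
    let ?T = "\<lambda>\<omega>. \<bar>Z \<omega>\<bar> * indicator {\<omega>. \<bar>Z \<omega>\<bar> > x} \<omega>"
    let ?R = "\<lambda>\<omega>. e1 * (c\<^sup>2 * ?A \<omega>) + (C + \<bar>\<kappa>\<bar>) * (c\<^sup>2 * (?A \<omega> - ?B \<omega>)) + C * (\<bar>c\<bar> * ?T \<omega>)"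
    have intf: "integrable M (\<lambda>\<omega>. f (c * Z \<omega>))"
      by (rule Bochner_Integration.integrable_bound[OF integrable_mult_right[OF integrable_qf, of C c]])
        (use f C in \<open>auto simp: abs_mult\<close>)
    have pt: "\<bar>f (c * Z \<omega>) - \<kappa> * (c\<^sup>2 * ?A \<omega>)\<bar> \<le> ?R \<omega>" for \<omega>
    proof -
      consider "\<bar>Z \<omega>\<bar> \<le> d * x" | "d * x < \<bar>Z \<omega>\<bar>" "\<bar>Z \<omega>\<bar> \<le> x" | "\<bar>Z \<omega>\<bar> > x" by linarith
      then show ?thesis
      proof cases
        case 1
        then have "\<bar>Z \<omega>\<bar> \<le> x" using d x by (smt (verit) mult_le_cancel_right1)
        moreover have "\<bar>c * Z \<omega>\<bar> \<le> d" using 1 x by (simp add: abs_mult cx field_simps)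
        ultimately show ?thesis using near[of "c * Z \<omega>"] 1 by (simp add: power_mult_distrib)
      next
        case 2
        have "\<bar>c * Z \<omega>\<bar> \<le> 1" using 2 x by (simp add: abs_mult cx field_simps)
        then have "\<bar>f (c * Z \<omega>)\<bar> \<le> C * (c\<^sup>2 * (Z \<omega>)\<^sup>2)"
          using f[of "c * Z \<omega>"] by (simp add: qf_eq_square power_mult_distrib)
        then have "\<bar>f (c * Z \<omega>) - \<kappa> * (c\<^sup>2 * (Z \<omega>)\<^sup>2)\<bar> \<le> C * (c\<^sup>2 * (Z \<omega>)\<^sup>2) + \<bar>\<kappa>\<bar> * (c\<^sup>2 * (Z \<omega>)\<^sup>2)"
          using abs_triangle_ineq4[of "f (c * Z \<omega>)" "\<kappa> * (c\<^sup>2 * (Z \<omega>)\<^sup>2)"] by (simp add: abs_mult)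
        moreover have "0 \<le> e1 * (c\<^sup>2 * (Z \<omega>)\<^sup>2)" using e1 by simp
        ultimately show ?thesis using 2 by (simp add: algebra_simps)
      next
        case 3
        have "\<bar>c * Z \<omega>\<bar> \<ge> 1" using 3 x by (simp add: abs_mult cx field_simps)
        then have "\<bar>f (c * Z \<omega>)\<bar> \<le> C * (\<bar>c\<bar> * \<bar>Z \<omega>\<bar>)"
          using f[of "c * Z \<omega>"] by (simp add: qf_eq_abs abs_mult)
        moreover have "\<not> \<bar>Z \<omega>\<bar> \<le> d * x" using 3 d x by (smt (verit) mult_le_cancel_right1)
        ultimately show ?thesis using 3 by simp
      qed
    qed
    have intR: "integrable M ?R"
      by (intro Bochner_Integration.integrable_add integrable_mult_right Bochner_Integration.integrable_diff
          integrable_trunc integrable_tail)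
    have ER: "expectation ?R = e1 * (c\<^sup>2 * H0 x) + (C + \<bar>\<kappa>\<bar>) * (c\<^sup>2 * (H0 x - H0 (d * x))) + C * (\<bar>c\<bar> * tail x)"
      unfolding trunc_moment_def tail_def
      by (simp add: integrable_trunc integrable_tail Bochner_Integration.integrable_add
          Bochner_Integration.integrable_diff)
    have E1: "expectation (\<lambda>\<omega>. f (c * Z \<omega>)) - \<kappa> * g c = expectation (\<lambda>\<omega>. f (c * Z \<omega>) - \<kappa> * (c\<^sup>2 * ?A \<omega>))"
      unfolding gc trunc_moment_def
      by (subst Bochner_Integration.integral_diff[OF intf]) (auto intro!: integrable_mult_right integrable_trunc)
    have int1: "integrable M (\<lambda>\<omega>. \<bar>f (c * Z \<omega>) - \<kappa> * (c\<^sup>2 * ?A \<omega>)\<bar>)"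
      by (intro integrable_abs Bochner_Integration.integrable_diff intf integrable_mult_right integrable_trunc)
    have E2: "\<bar>expectation (\<lambda>\<omega>. f (c * Z \<omega>)) - \<kappa> * g c\<bar> \<le> expectation ?R"
      unfolding E1 using integral_mono[OF int1 intR pt]
      by (rule order_trans[OF integral_abs_bound])
    have c2: "c\<^sup>2 * (H0 x - H0 (d * x)) \<le> e2 * g c"
      using X[OF xX(1)] mult_left_mono[of "H0 x - H0 (d * x)" "e2 * H0 x" "c\<^sup>2"]
      by (simp add: gc mult.left_commute)
    have c3_eq: "\<bar>c\<bar> * tail x = c\<^sup>2 * (x * tail x)"
    proof -
      have "c\<^sup>2 = \<bar>c\<bar> * \<bar>c\<bar>" by (simp add: power2_eq_square)
      moreover have "\<bar>c\<bar> * x = 1" using False by (simp add: x_def)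
      moreover have "\<bar>c\<bar> * \<bar>c\<bar> * (x * tail x) = \<bar>c\<bar> * ((\<bar>c\<bar> * x) * tail x)"
        by (simp only: mult.assoc)
      ultimately show ?thesis by (simp only: mult_1)
    qed
    have c3: "\<bar>c\<bar> * tail x \<le> e2 * g c"
      unfolding c3_eq
      using X[OF xX(1)] mult_left_mono[of "x * tail x" "e2 * H0 x" "c\<^sup>2"]
      by (simp add: gc mult.left_commute)
    have "expectation ?R \<le> e1 * g c + (C + \<bar>\<kappa>\<bar>) * (e2 * g c) + C * (e2 * g c)"
      unfolding ER gc[symmetric] using c2 c3 C e1 by (intro add_mono mult_left_mono) auto
    moreover have "e1 * g c + (C + \<bar>\<kappa>\<bar>) * (e2 * g c) + C * (e2 * g c) = (e1 + (C + \<bar>\<kappa>\<bar>) * e2 + C * e2) * g c"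
      by (simp add: distrib_right mult.assoc)
    moreover have "(e1 + (C + \<bar>\<kappa>\<bar>) * e2 + C * e2) * g c \<le> e * g c"
      using e12 g_nonneg by (rule mult_right_mono)
    ultimately show ?thesis using E2 by linarith
  qed
  then show ?thesis using c0 by blast
qed

end

subsection \<open>Almost sure convergence of sums of independent variables\<close>

context prob_space
begin

lemma indep_vars_blocks:
  fixes X :: "'i \<Rightarrow> 'a \<Rightarrow> real" and F :: "'j \<Rightarrow> ('i \<Rightarrow> real) \<Rightarrow> real"
  assumes "indep_vars (\<lambda>_. borel) X I" "\<And>j. j \<in> L \<Longrightarrow> K j \<subseteq> I" "disjoint_family_on K L"
    and "\<And>j. j \<in> L \<Longrightarrow> F j \<in> borel_measurable (PiM (K j) (\<lambda>_. borel))"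
  shows "indep_vars (\<lambda>_. borel) (\<lambda>j \<omega>. F j (restrict (\<lambda>i. X i \<omega>) (K j))) L"
  by (rule indep_vars_compose2[OF indep_vars_restrict[OF assms(1-3)] assms(4)])

lemma indep_vars_reindex_inj:
  fixes X :: "'i \<Rightarrow> 'a \<Rightarrow> real"
  assumes "indep_vars (\<lambda>_. borel) X I" "f ` L \<subseteq> I" "inj_on f L"
  shows "indep_vars (\<lambda>_. borel) (\<lambda>j. X (f j)) L"
proof -
  have "indep_vars (\<lambda>_. borel) (\<lambda>j \<omega>. (\<lambda>x. x (f j)) (restrict (\<lambda>i. X i \<omega>) {f j})) L"
    using assms(2,3)
    by (intro indep_vars_blocks[OF assms(1)])
      (auto simp: disjoint_family_on_def inj_on_def)
  then show ?thesis by simp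
qed

lemma indep_var_blocks:
  fixes X :: "'i \<Rightarrow> 'a \<Rightarrow> real"
  assumes "indep_vars (\<lambda>_. borel) X I" "A \<subseteq> I" "B \<subseteq> I" "A \<inter> B = {}"
    and "F \<in> borel_measurable (PiM A (\<lambda>_. borel))" "G \<in> borel_measurable (PiM B (\<lambda>_. borel))"
  shows "indep_var borel (\<lambda>\<omega>. F (restrict (\<lambda>i. X i \<omega>) A) :: real)
      borel (\<lambda>\<omega>. G (restrict (\<lambda>i. X i \<omega>) B) :: real)"
  using indep_var_compose[OF indep_var_restrict[OF assms(1,4,2,3)] assms(5,6)] by (simp add: comp_def)

lemma second_moment_sum_indep:
  fixes X :: "'i \<Rightarrow> 'a \<Rightarrow> real"
  assumes "finite J" "indep_vars (\<lambda>_. borel) X J"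
    and "\<And>j. j \<in> J \<Longrightarrow> integrable M (X j)" "\<And>j. j \<in> J \<Longrightarrow> integrable M (\<lambda>\<omega>. (X j \<omega>)\<^sup>2)"
    and "\<And>j. j \<in> J \<Longrightarrow> expectation (X j) = 0"
  shows "integrable M (\<lambda>\<omega>. (\<Sum>j\<in>J. X j \<omega>)\<^sup>2) \<and>
    expectation (\<lambda>\<omega>. (\<Sum>j\<in>J. X j \<omega>)\<^sup>2) = (\<Sum>j\<in>J. expectation (\<lambda>\<omega>. (X j \<omega>)\<^sup>2))"
  using assms
proof (induction J rule: finite_induct)
  case (insert i J)
  let ?S = "\<lambda>\<omega>. \<Sum>j\<in>J. X j \<omega>"
  have IH: "integrable M (\<lambda>\<omega>. (?S \<omega>)\<^sup>2)"
    "expectation (\<lambda>\<omega>. (?S \<omega>)\<^sup>2) = (\<Sum>j\<in>J. expectation (\<lambda>\<omega>. (X j \<omega>)\<^sup>2))"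
    using insert.IH[OF indep_vars_subset[OF insert.prems(1)]] insert.prems by auto
  have iv: "indep_var borel (X i) borel ?S" by (rule indep_vars_sum[OF insert.hyps insert.prems(1)])
  have intS: "integrable M ?S" using insert.prems by auto
  have inti: "integrable M (X i)" "integrable M (\<lambda>\<omega>. (X i \<omega>)\<^sup>2)" "expectation (X i) = 0"
    using insert.prems by auto
  have pr: "integrable M (\<lambda>\<omega>. X i \<omega> * ?S \<omega>)" "expectation (\<lambda>\<omega>. X i \<omega> * ?S \<omega>) = 0"
    using indep_var_integrable[OF iv inti(1) intS] indep_var_lebesgue_integral[OF iv inti(1) intS] inti(3)
    by auto
  have eq: "(\<Sum>j\<in>insert i J. X j \<omega>)\<^sup>2 = (X i \<omega>)\<^sup>2 + (?S \<omega>)\<^sup>2 + 2 * (X i \<omega> * ?S \<omega>)" for \<omega>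
    using insert.hyps by (simp add: power2_sum mult.assoc)
  show ?case unfolding eq using inti IH pr insert.hyps by auto
qed simp

text \<open>Nonnegativity of the variance of |Y|.\<close>

lemma expectation_abs_le_sqrt:
  assumes "integrable M (\<lambda>\<omega>. (Y \<omega>)\<^sup>2)" and [measurable]: "Y \<in> borel_measurable M"
  shows "integrable M Y" "expectation (\<lambda>\<omega>. \<bar>Y \<omega>\<bar>) \<le> sqrt (expectation (\<lambda>\<omega>. (Y \<omega>)\<^sup>2))"
proof -
  have b: "\<bar>y\<bar> \<le> 1 + y\<^sup>2" for y :: real
    using zero_le_power2[of "\<bar>y\<bar> - 1"] zero_le_power2[of y] unfolding power2_diff by simp
  show int: "integrable M Y"
    by (rule Bochner_Integration.integrable_bound[of _ "\<lambda>\<omega>. 1 + (Y \<omega>)\<^sup>2"])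
      (use assms b in auto)
  let ?m = "expectation (\<lambda>\<omega>. \<bar>Y \<omega>\<bar>)"
  have "0 \<le> expectation (\<lambda>\<omega>. (\<bar>Y \<omega>\<bar> - ?m)\<^sup>2)" by (rule Bochner_Integration.integral_nonneg) simp
  also have "\<dots> = expectation (\<lambda>\<omega>. (Y \<omega>)\<^sup>2 - 2 * ?m * \<bar>Y \<omega>\<bar> + ?m\<^sup>2)"
    by (intro Bochner_Integration.integral_cong) (auto simp: power2_diff)
  also have "\<dots> = expectation (\<lambda>\<omega>. (Y \<omega>)\<^sup>2) - ?m\<^sup>2"
    using assms int by (simp add: prob_space power2_eq_square)
  finally show "?m \<le> sqrt (expectation (\<lambda>\<omega>. (Y \<omega>)\<^sup>2))" by (intro real_le_rsqrt) simp
qed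

text \<open>Truncation at 1: the centered truncated parts have total variance at most r, which gives
  sqrt r in mean. The parts cut off have total first moment at most r, and the centering constants,
  being minus their means because the variables are centered, add at most r more.\<close>

lemma expectation_abs_sum_indep_le:
  fixes X :: "'i \<Rightarrow> 'a \<Rightarrow> real"
  assumes J: "finite J" and ind: "indep_vars (\<lambda>_. borel) X J"
    and int: "\<And>j. j \<in> J \<Longrightarrow> integrable M (X j)" and mean: "\<And>j. j \<in> J \<Longrightarrow> expectation (X j) = 0"
  defines "r \<equiv> (\<Sum>j\<in>J. expectation (\<lambda>\<omega>. qf (X j \<omega>)))"
  shows "expectation (\<lambda>\<omega>. \<bar>\<Sum>j\<in>J. X j \<omega>\<bar>) \<le> sqrt r + 2 * r"
proof -
  define t :: "real \<Rightarrow> real" where "t u = (if \<bar>u\<bar> \<le> 1 then u else 0)" for u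
  have [measurable]: "t \<in> borel_measurable borel" unfolding t_def[abs_def] by measurable
  have meas [measurable]: "X j \<in> borel_measurable M" if "j \<in> J" for j using int[OF that] by auto
  define m where "m j = expectation (\<lambda>\<omega>. t (X j \<omega>))" for j
  define Y where "Y j \<omega> = t (X j \<omega>) - m j" for j \<omega>
  define W where "W j \<omega> = X j \<omega> - t (X j \<omega>)" for j \<omega>
  have intt: "integrable M (\<lambda>\<omega>. t (X j \<omega>))" "integrable M (\<lambda>\<omega>. (t (X j \<omega>))\<^sup>2)" if "j \<in> J" for j
    using meas[OF that] by (auto intro!: integrable_const_bound[where B = 1] simp: t_def abs_square_le_1)
  have indY: "indep_vars (\<lambda>_. borel) Y J"
    unfolding Y_def[abs_def] by (rule indep_vars_compose2[OF ind, where Y = "\<lambda>j u. t u - m j"]) measurable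
  have intY: "integrable M (Y j)" "expectation (Y j) = 0" "integrable M (\<lambda>\<omega>. (Y j \<omega>)\<^sup>2)"
     "expectation (\<lambda>\<omega>. (Y j \<omega>)\<^sup>2) \<le> expectation (\<lambda>\<omega>. qf (X j \<omega>))" if "j \<in> J" for j
  proof -
    note i = intt[OF that]
    show "integrable M (Y j)" "expectation (Y j) = 0"
      unfolding Y_def[abs_def] using i by (auto simp: m_def prob_space)
    have eq: "(Y j \<omega>)\<^sup>2 = (t (X j \<omega>))\<^sup>2 - 2 * m j * t (X j \<omega>) + (m j)\<^sup>2" for \<omega>
      by (simp add: Y_def power2_diff)
    show "integrable M (\<lambda>\<omega>. (Y j \<omega>)\<^sup>2)" unfolding eq using i by auto
    have "expectation (\<lambda>\<omega>. (Y j \<omega>)\<^sup>2) = expectation (\<lambda>\<omega>. (t (X j \<omega>))\<^sup>2) - (m j)\<^sup>2"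
      unfolding eq using i by (simp add: prob_space m_def power2_eq_square)
    also have "\<dots> \<le> expectation (\<lambda>\<omega>. (t (X j \<omega>))\<^sup>2)" by simp
    also have "\<dots> \<le> expectation (\<lambda>\<omega>. qf (X j \<omega>))"
    proof (intro integral_mono i)
      show "integrable M (\<lambda>\<omega>. qf (X j \<omega>))"
        by (rule Bochner_Integration.integrable_bound[OF int[OF that]]) (use meas[OF that] in \<open>auto simp: qf_le_abs\<close>)
      show "(t (X j \<omega>))\<^sup>2 \<le> qf (X j \<omega>)" for \<omega> by (simp add: t_def qf_eq_square)
    qed
    finally show "expectation (\<lambda>\<omega>. (Y j \<omega>)\<^sup>2) \<le> expectation (\<lambda>\<omega>. qf (X j \<omega>))" .
  qed
  have intW: "integrable M (W j)" "expectation (\<lambda>\<omega>. \<bar>W j \<omega>\<bar>) \<le> expectation (\<lambda>\<omega>. qf (X j \<omega>))"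
     "m j = - expectation (W j)" if "j \<in> J" for j
  proof -
    note i = intt[OF that]
    show iW: "integrable M (W j)" unfolding W_def[abs_def] using i int[OF that] by auto
    show "m j = - expectation (W j)" unfolding W_def[abs_def] m_def using i int[OF that] mean[OF that] by simp
    show "expectation (\<lambda>\<omega>. \<bar>W j \<omega>\<bar>) \<le> expectation (\<lambda>\<omega>. qf (X j \<omega>))"
    proof (intro integral_mono)
      show "integrable M (\<lambda>\<omega>. qf (X j \<omega>))"
        by (rule Bochner_Integration.integrable_bound[OF int[OF that]]) (use meas[OF that] in \<open>auto simp: qf_le_abs\<close>)
      show "\<bar>W j \<omega>\<bar> \<le> qf (X j \<omega>)" for \<omega> by (simp add: W_def t_def qf_eq_abs)
    qed (use iW in auto)
  qed
  have S2: "integrable M (\<lambda>\<omega>. (\<Sum>j\<in>J. Y j \<omega>)\<^sup>2)"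
    "expectation (\<lambda>\<omega>. (\<Sum>j\<in>J. Y j \<omega>)\<^sup>2) = (\<Sum>j\<in>J. expectation (\<lambda>\<omega>. (Y j \<omega>)\<^sup>2))"
    using second_moment_sum_indep[OF J indY intY(1) intY(3) intY(2)] by auto
  have intSY: "integrable M (\<lambda>\<omega>. \<Sum>j\<in>J. Y j \<omega>)" using intY by auto
  have "expectation (\<lambda>\<omega>. \<bar>\<Sum>j\<in>J. Y j \<omega>\<bar>) \<le> sqrt (\<Sum>j\<in>J. expectation (\<lambda>\<omega>. (Y j \<omega>)\<^sup>2))"
    using expectation_abs_le_sqrt(2)[OF S2(1)] intSY S2(2) by auto
  also have "\<dots> \<le> sqrt r" unfolding r_def by (intro real_sqrt_le_mono sum_mono intY)
  finally have A: "expectation (\<lambda>\<omega>. \<bar>\<Sum>j\<in>J. Y j \<omega>\<bar>) \<le> sqrt r" .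
  have "expectation (\<lambda>\<omega>. \<bar>\<Sum>j\<in>J. X j \<omega>\<bar>)
     \<le> expectation (\<lambda>\<omega>. \<bar>\<Sum>j\<in>J. Y j \<omega>\<bar> + (\<Sum>j\<in>J. \<bar>W j \<omega>\<bar> + \<bar>m j\<bar>))"
  proof (intro integral_mono)
    fix \<omega>
    have "(\<Sum>j\<in>J. X j \<omega>) = (\<Sum>j\<in>J. Y j \<omega>) + (\<Sum>j\<in>J. W j \<omega> + m j)"
      by (simp add: Y_def W_def sum.distrib[symmetric])
    moreover have "\<bar>\<Sum>j\<in>J. W j \<omega> + m j\<bar> \<le> (\<Sum>j\<in>J. \<bar>W j \<omega>\<bar> + \<bar>m j\<bar>)"
      by (rule order_trans[OF sum_abs sum_mono]) simp
    ultimately show "\<bar>\<Sum>j\<in>J. X j \<omega>\<bar> \<le> \<bar>\<Sum>j\<in>J. Y j \<omega>\<bar> + (\<Sum>j\<in>J. \<bar>W j \<omega>\<bar> + \<bar>m j\<bar>)" by linarith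
  qed (use int intSY intW in auto)
  also have "\<dots> = expectation (\<lambda>\<omega>. \<bar>\<Sum>j\<in>J. Y j \<omega>\<bar>) + (\<Sum>j\<in>J. expectation (\<lambda>\<omega>. \<bar>W j \<omega>\<bar>) + \<bar>m j\<bar>)"
    using intSY intW by (simp add: prob_space)
  also have "(\<Sum>j\<in>J. expectation (\<lambda>\<omega>. \<bar>W j \<omega>\<bar>) + \<bar>m j\<bar>) \<le> (\<Sum>j\<in>J. 2 * expectation (\<lambda>\<omega>. qf (X j \<omega>)))"
  proof (intro sum_mono)
    fix j assume j: "j \<in> J"
    have "\<bar>m j\<bar> \<le> expectation (\<lambda>\<omega>. \<bar>W j \<omega>\<bar>)"
      using intW(3)[OF j] integral_abs_bound[of M "W j"] by simp
    then show "expectation (\<lambda>\<omega>. \<bar>W j \<omega>\<bar>) + \<bar>m j\<bar> \<le> 2 * expectation (\<lambda>\<omega>. qf (X j \<omega>))"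
      using intW(2)[OF j] by simp
  qed
  also have "\<dots> = 2 * r" by (simp add: r_def sum_distrib_left)
  finally show ?thesis using A by simp
qed

lemma prob_ge_le_expectation:
  assumes "integrable M Y" "\<And>\<omega>. 0 \<le> Y \<omega>" "c > 0"
  shows "prob {\<omega>\<in>space M. Y \<omega> \<ge> c} \<le> expectation Y / c"
  by (rule integral_Markov_inequality_measure[of M Y "{}"]) (use assms in auto)

text \<open>Ottaviani's maximal inequality, by decomposing according to the first large partial sum.\<close>

lemma ottaviani:
  fixes X :: "nat \<Rightarrow> 'a \<Rightarrow> real"
  assumes ind: "indep_vars (\<lambda>_. borel) X UNIV"
  defines "S \<equiv> (\<lambda>k \<omega>. \<Sum>j<k. X j \<omega>)"
  assumes rho: "\<And>k. k \<le> n \<Longrightarrow> prob {\<omega>\<in>space M. \<bar>S n \<omega> - S k \<omega>\<bar> \<ge> e} \<le> \<rho>"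
  shows "prob {\<omega>\<in>space M. \<exists>k\<le>n. \<bar>S k \<omega>\<bar> \<ge> 2 * e} * (1 - \<rho>) \<le> prob {\<omega>\<in>space M. \<bar>S n \<omega>\<bar> \<ge> e}"
proof -
  have [measurable]: "X j \<in> borel_measurable M" for j using ind by (auto simp: indep_vars_def)
  have [measurable]: "S k \<in> borel_measurable M" for k unfolding S_def by measurable
  define A where "A k = {\<omega>\<in>space M. \<bar>S k \<omega>\<bar> \<ge> 2 * e \<and> (\<forall>i<k. \<bar>S i \<omega>\<bar> < 2 * e)}" for k
  define B where "B k = {\<omega>\<in>space M. \<bar>S n \<omega> - S k \<omega>\<bar> < e}" for k
  have [measurable]: "A k \<in> events" "B k \<in> events" for k unfolding A_def B_def by measurable
  have disj: "disjoint_family_on A {..n}"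
    unfolding disjoint_family_on_def A_def by (auto simp: not_less[symmetric]) (metis linorder_neqE_nat not_less)
  have un: "{\<omega>\<in>space M. \<exists>k\<le>n. \<bar>S k \<omega>\<bar> \<ge> 2 * e} = (\<Union>k\<le>n. A k)"
  proof (intro equalityI subsetI)
    fix \<omega> assume w: "\<omega> \<in> {\<omega>\<in>space M. \<exists>k\<le>n. \<bar>S k \<omega>\<bar> \<ge> 2 * e}"
    then obtain k where k: "k \<le> n" "\<bar>S k \<omega>\<bar> \<ge> 2 * e" by auto
    define l where "l = (LEAST k. \<bar>S k \<omega>\<bar> \<ge> 2 * e)"
    have "\<bar>S l \<omega>\<bar> \<ge> 2 * e" unfolding l_def using k by (rule_tac LeastI)
    moreover have "\<forall>i<l. \<bar>S i \<omega>\<bar> < 2 * e" unfolding l_def using not_less_Least not_le by blast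
    moreover have "l \<le> n" unfolding l_def using k Least_le[of "\<lambda>k. \<bar>S k \<omega>\<bar> \<ge> 2 * e" k] by simp
    ultimately show "\<omega> \<in> (\<Union>k\<le>n. A k)" using w by (auto simp: A_def)
  qed (auto simp: A_def)
  have ab: "prob (A k \<inter> B k) = prob (A k) * prob (B k)" if k: "k \<le> n" for k
  proof -
    \<comment> \<open>F and G express the indicators of \<open>A k\<close> and \<open>B k\<close>
      through the disjoint blocks of variables before k and from k to n, which are
      independent.\<close>
    define F where "F y = (if \<bar>\<Sum>j<k. y j\<bar> \<ge> 2 * e \<and> (\<forall>i<k. \<bar>\<Sum>j<i. y j\<bar> < 2 * e) then 1 else 0 :: real)"
      for y :: "nat \<Rightarrow> real"
    define G where "G y = (if \<bar>\<Sum>j\<in>{k..<n}. y j\<bar> < e then 1 else 0 :: real)" for y :: "nat \<Rightarrow> real"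
    have m1: "(\<lambda>y. \<Sum>j<i. y j :: real) \<in> borel_measurable (PiM {..<k} (\<lambda>_. borel))" if "i \<le> k" for i
      using that by (intro borel_measurable_sum) auto
    have m2: "(\<lambda>y. \<Sum>j\<in>{k..<n}. y j :: real) \<in> borel_measurable (PiM {k..<n} (\<lambda>_. borel))"
      by (intro borel_measurable_sum) auto
    have F: "F \<in> borel_measurable (PiM {..<k} (\<lambda>_. borel))"
    proof -
      have "F = (\<lambda>y. indicator {2 * e..} \<bar>\<Sum>j<k. y j\<bar> * (\<Prod>i<k. indicator {..<2 * e} \<bar>\<Sum>j<i. y j\<bar>))"
        by (auto simp: F_def fun_eq_iff indicator_def prod_eq_1_iff prod_zero_iff)
      also have "\<dots> \<in> borel_measurable (PiM {..<k} (\<lambda>_. borel))"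
      proof (intro borel_measurable_times borel_measurable_prod)
        show "(\<lambda>y. indicator {2 * e..} \<bar>\<Sum>j<k. y j\<bar> :: real) \<in> borel_measurable (PiM {..<k} (\<lambda>_. borel))"
          using m1[of k] by measurable
        show "(\<lambda>y. indicator {..<2 * e} \<bar>\<Sum>j<i. y j\<bar> :: real) \<in> borel_measurable (PiM {..<k} (\<lambda>_. borel))"
          if "i \<in> {..<k}" for i
          using m1[of i] that by (auto intro!: borel_measurable_indicator' borel_measurable_abs)
      qed
      finally show ?thesis .
    qed
    have G: "G \<in> borel_measurable (PiM {k..<n} (\<lambda>_. borel))"
      unfolding G_def using m2 by measurable
    have iv: "indep_var borel (\<lambda>\<omega>. F (restrict (\<lambda>i. X i \<omega>) {..<k})) borel (\<lambda>\<omega>. G (restrict (\<lambda>i. X i \<omega>) {k..<n}))"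
      by (rule indep_var_blocks[OF ind _ _ _ F G]) auto
    have eqF: "F (restrict (\<lambda>i. X i \<omega>) {..<k}) = indicator (A k) \<omega>" if "\<omega> \<in> space M" for \<omega>
      using that by (auto simp: F_def A_def S_def indicator_def)
    have eqG: "G (restrict (\<lambda>i. X i \<omega>) {k..<n}) = indicator (B k) \<omega>" if "\<omega> \<in> space M" for \<omega>
    proof -
      have "S n \<omega> - S k \<omega> = (\<Sum>j\<in>{k..<n}. X j \<omega>)"
        unfolding S_def using k sum_diff_nat_ivl[of 0 k n "\<lambda>j. X j \<omega>"] by (simp add: lessThan_atLeast0)
      then show ?thesis using that by (auto simp: G_def B_def indicator_def)
    qed
    have intF: "integrable M (\<lambda>\<omega>. F (restrict (\<lambda>i. X i \<omega>) {..<k}))"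
      and intG: "integrable M (\<lambda>\<omega>. G (restrict (\<lambda>i. X i \<omega>) {k..<n}))"
      using iv by (auto simp: indep_var_eq F_def G_def intro!: integrable_const_bound[where B = 1])
    have "expectation (\<lambda>\<omega>. indicator (A k) \<omega> * indicator (B k) \<omega>)
       = expectation (\<lambda>\<omega>. F (restrict (\<lambda>i. X i \<omega>) {..<k}) * G (restrict (\<lambda>i. X i \<omega>) {k..<n}))"
      by (intro Bochner_Integration.integral_cong refl) (simp only: eqF eqG)
    also have "\<dots> = expectation (\<lambda>\<omega>. F (restrict (\<lambda>i. X i \<omega>) {..<k})) * expectation (\<lambda>\<omega>. G (restrict (\<lambda>i. X i \<omega>) {k..<n}))"
      by (rule indep_var_lebesgue_integral[OF iv intF intG])
    also have "expectation (\<lambda>\<omega>. F (restrict (\<lambda>i. X i \<omega>) {..<k})) = expectation (indicator (A k))"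
      by (intro Bochner_Integration.integral_cong refl eqF)
    also have "expectation (\<lambda>\<omega>. G (restrict (\<lambda>i. X i \<omega>) {k..<n})) = expectation (indicator (B k))"
      by (intro Bochner_Integration.integral_cong refl eqG)
    finally have "expectation (\<lambda>\<omega>. indicator (A k) \<omega> * indicator (B k) \<omega>)
       = expectation (indicator (A k)) * expectation (indicator (B k) :: _ \<Rightarrow> real)" .
    then show ?thesis by (simp add: indicator_inter_arith[symmetric])
  qed
  have B: "prob (B k) \<ge> 1 - \<rho>" if "k \<le> n" for k
  proof -
    have "B k = space M - {\<omega>\<in>space M. \<bar>S n \<omega> - S k \<omega>\<bar> \<ge> e}" by (auto simp: B_def)
    then have "prob (B k) = 1 - prob {\<omega>\<in>space M. \<bar>S n \<omega> - S k \<omega>\<bar> \<ge> e}" by (simp add: prob_compl)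
    then show ?thesis using rho[OF that] by simp
  qed
  have "prob {\<omega>\<in>space M. \<exists>k\<le>n. \<bar>S k \<omega>\<bar> \<ge> 2 * e} * (1 - \<rho>) = (\<Sum>k\<le>n. prob (A k)) * (1 - \<rho>)"
    unfolding un using disj by (subst finite_measure_finite_Union) auto
  also have "\<dots> \<le> (\<Sum>k\<le>n. prob (A k) * prob (B k))"
    unfolding sum_distrib_right using B by (intro sum_mono mult_left_mono) auto
  also have "\<dots> = (\<Sum>k\<le>n. prob (A k \<inter> B k))" using ab by simp
  also have "\<dots> = prob (\<Union>k\<le>n. A k \<inter> B k)"
    using disj by (intro finite_measure_finite_Union[symmetric]) (auto simp: disjoint_family_on_def)
  also have "\<dots> \<le> prob {\<omega>\<in>space M. \<bar>S n \<omega>\<bar> \<ge> e}"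
    by (intro finite_measure_mono) (auto simp: A_def B_def)
  finally show ?thesis .
qed

text \<open>The remainder \<open>R m\<close> controls all block sums beyond m in mean, hence in
  probability; Ottaviani's inequality extends this to the maximum over all later partial sums, so
  that almost surely the partial sums are Cauchy.\<close>

lemma AE_convergent_sum_indep:
  fixes X :: "nat \<Rightarrow> 'a \<Rightarrow> real"
  assumes ind: "indep_vars (\<lambda>_. borel) X UNIV"
    and int: "\<And>j. integrable M (X j)" and mean: "\<And>j. expectation (X j) = 0"
    and summ: "summable (\<lambda>j. expectation (\<lambda>\<omega>. qf (X j \<omega>)))"
  shows "AE \<omega> in M. convergent (\<lambda>n. \<Sum>j<n. X j \<omega>)"
proof -
  have [measurable]: "X j \<in> borel_measurable M" for j using int by auto
  define S where "S k \<omega> = (\<Sum>j<k. X j \<omega>)" for k \<omega>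
  have [measurable]: "S k \<in> borel_measurable M" for k unfolding S_def by measurable
  define a where "a j = expectation (\<lambda>\<omega>. qf (X j \<omega>))" for j
  have a0: "a j \<ge> 0" for j unfolding a_def by (intro Bochner_Integration.integral_nonneg) simp
  have sa: "summable a" using summ unfolding a_def .
  define R where "R m = (\<Sum>j. a (m + j))" for m
  have R0: "R \<longlonglongrightarrow> 0"
  proof -
    have "R = (\<lambda>m. suminf a - (\<Sum>j<m. a j))"
      unfolding R_def fun_eq_iff using suminf_minus_initial_segment[OF sa] by (simp add: add.commute)
    moreover have "(\<lambda>m. suminf a - (\<Sum>j<m. a j)) \<longlonglongrightarrow> suminf a - suminf a"
      by (intro tendsto_intros summable_LIMSEQ sa)
    ultimately show ?thesis by simp
  qed
  have Rnn: "R m \<ge> 0" for m unfolding R_def using a0 sa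
    by (intro suminf_nonneg) (auto simp: add.commute summable_iff_shift)
  have small: "prob {\<omega>\<in>space M. \<bar>\<Sum>j\<in>{p..<q}. X j \<omega>\<bar> \<ge> e} \<le> (sqrt (R m) + 2 * R m) / e"
    if "m \<le> p" "e > 0" for m p q e
  proof -
    have le: "(\<Sum>j\<in>{p..<q}. a j) \<le> R m"
    proof -
      have "(\<Sum>j\<in>{p..<q}. a j) \<le> (\<Sum>j\<in>{m..<q}. a j)" using that a0 by (intro sum_mono2) auto
      also have "\<dots> = (\<Sum>j\<in>{0..<q-m}. a (m + j))"
        by (cases "m \<le> q") (auto simp: sum.atLeastLessThan_shift_0[of _ m q] intro!: sum.cong)
      also have "\<dots> \<le> R m" unfolding R_def using a0 sa
        by (intro sum_le_suminf) (auto simp: add.commute summable_iff_shift)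
      finally show ?thesis .
    qed
    have "prob {\<omega>\<in>space M. \<bar>\<Sum>j\<in>{p..<q}. X j \<omega>\<bar> \<ge> e} \<le> expectation (\<lambda>\<omega>. \<bar>\<Sum>j\<in>{p..<q}. X j \<omega>\<bar>) / e"
      using int that by (intro prob_ge_le_expectation) auto
    also have "\<dots> \<le> (sqrt (\<Sum>j\<in>{p..<q}. a j) + 2 * (\<Sum>j\<in>{p..<q}. a j)) / e"
      unfolding a_def using that int mean
      by (intro divide_right_mono expectation_abs_sum_indep_le indep_vars_subset[OF ind]) auto
    also have "\<dots> \<le> (sqrt (R m) + 2 * R m) / e"
      using that le by (intro divide_right_mono add_mono mult_left_mono real_sqrt_le_mono) auto
    finally show ?thesis .
  qed
  have key: "AE \<omega> in M. \<exists>m. \<forall>k. \<bar>S (m + k) \<omega> - S m \<omega>\<bar> < 2 * e" if e: "e > 0" for e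
  proof -
    define N where "N m = {\<omega>\<in>space M. \<exists>k. \<bar>S (m + k) \<omega> - S m \<omega>\<bar> \<ge> 2 * e}" for m
    have [measurable]: "N m \<in> events" for m unfolding N_def by measurable
    have lim: "(\<lambda>m. (sqrt (R m) + 2 * R m) / e) \<longlonglongrightarrow> (sqrt 0 + 2 * 0) / e"
      by (intro tendsto_intros R0) (use e in auto)
    have ev: "\<forall>\<^sub>F m in sequentially. (sqrt (R m) + 2 * R m) / e < 1/2"
      by (rule order_tendstoD(2)[OF lim]) simp
    \<comment> \<open>Below 1/2 the bound serves as \<rho> = 1/2 in Ottaviani's inequality, whose
      factor 1 - \<rho> becomes the factor 2 here. Finite horizons n are passed to the limit by
      continuity from below.\<close>
    have bound: "prob (N m) \<le> 2 * ((sqrt (R m) + 2 * R m) / e)" if r: "(sqrt (R m) + 2 * R m) / e < 1/2" for m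
    proof -
      define N' where "N' n = {\<omega>\<in>space M. \<exists>k\<le>n. \<bar>S (m + k) \<omega> - S m \<omega>\<bar> \<ge> 2 * e}" for n
      have [measurable]: "N' n \<in> events" for n unfolding N'_def by measurable
      have "prob (N' n) \<le> 2 * ((sqrt (R m) + 2 * R m) / e)" for n
      proof -
        have half: "p \<le> 2 * x" if "p * (1 - 1/2) \<le> x" for p x :: real using that by simp
        have ind': "indep_vars (\<lambda>_. borel) (\<lambda>j. X (m + j)) UNIV"
          by (rule indep_vars_reindex_inj[OF ind]) auto
        have eq: "(\<Sum>j<k. X (m + j) \<omega>) = S (m + k) \<omega> - S m \<omega>" for k \<omega>
          unfolding S_def by (induction k) auto
        have eq2: "S (m + n) \<omega> - S m \<omega> - (S (m + k) \<omega> - S m \<omega>) = (\<Sum>j\<in>{m+k..<m+n}. X j \<omega>)" if "k \<le> n" for k \<omega>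
          unfolding S_def using that sum_diff_nat_ivl[of 0 "m+k" "m+n" "\<lambda>j. X j \<omega>"] by (simp add: lessThan_atLeast0)
        have eq3: "S (m + n) \<omega> - S m \<omega> = (\<Sum>j\<in>{m..<m+n}. X j \<omega>)" for \<omega> using eq2[of 0 \<omega>] by simp
        have "prob (N' n) * (1 - 1/2) \<le> prob {\<omega>\<in>space M. \<bar>S (m + n) \<omega> - S m \<omega>\<bar> \<ge> e}"
          unfolding N'_def
        proof (rule ottaviani[OF ind', unfolded eq])
          fix k assume k: "k \<le> n"
          show "prob {\<omega>\<in>space M. \<bar>S (m + n) \<omega> - S m \<omega> - (S (m + k) \<omega> - S m \<omega>)\<bar> \<ge> e} \<le> 1/2"
            unfolding eq2[OF k] using small[of m "m+k" e "m+n"] e r by linarith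
        qed
        also have "\<dots> \<le> (sqrt (R m) + 2 * R m) / e" unfolding eq3 using small[of m m e "m+n"] e by simp
        finally have "prob (N' n) * (1 - 1/2) \<le> (sqrt (R m) + 2 * R m) / e" .
        then show ?thesis by (rule half)
      qed
      moreover have "(\<lambda>n. prob (N' n)) \<longlonglongrightarrow> prob (\<Union>n. N' n)"
        by (intro finite_Lim_measure_incseq) (auto simp: incseq_def N'_def intro: order_trans)
      moreover have "(\<Union>n. N' n) = N m" by (auto simp: N'_def N_def)
      ultimately show ?thesis by (intro LIMSEQ_le_const2) auto
    qed
    have "(\<Inter>m. N m) \<in> null_sets M"
    proof -
      have "prob (\<Inter>m. N m) \<le> 0"
      proof (rule tendsto_lowerbound)
        show "(\<lambda>m. 2 * ((sqrt (R m) + 2 * R m) / e)) \<longlonglongrightarrow> 0" using tendsto_mult_left[OF lim, of 2] by simp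
        show "\<forall>\<^sub>F m in sequentially. prob (\<Inter>m. N m) \<le> 2 * ((sqrt (R m) + 2 * R m) / e)"
          using ev
        proof eventually_elim
          case (elim m)
          have "prob (\<Inter>m. N m) \<le> prob (N m)" by (intro finite_measure_mono) auto
          then show ?case using bound[OF elim] by simp
        qed
      qed simp
      then have "prob (\<Inter>m. N m) = 0" using measure_nonneg[of M "\<Inter>m. N m"] by linarith
      then show ?thesis by (auto simp: emeasure_eq_measure intro!: null_setsI)
    qed
    then show ?thesis
      by (rule AE_I') (auto simp: N_def not_less)
  qed
  \<comment> \<open>Two partial sums, each within \<open>2 * d i\<close> of the reference sum at m,
    differ by less than \<open>4 * d i\<close>, which is 1/(i + 1).\<close>
  define d where "d i = 1 / (4 * real (Suc i))" for i :: nat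
  have d: "d i > 0" "2 * d i + 2 * d i = inverse (real (Suc i))" for i
  proof -
    have q: "2 * (1 / (4 * x)) + 2 * (1 / (4 * x)) = inverse x" for x :: real
      by (cases "x = 0") (simp_all add: field_simps)
    show "d i > 0" unfolding d_def by (intro divide_pos_pos mult_pos_pos) auto
    show "2 * d i + 2 * d i = inverse (real (Suc i))" by (simp only: d_def q)
  qed
  have "\<forall>i. AE \<omega> in M. \<exists>m. \<forall>k. \<bar>S (m + k) \<omega> - S m \<omega>\<bar> < 2 * d i"
    using key[OF d(1)] by (rule allI)
  then have "AE \<omega> in M. \<forall>i. \<exists>m. \<forall>k. \<bar>S (m + k) \<omega> - S m \<omega>\<bar> < 2 * d i"
    by (rule AE_all_countable[THEN iffD2])
  then show ?thesis
  proof eventually_elim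
    case (elim \<omega>)
    have "Cauchy (\<lambda>n. S n \<omega>)"
    proof (rule metric_CauchyI)
      fix e :: real assume "e > 0"
      then obtain i where i: "inverse (real (Suc i)) < e" using reals_Archimedean by blast
      obtain m where m: "\<And>k. \<bar>S (m + k) \<omega> - S m \<omega>\<bar> < 2 * d i" using elim by blast
      have "dist (S p \<omega>) (S q \<omega>) < e" if "p \<ge> m" "q \<ge> m" for p q
      proof -
        have "\<bar>S p \<omega> - S m \<omega>\<bar> < 2 * d i" "\<bar>S q \<omega> - S m \<omega>\<bar> < 2 * d i"
          using m[of "p - m"] m[of "q - m"] that by simp_all
        then show ?thesis using i d(2)[of i] unfolding dist_real_def by linarith
      qed
      then show "\<exists>m. \<forall>p\<ge>m. \<forall>q\<ge>m. dist (S p \<omega>) (S q \<omega>) < e" by blast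
    qed
    then show ?case unfolding S_def by (simp add: Cauchy_convergent_iff)
  qed
qed

end

subsection \<open>Series indexed by the integers\<close>

lemma sum_int_window:
  "(\<Sum>j = - int M..int N. f j) = (\<Sum>j<M. f (- 1 - int j)) + (\<Sum>j<Suc N. f (int j))" for f :: "int \<Rightarrow> real"
proof (induction M)
  case 0
  have "{- int 0..int N} = int ` {..<Suc N}"
    by (auto simp: image_iff) (metis lessThan_iff nat_int nat_less_iff nonneg_int_cases of_nat_less_iff zless_nat_eq_int_zless le_imp_less_Suc of_nat_le_iff)
  then show ?case by (simp add: sum.reindex)
next
  case (Suc M)
  have "{- int (Suc M)..int N} = insert (- 1 - int M) {- int M..int N}" by auto
  then show ?case using Suc by simp
qed

text \<open>Because the two ends move independently, keeping the upper end fixed and varying the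
  lower one shows that the negative half is Cauchy; the positive half then converges by subtraction
  along the diagonal.\<close>

lemma bilateral_sums_iff:
  "bilateral_sums f l \<longleftrightarrow> (\<exists>\<alpha> \<beta>. (\<lambda>N. \<Sum>j<N. f (int j)) \<longlonglongrightarrow> \<alpha> \<and> (\<lambda>M. \<Sum>j<M. f (- 1 - int j)) \<longlonglongrightarrow> \<beta> \<and> l = \<alpha> + \<beta>)"
proof
  let ?u = "\<lambda>N. \<Sum>j<N. f (int j)" and ?d = "\<lambda>M. \<Sum>j<M. f (- 1 - int j)"
  assume "bilateral_sums f l"
  then have lim: "((\<lambda>(M, N). ?d M + ?u (Suc N)) \<longlongrightarrow> l) (sequentially \<times>\<^sub>F sequentially)"
    unfolding bilateral_sums_def sum_int_window .
  have ev: "\<exists>K. \<forall>M\<ge>K. \<forall>N\<ge>K. dist (?d M + ?u (Suc N)) l < e" if "e > 0" for e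
  proof -
    have "\<forall>\<^sub>F p in sequentially \<times>\<^sub>F sequentially. dist (case p of (M, N) \<Rightarrow> ?d M + ?u (Suc N)) l < e"
      using lim that by (rule tendstoD)
    then obtain P Q where "eventually P sequentially" "eventually Q sequentially"
      "\<And>M N. P M \<Longrightarrow> Q N \<Longrightarrow> dist (?d M + ?u (Suc N)) l < e"
      unfolding eventually_prod_filter by auto
    then obtain A B where "\<And>M. M \<ge> A \<Longrightarrow> P M" "\<And>M. M \<ge> B \<Longrightarrow> Q M"
      and PQ: "\<And>M N. P M \<Longrightarrow> Q N \<Longrightarrow> dist (?d M + ?u (Suc N)) l < e"
      unfolding eventually_sequentially by auto
    then show ?thesis by (intro exI[of _ "max A B"]) auto
  qed
  have "Cauchy ?d"
  proof (rule metric_CauchyI)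
    fix e :: real assume "e > 0"
    then obtain K where K: "\<And>M N. M \<ge> K \<Longrightarrow> N \<ge> K \<Longrightarrow> dist (?d M + ?u (Suc N)) l < e / 2"
      using ev[of "e / 2"] by auto
    have "dist (?d m) (?d n) < e" if "m \<ge> K" "n \<ge> K" for m n
      using K[OF that(1) order_refl] K[OF that(2) order_refl] unfolding dist_real_def by linarith
    then show "\<exists>K. \<forall>m\<ge>K. \<forall>n\<ge>K. dist (?d m) (?d n) < e" by blast
  qed
  then obtain \<beta> where b: "?d \<longlonglongrightarrow> \<beta>" using Cauchy_convergent_iff convergent_def by blast
  have diag: "(\<lambda>N. ?d N + ?u (Suc N)) \<longlonglongrightarrow> l"
    unfolding lim_sequentially using ev by meson
  have "(\<lambda>N. ?u (Suc N)) \<longlonglongrightarrow> l - \<beta>" using tendsto_diff[OF diag b] by simp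
  then have "?u \<longlonglongrightarrow> l - \<beta>" by (rule LIMSEQ_imp_Suc)
  with b show "\<exists>\<alpha> \<beta>. ?u \<longlonglongrightarrow> \<alpha> \<and> ?d \<longlonglongrightarrow> \<beta> \<and> l = \<alpha> + \<beta>" by force
next
  let ?u = "\<lambda>N. \<Sum>j<N. f (int j)" and ?d = "\<lambda>M. \<Sum>j<M. f (- 1 - int j)"
  assume "\<exists>\<alpha> \<beta>. ?u \<longlonglongrightarrow> \<alpha> \<and> ?d \<longlonglongrightarrow> \<beta> \<and> l = \<alpha> + \<beta>"
  then obtain \<alpha> \<beta> where u: "?u \<longlonglongrightarrow> \<alpha>" and d: "?d \<longlonglongrightarrow> \<beta>" and l: "l = \<beta> + \<alpha>" by auto
  have "((\<lambda>p. ?d (fst p) + ?u (Suc (snd p))) \<longlongrightarrow> l) (sequentially \<times>\<^sub>F sequentially)"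
    unfolding l
    by (intro tendsto_add filterlim_compose[OF d filterlim_fst] filterlim_compose[OF LIMSEQ_Suc[OF u] filterlim_snd])
  then show "bilateral_sums f l" unfolding bilateral_sums_def sum_int_window by (simp add: case_prod_unfold)
qed

lemma bilateral_sums_unique: "bilateral_sums f l \<Longrightarrow> bilateral_sums f l' \<Longrightarrow> l = l'"
  unfolding bilateral_sums_def
  by (rule tendsto_unique[rotated]) (auto simp: prod_filter_eq_bot)

lemma bilateral_sum_eqI: "bilateral_sums f l \<Longrightarrow> bilateral_sum f = l"
  unfolding bilateral_sum_def bilateral_summable_def using bilateral_sums_unique by auto

lemma bilateral_sums_bilateral_sum: "bilateral_summable f \<Longrightarrow> bilateral_sums f (bilateral_sum f)"
  using bilateral_sum_eqI unfolding bilateral_summable_def by blast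

lemma bilateral_summable_iff:
  "bilateral_summable f \<longleftrightarrow> convergent (\<lambda>N. \<Sum>j<N. f (int j)) \<and> convergent (\<lambda>M. \<Sum>j<M. f (- 1 - int j))"
  unfolding bilateral_summable_def bilateral_sums_iff convergent_def by blast

text \<open>Replaces the definite description by one-sided limits, a form from which measurability
  in \<omega> can be read off.\<close>

lemma bilateral_sum_eq:
  "bilateral_sum f = (if convergent (\<lambda>N. \<Sum>j<N. f (int j)) \<and> convergent (\<lambda>M. \<Sum>j<M. f (- 1 - int j))
     then lim (\<lambda>N. \<Sum>j<N. f (int j)) + lim (\<lambda>M. \<Sum>j<M. f (- 1 - int j)) else 0)"
proof (cases "bilateral_summable f")
  case True
  then have "bilateral_sums f (lim (\<lambda>N. \<Sum>j<N. f (int j)) + lim (\<lambda>M. \<Sum>j<M. f (- 1 - int j)))"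
    unfolding bilateral_summable_iff bilateral_sums_iff convergent_LIMSEQ_iff by blast
  with True show ?thesis using bilateral_sum_eqI bilateral_summable_iff by auto
next
  case False
  then show ?thesis unfolding bilateral_summable_iff[symmetric] by (simp add: bilateral_sum_def)
qed

lemma bilateral_sum_measurable:
  fixes f :: "int \<Rightarrow> 'b \<Rightarrow> real"
  assumes [measurable]: "\<And>j. f j \<in> borel_measurable N"
  shows "(\<lambda>\<omega>. bilateral_sum (\<lambda>j. f j \<omega>)) \<in> borel_measurable N"
  unfolding bilateral_sum_eq Cauchy_convergent_iff[symmetric] by measurable

lemma bilateral_sums_window:
  assumes "bilateral_sums f l" shows "(\<lambda>m. \<Sum>j = - int m..int m. f j) \<longlonglongrightarrow> l"
proof -
  obtain \<alpha> \<beta> where "(\<lambda>N. \<Sum>j<N. f (int j)) \<longlonglongrightarrow> \<alpha>" "(\<lambda>M. \<Sum>j<M. f (- 1 - int j)) \<longlonglongrightarrow> \<beta>" "l = \<beta> + \<alpha>"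
    using assms unfolding bilateral_sums_iff by (auto simp: add.commute)
  then show ?thesis unfolding sum_int_window by (auto simp del: sum.lessThan_Suc intro!: tendsto_add LIMSEQ_Suc)
qed

lemma bilateral_sums_sum:
  assumes "finite A" "\<And>i. i \<in> A \<Longrightarrow> bilateral_sums (f i) (l i)"
  shows "bilateral_sums (\<lambda>j. \<Sum>i\<in>A. f i j) (\<Sum>i\<in>A. l i)"
proof -
  have "((\<lambda>p. \<Sum>i\<in>A. case p of (M, N) \<Rightarrow> \<Sum>j = - int M..int N. f i j) \<longlongrightarrow> (\<Sum>i\<in>A. l i)) (sequentially \<times>\<^sub>F sequentially)"
    using assms by (intro tendsto_sum) (auto simp: bilateral_sums_def)
  then show ?thesis
    unfolding bilateral_sums_def by (simp add: case_prod_unfold sum.swap[of _ A])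
qed

lemma filterlim_window: "filterlim (\<lambda>m. {- int m..int m}) (finite_subsets_at_top UNIV) sequentially"
  unfolding filterlim_finite_subsets_at_top
proof (intro allI impI)
  fix X :: "int set" assume "finite X \<and> X \<subseteq> UNIV"
  then have fin: "finite X" by simp
  define K where "K = (\<Sum>x\<in>X. nat \<bar>x\<bar>)"
  have K: "\<bar>x\<bar> \<le> int K" if "x \<in> X" for x
  proof -
    have "nat \<bar>x\<bar> \<le> K" unfolding K_def using that fin by (intro member_le_sum) auto
    then show ?thesis by linarith
  qed
  show "\<forall>\<^sub>F m in sequentially. finite {- int m..int m} \<and> X \<subseteq> {- int m..int m} \<and> {- int m..int m} \<subseteq> UNIV"
    using eventually_ge_at_top[of K]
  proof eventually_elim
    case (elim m)
    then have "X \<subseteq> {- int m..int m}" using K by (force simp: abs_le_iff)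
    then show ?case by simp
  qed
qed

lemma infsum_window:
  "f summable_on UNIV \<Longrightarrow> (\<lambda>m. \<Sum>j = - int m..int m. f j) \<longlonglongrightarrow> infsum f UNIV" for f :: "int \<Rightarrow> real"
  using filterlim_compose[OF _ filterlim_window, of "sum f"] unfolding summable_iff_has_sum_infsum has_sum_def by blast

lemma finite_subset_window:
  assumes "finite (X :: int set)" shows "\<exists>m. X \<subseteq> {- int m..int m}"
proof -
  have "\<forall>\<^sub>F m in sequentially. X \<subseteq> {- int m..int m}"
    using filterlim_window assms unfolding filterlim_finite_subsets_at_top by (auto elim: eventually_mono)
  then show ?thesis by (auto simp: eventually_sequentially)
qed

lemma summable_on_window:
  fixes f :: "int \<Rightarrow> real"
  assumes nn: "\<And>j. 0 \<le> f j" and le: "\<And>m. (\<Sum>j = - int m..int m. f j) \<le> B"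
  shows "f summable_on UNIV" "infsum f UNIV \<le> B"
proof -
  have le': "sum f X \<le> B" if fin: "finite X" for X
  proof -
    obtain m where "X \<subseteq> {- int m..int m}" using finite_subset_window[OF fin] by blast
    then have "sum f X \<le> (\<Sum>j = - int m..int m. f j)" using nn by (intro sum_mono2) auto
    then show ?thesis using le[of m] by linarith
  qed
  show "f summable_on UNIV"
    by (rule nonneg_bdd_above_summable_on) (use nn le' in \<open>auto intro!: bdd_aboveI[of _ B]\<close>)
  then show "infsum f UNIV \<le> B" using infsum_window le by (meson LIMSEQ_le_const2)
qed

lemma sum_le_infsum: "finite J \<Longrightarrow> f summable_on UNIV \<Longrightarrow> (\<And>j. 0 \<le> f j) \<Longrightarrow> sum f J \<le> infsum f UNIV" for f :: "'i \<Rightarrow> real"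
  by (rule finite_sum_le_infsum) auto

text \<open>Holds without summability because both defaults agree: a divergent \<open>infsum\<close>
  is 0, and so is \<open>enn2real\<close> of infinity. It makes \<open>infsum\<close> measurable for
  nonnegative terms.\<close>

lemma infsum_eq_enn2real:
  fixes f :: "int \<Rightarrow> real"
  assumes nn: "\<And>j. 0 \<le> f j"
  shows "infsum f UNIV = enn2real (SUP m. ennreal (\<Sum>j = - int m..int m. f j))"
proof (cases "f summable_on UNIV")
  case True
  have inc: "incseq (\<lambda>m. ennreal (\<Sum>j = - int m..int m. f j))"
    unfolding incseq_def using nn by (auto intro!: ennreal_leI sum_mono2)
  have "(\<lambda>m. ennreal (\<Sum>j = - int m..int m. f j)) \<longlonglongrightarrow> ennreal (infsum f UNIV)"
    using infsum_window[OF True] by (intro tendsto_ennrealI)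
  then have "(SUP m. ennreal (\<Sum>j = - int m..int m. f j)) = ennreal (infsum f UNIV)"
    using LIMSEQ_SUP[OF inc] LIMSEQ_unique by blast
  then show ?thesis using nn by (simp add: infsum_nonneg)
next
  case False
  have "(SUP m. ennreal (\<Sum>j = - int m..int m. f j)) = top"
  proof (rule ccontr)
    assume "\<not> ?thesis"
    then obtain B where B: "(SUP m. ennreal (\<Sum>j = - int m..int m. f j)) = ennreal B" "B \<ge> 0"
      by (cases "SUP m. ennreal (\<Sum>j = - int m..int m. f j)") auto
    have "(\<Sum>j = - int m..int m. f j) \<le> B" for m
    proof -
      have "ennreal (\<Sum>j = - int m..int m. f j) \<le> ennreal B"
        unfolding B(1)[symmetric] by (rule SUP_upper) simp
      then show ?thesis using B(2) by simp
    qed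
    then show False using summable_on_window(1)[of f B] nn False by blast
  qed
  then show ?thesis by (simp only: infsum_not_exists[OF False] enn2real_top)
qed

lemma infsum_measurable_int:
  fixes f :: "int \<Rightarrow> 'b \<Rightarrow> real"
  assumes [measurable]: "\<And>j. f j \<in> borel_measurable N" and nn: "\<And>j \<omega>. 0 \<le> f j \<omega>"
  shows "(\<lambda>\<omega>. infsum (\<lambda>j. f j \<omega>) UNIV) \<in> borel_measurable N"
  unfolding infsum_eq_enn2real[OF nn] by measurable

lemma summable_on_shift: "f summable_on (UNIV :: int set) \<Longrightarrow> (\<lambda>j. f (c + j)) summable_on UNIV" for f :: "int \<Rightarrow> real"
  using summable_on_reindex[of "\<lambda>j. c + j" UNIV f] by (simp add: comp_def inj_def)

lemma sum_squares_le:
  fixes f :: "'i \<Rightarrow> real"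
  assumes "finite A" "\<And>i. i \<in> A \<Longrightarrow> 0 \<le> f i"
  shows "(\<Sum>i\<in>A. (f i)\<^sup>2) \<le> (\<Sum>i\<in>A. f i)\<^sup>2"
proof -
  have "(\<Sum>i\<in>A. (f i)\<^sup>2) \<le> (\<Sum>i\<in>A. f i * (\<Sum>i\<in>A. f i))"
    unfolding power2_eq_square using assms by (intro sum_mono mult_left_mono member_le_sum) auto
  then show ?thesis by (simp add: sum_distrib_right[symmetric] power2_eq_square)
qed

text \<open>Fatou's lemma applied to the absolute values.\<close>

lemma (in prob_space) expectation_abs_limit_le:
  fixes X :: "nat \<Rightarrow> 'a \<Rightarrow> real" and Y :: "'a \<Rightarrow> real"
  assumes int: "\<And>m. integrable M (X m)" and [measurable]: "Y \<in> borel_measurable M"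
    and lim: "AE \<omega> in M. (\<lambda>m. X m \<omega>) \<longlonglongrightarrow> Y \<omega>"
    and le: "\<And>m. expectation (\<lambda>\<omega>. \<bar>X m \<omega>\<bar>) \<le> B"
  shows "integrable M Y" "expectation (\<lambda>\<omega>. \<bar>Y \<omega>\<bar>) \<le> B"
proof -
  have [measurable]: "X m \<in> borel_measurable M" for m using int by auto
  have "0 \<le> expectation (\<lambda>\<omega>. \<bar>X 0 \<omega>\<bar>)" by (rule Bochner_Integration.integral_nonneg) simp
  then have B: "B \<ge> 0" using le[of 0] by linarith
  have "(\<integral>\<^sup>+\<omega>. ennreal \<bar>Y \<omega>\<bar> \<partial>M) = (\<integral>\<^sup>+\<omega>. liminf (\<lambda>m. ennreal \<bar>X m \<omega>\<bar>) \<partial>M)"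
  proof (rule nn_integral_cong_AE)
    show "AE \<omega> in M. ennreal \<bar>Y \<omega>\<bar> = liminf (\<lambda>m. ennreal \<bar>X m \<omega>\<bar>)"
      using lim
    proof eventually_elim
      case (elim \<omega>)
      then have "(\<lambda>m. ennreal \<bar>X m \<omega>\<bar>) \<longlonglongrightarrow> ennreal \<bar>Y \<omega>\<bar>" by (intro tendsto_ennrealI tendsto_rabs)
      then show ?case by (intro lim_imp_Liminf[symmetric]) auto
    qed
  qed
  also have "\<dots> \<le> liminf (\<lambda>m. \<integral>\<^sup>+\<omega>. ennreal \<bar>X m \<omega>\<bar> \<partial>M)" by (rule nn_integral_liminf) measurable
  also have "\<dots> = liminf (\<lambda>m. ennreal (expectation (\<lambda>\<omega>. \<bar>X m \<omega>\<bar>)))"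
    using int by (subst nn_integral_eq_integral) auto
  also have "\<dots> \<le> ennreal B"
    by (rule order_trans[OF Liminf_le_Limsup Limsup_bounded])
      (auto intro!: always_eventually ennreal_leI le)
  finally have *: "(\<integral>\<^sup>+\<omega>. ennreal \<bar>Y \<omega>\<bar> \<partial>M) \<le> ennreal B" .
  then show "integrable M Y"
    unfolding integrable_iff_bounded by (auto simp: le_less_trans[OF _ ennreal_less_top])
  then have "ennreal (expectation (\<lambda>\<omega>. \<bar>Y \<omega>\<bar>)) \<le> ennreal B"
    using * by (subst nn_integral_eq_integral[symmetric]) auto
  then show "expectation (\<lambda>\<omega>. \<bar>Y \<omega>\<bar>) \<le> B" using B by simp
qed

section \<open>Linear series in an i.i.d. sequence\<close>

locale iid_seq = infinite_variance M "\<xi> 0" for M :: "'a measure" and \<xi> :: "int \<Rightarrow> 'a \<Rightarrow> real" +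
  assumes indep: "indep_vars (\<lambda>_. borel) \<xi> UNIV"
    and ident: "distr M borel (\<xi> k) = distr M borel (\<xi> 0)"
    and mean0: "expectation (\<xi> 0) = 0"
begin

lemma xi_measurable [measurable]: "\<xi> k \<in> borel_measurable M"
  using indep by (auto simp: indep_vars_def)

lemma expectation_ident:
  fixes f :: "real \<Rightarrow> 'b :: {banach, second_countable_topology}"
  assumes [measurable]: "f \<in> borel_measurable borel"
  shows "expectation (\<lambda>\<omega>. f (\<xi> k \<omega>)) = expectation (\<lambda>\<omega>. f (\<xi> 0 \<omega>))"
  using integral_distr[of "\<xi> k" M borel f] integral_distr[of "\<xi> 0" M borel f] ident[of k] by simp

lemma integrable_ident:
  fixes f :: "real \<Rightarrow> 'b :: {banach, second_countable_topology}"
  assumes [measurable]: "f \<in> borel_measurable borel"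
  shows "integrable M (\<lambda>\<omega>. f (\<xi> k \<omega>)) \<longleftrightarrow> integrable M (\<lambda>\<omega>. f (\<xi> 0 \<omega>))"
  using integrable_distr_eq[of "\<xi> k" M borel f] integrable_distr_eq[of "\<xi> 0" M borel f] ident[of k] by simp

lemma prob_ident:
  assumes [measurable]: "Measurable.pred borel P"
  shows "prob {\<omega>\<in>space M. P (\<xi> k \<omega>)} = prob {\<omega>\<in>space M. P (\<xi> 0 \<omega>)}"
proof -
  have "measure (distr M borel (\<xi> j)) {x. P x} = prob {\<omega>\<in>space M. P (\<xi> j \<omega>)}" for j
    by (subst measure_distr) (auto intro!: arg_cong[where f = prob])
  then show ?thesis using ident by metis
qed

lemma xi_integrable: "integrable M (\<xi> k)" and xi_mean: "expectation (\<xi> k) = 0"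
  using integrable_ident[of "\<lambda>x. x" k] expectation_ident[of "\<lambda>x. x" k] integrable_Z mean0 by auto

lemma expectation_qf: "expectation (\<lambda>\<omega>. qf (c * \<xi> k \<omega>)) = Q c"
  and integrable_qf_xi: "integrable M (\<lambda>\<omega>. qf (c * \<xi> k \<omega>))"
  unfolding Q_def
  using expectation_ident[of "\<lambda>x. qf (c * x)" k] integrable_ident[of "\<lambda>x. qf (c * x)" k] integrable_qf[of c] by auto

lemma indep_scaled: "indep_vars (\<lambda>_. borel) (\<lambda>j \<omega>. c j * \<xi> j \<omega>) J"
  by (rule indep_vars_compose2[OF indep_vars_subset[OF indep subset_UNIV], where Y = "\<lambda>j x. c j * x"]) measurable

lemma expectation_abs_linear_le:
  assumes "finite J"
  shows "expectation (\<lambda>\<omega>. \<bar>\<Sum>j\<in>J. c j * \<xi> j \<omega>\<bar>) \<le> sqrt (\<Sum>j\<in>J. Q (c j)) + 2 * (\<Sum>j\<in>J. Q (c j))"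
  using expectation_abs_sum_indep_le[OF assms indep_scaled[of c]] xi_integrable xi_mean
  by (simp add: expectation_qf)

lemma AE_bilateral_summable:
  assumes s: "(\<lambda>j. Q (c j)) summable_on UNIV"
  shows "AE \<omega> in M. bilateral_summable (\<lambda>j. c j * \<xi> j \<omega>)"
proof -
  have one: "AE \<omega> in M. convergent (\<lambda>n. \<Sum>j<n. c (h j) * \<xi> (h j) \<omega>)" if h: "inj h" for h :: "nat \<Rightarrow> int"
  proof (rule AE_convergent_sum_indep)
    show "indep_vars (\<lambda>_. borel) (\<lambda>j \<omega>. c (h j) * \<xi> (h j) \<omega>) UNIV"
      using indep_vars_reindex_inj[OF indep_scaled[of c UNIV], of h UNIV] h by simp
    have "(\<lambda>j. Q (c (h j))) summable_on UNIV"
      using summable_on_reindex[OF h, of "\<lambda>j. Q (c j)"] summable_on_subset_banach[OF s, of "range h"]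
      by (simp add: comp_def)
    then show "summable (\<lambda>j. expectation (\<lambda>\<omega>. qf (c (h j) * \<xi> (h j) \<omega>)))"
      unfolding expectation_qf by (rule summable_on_imp_summable)
  qed (use xi_integrable xi_mean in auto)
  show ?thesis
    using one[of int] one[of "\<lambda>j. - 1 - int j"]
    by (auto simp: bilateral_summable_iff inj_def elim: eventually_elim2)
qed

text \<open>The sum of \<open>qf (c j * \<xi> j)\<close> has finite mean, hence is almost surely
  finite. Since u^2 \<le> \<open>qf u\<close> + (\<open>qf u\<close>)^2 and a sum of squares of
  nonnegative terms is at most the square of their sum, the squares are summable as well.\<close>

lemma AE_squares_summable:
  assumes s: "(\<lambda>j. Q (c j)) summable_on UNIV"
  shows "AE \<omega> in M. (\<lambda>j. (c j)\<^sup>2 * (\<xi> j \<omega>)\<^sup>2) summable_on UNIV"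
proof -
  define B where "B = infsum (\<lambda>j. Q (c j)) UNIV"
  let ?W = "\<lambda>m \<omega>. \<Sum>j = - int m..int m. qf (c j * \<xi> j \<omega>)"
  have "(\<integral>\<^sup>+\<omega>. (SUP m. ennreal (?W m \<omega>)) \<partial>M) = (SUP m. \<integral>\<^sup>+\<omega>. ennreal (?W m \<omega>) \<partial>M)"
    by (intro nn_integral_monotone_convergence_SUP)
      (auto simp: incseq_def le_fun_def intro!: ennreal_leI sum_mono2)
  also have "\<dots> = (SUP m. ennreal (\<Sum>j = - int m..int m. Q (c j)))"
    using integrable_qf_xi by (intro SUP_cong refl, subst nn_integral_eq_integral)
      (auto simp: expectation_qf sum_nonneg)
  also have "\<dots> \<le> ennreal B"
    unfolding B_def using s Q_nonneg by (intro SUP_least ennreal_leI sum_le_infsum) auto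
  finally have "(\<integral>\<^sup>+\<omega>. (SUP m. ennreal (?W m \<omega>)) \<partial>M) \<noteq> \<infinity>" by (auto simp: top_unique)
  then have "AE \<omega> in M. (SUP m. ennreal (?W m \<omega>)) \<noteq> \<infinity>"
    by (intro nn_integral_PInf_AE) measurable
  then show ?thesis
  proof eventually_elim
    case (elim \<omega>)
    then obtain K where K: "(SUP m. ennreal (?W m \<omega>)) = ennreal K" "K \<ge> 0"
      by (cases "SUP m. ennreal (?W m \<omega>)") auto
    have W: "?W m \<omega> \<le> K" for m
    proof -
      have "ennreal (?W m \<omega>) \<le> ennreal K" unfolding K(1)[symmetric] by (rule SUP_upper) simp
      then show ?thesis using K(2) by simp
    qed
    have sq: "u\<^sup>2 \<le> qf u + (qf u)\<^sup>2" for u :: real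
      using qf_eq_square[of u] qf_eq_abs[of u] by (cases "\<bar>u\<bar> \<le> 1") auto
    show ?case
    proof (rule summable_on_window(1))
      fix m
      have "(\<Sum>j = - int m..int m. (c j)\<^sup>2 * (\<xi> j \<omega>)\<^sup>2)
          \<le> (\<Sum>j = - int m..int m. qf (c j * \<xi> j \<omega>) + (qf (c j * \<xi> j \<omega>))\<^sup>2)"
        using sq by (intro sum_mono) (simp add: power_mult_distrib[symmetric])
      also have "\<dots> \<le> ?W m \<omega> + (?W m \<omega>)\<^sup>2"
        unfolding sum.distrib by (intro add_left_mono sum_squares_le) auto
      also have "\<dots> \<le> K + K\<^sup>2" using W[of m] by (intro add_mono power_mono) (auto intro!: sum_nonneg)
      finally show "(\<Sum>j = - int m..int m. (c j)\<^sup>2 * (\<xi> j \<omega>)\<^sup>2) \<le> K + K\<^sup>2" .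
    qed simp
  qed
qed

lemma X_proc_measurable [measurable]: "X_proc \<xi> a k \<in> borel_measurable M"
  unfolding X_proc_def[abs_def] by (intro bilateral_sum_measurable) measurable

lemma S_proc_measurable [measurable]: "S_proc \<xi> a n \<in> borel_measurable M"
  unfolding S_proc_def[abs_def] by measurable

lemma V_norm_measurable [measurable]: "V_norm \<xi> a n \<in> borel_measurable M"
proof -
  have [measurable]: "(\<lambda>\<omega>. \<Sum>\<^sub>\<infinity>k. (b_coeff a n k)\<^sup>2 * (\<xi> k \<omega>)\<^sup>2) \<in> borel_measurable M"
    by (rule infsum_measurable_int) auto
  show ?thesis unfolding V_norm_def[abs_def] by measurable
qed

lemma S_converges_if:
  assumes s: "(\<lambda>j. Q (a j)) summable_on UNIV"
  shows "S_converges M \<xi> a"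
proof -
  have X: "AE \<omega> in M. bilateral_summable (\<lambda>j. a (int k + j) * \<xi> j \<omega>)" for k
    by (rule AE_bilateral_summable[OF summable_on_shift[OF s]])
  have "AE \<omega> in M. bilateral_sums (\<lambda>j. b_coeff a n j * \<xi> j \<omega>) (S_proc \<xi> a n \<omega>)" for n
  proof -
    have "AE \<omega> in M. \<forall>k. bilateral_summable (\<lambda>j. a (int k + j) * \<xi> j \<omega>)"
      unfolding AE_all_countable using X by blast
    then show ?thesis
    proof eventually_elim
      case (elim \<omega>)
      have "bilateral_sums (\<lambda>j. \<Sum>k\<in>{1..n}. a (int k + j) * \<xi> j \<omega>) (\<Sum>k\<in>{1..n}. X_proc \<xi> a k \<omega>)"
        unfolding X_proc_def using elim by (intro bilateral_sums_sum bilateral_sums_bilateral_sum) auto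
      then show ?case
        unfolding S_proc_def b_coeff_def by (simp add: sum_distrib_right add.commute)
    qed
  qed
  with X show ?thesis unfolding S_converges_def by blast
qed

end

subsection \<open>Coefficients and the normalizing sequence\<close>

lemma summable_on_le:
  fixes f h :: "int \<Rightarrow> real"
  assumes "h summable_on UNIV" "\<And>j. 0 \<le> f j" "\<And>j. f j \<le> h j"
  shows "f summable_on UNIV"
proof (rule summable_on_window(1)[OF assms(2)])
  fix m
  have "(\<Sum>j = - int m..int m. f j) \<le> (\<Sum>j = - int m..int m. h j)" using assms by (intro sum_mono) auto
  also have "\<dots> \<le> infsum h UNIV" using assms by (intro sum_le_infsum) (auto intro: order_trans)
  finally show "(\<Sum>j = - int m..int m. f j) \<le> infsum h UNIV" .
qed

lemma summable_on_finite_sum: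
  fixes f :: "'i \<Rightarrow> int \<Rightarrow> real"
  assumes "finite A" "\<And>i. i \<in> A \<Longrightarrow> f i summable_on UNIV"
  shows "(\<lambda>j. \<Sum>i\<in>A. f i j) summable_on UNIV"
  using assms by (induction A rule: finite_induct) (auto intro: summable_on_add)

lemma b_coeff_square_summable:
  assumes "(\<lambda>j. (a j)\<^sup>2) summable_on UNIV"
  shows "(\<lambda>j. (b_coeff a n j)\<^sup>2) summable_on UNIV"
proof (rule summable_on_le)
  have "(\<lambda>j. (a (int i + j))\<^sup>2) summable_on UNIV" for i by (rule summable_on_shift[OF assms])
  then have "(\<lambda>j. \<Sum>i\<in>{1..n}. (a (j + int i))\<^sup>2) summable_on UNIV"
    by (intro summable_on_finite_sum) (auto simp: add.commute)
  then show "(\<lambda>j. (\<Sum>i\<in>{1..n}. (a (j + int i))\<^sup>2) * real n) summable_on UNIV"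
    by (rule summable_on_cmult_left)
  show "(b_coeff a n j)\<^sup>2 \<le> (\<Sum>i\<in>{1..n}. (a (j + int i))\<^sup>2) * real n" for j
    unfolding b_coeff_def using sum_squared_le_sum_of_squares[of "\<lambda>i. a (j + int i)" "{1..n}"] by simp
qed simp

text \<open>Telescoping \<open>b\<^sub>k\<^sup>2 - b\<^sub>k\<^sub>-\<^sub>m\<^sup>2 = \<Sum> (b\<^sub>j - b\<^sub>j\<^sub>-\<^sub>1) (b\<^sub>j + b\<^sub>j\<^sub>-\<^sub>1)\<close> and Cauchy-Schwarz.\<close>

lemma b_coeff_sup_le:
  assumes sa: "(\<lambda>j. (a j)\<^sup>2) summable_on UNIV"
  shows "(b_coeff a n k)\<^sup>2 \<le> 4 * sqrt (\<Sum>\<^sub>\<infinity>j. (a j)\<^sup>2) * sqrt (\<Sum>\<^sub>\<infinity>j. (b_coeff a n j)\<^sup>2)"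
proof -
  define b where "b = b_coeff a n"
  define A where "A = (\<Sum>\<^sub>\<infinity>j. (a j)\<^sup>2)"
  define B where "B = (\<Sum>\<^sub>\<infinity>j. (b j)\<^sup>2)"
  have sb: "(\<lambda>j. (b j)\<^sup>2) summable_on UNIV" unfolding b_def by (rule b_coeff_square_summable[OF sa])
  \<comment> \<open>Neighbouring windows of length n share all but their end points, so the
    increments of b are bounded in square sum by \<open>a\<close> alone, independently of n.\<close>
  have diff: "b j - b (j - 1) = a (j + int n) - a j" for j
  proof -
    have "(\<Sum>i = 1..n. a (j - 1 + int i)) = (\<Sum>i<n. a (j + int i))"
      by (rule sum.reindex_bij_witness[of _ Suc "\<lambda>i. i - 1"]) (auto simp: algebra_simps of_nat_diff)
    moreover have "(\<Sum>i = 1..n. a (j + int i)) = (\<Sum>i<n. a (j + int i)) + a (j + int n) - a j"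
      by (induction n) auto
    ultimately show ?thesis by (simp add: b_def b_coeff_def)
  qed
  have sq2: "(x - y)\<^sup>2 \<le> 2 * x\<^sup>2 + 2 * y\<^sup>2" "(x + y)\<^sup>2 \<le> 2 * x\<^sup>2 + 2 * y\<^sup>2" for x y :: real
    using zero_le_power2[of "x + y"] zero_le_power2[of "x - y"] unfolding power2_sum power2_diff by auto
  have shift_le: "(\<Sum>j\<in>J. f (j + d)) \<le> infsum f UNIV" if "finite J" "f summable_on UNIV" "\<And>j. 0 \<le> f j"
    for J :: "int set" and f :: "int \<Rightarrow> real" and d
  proof -
    have "(\<Sum>j\<in>J. f (j + d)) = sum f ((\<lambda>j. j + d) ` J)" by (subst sum.reindex) (auto simp: inj_on_def)
    also have "\<dots> \<le> infsum f UNIV" using that by (intro sum_le_infsum) auto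
    finally show ?thesis .
  qed
  have main: "(b k)\<^sup>2 \<le> (b (k - int m))\<^sup>2 + 4 * sqrt A * sqrt B" for m
  proof -
    have tel: "(b k)\<^sup>2 - (b (k - int m))\<^sup>2 = (\<Sum>j\<in>{k - int m + 1..k}. (b j)\<^sup>2 - (b (j - 1))\<^sup>2)"
    proof (induction m)
      case (Suc m)
      have "{k - int (Suc m) + 1..k} = insert (k - int m) {k - int m + 1..k}" by auto
      then show ?case using Suc by (simp add: diff_add_eq_diff_diff_swap)
    qed simp
    let ?J = "{k - int m + 1..k}"
    have "(\<Sum>j\<in>?J. (b j)\<^sup>2 - (b (j - 1))\<^sup>2) \<le> (\<Sum>j\<in>?J. \<bar>b j - b (j - 1)\<bar> * \<bar>b j + b (j - 1)\<bar>)"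
    proof (rule sum_mono)
      fix j
      have "(b j)\<^sup>2 - (b (j - 1))\<^sup>2 = (b j - b (j - 1)) * (b j + b (j - 1))"
        by (simp add: power2_eq_square algebra_simps)
      then show "(b j)\<^sup>2 - (b (j - 1))\<^sup>2 \<le> \<bar>b j - b (j - 1)\<bar> * \<bar>b j + b (j - 1)\<bar>"
        by (metis abs_ge_self abs_mult)
    qed
    also have "\<dots> \<le> L2_set (\<lambda>j. b j - b (j - 1)) ?J * L2_set (\<lambda>j. b j + b (j - 1)) ?J"
      by (rule L2_set_mult_ineq)
    also have "\<dots> \<le> sqrt (4 * A) * sqrt (4 * B)"
    proof (intro mult_mono)
      have "(\<Sum>j\<in>?J. (b j - b (j - 1))\<^sup>2) \<le> (\<Sum>j\<in>?J. 2 * (a (j + int n))\<^sup>2 + 2 * (a j)\<^sup>2)"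
        unfolding diff by (intro sum_mono sq2)
      also have "\<dots> = 2 * (\<Sum>j\<in>?J. (a (j + int n))\<^sup>2) + 2 * (\<Sum>j\<in>?J. (a (j + 0))\<^sup>2)"
        by (simp add: sum.distrib sum_distrib_left)
      also have "\<dots> \<le> 2 * A + 2 * A"
        unfolding A_def using sa by (intro add_mono mult_left_mono shift_le[where f = "\<lambda>j. (a j)\<^sup>2"]) auto
      finally show "L2_set (\<lambda>j. b j - b (j - 1)) ?J \<le> sqrt (4 * A)"
        unfolding L2_set_def by (intro real_sqrt_le_mono) simp
      have "(\<Sum>j\<in>?J. (b j + b (j - 1))\<^sup>2) \<le> (\<Sum>j\<in>?J. 2 * (b j)\<^sup>2 + 2 * (b (j - 1))\<^sup>2)"
        by (intro sum_mono sq2)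
      also have "\<dots> = 2 * (\<Sum>j\<in>?J. (b (j + 0))\<^sup>2) + 2 * (\<Sum>j\<in>?J. (b (j + (- 1)))\<^sup>2)"
        by (simp add: sum.distrib sum_distrib_left)
      also have "\<dots> \<le> 2 * B + 2 * B"
        unfolding B_def using sb by (intro add_mono mult_left_mono shift_le[where f = "\<lambda>j. (b j)\<^sup>2"]) auto
      finally show "L2_set (\<lambda>j. b j + b (j - 1)) ?J \<le> sqrt (4 * B)"
        unfolding L2_set_def by (intro real_sqrt_le_mono) simp
    qed (auto simp: L2_set_nonneg A_def intro!: infsum_nonneg)
    also have "sqrt (4 * A) * sqrt (4 * B) = 4 * sqrt A * sqrt B" by (simp add: real_sqrt_mult)
    finally show ?thesis using tel by simp
  qed
  \<comment> \<open>If this failed by d > 0, \<open>main\<close> would give (b (k - m))^2 \<ge> d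
    for every m, contradicting square summability of b.\<close>
  have "(b k)\<^sup>2 \<le> 4 * sqrt A * sqrt B"
  proof (rule ccontr)
    define d where "d = (b k)\<^sup>2 - 4 * sqrt A * sqrt B"
    assume "\<not> ?thesis"
    then have d: "d > 0" by (simp add: d_def)
    obtain N :: nat where N: "B < real N * d" using reals_Archimedean3[OF d] by blast
    have "real N * d = (\<Sum>m<N. d)" by simp
    also have "\<dots> \<le> (\<Sum>m<N. (b (k - int m))\<^sup>2)" using main by (intro sum_mono) (auto simp: d_def algebra_simps)
    also have "\<dots> = (\<Sum>j\<in>(\<lambda>m. k - int m) ` {..<N}. (b j)\<^sup>2)" by (subst sum.reindex) (auto simp: inj_on_def)
    also have "\<dots> \<le> B" unfolding B_def using sb by (intro sum_le_infsum) auto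
    finally show False using N by simp
  qed
  then show ?thesis by (simp add: A_def B_def b_def)
qed

section \<open>The weight function \<open>g\<close> and the root that defines the norming
  constants\<close>

context infinite_variance
begin

lemma Q_sum_le:
  assumes "finite A" shows "Q (\<Sum>i\<in>A. c i) \<le> (real (card A))\<^sup>2 * (\<Sum>i\<in>A. Q (c i))"
proof -
  have "Q (\<Sum>i\<in>A. c i) \<le> expectation (\<lambda>\<omega>. (real (card A))\<^sup>2 * (\<Sum>i\<in>A. qf (c i * Z \<omega>)))"
    unfolding Q_def
  proof (intro integral_mono integrable_qf)
    show "qf ((\<Sum>i\<in>A. c i) * Z \<omega>) \<le> (real (card A))\<^sup>2 * (\<Sum>i\<in>A. qf (c i * Z \<omega>))" for \<omega>
      using qf_sum_le[OF assms, of "\<lambda>i. c i * Z \<omega>"] by (simp add: sum_distrib_right)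
  qed (auto intro!: integrable_qf)
  then show ?thesis by (simp add: Q_def integrable_qf)
qed

lemma b_coeff_Q_summable:
  assumes "(\<lambda>j. Q (a j)) summable_on UNIV"
  shows "(\<lambda>j. Q (b_coeff a n j)) summable_on UNIV"
proof (rule summable_on_le)
  have "(\<lambda>j. Q (a (int i + j))) summable_on UNIV" for i by (rule summable_on_shift[OF assms])
  then have "(\<lambda>j. \<Sum>i\<in>{1..n}. Q (a (j + int i))) summable_on UNIV"
    by (intro summable_on_finite_sum) (auto simp: add.commute)
  then show "(\<lambda>j. (real n)\<^sup>2 * (\<Sum>i\<in>{1..n}. Q (a (j + int i)))) summable_on UNIV"
    by (rule summable_on_cmult_right)
  show "Q (b_coeff a n j) \<le> (real n)\<^sup>2 * (\<Sum>i\<in>{1..n}. Q (a (j + int i)))" for j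
    unfolding b_coeff_def using Q_sum_le[of "{1..n}" "\<lambda>i. a (j + int i)"] by simp
qed (rule Q_nonneg)

lemma Q_le_abs: "Q c \<le> \<bar>c\<bar> * expectation (\<lambda>\<omega>. \<bar>Z \<omega>\<bar>)"
proof -
  have "Q c \<le> expectation (\<lambda>\<omega>. \<bar>c\<bar> * \<bar>Z \<omega>\<bar>)"
    unfolding Q_def using integrable_Z
    by (intro integral_mono integrable_qf) (auto simp: abs_mult[symmetric] qf_le_abs)
  then show ?thesis by simp
qed

text \<open>For |c| \<le> 1 one has c^2 \<le> |c|, so \<open>g c\<close> is at most a constant
  multiple of |c|.\<close>

lemma g_small: assumes "e > 0" shows "\<exists>c0>0. \<forall>c. \<bar>c\<bar> \<le> c0 \<longrightarrow> g c \<le> e"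
proof -
  define m where "m = expectation (\<lambda>\<omega>. \<bar>Z \<omega>\<bar>) + H0 (b0 + 1)"
  have m: "m \<ge> 0" unfolding m_def using H0_nonneg by (intro add_nonneg_nonneg Bochner_Integration.integral_nonneg) auto
  define c0 where "c0 = min 1 (e / (m + 1))"
  have c0: "c0 > 0" using assms m by (auto simp: c0_def)
  have "g c \<le> e" if c: "\<bar>c\<bar> \<le> c0" for c
  proof -
    have "c\<^sup>2 \<le> \<bar>c\<bar>"
      using c mult_left_mono[of "\<bar>c\<bar>" 1 "\<bar>c\<bar>"] by (auto simp: c0_def power2_eq_square)
    then have "H0 (b0 + 1) * c\<^sup>2 \<le> H0 (b0 + 1) * \<bar>c\<bar>" using H0_nonneg by (intro mult_left_mono)
    then have "g c \<le> \<bar>c\<bar> * m" using g_le_Q[of c] Q_le_abs[of c] by (simp add: m_def algebra_simps)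
    also have "\<dots> \<le> e / (m + 1) * m" using c m by (intro mult_right_mono) (auto simp: c0_def)
    also have "\<dots> \<le> e" using m assms by (simp add: field_simps)
    finally show ?thesis .
  qed
  then show ?thesis using c0 by blast
qed

text \<open>Near 0 the two functions are asymptotically equal by \<open>expectation_approx_g\<close>
  with f = \<open>qf\<close>; away from 0 the linear bound on \<open>Q\<close> is absorbed by c^2.
  Through this, summability of \<open>g (a j)\<close>, which is what admissibility states, passes to
  \<open>Q (a j)\<close>, which is what almost sure convergence requires.\<close>

lemma Q_le_g:
  assumes sv: "slowly_varying H0"
  obtains K where "K \<ge> 0" "\<And>c. Q c \<le> K * g c"
proof -
  have lim: "((\<lambda>u. qf u / u\<^sup>2) \<longlongrightarrow> 1) (at 0)"
  proof (rule tendsto_eventually)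
    show "\<forall>\<^sub>F u in at 0. qf u / u\<^sup>2 = 1"
      unfolding eventually_at by (intro exI[of _ 1]) (auto simp: qf_eq_square)
  qed
  obtain c0 where c0: "c0 > 0" "\<And>c. \<bar>c\<bar> \<le> c0 \<Longrightarrow> \<bar>expectation (\<lambda>\<omega>. qf (c * Z \<omega>)) - 1 * g c\<bar> \<le> 1 * g c"
    using expectation_approx_g[OF sv, of qf 1 1 1] lim by auto
  define m where "m = expectation (\<lambda>\<omega>. \<bar>Z \<omega>\<bar>)"
  have m: "m \<ge> 0" unfolding m_def by (intro Bochner_Integration.integral_nonneg) auto
  define K where "K = 2 + m / c0"
  have K: "K \<ge> 0" "K \<ge> 2" "K \<ge> m / c0" using m c0 by (auto simp: K_def)
  have "Q c \<le> K * g c" for c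
  proof (cases "\<bar>c\<bar> \<le> c0")
    case True
    then have "Q c \<le> 2 * g c" using c0(2)[OF True] by (auto simp: Q_def[symmetric])
    also have "\<dots> \<le> K * g c" using K g_nonneg by (intro mult_right_mono) auto
    finally show ?thesis .
  next
    case False
    have "c0 * \<bar>c\<bar> \<le> \<bar>c\<bar> * \<bar>c\<bar>" using False by (intro mult_right_mono) auto
    then have "\<bar>c\<bar> \<le> c\<^sup>2 / c0" using c0 by (simp add: field_simps power2_eq_square)
    then have "\<bar>c\<bar> * m \<le> c\<^sup>2 / c0 * m" using m by (rule mult_right_mono)
    also have "\<dots> = m / c0 * c\<^sup>2" by simp
    also have "\<dots> \<le> K * g c" using K g_ge_square m c0 by (intro mult_mono) auto
    finally show ?thesis using Q_le_abs[of c] by (simp add: m_def)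
  qed
  then show ?thesis using that K by blast
qed

text \<open>Both sides have the form b^2 \<open>H\<close> (r / |b|), and \<open>H\<close> is
  monotone. This monotonicity stands in for continuity in s of the series defining
  \<open>D_norm\<close>: \<open>H\<close> may have jumps.\<close>

lemma g_scaled_mono:
  assumes "0 < s" "s \<le> t" shows "s\<^sup>2 * g (b / s) \<le> t\<^sup>2 * g (b / t)"
proof (cases "b = 0")
  case False
  have eq: "r\<^sup>2 * g (b / r) = b\<^sup>2 * H (r / \<bar>b\<bar>)" if "r > 0" for r
    using that False by (simp add: g_def power_divide inverse_eq_divide)
  have "s / \<bar>b\<bar> \<le> t / \<bar>b\<bar>" using assms by (intro divide_right_mono) auto
  then have "b\<^sup>2 * H (s / \<bar>b\<bar>) \<le> b\<^sup>2 * H (t / \<bar>b\<bar>)" by (intro mult_left_mono H_mono) auto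
  then show ?thesis using eq assms by simp
qed simp

text \<open>Dominates the series for every s \<ge> 1 at once, and its factor 1/s makes the series at
  most 1 for large s, so that \<open>D_norm\<close> is finite.\<close>

lemma g_divide_le:
  assumes "s \<ge> 1" shows "g (b / s) \<le> (Q b + H0 (b0 + 1) * b\<^sup>2) / s"
proof -
  have "g (b / s) \<le> Q b / s + H0 (b0 + 1) * (b\<^sup>2 / s\<^sup>2)"
    using g_le_Q[of "b / s"] Q_divide_le[OF assms, of b] by (simp add: power_divide)
  also have "b\<^sup>2 / s\<^sup>2 \<le> b\<^sup>2 / s"
    using assms by (intro divide_left_mono) (auto simp: power2_eq_square)
  finally show ?thesis using H0_nonneg by (simp add: add_divide_distrib mult_left_mono)
qed

text \<open>The series G may be discontinuous in s, so that G D = 1 cannot come from an intermediate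
  value argument. It follows instead from monotonicity of s^2 G s, used once to the right and once
  to the left of the infimum.\<close>

lemma D_norm_properties:
  assumes sQ: "(\<lambda>j. Q (b_coeff a n j)) summable_on UNIV" and s2: "(\<lambda>j. (b_coeff a n j)\<^sup>2) summable_on UNIV"
  shows "\<exists>D. D_norm H a n = ereal D \<and> D \<ge> 1 \<and> (\<lambda>k. g (b_coeff a n k / D)) summable_on UNIV \<and>
     ((\<Sum>\<^sub>\<infinity>k. (b_coeff a n k)\<^sup>2) > 1 \<longrightarrow> (\<Sum>\<^sub>\<infinity>k. g (b_coeff a n k / D)) = 1)"
proof -
  define b where "b = b_coeff a n"
  define h where "h j = Q (b j) + H0 (b0 + 1) * (b j)\<^sup>2" for j
  have h: "h summable_on UNIV" "\<And>j. 0 \<le> h j"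
    unfolding h_def b_def using sQ s2 Q_nonneg H0_nonneg
    by (auto intro!: summable_on_add summable_on_cmult_right add_nonneg_nonneg mult_nonneg_nonneg)
  define G where "G s = (\<Sum>\<^sub>\<infinity>k. g (b k / s))" for s
  have gs: "(\<lambda>k. g (b k / s)) summable_on UNIV" if "s \<ge> 1" for s
  proof (rule summable_on_le)
    show "(\<lambda>k. h k * (1 / s)) summable_on UNIV" by (rule summable_on_cmult_left[OF h(1)])
    show "g (b k / s) \<le> h k * (1 / s)" for k using g_divide_le[OF that, of "b k"] by (simp add: h_def)
  qed (rule g_nonneg)
  have G0: "0 \<le> G s" for s unfolding G_def by (intro infsum_nonneg g_nonneg)
  have Gmono: "s\<^sup>2 * G s \<le> t\<^sup>2 * G t" if "1 \<le> s" "s \<le> t" for s t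
  proof -
    have "s\<^sup>2 * G s = (\<Sum>\<^sub>\<infinity>k. s\<^sup>2 * g (b k / s))" "t\<^sup>2 * G t = (\<Sum>\<^sub>\<infinity>k. t\<^sup>2 * g (b k / t))"
      unfolding G_def using gs that by (auto intro!: infsum_cmult_right[symmetric])
    moreover have "(\<Sum>\<^sub>\<infinity>k. s\<^sup>2 * g (b k / s)) \<le> (\<Sum>\<^sub>\<infinity>k. t\<^sup>2 * g (b k / t))"
      using that gs by (intro infsum_mono summable_on_cmult_right g_scaled_mono) auto
    ultimately show ?thesis by simp
  qed
  have Gle: "G s \<le> infsum h UNIV / s" if "s \<ge> 1" for s
  proof -
    have "G s \<le> (\<Sum>\<^sub>\<infinity>k. h k * (1 / s))"
      unfolding G_def
    proof (rule infsum_mono[OF gs[OF that] summable_on_cmult_left[OF h(1)]])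
      show "g (b k / s) \<le> h k * (1 / s)" for k using g_divide_le[OF that, of "b k"] by (simp add: h_def)
    qed
    also have "\<dots> = infsum h UNIV / s" using h by (subst infsum_cmult_left) auto
    finally show ?thesis .
  qed
  define A where "A = {s. s \<ge> 1 \<and> G s \<le> 1}"
  have ne: "A \<noteq> {}"
  proof -
    define s where "s = max 1 (infsum h UNIV)"
    have le: "infsum h UNIV / s \<le> 1" by (auto simp: s_def)
    have s1: "s \<ge> 1" by (simp add: s_def)
    have "G s \<le> 1" using Gle[OF s1] le by (rule order_trans)
    then have "s \<in> A" using s1 by (simp add: A_def)
    then show ?thesis by blast
  qed
  have bdd: "bdd_below A" by (rule bdd_belowI[of _ 1]) (auto simp: A_def)
  define D where "D = Inf A"
  have D1: "D \<ge> 1" unfolding D_def using ne by (intro cInf_greatest) (auto simp: A_def)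
  have term_eq: "(if b k = 0 then 0 else (b k)\<^sup>2 / s\<^sup>2 * H (s / \<bar>b k\<bar>)) = g (b k / s)" if "s \<ge> 1" for s k
    using that by (simp add: g_def power_divide inverse_eq_divide)
  have "D_norm H a n = Inf (ereal ` A)"
    unfolding D_norm_def Let_def b_def[symmetric]
  proof (rule arg_cong[where f = Inf], intro equalityI subsetI)
    fix x assume "x \<in> {ereal s |s. 1 \<le> s \<and> (\<lambda>k. if b k = 0 then 0 else (b k)\<^sup>2 / s\<^sup>2 * H (s / \<bar>b k\<bar>)) summable_on UNIV \<and>
       (\<Sum>\<^sub>\<infinity>k. if b k = 0 then 0 else (b k)\<^sup>2 / s\<^sup>2 * H (s / \<bar>b k\<bar>)) \<le> 1}"
    then show "x \<in> ereal ` A" using term_eq by (auto simp: A_def G_def)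
  next
    fix x assume "x \<in> ereal ` A"
    then obtain s where s: "x = ereal s" "s \<ge> 1" "G s \<le> 1" by (auto simp: A_def)
    then show "x \<in> {ereal s |s. 1 \<le> s \<and> (\<lambda>k. if b k = 0 then 0 else (b k)\<^sup>2 / s\<^sup>2 * H (s / \<bar>b k\<bar>)) summable_on UNIV \<and>
       (\<Sum>\<^sub>\<infinity>k. if b k = 0 then 0 else (b k)\<^sup>2 / s\<^sup>2 * H (s / \<bar>b k\<bar>)) \<le> 1}"
      using gs[of s] by (auto simp: term_eq G_def)
  qed
  also have "\<dots> = ereal D" unfolding D_def using ereal_Inf'[OF bdd ne] by simp
  finally have DD: "D_norm H a n = ereal D" .
  \<comment> \<open>If G D > 1, the infimum is approached by some t < D sqrt (G D) with G t \<le> 1,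
    and D^2 G D \<le> t^2 G t \<le> t^2 < D^2 G D.\<close>
  have le1: "G D \<le> 1"
  proof (rule ccontr)
    assume gt: "\<not> G D \<le> 1"
    then have "D * 1 < D * sqrt (G D)" using D1 by (intro mult_strict_left_mono) auto
    then have "Inf A < D * sqrt (G D)" by (simp add: D_def)
    then obtain t where t: "t \<in> A" "t < D * sqrt (G D)" using cInf_less_iff[OF ne bdd] by blast
    have tD: "D \<le> t" unfolding D_def using t bdd by (intro cInf_lower) auto
    have "D\<^sup>2 * G D \<le> t\<^sup>2 * G t" by (rule Gmono[OF D1 tD])
    also have "\<dots> \<le> t\<^sup>2 * 1" using t by (intro mult_left_mono) (auto simp: A_def)
    also have "t\<^sup>2 < (D * sqrt (G D))\<^sup>2" using t D1 tD by (intro power_strict_mono) auto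
    also have "\<dots> = D\<^sup>2 * G D" using G0 by (simp add: power_mult_distrib)
    finally show False by simp
  qed
  have eq1: "G D = 1" if gt: "(\<Sum>\<^sub>\<infinity>k. (b k)\<^sup>2) > 1"
  proof (rule ccontr)
    assume "G D \<noteq> 1"
    then have lt: "G D < 1" using le1 by simp
    \<comment> \<open>As \<open>g\<close> dominates the square, a square sum above 1 excludes s = 1.
      Hence D > 1, and there is room to the left of D.\<close>
    have "(\<Sum>\<^sub>\<infinity>k. (b k)\<^sup>2) \<le> G 1"
      unfolding G_def using gs[of 1] s2 by (intro infsum_mono) (auto simp: b_def g_ge_square)
    then have notA: "1 \<notin> A" using gt by (simp add: A_def)
    have "D \<noteq> 1" using notA le1 by (auto simp: A_def)
    then have Dgt: "D > 1" using D1 by simp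
    \<comment> \<open>If G D < 1, this s is below D, so G s > 1; but then s^2 < s^2 G s \<le> D^2 G
      D \<le> s^2.\<close>
    define s where "s = max 1 (D * sqrt (G D))"
    have "D * sqrt (G D) < D * 1" using lt G0 Dgt by (intro mult_strict_left_mono) auto
    then have s: "s < D" "s \<ge> 1" "D * sqrt (G D) \<le> s" using Dgt by (auto simp: s_def)
    have "s \<notin> A" using s bdd cInf_lower[of s A] by (auto simp: D_def)
    then have "G s > 1" using s by (simp add: A_def)
    then have "s\<^sup>2 * 1 < s\<^sup>2 * G s" using s by (intro mult_strict_left_mono) auto
    also have "\<dots> \<le> D\<^sup>2 * G D" using s by (intro Gmono) auto
    also have "\<dots> = (D * sqrt (G D))\<^sup>2" using G0 by (simp add: power_mult_distrib)
    also have "\<dots> \<le> s\<^sup>2" using s D1 G0 by (intro power_mono) auto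
    finally show False by simp
  qed
  show ?thesis using DD D1 gs[OF D1] eq1 unfolding b_def G_def by blast
qed

text \<open>Cosine and sine are treated separately by \<open>expectation_approx_g\<close>. As the
  mean is zero, t u may be subtracted from sin (t u); the difference is o(u^2) at 0 and linear at
  infinity, so the imaginary part contributes nothing in the limit.\<close>

lemma expectation_iexp_approx:
  assumes sv: "slowly_varying H0" and mean: "expectation Z = 0" and e: "e > 0"
  shows "\<exists>c0>0. \<forall>c. \<bar>c\<bar> \<le> c0 \<longrightarrow> norm (expectation (\<lambda>\<omega>. iexp (t * (c * Z \<omega>))) - 1 + complex_of_real (t\<^sup>2 / 2 * g c)) \<le> e * g c"
proof -
  have cb: "\<bar>cos x - 1\<bar> \<le> x\<^sup>2 / 2" for x :: real
  proof -
    have "\<bar>sin (x / 2)\<bar>\<^sup>2 \<le> \<bar>x / 2\<bar>\<^sup>2" by (intro power_mono abs_sin_x_le_abs_x) simp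
    then show ?thesis using cos_double_sin[of "x / 2"] by (simp add: power_divide)
  qed
  have f1: "\<bar>cos (t * u) - 1\<bar> \<le> (t\<^sup>2 / 2 + 2) * qf u" for u
  proof (cases "\<bar>u\<bar> \<le> 1")
    case True
    have "\<bar>cos (t * u) - 1\<bar> \<le> t\<^sup>2 / 2 * u\<^sup>2" using cb[of "t * u"] by (simp add: power_mult_distrib)
    also have "\<dots> \<le> (t\<^sup>2 / 2 + 2) * u\<^sup>2" by (intro mult_right_mono) auto
    finally show ?thesis using True by (simp add: qf_eq_square)
  next
    case False
    have "\<bar>cos (t * u) - 1\<bar> \<le> 2 * 1" using cos_ge_minus_one[of "t * u"] cos_le_one[of "t * u"] by linarith
    also have "\<dots> \<le> (t\<^sup>2 / 2 + 2) * \<bar>u\<bar>" using False by (intro mult_mono) auto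
    finally show ?thesis using False by (simp add: qf_eq_abs)
  qed
  have l1: "((\<lambda>u. (cos (t * u) - 1) / u\<^sup>2) \<longlongrightarrow> - (t\<^sup>2 / 2)) (at 0)"
    unfolding power2_eq_square[of t] by real_asymp
  have sb: "\<bar>sin x - x\<bar> \<le> x\<^sup>2 / 2" "\<bar>sin x - x\<bar> \<le> 2 * \<bar>x\<bar>" for x :: real
  proof -
    have "\<bar>Im (iexp x - (\<Sum>k \<le> 1. (\<i> * x)^k / fact k))\<bar> \<le> \<bar>x\<bar>^(Suc 1) / fact (Suc 1)"
      by (rule order_trans[OF abs_Im_le_cmod iexp_approx1])
    then show "\<bar>sin x - x\<bar> \<le> x\<^sup>2 / 2" by (simp add: Im_exp power2_eq_square fact_numeral)
    show "\<bar>sin x - x\<bar> \<le> 2 * \<bar>x\<bar>" using abs_sin_x_le_abs_x[of x] by linarith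
  qed
  have f2: "\<bar>sin (t * u) - t * u\<bar> \<le> (t\<^sup>2 / 2 + 2 * \<bar>t\<bar>) * qf u" for u
  proof (cases "\<bar>u\<bar> \<le> 1")
    case True
    have "\<bar>sin (t * u) - t * u\<bar> \<le> t\<^sup>2 / 2 * u\<^sup>2" using sb(1)[of "t * u"] by (simp add: power_mult_distrib)
    also have "\<dots> \<le> (t\<^sup>2 / 2 + 2 * \<bar>t\<bar>) * u\<^sup>2" by (intro mult_right_mono) auto
    finally show ?thesis using True by (simp add: qf_eq_square)
  next
    case False
    have "\<bar>sin (t * u) - t * u\<bar> \<le> 2 * \<bar>t\<bar> * \<bar>u\<bar>" using sb(2)[of "t * u"] by (simp add: abs_mult)
    also have "\<dots> \<le> (t\<^sup>2 / 2 + 2 * \<bar>t\<bar>) * \<bar>u\<bar>" by (intro mult_right_mono) auto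
    finally show ?thesis using False by (simp add: qf_eq_abs)
  qed
  have l2: "((\<lambda>u. (sin (t * u) - t * u) / u\<^sup>2) \<longlongrightarrow> 0) (at 0)" by real_asymp
  obtain c1 where c1: "c1 > 0" "\<And>c. \<bar>c\<bar> \<le> c1 \<Longrightarrow>
      \<bar>expectation (\<lambda>\<omega>. cos (t * (c * Z \<omega>)) - 1) - (- (t\<^sup>2 / 2)) * g c\<bar> \<le> e / 2 * g c"
    using expectation_approx_g[OF sv _ f1 l1, of "e / 2"] e by auto
  obtain c2 where c2: "c2 > 0" "\<And>c. \<bar>c\<bar> \<le> c2 \<Longrightarrow>
      \<bar>expectation (\<lambda>\<omega>. sin (t * (c * Z \<omega>)) - t * (c * Z \<omega>)) - 0 * g c\<bar> \<le> e / 2 * g c"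
    using expectation_approx_g[OF sv _ f2 l2, of "e / 2"] e by auto
  have "norm (expectation (\<lambda>\<omega>. iexp (t * (c * Z \<omega>))) - 1 + complex_of_real (t\<^sup>2 / 2 * g c)) \<le> e * g c"
    if c: "\<bar>c\<bar> \<le> min c1 c2" for c
  proof -
    let ?E = "expectation (\<lambda>\<omega>. iexp (t * (c * Z \<omega>)))"
    have int: "integrable M (\<lambda>\<omega>. iexp (t * (c * Z \<omega>)))"
      by (rule integrable_const_bound[where B = 1]) auto
    have ic: "integrable M (\<lambda>\<omega>. cos (t * (c * Z \<omega>)))" "integrable M (\<lambda>\<omega>. sin (t * (c * Z \<omega>)))"
      by (auto intro!: integrable_const_bound[where B = 1])
    have Re: "Re ?E = expectation (\<lambda>\<omega>. cos (t * (c * Z \<omega>)))"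
      using integral_Re[OF int] by (simp add: Re_exp)
    have Im: "Im ?E = expectation (\<lambda>\<omega>. sin (t * (c * Z \<omega>)))"
      using integral_Im[OF int] by (simp add: Im_exp)
    have "\<bar>Re ?E - 1 + t\<^sup>2 / 2 * g c\<bar> \<le> e / 2 * g c"
      unfolding Re using c1(2)[of c] c ic by (simp add: prob_space)
    moreover have "\<bar>Im ?E\<bar> \<le> e / 2 * g c"
      unfolding Im using c2(2)[of c] c ic integrable_Z mean by simp
    moreover have "cmod (?E - 1 + complex_of_real (t\<^sup>2 / 2 * g c)) \<le> \<bar>Re ?E - 1 + t\<^sup>2 / 2 * g c\<bar> + \<bar>Im ?E\<bar>"
      using cmod_le[of "?E - 1 + complex_of_real (t\<^sup>2 / 2 * g c)"]
      by (simp only: plus_complex.sel minus_complex.sel one_complex.sel Re_complex_of_real Im_complex_of_real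
          diff_0_right add_0_right)
    ultimately show ?thesis by linarith
  qed
  then show ?thesis using c1 c2 by (intro exI[of _ "min c1 c2"]) auto
qed

text \<open>\<open>expectation_approx_g\<close> for 1 - exp (- l u^2). It is stated over the complex
  numbers so that \<open>array_limit\<close> serves both the characteristic function and the Laplace
  transform.\<close>

lemma expectation_laplace_approx:
  assumes sv: "slowly_varying H0" and l: "l > 0" and e: "e > 0"
  shows "\<exists>c0>0. \<forall>c. \<bar>c\<bar> \<le> c0 \<longrightarrow> norm (expectation (\<lambda>\<omega>. complex_of_real (exp (- l * (c * Z \<omega>)\<^sup>2))) - 1 + complex_of_real (l * g c)) \<le> e * g c"
proof -
  have nn: "l * u\<^sup>2 \<ge> 0" for u using l by simp
  have f: "\<bar>1 - exp (- l * u\<^sup>2)\<bar> \<le> (l + 1) * qf u" for u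
  proof (cases "\<bar>u\<bar> \<le> 1")
    case True
    have "\<bar>1 - exp (- l * u\<^sup>2)\<bar> \<le> l * u\<^sup>2"
      using nn[of u] l exp_ge_add_one_self[of "- l * u\<^sup>2"] by (auto simp: abs_if not_less)
    also have "\<dots> \<le> (l + 1) * u\<^sup>2" by (intro mult_right_mono) auto
    finally show ?thesis using True by (simp add: qf_eq_square)
  next
    case False
    have "\<bar>1 - exp (- l * u\<^sup>2)\<bar> \<le> 1 * 1" using nn[of u] by (simp add: abs_if)
    also have "\<dots> \<le> (l + 1) * \<bar>u\<bar>" using False l by (intro mult_mono) auto
    finally show ?thesis using False by (simp add: qf_eq_abs)
  qed
  have lim: "((\<lambda>u. (1 - exp (- l * u\<^sup>2)) / u\<^sup>2) \<longlongrightarrow> l) (at 0)" by real_asymp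
  obtain c1 where c1: "c1 > 0" "\<And>c. \<bar>c\<bar> \<le> c1 \<Longrightarrow>
      \<bar>expectation (\<lambda>\<omega>. 1 - exp (- l * (c * Z \<omega>)\<^sup>2)) - l * g c\<bar> \<le> e * g c"
    using expectation_approx_g[OF sv _ f lim e] by auto
  have "norm (expectation (\<lambda>\<omega>. complex_of_real (exp (- l * (c * Z \<omega>)\<^sup>2))) - 1 + complex_of_real (l * g c)) \<le> e * g c"
    if c: "\<bar>c\<bar> \<le> c1" for c
  proof -
    have int: "integrable M (\<lambda>\<omega>. exp (- l * (c * Z \<omega>)\<^sup>2))"
      using l by (intro integrable_const_bound[where B = 1]) auto
    have "expectation (\<lambda>\<omega>. complex_of_real (exp (- l * (c * Z \<omega>)\<^sup>2))) - 1 + complex_of_real (l * g c)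
       = complex_of_real (- (expectation (\<lambda>\<omega>. 1 - exp (- l * (c * Z \<omega>)\<^sup>2)) - l * g c))"
      unfolding integral_complex_of_real using int by (simp add: prob_space)
    then have "norm (expectation (\<lambda>\<omega>. complex_of_real (exp (- l * (c * Z \<omega>)\<^sup>2))) - 1 + complex_of_real (l * g c))
       = \<bar>expectation (\<lambda>\<omega>. 1 - exp (- l * (c * Z \<omega>)\<^sup>2)) - l * g c\<bar>"
      by (simp only: norm_of_real abs_minus_cancel)
    then show ?thesis using c1(2)[OF c] by simp
  qed
  then show ?thesis using c1 by blast
qed

end

subsection \<open>Asymptotic normality under slow variation\<close>

lemma std_normal_iff_char:
  assumes "prob_space M" and [measurable]: "\<And>n. Y n \<in> borel_measurable M"
  shows "converges_to_std_normal M Y \<longleftrightarrow>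
    (\<forall>t. (\<lambda>n. integral\<^sup>L M (\<lambda>\<omega>. iexp (t * Y n \<omega>))) \<longlonglongrightarrow> complex_of_real (exp (- t\<^sup>2 / 2)))"
proof -
  interpret prob_space M by fact
  have c: "char (distr M borel (Y n)) t = integral\<^sup>L M (\<lambda>\<omega>. iexp (t * Y n \<omega>))" for n t
    unfolding char_def by (subst integral_distr) auto
  have rd: "real_distribution (distr M borel (Y n))" for n by (intro real_distribution_distr) auto
  show ?thesis
  proof
    assume w: "converges_to_std_normal M Y"
    show "\<forall>t. (\<lambda>n. integral\<^sup>L M (\<lambda>\<omega>. iexp (t * Y n \<omega>))) \<longlonglongrightarrow> complex_of_real (exp (- t\<^sup>2 / 2))"
    proof
      fix t
      have "(\<lambda>n. char (distr M borel (Y n)) t) \<longlonglongrightarrow> char std_normal_distribution t"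
        using w unfolding converges_to_std_normal_def
        by (intro levy_continuity1[OF rd real_dist_normal_dist])
      then show "(\<lambda>n. integral\<^sup>L M (\<lambda>\<omega>. iexp (t * Y n \<omega>))) \<longlonglongrightarrow> complex_of_real (exp (- t\<^sup>2 / 2))"
        unfolding c by (simp add: char_std_normal_distribution)
    qed
  next
    assume "\<forall>t. (\<lambda>n. integral\<^sup>L M (\<lambda>\<omega>. iexp (t * Y n \<omega>))) \<longlonglongrightarrow> complex_of_real (exp (- t\<^sup>2 / 2))"
    then show "converges_to_std_normal M Y"
      unfolding converges_to_std_normal_def
      by (intro levy_continuity[OF rd real_dist_normal_dist]) (simp add: c char_std_normal_distribution)
  qed
qed

context iid_seq
begin

lemma expectation_prod:
  fixes \<psi> :: "real \<Rightarrow> complex"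
  assumes [measurable]: "\<psi> \<in> borel_measurable borel" and le: "\<And>u. norm (\<psi> u) \<le> 1" and "finite J"
  shows "expectation (\<lambda>\<omega>. \<Prod>k\<in>J. \<psi> (c k * \<xi> k \<omega>)) = (\<Prod>k\<in>J. expectation (\<lambda>\<omega>. \<psi> (c k * \<xi> 0 \<omega>)))"
proof -
  have "expectation (\<lambda>\<omega>. \<Prod>k\<in>J. \<psi> (c k * \<xi> k \<omega>)) = (\<Prod>k\<in>J. expectation (\<lambda>\<omega>. \<psi> (c k * \<xi> k \<omega>)))"
  proof (rule indep_vars_lebesgue_integral[OF \<open>finite J\<close>])
    show "indep_vars (\<lambda>_. borel) (\<lambda>k \<omega>. \<psi> (c k * \<xi> k \<omega>)) J"
      by (rule indep_vars_compose2[OF indep_scaled[of c J], where Y = "\<lambda>k. \<psi>"]) simp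
    show "integrable M (\<lambda>\<omega>. \<psi> (c k * \<xi> k \<omega>))" for k
      using le by (intro integrable_const_bound[where B = 1]) auto
  qed
  also have "\<dots> = (\<Prod>k\<in>J. expectation (\<lambda>\<omega>. \<psi> (c k * \<xi> 0 \<omega>)))"
  proof (rule prod.cong[OF refl])
    fix k show "expectation (\<lambda>\<omega>. \<psi> (c k * \<xi> k \<omega>)) = expectation (\<lambda>\<omega>. \<psi> (c k * \<xi> 0 \<omega>))"
      by (rule expectation_ident[of "\<lambda>x. \<psi> (c k * x)"]) simp
  qed
  finally show ?thesis .
qed

text \<open>Each factor E \<psi>(c \<xi>) is within (e/2) \<open>g c\<close> of exp (- \<kappa>
  \<open>g c\<close>), and a product of numbers in the unit disc changes by at most the sum of the
  changes of its factors. As the \<open>g (c n k)\<close> add up to 1, the total error is at most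
  e/2. The bound is proved on finite windows, uniformly in their length, and then passed to the
  limit.\<close>

lemma array_limit:
  fixes \<psi> :: "real \<Rightarrow> complex" and c :: "nat \<Rightarrow> int \<Rightarrow> real" and Y :: "nat \<Rightarrow> 'a \<Rightarrow> complex"
  assumes meas [measurable]: "\<psi> \<in> borel_measurable borel" and le: "\<And>u. norm (\<psi> u) \<le> 1" and \<kappa>: "\<kappa> \<ge> 0"
    and approx: "\<And>e. e > 0 \<Longrightarrow> \<exists>c0>0. \<forall>c. \<bar>c\<bar> \<le> c0 \<longrightarrow>
      norm (expectation (\<lambda>\<omega>. \<psi> (c * \<xi> 0 \<omega>)) - 1 + complex_of_real (\<kappa> * g c)) \<le> e * g c"
    and one: "\<forall>\<^sub>F n in sequentially. (\<lambda>k. g (c n k)) summable_on UNIV \<and> (\<Sum>\<^sub>\<infinity>k. g (c n k)) = 1"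
    and small: "\<And>e. e > 0 \<Longrightarrow> \<forall>\<^sub>F n in sequentially. \<forall>k. \<bar>c n k\<bar> \<le> e"
    and Y [measurable]: "\<And>n. Y n \<in> borel_measurable M"
    and lim: "\<And>n. AE \<omega> in M. (\<lambda>m. \<Prod>k = - int m..int m. \<psi> (c n k * \<xi> k \<omega>)) \<longlonglongrightarrow> Y n \<omega>"
  shows "(\<lambda>n. expectation (Y n)) \<longlonglongrightarrow> complex_of_real (exp (- \<kappa>))"
proof (rule tendstoI)
  fix e :: real assume e: "e > 0"
  obtain c1 where c1: "c1 > 0" "\<And>c. \<bar>c\<bar> \<le> c1 \<Longrightarrow>
      norm (expectation (\<lambda>\<omega>. \<psi> (c * \<xi> 0 \<omega>)) - 1 + complex_of_real (\<kappa> * g c)) \<le> e / 4 * g c"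
    using approx[of "e / 4"] e by auto
  \<comment> \<open>The quadratic error of exp (- x) against 1 - x at x = \<kappa>
    \<open>g c\<close> is at most \<kappa>^2 d \<open>g c\<close> when \<open>g c\<close> \<le> d,
    and this choice keeps it below (e/4) \<open>g c\<close>.\<close>
  define d where "d = e / (4 * (\<kappa>\<^sup>2 + 1))"
  have d: "d > 0" "\<kappa>\<^sup>2 * d \<le> e / 4"
    using e by (auto simp: d_def field_simps add_pos_nonneg intro!: divide_pos_pos)
  obtain c2 where c2: "c2 > 0" "\<And>c. \<bar>c\<bar> \<le> c2 \<Longrightarrow> g c \<le> d" using g_small[OF d(1)] by blast
  have "\<forall>\<^sub>F n in sequentially. \<forall>k. \<bar>c n k\<bar> \<le> min c1 c2" using c1 c2 by (intro small) auto
  with one show "\<forall>\<^sub>F n in sequentially. dist (expectation (Y n)) (complex_of_real (exp (- \<kappa>))) < e"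
  proof eventually_elim
    case (elim n)
    then have sg: "(\<lambda>k. g (c n k)) summable_on UNIV" and one: "(\<Sum>\<^sub>\<infinity>k. g (c n k)) = 1"
      and cs: "\<And>k. \<bar>c n k\<bar> \<le> c1" "\<And>k. \<bar>c n k\<bar> \<le> c2" by auto
    define P where "P m \<omega> = (\<Prod>k = - int m..int m. \<psi> (c n k * \<xi> k \<omega>))" for m \<omega>
    have [measurable]: "P m \<in> borel_measurable M" for m unfolding P_def by measurable
    have P1: "norm (P m \<omega>) \<le> 1" for m \<omega>
      unfolding P_def prod_norm[symmetric] using le by (intro prod_le_1) auto
    define z where "z k = expectation (\<lambda>\<omega>. \<psi> (c n k * \<xi> 0 \<omega>))" for k
    have z1: "norm (z k) \<le> 1" for k
    proof -
      have "norm (z k) \<le> expectation (\<lambda>\<omega>. norm (\<psi> (c n k * \<xi> 0 \<omega>)))" unfolding z_def by (rule integral_norm_bound)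
      also have "\<dots> \<le> expectation (\<lambda>\<omega>. 1)"
        using le by (intro integral_mono integrable_const_bound[where B = 1]) auto
      finally show ?thesis by (simp add: prob_space)
    qed
    define w where "w k = complex_of_real (exp (- \<kappa> * g (c n k)))" for k
    have w1: "norm (w k) \<le> 1" for k unfolding w_def norm_of_real using \<kappa> g_nonneg by simp
    have zw: "norm (z k - w k) \<le> e / 2 * g (c n k)" for k
    proof -
      define x where "x = \<kappa> * g (c n k)"
      have x: "x \<ge> 0" unfolding x_def using \<kappa> g_nonneg by simp
      have xb: "\<bar>exp (- x) - 1 + x\<bar> \<le> x\<^sup>2"
      proof -
        have "1 - x \<le> exp (- x)" using exp_ge_add_one_self[of "- x"] by simp
        moreover have "exp (- x) \<le> 1 / (1 + x)"
          using exp_ge_add_one_self[of x] x by (simp add: exp_minus inverse_eq_divide frac_le)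
        moreover have "1 / (1 + x) \<le> 1 - x + x\<^sup>2"
          using x by (simp add: field_simps power2_eq_square)
        ultimately show ?thesis by linarith
      qed
      have "z k - w k = (z k - 1 + complex_of_real x) - complex_of_real (exp (- x) - 1 + x)"
        by (simp add: w_def x_def)
      then have "norm (z k - w k) \<le> norm (z k - 1 + complex_of_real x) + norm (complex_of_real (exp (- x) - 1 + x))"
        by (metis norm_triangle_ineq4)
      also have "\<dots> \<le> e / 4 * g (c n k) + x\<^sup>2"
        unfolding norm_of_real using c1(2)[OF cs(1)[of k]] xb unfolding z_def x_def by (rule add_mono)
      also have "x\<^sup>2 = \<kappa>\<^sup>2 * g (c n k) * g (c n k)" by (simp add: x_def power2_eq_square)
      also have "\<dots> \<le> \<kappa>\<^sup>2 * d * g (c n k)"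
        using c2(2)[OF cs(2)[of k]] g_nonneg by (intro mult_right_mono mult_left_mono) auto
      also have "\<dots> \<le> e / 4 * g (c n k)" using d g_nonneg by (intro mult_right_mono)
      finally show ?thesis by simp
    qed
    have bound: "norm (expectation (P m) - complex_of_real (exp (- \<kappa> * (\<Sum>k = - int m..int m. g (c n k))))) \<le> e / 2" for m
    proof -
      have "expectation (P m) = (\<Prod>k = - int m..int m. z k)"
        unfolding P_def z_def by (rule expectation_prod[OF meas le]) simp
      moreover have "complex_of_real (exp (- \<kappa> * (\<Sum>k = - int m..int m. g (c n k)))) = (\<Prod>k = - int m..int m. w k)"
        unfolding w_def sum_distrib_left by (simp add: exp_sum)
      ultimately have "norm (expectation (P m) - complex_of_real (exp (- \<kappa> * (\<Sum>k = - int m..int m. g (c n k)))))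
          \<le> (\<Sum>k = - int m..int m. norm (z k - w k))"
        using norm_prod_diff[of "{- int m..int m}" z w] z1 w1 by simp
      also have "\<dots> \<le> (\<Sum>k = - int m..int m. e / 2 * g (c n k))" by (intro sum_mono zw)
      also have "\<dots> = e / 2 * (\<Sum>k = - int m..int m. g (c n k))" by (simp add: sum_distrib_left)
      also have "\<dots> \<le> e / 2 * 1"
        unfolding one[symmetric] using e sg g_nonneg by (intro mult_left_mono sum_le_infsum) auto
      finally show ?thesis by simp
    qed
    have "(\<lambda>m. expectation (P m)) \<longlonglongrightarrow> expectation (Y n)"
      by (rule integral_dominated_convergence[where w = "\<lambda>_. 1"]) (use lim[of n] P1 in \<open>auto simp: P_def\<close>)
    moreover have "(\<lambda>m. complex_of_real (exp (- \<kappa> * (\<Sum>k = - int m..int m. g (c n k))))) \<longlonglongrightarrow> complex_of_real (exp (- \<kappa> * 1))"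
      unfolding one[symmetric] by (intro tendsto_of_real tendsto_exp tendsto_mult tendsto_const infsum_window sg)
    ultimately have "(\<lambda>m. norm (expectation (P m) - complex_of_real (exp (- \<kappa> * (\<Sum>k = - int m..int m. g (c n k))))))
        \<longlonglongrightarrow> norm (expectation (Y n) - complex_of_real (exp (- \<kappa> * 1)))"
      by (intro tendsto_norm tendsto_diff)
    then have "norm (expectation (Y n) - complex_of_real (exp (- \<kappa> * 1))) \<le> e / 2"
      by (rule LIMSEQ_le_const2) (use bound in auto)
    then show ?case using e by (simp add: dist_norm)
  qed
qed

text \<open>Uniform smallness rests on two orders of growth: with B the square sum of
  \<open>b_coeff a n\<close>, every squared coefficient is O(sqrt B) by
  \<open>b_coeff_sup_le\<close>, whereas D^2 \<ge> B because the weights \<open>g\<close> sum to 1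
  and dominate squares.\<close>

lemma D_norm_array:
  assumes sv: "slowly_varying H0" and adm: "admissible H a"
  shows "\<exists>D. (\<forall>n. D_norm H a n = ereal (D n) \<and> D n \<ge> 1 \<and> (\<lambda>k. g (b_coeff a n k / D n)) summable_on UNIV) \<and>
    (\<forall>\<^sub>F n in sequentially. (\<Sum>\<^sub>\<infinity>k. g (b_coeff a n k / D n)) = 1) \<and>
    (\<forall>e>0. \<forall>\<^sub>F n in sequentially. \<forall>k. \<bar>b_coeff a n k / D n\<bar> \<le> e) \<and>
    (\<forall>n. (\<lambda>j. Q (b_coeff a n j)) summable_on UNIV) \<and> (\<lambda>j. Q (a j)) summable_on UNIV"
proof -
  obtain K where K: "K \<ge> 0" "\<And>c. Q c \<le> K * g c" using Q_le_g[OF sv] by blast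
  have "(\<lambda>j. if a j = 0 then 0 else (a j)\<^sup>2 * H (inverse \<bar>a j\<bar>)) = (\<lambda>j. g (a j))"
    by (auto simp: g_def fun_eq_iff)
  then have sg: "(\<lambda>j. g (a j)) summable_on UNIV" and lim: "filterlim (\<lambda>n. \<Sum>\<^sub>\<infinity>k. (b_coeff a n k)\<^sup>2) at_top sequentially"
    using adm unfolding admissible_def by auto
  have sa: "(\<lambda>j. (a j)\<^sup>2) summable_on UNIV" by (rule summable_on_le[OF sg]) (auto simp: g_ge_square)
  have sQ: "(\<lambda>j. Q (a j)) summable_on UNIV"
    by (rule summable_on_le[OF summable_on_cmult_right[OF sg, of K]]) (auto simp: Q_nonneg K)
  have sb: "(\<lambda>j. (b_coeff a n j)\<^sup>2) summable_on UNIV" for n by (rule b_coeff_square_summable[OF sa])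
  have sQb: "(\<lambda>j. Q (b_coeff a n j)) summable_on UNIV" for n by (rule b_coeff_Q_summable[OF sQ])
  obtain D where D: "\<And>n. D_norm H a n = ereal (D n)" "\<And>n. D n \<ge> 1"
    "\<And>n. (\<lambda>k. g (b_coeff a n k / D n)) summable_on UNIV"
    "\<And>n. (\<Sum>\<^sub>\<infinity>k. (b_coeff a n k)\<^sup>2) > 1 \<Longrightarrow> (\<Sum>\<^sub>\<infinity>k. g (b_coeff a n k / D n)) = 1"
    using D_norm_properties[OF sQb sb] by metis
  have ev: "\<forall>\<^sub>F n in sequentially. (\<Sum>\<^sub>\<infinity>k. (b_coeff a n k)\<^sup>2) > X" for X
    using lim by (simp add: filterlim_at_top_dense)
  have one: "\<forall>\<^sub>F n in sequentially. (\<Sum>\<^sub>\<infinity>k. g (b_coeff a n k / D n)) = 1"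
    using ev[of 1] by eventually_elim (rule D(4))
  have small: "\<forall>\<^sub>F n in sequentially. \<forall>k. \<bar>b_coeff a n k / D n\<bar> \<le> e" if e: "e > 0" for e
  proof -
    define A where "A = (\<Sum>\<^sub>\<infinity>j. (a j)\<^sup>2)"
    have A: "A \<ge> 0" unfolding A_def by (intro infsum_nonneg) auto
    \<comment> \<open>Beyond this value 4 sqrt A \<le> e^2 sqrt B, so the bound 4 sqrt A sqrt B on
      squared coefficients is at most e^2 B; the 1 ensures that the weights sum to 1.\<close>
    define X where "X = max 1 ((4 * sqrt A / e\<^sup>2)\<^sup>2)"
    show ?thesis using ev[of X] one
    proof eventually_elim
      case (elim n)
      define B where "B = (\<Sum>\<^sub>\<infinity>k. (b_coeff a n k)\<^sup>2)"
      have B: "B > 1" "B > (4 * sqrt A / e\<^sup>2)\<^sup>2" using elim by (auto simp: B_def X_def)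
      have sB: "4 * sqrt A / e\<^sup>2 \<le> sqrt B" using B by (intro real_le_rsqrt) auto
      have "B \<le> (\<Sum>\<^sub>\<infinity>k. (D n)\<^sup>2 * g (b_coeff a n k / D n))"
        unfolding B_def
      proof (rule infsum_mono[OF sb summable_on_cmult_right[OF D(3)]])
        fix k
        have "(D n)\<^sup>2 * (b_coeff a n k / D n)\<^sup>2 \<le> (D n)\<^sup>2 * g (b_coeff a n k / D n)"
          by (intro mult_left_mono g_ge_square) auto
        then show "(b_coeff a n k)\<^sup>2 \<le> (D n)\<^sup>2 * g (b_coeff a n k / D n)"
          using D(2)[of n] by (simp add: power_divide)
      qed
      also have "\<dots> = (D n)\<^sup>2" using D(3) elim by (subst infsum_cmult_right) auto
      finally have BD: "B \<le> (D n)\<^sup>2" .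
      show ?case
      proof
        fix k
        have "(b_coeff a n k)\<^sup>2 \<le> 4 * sqrt A * sqrt B"
          unfolding A_def B_def by (rule b_coeff_sup_le[OF sa])
        also have "\<dots> \<le> e\<^sup>2 * sqrt B * sqrt B"
          using sB e B by (intro mult_right_mono) (auto simp: field_simps)
        also have "\<dots> = e\<^sup>2 * B" using B by simp
        also have "\<dots> \<le> e\<^sup>2 * (D n)\<^sup>2" using BD by (intro mult_left_mono) auto
        finally have "(b_coeff a n k / D n)\<^sup>2 \<le> e\<^sup>2" using D(2)[of n] by (simp add: power_divide field_simps)
        then show "\<bar>b_coeff a n k / D n\<bar> \<le> e" using e by (simp add: abs_le_square_iff[symmetric])
      qed
    qed
  qed
  show ?thesis using D(1-3) one small sQb sQ by (intro exI[of _ D] conjI allI impI)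
qed

text \<open>After the two applications of \<open>array_limit\<close>, the self-normalized sum is
  compared with S_n / D_n by a Slutsky argument at the level of characteristic functions, for which
  S_n / D_n must be bounded in mean.\<close>

lemma slowly_varying_imp_asymptotic_normality:
  assumes sv: "slowly_varying H0" and adm: "admissible H a"
  shows "S_converges M \<xi> a" and "D_norm H a n < \<infinity>"
    and "converges_to_std_normal M (\<lambda>n \<omega>. S_proc \<xi> a n \<omega> / real_of_ereal (D_norm H a n))"
    and "AE \<omega> in M. (\<lambda>k. (b_coeff a n k)\<^sup>2 * (\<xi> k \<omega>)\<^sup>2) summable_on UNIV"
    and "converges_to_std_normal M (\<lambda>n \<omega>. S_proc \<xi> a n \<omega> / V_norm \<xi> a n \<omega>)"
proof -
  obtain D where D: "\<And>n. D_norm H a n = ereal (D n)" "\<And>n. D n \<ge> 1"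
    and sg: "\<And>n. (\<lambda>k. g (b_coeff a n k / D n)) summable_on UNIV"
    and one: "\<forall>\<^sub>F n in sequentially. (\<Sum>\<^sub>\<infinity>k. g (b_coeff a n k / D n)) = 1"
    and small: "\<And>e. e > 0 \<Longrightarrow> \<forall>\<^sub>F n in sequentially. \<forall>k. \<bar>b_coeff a n k / D n\<bar> \<le> e"
    and sQb: "\<And>n. (\<lambda>j. Q (b_coeff a n j)) summable_on UNIV" and sQ: "(\<lambda>j. Q (a j)) summable_on UNIV"
  proof -
    obtain D where *: "(\<forall>n. D_norm H a n = ereal (D n) \<and> D n \<ge> 1 \<and> (\<lambda>k. g (b_coeff a n k / D n)) summable_on UNIV) \<and>
    (\<forall>\<^sub>F n in sequentially. (\<Sum>\<^sub>\<infinity>k. g (b_coeff a n k / D n)) = 1) \<and>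
    (\<forall>e>0. \<forall>\<^sub>F n in sequentially. \<forall>k. \<bar>b_coeff a n k / D n\<bar> \<le> e) \<and>
    (\<forall>n. (\<lambda>j. Q (b_coeff a n j)) summable_on UNIV) \<and> (\<lambda>j. Q (a j)) summable_on UNIV"
      using D_norm_array[OF sv adm] by (rule exE)
    show thesis
    proof (rule that[of D])
      show "\<And>n. D_norm H a n = ereal (D n)" "\<And>n. D n \<ge> 1" "\<And>n. (\<lambda>k. g (b_coeff a n k / D n)) summable_on UNIV"
        using * by auto
      show "\<forall>\<^sub>F n in sequentially. (\<Sum>\<^sub>\<infinity>k. g (b_coeff a n k / D n)) = 1" using * by (elim conjE)
      show "\<And>n. (\<lambda>j. Q (b_coeff a n j)) summable_on UNIV" "(\<lambda>j. Q (a j)) summable_on UNIV"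
        using * by auto
      show "\<And>e. e > 0 \<Longrightarrow> \<forall>\<^sub>F n in sequentially. \<forall>k. \<bar>b_coeff a n k / D n\<bar> \<le> e" using * by (elim conjE) simp
    qed
  qed
  obtain K where K: "K \<ge> 0" "\<And>c. Q c \<le> K * g c" using Q_le_g[OF sv] by blast
  show conv: "S_converges M \<xi> a" by (rule S_converges_if[OF sQ])
  show "D_norm H a n < \<infinity>" by (simp add: D)
  have AEs: "AE \<omega> in M. (\<lambda>k. (b_coeff a n k)\<^sup>2 * (\<xi> k \<omega>)\<^sup>2) summable_on UNIV" for n
    by (rule AE_squares_summable[OF sQb])
  then show "AE \<omega> in M. (\<lambda>k. (b_coeff a n k)\<^sup>2 * (\<xi> k \<omega>)\<^sup>2) summable_on UNIV" .
  have ones: "\<forall>\<^sub>F n in sequentially. (\<lambda>k. g (b_coeff a n k / D n)) summable_on UNIV \<and> (\<Sum>\<^sub>\<infinity>k. g (b_coeff a n k / D n)) = 1"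
    using one sg by (auto elim: eventually_mono)
  define S where "S n = S_proc \<xi> a n" for n
  define V where "V n = V_norm \<xi> a n" for n
  have [measurable]: "S n \<in> borel_measurable M" "V n \<in> borel_measurable M" for n unfolding S_def V_def by measurable
  have Slim: "AE \<omega> in M. (\<lambda>m. \<Sum>k = - int m..int m. b_coeff a n k / D n * \<xi> k \<omega>) \<longlonglongrightarrow> S n \<omega> / D n" for n
  proof -
    have "AE \<omega> in M. bilateral_sums (\<lambda>j. b_coeff a n j * \<xi> j \<omega>) (S n \<omega>)"
    \<comment> \<open>\<open>S_converges\<close> speaks of n \<ge> 1 only; for n = 0 all
      coefficients and the sum vanish.\<close>
    proof (cases "n \<ge> 1")
      case False
      then have "b_coeff a n j = 0" "S n \<omega> = 0" for j \<omega> by (auto simp: b_coeff_def S_def S_proc_def)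
      then show ?thesis by (simp add: bilateral_sums_def case_prod_unfold)
    qed (use conv in \<open>auto simp: S_converges_def S_def\<close>)
    then show ?thesis
    proof eventually_elim
      case (elim \<omega>)
      then have "(\<lambda>m. (\<Sum>k = - int m..int m. b_coeff a n k * \<xi> k \<omega>) / D n) \<longlonglongrightarrow> S n \<omega> / D n"
        using D(2)[of n] by (intro tendsto_divide bilateral_sums_window tendsto_const) auto
      then show ?case by (simp add: sum_divide_distrib)
    qed
  qed
  have limS: "(\<lambda>n. expectation (\<lambda>\<omega>. iexp (t * (S n \<omega> / D n)))) \<longlonglongrightarrow> complex_of_real (exp (- (t\<^sup>2 / 2)))" for t
  proof (rule array_limit[where \<psi> = "\<lambda>u. iexp (t * u)" and c = "\<lambda>n k. b_coeff a n k / D n", OF _ _ _ _ ones small])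
    show "\<exists>c0>0. \<forall>c. \<bar>c\<bar> \<le> c0 \<longrightarrow> cmod (expectation (\<lambda>\<omega>. iexp (t * (c * \<xi> 0 \<omega>))) - 1 + complex_of_real (t\<^sup>2 / 2 * g c)) \<le> e * g c"
      if "e > 0" for e by (rule expectation_iexp_approx[OF sv mean0 that])
    show "AE \<omega> in M. (\<lambda>m. \<Prod>k = - int m..int m. iexp (t * (b_coeff a n k / D n * \<xi> k \<omega>))) \<longlonglongrightarrow> iexp (t * (S n \<omega> / D n))" for n
      using Slim[of n]
    proof eventually_elim
      case (elim \<omega>)
      have "(\<lambda>m. iexp (t * (\<Sum>k = - int m..int m. b_coeff a n k / D n * \<xi> k \<omega>))) \<longlonglongrightarrow> iexp (t * (S n \<omega> / D n))"
        by (intro tendsto_exp tendsto_mult tendsto_of_real tendsto_const elim)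
      moreover have "iexp (t * (\<Sum>k = - int m..int m. b_coeff a n k / D n * \<xi> k \<omega>)) = (\<Prod>k = - int m..int m. iexp (t * (b_coeff a n k / D n * \<xi> k \<omega>)))" for m
        by (simp add: exp_sum[symmetric] sum_distrib_left)
      ultimately show ?case by simp
    qed
  qed auto
  then show "converges_to_std_normal M (\<lambda>n \<omega>. S_proc \<xi> a n \<omega> / real_of_ereal (D_norm H a n))"
    by (subst std_normal_iff_char) (auto simp: prob_space_axioms D S_def)
  define W where "W n \<omega> = (V n \<omega> / D n)\<^sup>2" for n \<omega>
  have [measurable]: "W n \<in> borel_measurable M" for n unfolding W_def by measurable
  have Wlim: "AE \<omega> in M. (\<lambda>m. \<Sum>k = - int m..int m. (b_coeff a n k / D n * \<xi> k \<omega>)\<^sup>2) \<longlonglongrightarrow> W n \<omega>" for n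
    using AEs[of n]
  proof eventually_elim
    case (elim \<omega>)
    have "(\<lambda>m. (\<Sum>k = - int m..int m. (b_coeff a n k)\<^sup>2 * (\<xi> k \<omega>)\<^sup>2) / (D n)\<^sup>2) \<longlonglongrightarrow> (\<Sum>\<^sub>\<infinity>k. (b_coeff a n k)\<^sup>2 * (\<xi> k \<omega>)\<^sup>2) / (D n)\<^sup>2"
      using D(2)[of n] by (intro tendsto_divide infsum_window elim tendsto_const) auto
    moreover have "(\<Sum>\<^sub>\<infinity>k. (b_coeff a n k)\<^sup>2 * (\<xi> k \<omega>)\<^sup>2) / (D n)\<^sup>2 = W n \<omega>"
      by (simp add: W_def V_def V_norm_def power_divide infsum_nonneg)
    ultimately show ?case by (simp add: sum_divide_distrib power_mult_distrib power_divide)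
  qed
  have limW: "(\<lambda>n. expectation (\<lambda>\<omega>. complex_of_real (exp (- l * W n \<omega>)))) \<longlonglongrightarrow> complex_of_real (exp (- l))" if l: "l > 0" for l
  proof (rule array_limit[where \<psi> = "\<lambda>u. complex_of_real (exp (- l * u\<^sup>2))" and c = "\<lambda>n k. b_coeff a n k / D n", OF _ _ _ _ ones small])
    show "\<exists>c0>0. \<forall>c. \<bar>c\<bar> \<le> c0 \<longrightarrow> cmod (expectation (\<lambda>\<omega>. complex_of_real (exp (- l * (c * \<xi> 0 \<omega>)\<^sup>2))) - 1 + complex_of_real (l * g c)) \<le> e * g c"
      if "e > 0" for e by (rule expectation_laplace_approx[OF sv l that])
    show "AE \<omega> in M. (\<lambda>m. \<Prod>k = - int m..int m. complex_of_real (exp (- l * (b_coeff a n k / D n * \<xi> k \<omega>)\<^sup>2))) \<longlonglongrightarrow> complex_of_real (exp (- l * W n \<omega>))" for n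
      using Wlim[of n]
    proof eventually_elim
      case (elim \<omega>)
      have "(\<lambda>m. complex_of_real (exp (- l * (\<Sum>k = - int m..int m. (b_coeff a n k / D n * \<xi> k \<omega>)\<^sup>2)))) \<longlonglongrightarrow> complex_of_real (exp (- l * W n \<omega>))"
        by (intro tendsto_exp tendsto_mult tendsto_of_real tendsto_const elim)
      moreover have "complex_of_real (exp (- l * (\<Sum>k = - int m..int m. (b_coeff a n k / D n * \<xi> k \<omega>)\<^sup>2)))
          = (\<Prod>k = - int m..int m. complex_of_real (exp (- l * (b_coeff a n k / D n * \<xi> k \<omega>)\<^sup>2)))" for m
        unfolding sum_distrib_left exp_sum[OF finite_atLeastAtMost_int] of_real_prod ..
      ultimately show ?case by simp
    qed
  qed (use l in auto)
  have limWr: "(\<lambda>n. expectation (\<lambda>\<omega>. exp (- l * W n \<omega>))) \<longlonglongrightarrow> exp (- l)" if l: "l > 0" for l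
    using tendsto_Re[OF limW[OF l]] by (simp add: integral_complex_of_real)
  have W0: "W n \<omega> \<ge> 0" for n \<omega> by (simp add: W_def)
  have intW: "integrable M (\<lambda>\<omega>. exp (- l * W n \<omega>))" if "l > 0" for l n
    using that W0 by (intro integrable_const_bound[where B = 1]) auto
  \<comment> \<open>The Laplace transforms at l = 1 and l = 2 are the first two moments of exp (- W
    n), whence convergence to exp (- 1) in mean square.\<close>
  have limL2: "(\<lambda>n. expectation (\<lambda>\<omega>. (exp (- W n \<omega>) - exp (- 1))\<^sup>2)) \<longlonglongrightarrow> 0"
  proof -
    have eq: "expectation (\<lambda>\<omega>. (exp (- W n \<omega>) - exp (- 1))\<^sup>2)
        = expectation (\<lambda>\<omega>. exp (- 2 * W n \<omega>)) - 2 * exp (- 1) * expectation (\<lambda>\<omega>. exp (- 1 * W n \<omega>)) + exp (- 2)" for n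
    proof -
      have "(exp (- W n \<omega>) - exp (- 1))\<^sup>2 = exp (- 2 * W n \<omega>) - 2 * exp (- 1) * exp (- 1 * W n \<omega>) + exp (- 2 :: real)" for \<omega>
      proof -
        have "(exp (- W n \<omega>))\<^sup>2 = exp (- 2 * W n \<omega>)" "(exp (- 1 :: real))\<^sup>2 = exp (- 2)"
          by (auto simp: power2_eq_square exp_add[symmetric])
        then show ?thesis by (simp add: power2_diff)
      qed
      then show ?thesis using intW[of 2 n] intW[of 1 n] by (simp add: prob_space)
    qed
    have "(\<lambda>n. expectation (\<lambda>\<omega>. exp (- 2 * W n \<omega>)) - 2 * exp (- 1) * expectation (\<lambda>\<omega>. exp (- 1 * W n \<omega>)) + exp (- 2))
       \<longlonglongrightarrow> exp (- 2) - 2 * exp (- 1) * exp (- 1) + exp (- 2)"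
      by (intro tendsto_intros limWr) auto
    moreover have "exp (- 2) - 2 * exp (- 1) * exp (- 1) + exp (- 2) = (0::real)"
      by (simp add: mult.assoc exp_add[symmetric])
    ultimately show ?thesis unfolding eq by simp
  qed
  \<comment> \<open>The mean bound for sums of independent variables when the \<open>Q\<close> of
    the weights add up to at most K, which holds since \<open>Q\<close> \<le> K \<open>g\<close> and
    the \<open>g\<close> sum to 1.\<close>
  define L where "L = sqrt K + 2 * K"
  have L: "L \<ge> 0" using K by (simp add: L_def)
  have tight: "\<forall>\<^sub>F n in sequentially. integrable M (\<lambda>\<omega>. S n \<omega> / D n) \<and> expectation (\<lambda>\<omega>. \<bar>S n \<omega> / D n\<bar>) \<le> L"
    using one
  proof eventually_elim
    case (elim n)
    have bd: "expectation (\<lambda>\<omega>. \<bar>\<Sum>k = - int m..int m. b_coeff a n k / D n * \<xi> k \<omega>\<bar>) \<le> L" for m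
    proof -
      have "(\<Sum>k = - int m..int m. Q (b_coeff a n k / D n)) \<le> (\<Sum>k = - int m..int m. K * g (b_coeff a n k / D n))"
        by (intro sum_mono K)
      also have "\<dots> = K * (\<Sum>k = - int m..int m. g (b_coeff a n k / D n))" by (simp add: sum_distrib_left)
      also have "\<dots> \<le> K * 1"
        unfolding elim[symmetric] using K sg g_nonneg by (intro mult_left_mono sum_le_infsum) auto
      finally have r: "(\<Sum>k = - int m..int m. Q (b_coeff a n k / D n)) \<le> K" by simp
      have "expectation (\<lambda>\<omega>. \<bar>\<Sum>k = - int m..int m. b_coeff a n k / D n * \<xi> k \<omega>\<bar>)
         \<le> sqrt (\<Sum>k = - int m..int m. Q (b_coeff a n k / D n)) + 2 * (\<Sum>k = - int m..int m. Q (b_coeff a n k / D n))"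
        by (rule expectation_abs_linear_le) simp
      also have "\<dots> \<le> L" unfolding L_def using r by (intro add_mono real_sqrt_le_mono mult_left_mono) auto
      finally show ?thesis .
    qed
    have int: "integrable M (\<lambda>\<omega>. \<Sum>k = - int m..int m. b_coeff a n k / D n * \<xi> k \<omega>)" for m
      using xi_integrable by auto
    show ?case using expectation_abs_limit_le[OF int _ Slim bd] by simp
  qed
  have diff: "(\<lambda>n. expectation (\<lambda>\<omega>. iexp (t * (S n \<omega> / V n \<omega>))) - expectation (\<lambda>\<omega>. iexp (t * (S n \<omega> / D n)))) \<longlonglongrightarrow> 0" for t
  proof (rule tendstoI)
    fix e :: real assume e: "e > 0"
    \<comment> \<open>Recovers D n / V n from exp (- W n). On paths with V n = 0 the conventions for
      division by zero make both sides of \<open>SV\<close> zero.\<close>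
    define h where "h y = 1 / sqrt (- ln y)" for y :: real
    define e1 where "e1 = e / (2 * (\<bar>t\<bar> * L + 1))"
    have e1: "e1 > 0" "\<bar>t\<bar> * e1 * L < e / 2 + e / 4"
    proof -
      have p: "\<bar>t\<bar> * L + 1 > 0" using L by (intro add_nonneg_pos) auto
      show "e1 > 0" using e p by (simp add: e1_def)
      have "e / (2 * x) * x = e / 2" if "x > 0" for x :: real using that by simp
      from this[OF p] have "e1 * (\<bar>t\<bar> * L + 1) = e / 2" unfolding e1_def .
      then have "\<bar>t\<bar> * e1 * L = e / 2 - e1" by (simp add: algebra_simps)
      then show "\<bar>t\<bar> * e1 * L < e / 2 + e / 4" using \<open>e1 > 0\<close> e by simp
    qed
    have "isCont h (exp (- 1))" unfolding h_def by (intro continuous_intros) auto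
    moreover have h1: "h (exp (- 1)) = 1" by (simp add: h_def)
    ultimately have "(h \<longlongrightarrow> 1) (at (exp (- 1)))" by (simp add: isCont_def)
    then obtain d where d: "d > 0" "\<And>y. y \<noteq> exp (- 1) \<Longrightarrow> dist y (exp (- 1)) < d \<Longrightarrow> dist (h y) 1 < e1"
      using e1 unfolding tendsto_iff eventually_at by auto
    then have d': "\<bar>h y - 1\<bar> \<le> e1" if "\<bar>y - exp (- 1)\<bar> < d" for y
      using that h1 e1 by (cases "y = exp (- 1)") (auto simp: dist_real_def less_imp_le)
    have SV: "S n \<omega> / V n \<omega> = S n \<omega> / D n * h (exp (- W n \<omega>))" for n \<omega>
    proof -
      have "V n \<omega> \<ge> 0" by (simp add: V_def V_norm_def infsum_nonneg)
      then have "h (exp (- W n \<omega>)) = D n / V n \<omega>" using D(2)[of n] by (simp add: h_def W_def)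
      then show ?thesis using D(2)[of n] by simp
    qed
    \<comment> \<open>Where exp (- W n) is d-close to exp (- 1), the Lipschitz bound applies with h
      within e1 of 1; elsewhere the trivial bound 2 is dominated by a multiple of the squared
      deviation, as in Chebyshev's inequality.\<close>
    have pt: "norm (iexp (t * (S n \<omega> / V n \<omega>)) - iexp (t * (S n \<omega> / D n)))
       \<le> \<bar>t\<bar> * e1 * \<bar>S n \<omega> / D n\<bar> + 2 / d\<^sup>2 * (exp (- W n \<omega>) - exp (- 1))\<^sup>2" for n \<omega>
    proof (cases "\<bar>exp (- W n \<omega>) - exp (- 1)\<bar> < d")
      case True
      have lip: "norm (iexp x - iexp y) \<le> \<bar>x - y\<bar>" for x y
      proof -
        have "iexp x - iexp y = iexp y * (iexp (x - y) - 1)"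
          by (simp add: algebra_simps exp_add[symmetric])
        then have "norm (iexp x - iexp y) = norm (iexp (x - y) - 1)" by (simp add: norm_mult)
        also have "\<dots> \<le> \<bar>x - y\<bar>" using iexp_approx1[of "x - y" 0] by simp
        finally show ?thesis .
      qed
      have "norm (iexp (t * (S n \<omega> / V n \<omega>)) - iexp (t * (S n \<omega> / D n))) \<le> \<bar>t * (S n \<omega> / V n \<omega>) - t * (S n \<omega> / D n)\<bar>"
        by (rule lip)
      also have "\<dots> = \<bar>t\<bar> * \<bar>S n \<omega> / D n\<bar> * \<bar>h (exp (- W n \<omega>)) - 1\<bar>"
        unfolding SV abs_mult[symmetric] by (simp only: right_diff_distrib mult.assoc mult_1_right)
      also have "\<dots> \<le> \<bar>t\<bar> * \<bar>S n \<omega> / D n\<bar> * e1" by (intro mult_left_mono d'[OF True]) auto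
      also have "\<dots> = \<bar>t\<bar> * e1 * \<bar>S n \<omega> / D n\<bar>" by (simp only: mult.assoc mult.commute mult.left_commute)
      finally show ?thesis by (smt (verit) zero_le_power2 divide_nonneg_nonneg mult_nonneg_nonneg)
    next
      case False
      then have "d\<^sup>2 \<le> (exp (- W n \<omega>) - exp (- 1))\<^sup>2"
        using d(1) by (metis abs_of_pos abs_le_square_iff not_less)
      then have "2 / d\<^sup>2 * d\<^sup>2 \<le> 2 / d\<^sup>2 * (exp (- W n \<omega>) - exp (- 1))\<^sup>2" by (intro mult_left_mono) auto
      then have "2 \<le> 2 / d\<^sup>2 * (exp (- W n \<omega>) - exp (- 1))\<^sup>2" using d(1) by simp
      moreover have "norm (iexp (t * (S n \<omega> / V n \<omega>)) - iexp (t * (S n \<omega> / D n))) \<le> 1 + 1"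
        by (rule order_trans[OF norm_triangle_ineq4]) simp
      moreover have "0 \<le> \<bar>t\<bar> * e1 * \<bar>S n \<omega> / D n\<bar>" using e1 by simp
      ultimately show ?thesis by linarith
    qed
    have "(\<lambda>n. 2 / d\<^sup>2 * expectation (\<lambda>\<omega>. (exp (- W n \<omega>) - exp (- 1))\<^sup>2)) \<longlonglongrightarrow> 2 / d\<^sup>2 * 0"
      by (intro tendsto_mult tendsto_const limL2)
    then have "\<forall>\<^sub>F n in sequentially. 2 / d\<^sup>2 * expectation (\<lambda>\<omega>. (exp (- W n \<omega>) - exp (- 1))\<^sup>2) < e / 4"
      using e by (intro order_tendstoD(2)) auto
    with tight show "\<forall>\<^sub>F n in sequentially. dist (expectation (\<lambda>\<omega>. iexp (t * (S n \<omega> / V n \<omega>))) - expectation (\<lambda>\<omega>. iexp (t * (S n \<omega> / D n)))) 0 < e"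
    proof eventually_elim
      case (elim n)
      have i1: "integrable M (\<lambda>\<omega>. iexp (t * (S n \<omega> / V n \<omega>)))" "integrable M (\<lambda>\<omega>. iexp (t * (S n \<omega> / D n)))"
        by (auto intro!: integrable_const_bound[where B = 1])
      have i2: "integrable M (\<lambda>\<omega>. (exp (- W n \<omega>) - exp (- 1))\<^sup>2)"
      proof (intro integrable_const_bound[where B = 1] AE_I2)
        fix \<omega>
        have "exp (- W n \<omega>) \<le> 1" "exp (- W n \<omega>) \<ge> 0" "exp (- 1 :: real) \<le> 1" "exp (- 1 :: real) \<ge> 0" using W0[of n \<omega>] by auto
        then have "\<bar>exp (- W n \<omega>) - exp (- 1)\<bar> \<le> 1" by linarith
        then show "norm ((exp (- W n \<omega>) - exp (- 1))\<^sup>2) \<le> 1" by (simp add: abs_square_le_1)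
      qed simp
      have "norm (expectation (\<lambda>\<omega>. iexp (t * (S n \<omega> / V n \<omega>))) - expectation (\<lambda>\<omega>. iexp (t * (S n \<omega> / D n))))
         = norm (expectation (\<lambda>\<omega>. iexp (t * (S n \<omega> / V n \<omega>)) - iexp (t * (S n \<omega> / D n))))"
        using i1 by simp
      also have "\<dots> \<le> expectation (\<lambda>\<omega>. norm (iexp (t * (S n \<omega> / V n \<omega>)) - iexp (t * (S n \<omega> / D n))))"
        by (rule integral_norm_bound)
      also have "\<dots> \<le> expectation (\<lambda>\<omega>. \<bar>t\<bar> * e1 * \<bar>S n \<omega> / D n\<bar> + 2 / d\<^sup>2 * (exp (- W n \<omega>) - exp (- 1))\<^sup>2)"
        using i1 i2 elim pt by (intro integral_mono) (auto simp del: abs_divide)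
      also have "\<dots> = \<bar>t\<bar> * e1 * expectation (\<lambda>\<omega>. \<bar>S n \<omega> / D n\<bar>) + 2 / d\<^sup>2 * expectation (\<lambda>\<omega>. (exp (- W n \<omega>) - exp (- 1))\<^sup>2)"
        using i2 elim by (simp del: abs_divide)
      also have "\<dots> < e"
      proof -
        have "\<bar>t\<bar> * e1 * expectation (\<lambda>\<omega>. \<bar>S n \<omega> / D n\<bar>) \<le> \<bar>t\<bar> * e1 * L"
          using elim e1 by (intro mult_left_mono) auto
        then show ?thesis using elim e1(2) by linarith
      qed
      finally show ?case by (simp only: dist_norm diff_zero)
    qed
  qed
  have "(\<lambda>n. expectation (\<lambda>\<omega>. iexp (t * (S n \<omega> / V n \<omega>)))) \<longlonglongrightarrow> complex_of_real (exp (- (t\<^sup>2 / 2)))" for t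
    using tendsto_add[OF diff[of t] limS[of t]] by simp
  then show "converges_to_std_normal M (\<lambda>n \<omega>. S_proc \<xi> a n \<omega> / V_norm \<xi> a n \<omega>)"
    by (subst std_normal_iff_char) (auto simp: prob_space_axioms S_def V_def)
qed

end

subsection \<open>The converse for deterministic normalization\<close>

text \<open>Taking logarithms, - n ln (x n) tends to c, which forces x n to tend to 1; then x (- ln
  x) \<le> 1 - x \<le> - ln x sandwiches the claim.\<close>

lemma tendsto_n_one_minus:
  fixes x :: "nat \<Rightarrow> real"
  assumes x: "\<And>n. 0 \<le> x n" "\<And>n. x n \<le> 1" and lim: "(\<lambda>n. x n ^ n) \<longlonglongrightarrow> exp (- c)"
  shows "(\<lambda>n. real n * (1 - x n)) \<longlonglongrightarrow> c"
proof -
  have ev: "\<forall>\<^sub>F n in sequentially. x n ^ n > 0" using lim by (rule order_tendstoD) simp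
  then have pos: "\<forall>\<^sub>F n in sequentially. x n > 0"
    using eventually_gt_at_top[of 0]
  proof eventually_elim
    case (elim n)
    then have "x n \<noteq> 0" by (intro notI) (simp add: power_0_left)
    then show ?case using x(1)[of n] by simp
  qed
  define l where "l n = - (real n * ln (x n))" for n
  have "(\<lambda>n. - ln (x n ^ n)) \<longlonglongrightarrow> - ln (exp (- c))" by (intro tendsto_intros lim) auto
  moreover have "\<forall>\<^sub>F n in sequentially. - ln (x n ^ n) = l n"
    using pos by eventually_elim (simp add: l_def ln_realpow)
  ultimately have l: "l \<longlonglongrightarrow> c" using Lim_transform_eventually by fastforce
  have "(\<lambda>n. exp (- (l n * inverse (real n)))) \<longlonglongrightarrow> exp (- (c * 0))"
    by (intro tendsto_intros l lim_inverse_n)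
  moreover have "\<forall>\<^sub>F n in sequentially. exp (- (l n * inverse (real n))) = x n"
    using pos eventually_gt_at_top[of 0] by eventually_elim (simp add: l_def field_simps)
  ultimately have x1: "x \<longlonglongrightarrow> 1" using Lim_transform_eventually by fastforce
  show ?thesis
  proof (rule real_tendsto_sandwich)
    show "\<forall>\<^sub>F n in sequentially. x n * l n \<le> real n * (1 - x n)" using pos
    proof eventually_elim
      case (elim n)
      have "ln (inverse (x n)) \<le> inverse (x n) - 1" using elim by (intro ln_le_minus_one) auto
      then have "x n * (- ln (x n)) \<le> x n * (inverse (x n) - 1)"
        using elim by (intro mult_left_mono) (auto simp: ln_inverse)
      also have "\<dots> = 1 - x n" using elim by (simp add: algebra_simps)
      finally have "real n * (x n * (- ln (x n))) \<le> real n * (1 - x n)" by (intro mult_left_mono) auto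
      then show ?case by (simp add: l_def algebra_simps)
    qed
    show "\<forall>\<^sub>F n in sequentially. real n * (1 - x n) \<le> l n" using pos
    proof eventually_elim
      case (elim n)
      have "1 - x n \<le> - ln (x n)" using ln_le_minus_one[of "x n"] elim by simp
      then have "real n * (1 - x n) \<le> real n * (- ln (x n))" by (intro mult_left_mono) auto
      then show ?case by (simp add: l_def)
    qed
    show "(\<lambda>n. x n * l n) \<longlonglongrightarrow> c" using tendsto_mult[OF x1 l] by simp
  qed (rule l)
qed

text \<open>n x^n is at most the geometric sum of the x^i, i < n, and (1 - x) times that sum is 1 -
  x^n. It yields a dominating constant when integrating over the frequency.\<close>

lemma power_mult_n_one_minus_le:
  fixes x :: real
  assumes "0 \<le> x" "x \<le> 1" shows "x ^ n * (real n * (1 - x)) \<le> 1"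
proof -
  have "x ^ n * real n = (\<Sum>i<n. x ^ n)" by simp
  also have "\<dots> \<le> (\<Sum>i<n. x ^ i)" using assms by (intro sum_mono power_decreasing) auto
  finally have "(x ^ n * real n) * (1 - x) \<le> (\<Sum>i<n. x ^ i) * (1 - x)" using assms by (intro mult_right_mono) auto
  also have "\<dots> = 1 - x ^ n" by (simp add: one_diff_power_eq mult.commute)
  also have "\<dots> \<le> 1" using assms by simp
  finally show ?thesis by (simp add: mult.assoc)
qed

lemma integral_cos_std_normal: "integral\<^sup>L std_normal_distribution (\<lambda>t. cos (t * y)) = exp (- y\<^sup>2 / 2)"
proof -
  interpret real_distribution std_normal_distribution by (rule real_dist_normal_dist)
  have int: "integrable std_normal_distribution (\<lambda>t. iexp (y * t))"
    by (rule integrable_const_bound[where B = 1]) auto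
  have "complex_of_real (exp (- y\<^sup>2 / 2)) = integral\<^sup>L std_normal_distribution (\<lambda>t. iexp (y * t))"
    using char_std_normal_distribution by (simp add: char_def fun_eq_iff)
  then have "Re (complex_of_real (exp (- y\<^sup>2 / 2))) = integral\<^sup>L std_normal_distribution (\<lambda>t. Re (iexp (y * t)))"
    using integral_Re[OF int] by simp
  then show ?thesis by (simp add: Re_exp mult.commute)
qed

lemma one_minus_cos_squared: "(1 - cos x)\<^sup>2 = 2 * (1 - cos x) - (1 - cos (2 * x)) / 2" for x :: real
  using cos_double_cos[of x] by (simp add: power2_diff field_simps)

text \<open>The integral is 3/2 - 2 exp (- (y/4)^2/2) + exp (- (y/2)^2/2)/2. At |y| = 12 the first
  exponential is exp (- 9/2), which is at most 1/4; this is where 12 comes from.\<close>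

lemma integral_one_minus_cos_squared_ge:
  assumes "\<bar>y\<bar> \<ge> 12"
  shows "integral\<^sup>L std_normal_distribution (\<lambda>t. (1 - cos (t / 4 * y))\<^sup>2) \<ge> 1"
proof -
  interpret real_distribution std_normal_distribution by (rule real_dist_normal_dist)
  have i: "integrable std_normal_distribution (\<lambda>t. cos (t * z))" for z
    by (rule integrable_const_bound[where B = 1]) auto
  have eq_t: "(1 - cos (t / 4 * y))\<^sup>2 = 3 / 2 - 2 * cos (t * (y / 4)) + cos (t * (y / 2)) / 2" for t
    unfolding one_minus_cos_squared by (simp add: field_simps)
  have eq: "integral\<^sup>L std_normal_distribution (\<lambda>t. (1 - cos (t / 4 * y))\<^sup>2)
     = 3 / 2 - 2 * exp (- (y / 4)\<^sup>2 / 2) + exp (- (y / 2)\<^sup>2 / 2) / 2"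
    unfolding eq_t
    using i[of "y / 4"] i[of "y / 2"] integral_cos_std_normal[of "y / 4"] integral_cos_std_normal[of "y / 2"]
      prob_space
    by (simp del: times_divide_eq_right times_divide_eq_left)
  have "12\<^sup>2 \<le> y\<^sup>2" using assms abs_le_square_iff[of 12 y] by simp
  then have "exp (- (y / 4)\<^sup>2 / 2) \<le> exp (- 9 / 2)" by (simp add: power_divide)
  also have "exp (- 9 / 2) \<le> (1 / 4 :: real)"
  proof -
    have "(4::real) \<le> exp (9 / 2)" using exp_ge_add_one_self[of "9/2 :: real"] by simp
    then have "inverse (exp (9 / 2)) \<le> inverse (4::real)" by (intro le_imp_inverse_le) auto
    then show ?thesis by (simp add: exp_minus)
  qed
  finally have "exp (- (y / 4)\<^sup>2 / 2) \<le> 1 / 4" .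
  then show ?thesis unfolding eq using exp_gt_zero[of "- (y / 2)\<^sup>2 / 2"] by linarith
qed

lemma second_moment_std_normal:
  "integrable std_normal_distribution (\<lambda>x. x\<^sup>2)" "integral\<^sup>L std_normal_distribution (\<lambda>x. x\<^sup>2) = 1"
  using integrable_std_normal_distribution_moment[of 2] std_normal_distribution_even_moments(1)[of 1]
  by (auto simp: fact_numeral)

text \<open>Makes \<open>S_proc\<close> the ordinary partial sum of \<xi>(-1), ...,
  \<xi>(-n).\<close>

definition unit_seq :: "int \<Rightarrow> real" where
  "unit_seq j = (if j = 0 then 1 else 0)"

lemma b_coeff_unit_seq: "b_coeff unit_seq n j = (if j \<in> {- int n..- 1} then 1 else 0)"
proof -
  have "b_coeff unit_seq n j = (\<Sum>i = 1..n. if i = nat (- j) \<and> j < 0 then 1 else 0)"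
    unfolding b_coeff_def unit_seq_def by (intro sum.cong) auto
  also have "\<dots> = (if j \<in> {- int n..- 1} then 1 else 0)"
    by (cases "j < 0") (auto simp: nat_le_iff)
  finally show ?thesis .
qed

context iid_seq
begin

lemma bilateral_sums_unit_seq:
  assumes "k \<ge> 1" shows "bilateral_sums (\<lambda>j. unit_seq (int k + j) * \<xi> j \<omega>) (\<xi> (- int k) \<omega>)"
proof -
  have z: "(\<Sum>j<N. unit_seq (int k + int j) * \<xi> (int j) \<omega>) = 0" for N
    using assms by (intro sum.neutral) (auto simp: unit_seq_def)
  have "(\<Sum>j<N. unit_seq (int k + (- 1 - int j)) * \<xi> (- 1 - int j) \<omega>) = \<xi> (- int k) \<omega>" if "N \<ge> k" for N
  proof -
    have "(\<Sum>j<N. unit_seq (int k + (- 1 - int j)) * \<xi> (- 1 - int j) \<omega>) = (\<Sum>j<N. if j = k - 1 then \<xi> (- int k) \<omega> else 0)"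
      using assms by (intro sum.cong) (auto simp: unit_seq_def of_nat_diff)
    also have "\<dots> = \<xi> (- int k) \<omega>" using that assms by simp
    finally show ?thesis .
  qed
  then have "(\<lambda>N. \<Sum>j<N. unit_seq (int k + (- 1 - int j)) * \<xi> (- 1 - int j) \<omega>) \<longlonglongrightarrow> \<xi> (- int k) \<omega>"
    by (intro tendsto_eventually) (auto simp: eventually_sequentially)
  then show ?thesis unfolding bilateral_sums_iff z by auto
qed

lemma S_proc_unit_seq: "S_proc \<xi> unit_seq n \<omega> = (\<Sum>k = 1..n. \<xi> (- int k) \<omega>)"
  unfolding S_proc_def X_proc_def using bilateral_sum_eqI[OF bilateral_sums_unit_seq] by (intro sum.cong) auto

lemma infsum_b_unit_seq:
  "(\<lambda>k. if k \<in> {- int n..- 1} then c else 0) summable_on UNIV"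
  "(\<Sum>\<^sub>\<infinity>k. if k \<in> {- int n..- 1} then c else 0) = real n * c"
proof -
  have eq: "(\<lambda>k. if k \<in> {- int n..- 1} then c else 0) summable_on UNIV \<longleftrightarrow> (\<lambda>k. c) summable_on {- int n..- 1}"
    by (rule summable_on_cong_neutral) auto
  show "(\<lambda>k. if k \<in> {- int n..- 1} then c else 0) summable_on UNIV" unfolding eq by (rule summable_on_finite) simp
  have "(\<Sum>\<^sub>\<infinity>k. if k \<in> {- int n..- 1} then c else 0) = (\<Sum>\<^sub>\<infinity>k\<in>{- int n..- 1}. c)"
    by (rule infsum_cong_neutral) auto
  then show "(\<Sum>\<^sub>\<infinity>k. if k \<in> {- int n..- 1} then c else 0) = real n * c" by simp
qed

lemma admissible_unit_seq: "admissible H unit_seq"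
  unfolding admissible_def
proof
  have "(\<lambda>j. if unit_seq j = 0 then 0 else (unit_seq j)\<^sup>2 * H (inverse \<bar>unit_seq j\<bar>)) summable_on UNIV
      \<longleftrightarrow> (\<lambda>j. H 1) summable_on {0::int}"
    by (rule summable_on_cong_neutral) (auto simp: unit_seq_def)
  then show "(\<lambda>j. if unit_seq j = 0 then 0 else (unit_seq j)\<^sup>2 * H (inverse \<bar>unit_seq j\<bar>)) summable_on UNIV"
    by (simp add: summable_on_finite)
  have "(b_coeff unit_seq n k)\<^sup>2 = (if k \<in> {- int n..- 1} then 1 else 0)" for n k
    unfolding b_coeff_unit_seq by auto
  then have "(\<Sum>\<^sub>\<infinity>k. (b_coeff unit_seq n k)\<^sup>2) = real n" for n
    by (simp only: infsum_b_unit_seq(2) mult_1_right)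
  then show "filterlim (\<lambda>n. \<Sum>\<^sub>\<infinity>k. (b_coeff unit_seq n k)\<^sup>2) at_top sequentially"
    by (simp add: filterlim_real_sequentially)
qed

text \<open>For this sequence the defining series has n equal terms \<open>H s\<close> /
  s^2.\<close>

lemma D_norm_unit_seq_le:
  assumes "s \<ge> 1" "real n * H s \<le> s\<^sup>2"
  shows "D_norm H unit_seq n \<le> ereal s"
proof -
  let ?t = "\<lambda>k. if b_coeff unit_seq n k = 0 then 0 else (b_coeff unit_seq n k)\<^sup>2 / s\<^sup>2 * H (s / \<bar>b_coeff unit_seq n k\<bar>)"
  have eq: "?t = (\<lambda>k. if k \<in> {- int n..- 1} then H s / s\<^sup>2 else 0)"
    unfolding b_coeff_unit_seq by auto
  have "real n * (H s / s\<^sup>2) \<le> 1" using assms by (simp add: field_simps)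
  then have "?t summable_on UNIV \<and> (\<Sum>\<^sub>\<infinity>k. ?t k) \<le> 1"
    unfolding eq using infsum_b_unit_seq[of n "H s / s\<^sup>2"] by simp
  then show ?thesis unfolding D_norm_def Let_def using assms(1) by (intro Inf_lower) auto
qed

text \<open>By independence the characteristic function of a difference of two copies is the squared
  modulus; in particular the left side is nonnegative.\<close>

lemma expectation_cos_diff:
  assumes "j \<noteq> k"
  shows "expectation (\<lambda>\<omega>. cos (t * (\<xi> j \<omega> - \<xi> k \<omega>))) = (norm (expectation (\<lambda>\<omega>. iexp (t * \<xi> 0 \<omega>))))\<^sup>2"
proof -
  have i: "integrable M (\<lambda>\<omega>. cos (t * \<xi> k \<omega>))" "integrable M (\<lambda>\<omega>. sin (t * \<xi> k \<omega>))" for k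
    by (auto intro!: integrable_const_bound[where B = 1])
  have iv: "indep_var borel (\<lambda>\<omega>. f (\<xi> j \<omega>)) borel (\<lambda>\<omega>. f (\<xi> k \<omega>))" if [measurable]: "f \<in> borel_measurable borel" for f :: "real \<Rightarrow> real"
  proof -
    have "indep_var borel (\<lambda>\<omega>. (\<lambda>x. f (x j)) (restrict (\<lambda>i. \<xi> i \<omega>) {j})) borel (\<lambda>\<omega>. (\<lambda>x. f (x k)) (restrict (\<lambda>i. \<xi> i \<omega>) {k}))"
      using assms by (intro indep_var_blocks[OF indep]) auto
    then show ?thesis by simp
  qed
  have C: "expectation (\<lambda>\<omega>. cos (t * \<xi> j \<omega>) * cos (t * \<xi> k \<omega>)) = (expectation (\<lambda>\<omega>. cos (t * \<xi> 0 \<omega>)))\<^sup>2"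
    using indep_var_lebesgue_integral[OF iv[of "\<lambda>x. cos (t * x)"] i(1) i(1)]
      expectation_ident[of "\<lambda>x. cos (t * x)" j] expectation_ident[of "\<lambda>x. cos (t * x)" k] by (simp add: power2_eq_square)
  have S: "expectation (\<lambda>\<omega>. sin (t * \<xi> j \<omega>) * sin (t * \<xi> k \<omega>)) = (expectation (\<lambda>\<omega>. sin (t * \<xi> 0 \<omega>)))\<^sup>2"
    using indep_var_lebesgue_integral[OF iv[of "\<lambda>x. sin (t * x)"] i(2) i(2)]
      expectation_ident[of "\<lambda>x. sin (t * x)" j] expectation_ident[of "\<lambda>x. sin (t * x)" k] by (simp add: power2_eq_square)
  have ip: "integrable M (\<lambda>\<omega>. cos (t * \<xi> j \<omega>) * cos (t * \<xi> k \<omega>))" "integrable M (\<lambda>\<omega>. sin (t * \<xi> j \<omega>) * sin (t * \<xi> k \<omega>))"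
    by (auto intro!: integrable_const_bound[where B = 1] simp: abs_mult mult_le_one)
  have int: "integrable M (\<lambda>\<omega>. iexp (t * \<xi> 0 \<omega>))" by (rule integrable_const_bound[where B = 1]) auto
  have "expectation (\<lambda>\<omega>. cos (t * (\<xi> j \<omega> - \<xi> k \<omega>))) = (expectation (\<lambda>\<omega>. cos (t * \<xi> 0 \<omega>)))\<^sup>2 + (expectation (\<lambda>\<omega>. sin (t * \<xi> 0 \<omega>)))\<^sup>2"
    unfolding C[symmetric] S[symmetric] right_diff_distrib cos_diff using ip by simp
  also have "expectation (\<lambda>\<omega>. cos (t * \<xi> 0 \<omega>)) = Re (expectation (\<lambda>\<omega>. iexp (t * \<xi> 0 \<omega>)))"
    using integral_Re[OF int] by (simp add: Re_exp)
  also have "expectation (\<lambda>\<omega>. sin (t * \<xi> 0 \<omega>)) = Im (expectation (\<lambda>\<omega>. iexp (t * \<xi> 0 \<omega>)))"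
    using integral_Im[OF int] by (simp add: Im_exp)
  finally show ?thesis by (simp add: cmod_power2)
qed

text \<open>If sums of \<open>n\<close> terms normalized by \<open>D n\<close> are asymptotically normal, then \<open>n (1 - cos (t \<eta> / D n))\<close>
  has mean close to \<open>t\<^sup>2\<close> for the symmetrized variable \<open>\<eta>\<close>, and \<open>n (1 - cos (t \<eta> / D n))\<^sup>2\<close> has mean close to 0.
  Averaging over a Gaussian \<open>t\<close> excludes large values of \<open>\<eta> / D n\<close>.\<close>

lemma normal_limit_imp_tail:
  fixes D :: "nat \<Rightarrow> real"
  assumes D: "\<And>n. D n > 0"
    and lim: "\<And>t. (\<lambda>n. expectation (\<lambda>\<omega>. iexp (t * ((\<Sum>k = 1..n. \<xi> (- int k) \<omega>) / D n)))) \<longlonglongrightarrow> complex_of_real (exp (- t\<^sup>2 / 2))"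
  shows "(\<lambda>n. real n * prob {\<omega>\<in>space M. \<bar>\<xi> 0 \<omega> - \<xi> 1 \<omega>\<bar> \<ge> 12 * D n}) \<longlonglongrightarrow> 0"
proof -
  interpret N: real_distribution std_normal_distribution by (rule real_dist_normal_dist)
  interpret P: pair_prob_space std_normal_distribution M ..
  define \<eta> where "\<eta> \<omega> = \<xi> 0 \<omega> - \<xi> 1 \<omega>" for \<omega>
  have [measurable]: "\<eta> \<in> borel_measurable M" unfolding \<eta>_def by measurable
  define r where "r n t = expectation (\<lambda>\<omega>. cos (t * \<eta> \<omega> / D n))" for n t
  have r_eq: "r n t = (norm (expectation (\<lambda>\<omega>. iexp (t / D n * \<xi> 0 \<omega>))))\<^sup>2" for n t
    using expectation_cos_diff[of 0 1 "t / D n"] by (simp add: r_def \<eta>_def)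
  have icos: "integrable M (\<lambda>\<omega>. cos (t * \<eta> \<omega> / D n))" for t n
    by (rule integrable_const_bound[where B = 1]) auto
  have r0: "0 \<le> r n t" for n t unfolding r_eq by simp
  have r1: "r n t \<le> 1" for n t
  proof -
    have "r n t \<le> expectation (\<lambda>\<omega>. 1)" unfolding r_def using icos by (intro integral_mono) auto
    then show ?thesis by (simp add: prob_space)
  qed
  have rlim: "(\<lambda>n. r n t ^ n) \<longlonglongrightarrow> exp (- t\<^sup>2)" for t
  proof -
    have "expectation (\<lambda>\<omega>. iexp (t * ((\<Sum>k = 1..n. \<xi> (- int k) \<omega>) / D n))) = (expectation (\<lambda>\<omega>. iexp (t / D n * \<xi> 0 \<omega>))) ^ n" for n
    proof -
      have "expectation (\<lambda>\<omega>. iexp (t * ((\<Sum>k = 1..n. \<xi> (- int k) \<omega>) / D n)))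
         = expectation (\<lambda>\<omega>. \<Prod>k\<in>(\<lambda>k. - int k) ` {1..n}. iexp (t / D n * \<xi> k \<omega>))"
      proof (intro Bochner_Integration.integral_cong refl)
        fix \<omega>
        have "(\<Prod>k\<in>(\<lambda>k. - int k) ` {1..n}. iexp (t / D n * \<xi> k \<omega>)) = (\<Prod>k = 1..n. iexp (t / D n * \<xi> (- int k) \<omega>))"
          by (subst prod.reindex) (auto simp: inj_on_def)
        also have "\<dots> = iexp (\<Sum>k = 1..n. t / D n * \<xi> (- int k) \<omega>)"
          by (simp add: exp_sum[symmetric] sum_distrib_left)
        also have "(\<Sum>k = 1..n. t / D n * \<xi> (- int k) \<omega>) = t * ((\<Sum>k = 1..n. \<xi> (- int k) \<omega>) / D n)"
          by (simp add: sum_distrib_left sum_divide_distrib)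
        finally show "iexp (t * ((\<Sum>k = 1..n. \<xi> (- int k) \<omega>) / D n)) = (\<Prod>k\<in>(\<lambda>k. - int k) ` {1..n}. iexp (t / D n * \<xi> k \<omega>))" ..
      qed
      also have "\<dots> = (\<Prod>k\<in>(\<lambda>k. - int k) ` {1..n}. expectation (\<lambda>\<omega>. iexp (t / D n * \<xi> 0 \<omega>)))"
        by (rule expectation_prod[of "\<lambda>x. iexp x" _ "\<lambda>_. t / D n"]) auto
      also have "\<dots> = (expectation (\<lambda>\<omega>. iexp (t / D n * \<xi> 0 \<omega>))) ^ n"
        by (simp add: card_image inj_on_def)
      finally show ?thesis .
    qed
    then have "(\<lambda>n. (norm ((expectation (\<lambda>\<omega>. iexp (t / D n * \<xi> 0 \<omega>))) ^ n))\<^sup>2) \<longlonglongrightarrow> (norm (complex_of_real (exp (- t\<^sup>2 / 2))))\<^sup>2"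
      using lim[of t] by (intro tendsto_power tendsto_norm) simp
    moreover have "(norm (complex_of_real (exp (- t\<^sup>2 / 2))))\<^sup>2 = exp (- t\<^sup>2)"
      by (simp add: power2_eq_square exp_add[symmetric])
    ultimately show ?thesis by (simp add: r_eq norm_power power_mult[symmetric] mult.commute)
  qed
  have nr: "(\<lambda>n. real n * (1 - r n t)) \<longlonglongrightarrow> t\<^sup>2" for t
    by (rule tendsto_n_one_minus[OF r0 r1 rlim])
  define U where "U n t = expectation (\<lambda>\<omega>. (1 - cos (t * \<eta> \<omega> / D n))\<^sup>2)" for n t
  have U_eq: "U n t = 2 * (1 - r n t) - (1 - r n (2 * t)) / 2" for n t
  proof -
    have "(1 - cos (t * \<eta> \<omega> / D n))\<^sup>2 = 2 * (1 - cos (t * \<eta> \<omega> / D n)) - (1 - cos (2 * t * \<eta> \<omega> / D n)) / 2" for \<omega>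
      using one_minus_cos_squared[of "t * \<eta> \<omega> / D n"] by (simp add: mult.assoc)
    then show ?thesis unfolding U_def r_def using icos[of t n] icos[of "2 * t" n] by (simp add: prob_space)
  qed
  have U0: "0 \<le> U n t" for n t unfolding U_def by (intro Bochner_Integration.integral_nonneg) simp
  \<comment> \<open>By \<open>one_minus_cos_squared\<close> the limit is a combination of the limits
    at t and 2t, namely 2 t^2 - (2 t)^2/2 = 0.\<close>
  have nU: "(\<lambda>n. real n * U n t) \<longlonglongrightarrow> 0" for t
  proof -
    have "(\<lambda>n. 2 * (real n * (1 - r n t)) - (real n * (1 - r n (2 * t))) / 2) \<longlonglongrightarrow> 2 * t\<^sup>2 - (2 * t)\<^sup>2 / 2"
      by (intro tendsto_intros nr) auto
    then show ?thesis unfolding U_eq by (simp add: algebra_simps power2_eq_square)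
  qed
  have [measurable]: "r n \<in> borel_measurable borel" for n
    unfolding r_def by (rule borel_measurable_lebesgue_integral) measurable
  have [measurable]: "U n \<in> borel_measurable borel" for n
    unfolding U_eq[abs_def] by measurable
  \<comment> \<open>The weight \<open>r n (t / 4) ^ n\<close> supplies the bound 2, uniform in t,
    that dominated convergence needs, while it stays near a positive limit for each t.\<close>
  define W where "W n t = r n (t / 4) ^ n * (real n * U n (t / 4))" for n t
  have W: "0 \<le> W n t" "W n t \<le> 2" for n t
  proof -
    show "0 \<le> W n t" unfolding W_def using r0 U0 by simp
    have "U n (t / 4) \<le> 2 * (1 - r n (t / 4))" unfolding U_eq using r1[of n "2 * (t / 4)"] by simp
    then have "W n t \<le> r n (t / 4) ^ n * (real n * (2 * (1 - r n (t / 4))))"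
      unfolding W_def using r0 by (intro mult_left_mono) auto
    also have "\<dots> = 2 * (r n (t / 4) ^ n * (real n * (1 - r n (t / 4))))" by simp
    also have "\<dots> \<le> 2 * 1" by (intro mult_left_mono power_mult_n_one_minus_le r0 r1) simp
    finally show "W n t \<le> 2" by simp
  qed
  have Wlim: "(\<lambda>n. integral\<^sup>L std_normal_distribution (W n)) \<longlonglongrightarrow> 0"
  proof -
    have "(\<lambda>n. integral\<^sup>L std_normal_distribution (W n)) \<longlonglongrightarrow> integral\<^sup>L std_normal_distribution (\<lambda>t. 0)"
    proof (rule integral_dominated_convergence[where w = "\<lambda>_. 2"])
      show "AE t in std_normal_distribution. (\<lambda>n. W n t) \<longlonglongrightarrow> 0"
      proof (rule AE_I2)
        fix t show "(\<lambda>n. W n t) \<longlonglongrightarrow> 0"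
          unfolding W_def using tendsto_mult[OF rlim nU, of "t / 4" "t / 4"] by simp
      qed
      show "AE t in std_normal_distribution. norm (W n t) \<le> 2" for n using W by simp
      show "W n \<in> borel_measurable std_normal_distribution" for n unfolding W_def[abs_def] by measurable
    qed auto
    then show ?thesis by simp
  qed
  define \<delta> where "\<delta> n = integral\<^sup>L std_normal_distribution (\<lambda>t. \<bar>r n (t / 4) ^ n - exp (- (t / 4)\<^sup>2)\<bar>)" for n
  have db: "\<bar>r n (t / 4) ^ n - exp (- (t / 4)\<^sup>2)\<bar> \<le> 1" for n t
    using r0[of n "t / 4"] r1[of n "t / 4"] power_le_one[of "r n (t / 4)" n] zero_le_power[of "r n (t / 4)" n]
      exp_gt_zero[of "- (t / 4)\<^sup>2"] exp_le_one_iff[of "- (t / 4)\<^sup>2"] zero_le_power2[of "t / 4"] by linarith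
  have dlim: "\<delta> \<longlonglongrightarrow> 0"
  proof -
    have "\<delta> \<longlonglongrightarrow> integral\<^sup>L std_normal_distribution (\<lambda>t. 0)"
      unfolding \<delta>_def
    proof (rule integral_dominated_convergence[where w = "\<lambda>_. 1"])
      show "AE t in std_normal_distribution. (\<lambda>n. \<bar>r n (t / 4) ^ n - exp (- (t / 4)\<^sup>2)\<bar>) \<longlonglongrightarrow> 0"
      proof (rule AE_I2)
        fix t show "(\<lambda>n. \<bar>r n (t / 4) ^ n - exp (- (t / 4)\<^sup>2)\<bar>) \<longlonglongrightarrow> 0"
          using tendsto_rabs[OF tendsto_diff[OF rlim[of "t / 4"] tendsto_const[of "exp (- (t / 4)\<^sup>2)"]]] by simp
      qed
    qed (use db in auto)
    then show ?thesis by simp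
  qed
  \<comment> \<open>The Gaussian average over t as a function of y = \<eta> / D n. Once it is at
    least 1/4 for |y| \<ge> 12, 4 J dominates the indicator of a large value.\<close>
  define J where "J n y = integral\<^sup>L std_normal_distribution (\<lambda>t. r n (t / 4) ^ n * (1 - cos (t / 4 * y))\<^sup>2)" for n y
  have sq4: "(1 - cos x)\<^sup>2 \<le> 4" for x :: real
  proof -
    have "\<bar>1 - cos x\<bar> \<le> 2" using cos_ge_minus_one[of x] cos_le_one[of x] by linarith
    then show ?thesis using power_mono[of "\<bar>1 - cos x\<bar>" 2 2] by simp
  qed
  have rb: "\<bar>r n (t / 4) ^ n * (1 - cos x)\<^sup>2\<bar> \<le> 4" for n t x
  proof -
    have "\<bar>r n (t / 4) ^ n * (1 - cos x)\<^sup>2\<bar> = r n (t / 4) ^ n * (1 - cos x)\<^sup>2" using r0 by simp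
    also have "\<dots> \<le> 1 * 4" using r0 r1 sq4 by (intro mult_mono power_le_one) auto
    finally show ?thesis by simp
  qed
  have J0: "0 \<le> J n y" for n y unfolding J_def using r0 by (intro Bochner_Integration.integral_nonneg) auto
  have J: "J n y \<ge> 1 / 4" if "\<bar>y\<bar> \<ge> 12" "\<delta> n < 1 / 8" for n y
  proof -
    have i1: "integrable std_normal_distribution (\<lambda>t. (1 - cos (t / 4 * y))\<^sup>2)"
      by (rule N.integrable_const_bound[where B = 4]) (use sq4 in auto)
    have i2: "integrable std_normal_distribution (\<lambda>t. \<bar>r n (t / 4) ^ n - exp (- (t / 4)\<^sup>2)\<bar>)"
      by (rule N.integrable_const_bound[where B = 1]) (use db in auto)
    have i3: "integrable std_normal_distribution (\<lambda>t. r n (t / 4) ^ n * (1 - cos (t / 4 * y))\<^sup>2)"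
      by (rule N.integrable_const_bound[where B = 4]) (use rb in auto)
    \<comment> \<open>The squared factor is at most 4, and exp (- (t/4)^2) \<ge> 1 - t^2/16, so
      dropping the weight costs at most t^2/4 plus 4 times the error of
      \<open>r n (t / 4) ^ n\<close>. In the mean 1 - 1/4 - 4 \<delta> \<ge> 1/4 remains for
      \<delta> < 1/8, which explains the scaling t/4.\<close>
    have "integral\<^sup>L std_normal_distribution (\<lambda>t. (1 - cos (t / 4 * y))\<^sup>2 - t\<^sup>2 / 4 - 4 * \<bar>r n (t / 4) ^ n - exp (- (t / 4)\<^sup>2)\<bar>) \<le> J n y"
      unfolding J_def
    proof (rule integral_mono[OF _ i3])
      show "integrable std_normal_distribution (\<lambda>t. (1 - cos (t / 4 * y))\<^sup>2 - t\<^sup>2 / 4 - 4 * \<bar>r n (t / 4) ^ n - exp (- (t / 4)\<^sup>2)\<bar>)"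
        using i1 i2 second_moment_std_normal(1) by auto
      fix t
      define c where "c = (1 - cos (t / 4 * y))\<^sup>2"
      have c: "0 \<le> c" "c \<le> 4" using sq4 by (auto simp: c_def)
      define p where "p = r n (t / 4) ^ n"
      define q where "q = exp (- (t / 4)\<^sup>2)"
      have "1 - t\<^sup>2 / 16 \<le> q" unfolding q_def using exp_ge_add_one_self[of "- (t / 4)\<^sup>2"] by (simp add: power_divide)
      then have "(1 - t\<^sup>2 / 16) * c \<le> q * c" using c by (intro mult_right_mono) auto
      moreover have "t\<^sup>2 / 16 * c \<le> t\<^sup>2 / 16 * 4" using c by (intro mult_left_mono) auto
      moreover have "(q - p) * c \<le> \<bar>p - q\<bar> * c" using c by (intro mult_right_mono) auto
      moreover have "\<bar>p - q\<bar> * c \<le> \<bar>p - q\<bar> * 4" using c by (intro mult_left_mono) auto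
      ultimately have "c - t\<^sup>2 / 4 - 4 * \<bar>p - q\<bar> \<le> p * c" by (simp add: algebra_simps)
      then show "(1 - cos (t / 4 * y))\<^sup>2 - t\<^sup>2 / 4 - 4 * \<bar>r n (t / 4) ^ n - exp (- (t / 4)\<^sup>2)\<bar> \<le> r n (t / 4) ^ n * (1 - cos (t / 4 * y))\<^sup>2"
        by (simp only: c_def p_def q_def)
    qed
    moreover have "integral\<^sup>L std_normal_distribution (\<lambda>t. (1 - cos (t / 4 * y))\<^sup>2 - t\<^sup>2 / 4 - 4 * \<bar>r n (t / 4) ^ n - exp (- (t / 4)\<^sup>2)\<bar>)
       = integral\<^sup>L std_normal_distribution (\<lambda>t. (1 - cos (t / 4 * y))\<^sup>2) - 1 / 4 - 4 * \<delta> n"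
      unfolding \<delta>_def using i1 i2 second_moment_std_normal by simp
    ultimately show ?thesis using integral_one_minus_cos_squared_ge[OF that(1)] that(2) by linarith
  qed
  have bound: "real n * prob {\<omega>\<in>space M. \<bar>\<eta> \<omega>\<bar> \<ge> 12 * D n} \<le> 4 * integral\<^sup>L std_normal_distribution (W n)" if "\<delta> n < 1 / 8" for n
  proof -
    let ?f = "\<lambda>t \<omega>. r n (t / 4) ^ n * (1 - cos (t / 4 * (\<eta> \<omega> / D n)))\<^sup>2"
    have if2: "integrable (std_normal_distribution \<Otimes>\<^sub>M M) (case_prod ?f)"
      by (rule P.P.integrable_const_bound[where B = 4]) (use rb in \<open>auto simp: case_prod_unfold\<close>)
    have Jm [measurable]: "(\<lambda>\<omega>. J n (\<eta> \<omega> / D n)) \<in> borel_measurable M"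
      unfolding J_def by (rule N.borel_measurable_lebesgue_integral) (auto simp: case_prod_unfold)
    have Jb: "J n y \<le> 4" for y
    proof -
      have "J n y \<le> integral\<^sup>L std_normal_distribution (\<lambda>_. 4)"
        unfolding J_def
      proof (rule integral_mono)
        show "integrable std_normal_distribution (\<lambda>t. r n (t / 4) ^ n * (1 - cos (t / 4 * y))\<^sup>2)"
          by (rule N.integrable_const_bound[where B = 4]) (use rb in auto)
        show "r n (t / 4) ^ n * (1 - cos (t / 4 * y))\<^sup>2 \<le> 4" for t using rb[of n t "t / 4 * y"] by linarith
      qed auto
      then show ?thesis using N.prob_space by simp
    qed
    have "prob {\<omega>\<in>space M. \<bar>\<eta> \<omega>\<bar> \<ge> 12 * D n} = expectation (indicator {\<omega>\<in>space M. \<bar>\<eta> \<omega>\<bar> \<ge> 12 * D n})" by simp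
    also have "\<dots> \<le> expectation (\<lambda>\<omega>. 4 * J n (\<eta> \<omega> / D n))"
    proof (rule integral_mono)
      show "integrable M (\<lambda>\<omega>. 4 * J n (\<eta> \<omega> / D n))"
        by (intro integrable_mult_right integrable_const_bound[where B = 4]) (use J0 Jb in auto)
      show "integrable M (indicator {\<omega>\<in>space M. \<bar>\<eta> \<omega>\<bar> \<ge> 12 * D n} :: _ \<Rightarrow> real)"
        by (rule integrable_const_bound[where B = 1]) auto
      fix \<omega>
      show "indicator {\<omega>\<in>space M. \<bar>\<eta> \<omega>\<bar> \<ge> 12 * D n} \<omega> \<le> 4 * J n (\<eta> \<omega> / D n)"
      proof (cases "\<bar>\<eta> \<omega>\<bar> \<ge> 12 * D n")
        case True
        then have "\<bar>\<eta> \<omega> / D n\<bar> \<ge> 12" using D[of n] by (simp add: abs_divide field_simps)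
        from J[OF this that] show ?thesis by (simp add: indicator_def)
      qed (use J0[of n "\<eta> \<omega> / D n"] in auto)
    qed
    also have "\<dots> = 4 * expectation (\<lambda>\<omega>. J n (\<eta> \<omega> / D n))" by simp
    also have "expectation (\<lambda>\<omega>. J n (\<eta> \<omega> / D n)) = integral\<^sup>L std_normal_distribution (\<lambda>t. expectation (?f t))"
      unfolding J_def by (rule P.Fubini_integral[OF if2])
    also have "\<dots> = integral\<^sup>L std_normal_distribution (\<lambda>t. r n (t / 4) ^ n * U n (t / 4))"
      unfolding U_def by (simp add: mult.assoc)
    finally have "real n * prob {\<omega>\<in>space M. \<bar>\<eta> \<omega>\<bar> \<ge> 12 * D n} \<le> real n * (4 * integral\<^sup>L std_normal_distribution (\<lambda>t. r n (t / 4) ^ n * U n (t / 4)))"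
      by (intro mult_left_mono) auto
    also have "\<dots> = 4 * integral\<^sup>L std_normal_distribution (W n)"
      unfolding W_def by (simp add: mult.left_commute)
    finally show ?thesis .
  qed
  have "(\<lambda>n. real n * prob {\<omega>\<in>space M. \<bar>\<eta> \<omega>\<bar> \<ge> 12 * D n}) \<longlonglongrightarrow> 0"
  proof (rule real_tendsto_sandwich[where f = "\<lambda>_. 0"])
    show "(\<lambda>n. 4 * integral\<^sup>L std_normal_distribution (W n)) \<longlonglongrightarrow> 0" using tendsto_mult_left[OF Wlim, of 4] by simp
    have "\<forall>\<^sub>F n in sequentially. \<delta> n < 1 / 8" using dlim by (rule order_tendstoD) simp
    then show "\<forall>\<^sub>F n in sequentially. real n * prob {\<omega>\<in>space M. \<bar>\<eta> \<omega>\<bar> \<ge> 12 * D n} \<le> 4 * integral\<^sup>L std_normal_distribution (W n)"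
      by eventually_elim (rule bound)
  qed auto
  then show ?thesis unfolding \<eta>_def .
qed

end

context infinite_variance
begin

lemma prob_gt_le: "x > 0 \<Longrightarrow> prob {\<omega>\<in>space M. \<bar>Z \<omega>\<bar> > x} \<le> expectation (\<lambda>\<omega>. \<bar>Z \<omega>\<bar>) / x"
  by (rule order_trans[OF finite_measure_mono prob_ge_le_expectation[of "\<lambda>\<omega>. \<bar>Z \<omega>\<bar>" x]])
    (use integrable_Z in auto)

lemma not_slowly_varyingD:
  assumes "\<not> slowly_varying H0"
  obtains e where "e > 0" "\<exists>\<^sub>F x in at_top. e * H0 x \<le> x\<^sup>2 * prob {\<omega>\<in>space M. \<bar>Z \<omega>\<bar> > x}"
proof -
  have "\<not> ((\<lambda>x. x\<^sup>2 * prob {\<omega>\<in>space M. \<bar>Z \<omega>\<bar> > x} / H0 x) \<longlongrightarrow> 0) at_top"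
    using slowly_varyingI assms by blast
  then obtain e where e: "e > 0" "\<exists>\<^sub>F x in at_top. \<not> dist (x\<^sup>2 * prob {\<omega>\<in>space M. \<bar>Z \<omega>\<bar> > x} / H0 x) 0 < e"
    unfolding tendsto_iff not_eventually[symmetric] by auto
  have pos: "\<forall>\<^sub>F x in at_top. H0 x > 0"
    using H0_filterlim by (auto simp: filterlim_at_top_dense)
  have "\<exists>\<^sub>F x in at_top. e * H0 x \<le> x\<^sup>2 * prob {\<omega>\<in>space M. \<bar>Z \<omega>\<bar> > x}"
    by (rule frequently_rev_mp[OF e(2) eventually_mono[OF pos]]) (auto simp: dist_real_def field_simps not_less)
  then show thesis using that e(1) by blast
qed

end

context iid_seq
begin

text \<open>Take a large x with x^2 P(|\<xi>| > x) \<ge> e \<open>H0 x\<close> and a sample size N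
  of order x^2 / \<open>H0 x\<close>. Then D N is at most x/24, so the event |\<xi> 0| > x, |\<xi>
  1| \<le> x/2 forces |\<xi> 0 - \<xi> 1| \<ge> 12 D N, while N P(|\<xi>| > x) stays bounded below,
  against \<open>normal_limit_imp_tail\<close>.\<close>

lemma normal_limit_imp_slowly_varying:
  assumes fin: "\<And>n. n \<ge> 1 \<Longrightarrow> D_norm H unit_seq n < \<infinity>"
    and conv: "converges_to_std_normal M (\<lambda>n \<omega>. S_proc \<xi> unit_seq n \<omega> / real_of_ereal (D_norm H unit_seq n))"
  shows "slowly_varying H0"
proof (rule ccontr)
  assume nsv: "\<not> slowly_varying H0"
  have ge1: "D_norm H unit_seq n \<ge> 1" for n
    unfolding D_norm_def Let_def by (intro Inf_greatest) (auto simp: one_ereal_def)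
  \<comment> \<open>Finiteness of \<open>D_norm\<close> is assumed for n \<ge> 1 only, whereas
    \<open>normal_limit_imp_tail\<close> asks for positive D at every index; at n = 0 the sum
    vanishes whatever D is.\<close>
  define D where "D n = (if n = 0 then 1 else real_of_ereal (D_norm H unit_seq n))" for n
  have D: "D_norm H unit_seq n = ereal (D n)" if "n \<ge> 1" for n
    using fin[OF that] ge1[of n] that by (cases "D_norm H unit_seq n") (auto simp: D_def)
  have Dpos: "D n > 0" for n
  proof (cases "n = 0")
    case False
    then show ?thesis using ge1[of n] D[of n] by (simp add: one_ereal_def del: ereal_less_eq) simp
  qed (simp add: D_def)
  have "(\<lambda>n. expectation (\<lambda>\<omega>. iexp (t * (S_proc \<xi> unit_seq n \<omega> / real_of_ereal (D_norm H unit_seq n))))) \<longlonglongrightarrow> complex_of_real (exp (- t\<^sup>2 / 2))" for t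
    using conv by (subst (asm) std_normal_iff_char) (auto simp: prob_space_axioms)
  moreover have "S_proc \<xi> unit_seq n \<omega> / real_of_ereal (D_norm H unit_seq n) = (\<Sum>k = 1..n. \<xi> (- int k) \<omega>) / D n" for n \<omega>
    by (cases "n = 0") (auto simp: S_proc_unit_seq D_def)
  ultimately have "(\<lambda>n. real n * prob {\<omega>\<in>space M. \<bar>\<xi> 0 \<omega> - \<xi> 1 \<omega>\<bar> \<ge> 12 * D n}) \<longlonglongrightarrow> 0"
    by (intro normal_limit_imp_tail Dpos) simp
  define p where "p x = prob {\<omega>\<in>space M. \<bar>\<xi> 0 \<omega>\<bar> > x}" for x
  define m where "m = expectation (\<lambda>\<omega>. \<bar>\<xi> 0 \<omega>\<bar>)"
  have m: "m \<ge> 0" unfolding m_def by (intro Bochner_Integration.integral_nonneg) simp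
  have pm: "p x \<le> m / x" if "x > 0" for x unfolding p_def m_def by (rule prob_gt_le[OF that])
  have p0: "p x \<ge> 0" for x by (simp add: p_def)
  obtain e where e: "e > 0" "\<exists>\<^sub>F x in at_top. e * H0 x \<le> x\<^sup>2 * p x"
    using not_slowly_varyingD[OF nsv] unfolding p_def by blast
  define e' where "e' = e / 24\<^sup>2"
  have e': "e' > 0" using e by (simp add: e'_def)
  have "\<forall>\<^sub>F n in sequentially. real n * prob {\<omega>\<in>space M. \<bar>\<xi> 0 \<omega> - \<xi> 1 \<omega>\<bar> \<ge> 12 * D n} < e' / 4"
    by (rule order_tendstoD(2)[OF \<open>_ \<longlonglongrightarrow> 0\<close>]) (use e' in simp)
  then obtain n0 where n0: "\<And>n. n \<ge> n0 \<Longrightarrow> real n * prob {\<omega>\<in>space M. \<bar>\<xi> 0 \<omega> - \<xi> 1 \<omega>\<bar> \<ge> 12 * D n} < e' / 4"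
    by (auto simp: eventually_sequentially)
  \<comment> \<open>In order, the entries ensure s \<ge> 1, \<open>H s = H0 s\<close>, p x \<le>
    e'/2, p (x/2) \<le> 1/2 and N \<ge> n0.\<close>
  define X where "X = Max {24, 24 * (b0 + 1), 2 * m / e', 4 * m, 24\<^sup>2 * (m + 1) * (real n0 + 2)}"
  obtain x where x: "x \<ge> X" "e * H0 x \<le> x\<^sup>2 * p x"
    using e(2) unfolding frequently_def eventually_at_top_linorder by (metis (no_types, lifting) not_le order.refl)
  have xs: "x \<ge> 24" "x \<ge> 24 * (b0 + 1)" "x \<ge> 2 * m / e'" "x \<ge> 4 * m" "x \<ge> 24\<^sup>2 * (m + 1) * (real n0 + 2)"
    using x(1) by (auto simp: X_def)
  \<comment> \<open>Chosen so that D N \<le> s gives 12 D N \<le> x/2.\<close>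
  define s where "s = x / 24"
  have s: "s \<ge> 1" "H s = H0 s" using xs by (auto simp: s_def intro!: H_eq_H0)
  have H0s: "H0 s \<ge> 1" using H_ge_1[of s] s by simp
  have H0x: "H0 s \<le> H0 x" using xs by (intro H0_mono) (auto simp: s_def)
  \<comment> \<open>The largest sample size with N \<open>H s\<close> \<le> s^2, the condition under
    which s bounds D N.\<close>
  define N where "N = nat \<lfloor>s\<^sup>2 / H0 s\<rfloor>"
  have q0: "s\<^sup>2 / H0 s \<ge> 0" using H0s by simp
  have N: "real N \<le> s\<^sup>2 / H0 s" "real N \<ge> s\<^sup>2 / H0 s - 1"
    using q0 unfolding N_def by linarith+
  have sm: "s\<^sup>2 / H0 s \<ge> real n0 + 2"
  proof -
    have "H0 s \<le> s * m" using H0_le[of s] s by (simp add: m_def)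
    also have "\<dots> \<le> s * (m + 1)" using s by (intro mult_left_mono) auto
    finally have "s\<^sup>2 / (s * (m + 1)) \<le> s\<^sup>2 / H0 s" using H0s s m by (intro divide_left_mono) auto
    moreover have "s\<^sup>2 / (s * (m + 1)) = s / (m + 1)" using s by (simp add: power2_eq_square)
    moreover have "real n0 + 2 \<le> s / (m + 1)"
    proof -
      have "24 * (m + 1) * (real n0 + 2) \<le> 24\<^sup>2 * (m + 1) * (real n0 + 2)" using m by (intro mult_right_mono) auto
      then have "24 * (m + 1) * (real n0 + 2) \<le> x" using xs(5) by (rule order_trans)
      then have "24 * ((m + 1) * (real n0 + 2)) \<le> x" by (simp only: mult.assoc)
      then show ?thesis using m by (simp add: s_def field_simps)
    qed
    ultimately show ?thesis by linarith
  qed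
  then have Nn: "N \<ge> n0" "N \<ge> 1" using N(2) by linarith+
  have "real N * H s \<le> s\<^sup>2" using N(1) H0s s by (simp add: field_simps)
  then have "D_norm H unit_seq N \<le> ereal s" by (rule D_norm_unit_seq_le[OF s(1)])
  then have Ds: "D N \<le> s" using D[OF Nn(2)] by simp
  have tail: "p x / 2 \<le> prob {\<omega>\<in>space M. \<bar>\<xi> 0 \<omega> - \<xi> 1 \<omega>\<bar> \<ge> 12 * D N}"
  proof -
    let ?A = "{\<omega>\<in>space M. \<bar>\<xi> 0 \<omega>\<bar> > x}" and ?B = "{\<omega>\<in>space M. \<bar>\<xi> 1 \<omega>\<bar> \<le> x / 2}"
    have "prob (\<Inter>i\<in>{0,1}. \<xi> i -` (if i = 0 then {y. \<bar>y\<bar> > x} else {y. \<bar>y\<bar> \<le> x / 2}) \<inter> space M)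
       = (\<Prod>i\<in>{0,1}. prob (\<xi> i -` (if i = 0 then {y. \<bar>y\<bar> > x} else {y. \<bar>y\<bar> \<le> x / 2}) \<inter> space M))"
      by (rule indep_varsD[OF indep]) auto
    moreover have "\<xi> 0 -` {y. \<bar>y\<bar> > x} \<inter> space M = ?A" "\<xi> 1 -` {y. \<bar>y\<bar> \<le> x / 2} \<inter> space M = ?B" by auto
    ultimately have AB: "prob (?A \<inter> ?B) = prob ?A * prob ?B" by simp
    have "?B = space M - {\<omega>\<in>space M. \<bar>\<xi> 1 \<omega>\<bar> > x / 2}" by auto
    then have "prob ?B = 1 - prob {\<omega>\<in>space M. \<bar>\<xi> 1 \<omega>\<bar> > x / 2}" by (simp add: prob_compl)
    also have "prob {\<omega>\<in>space M. \<bar>\<xi> 1 \<omega>\<bar> > x / 2} = p (x / 2)"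
      unfolding p_def by (rule prob_ident[of "\<lambda>y. \<bar>y\<bar> > x / 2"]) simp
    finally have pB: "prob ?B = 1 - p (x / 2)" .
    have "m / (x / 2) \<le> 1 / 2" using xs(1,4) by (simp add: field_simps)
    then have "p (x / 2) \<le> 1 / 2" using pm[of "x / 2"] xs(1) by linarith
    then have "prob ?B \<ge> 1 / 2" unfolding pB by linarith
    then have "prob ?A * (1 / 2) \<le> prob ?A * prob ?B" by (intro mult_left_mono) auto
    also have "\<dots> = prob (?A \<inter> ?B)" by (rule AB[symmetric])
    also have "\<dots> \<le> prob {\<omega>\<in>space M. \<bar>\<xi> 0 \<omega> - \<xi> 1 \<omega>\<bar> \<ge> 12 * D N}"
      using Ds by (intro finite_measure_mono) (auto simp: s_def)
    finally show ?thesis by (simp add: p_def)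
  qed
  have "e' \<le> s\<^sup>2 / H0 s * p x"
  proof -
    have "e' * H0 s \<le> e' * H0 x" using H0x e' by (intro mult_left_mono) auto
    also have "\<dots> \<le> s\<^sup>2 * p x" using x(2) by (simp add: e'_def s_def power_divide divide_right_mono)
    finally show ?thesis using H0s by (simp add: field_simps)
  qed
  also have "s\<^sup>2 / H0 s * p x \<le> (real N + 1) * p x" using N(2) p0 by (intro mult_right_mono) auto
  also have "\<dots> = real N * p x + p x" by (simp add: algebra_simps)
  finally have e1: "e' \<le> real N * p x + p x" .
  have "p x \<le> e' / 2"
  proof -
    have "m / x \<le> e' / 2" using xs(1,3) e' by (simp add: field_simps)
    then show ?thesis using pm[of x] xs by linarith
  qed
  then have "e' / 2 \<le> real N * p x" using e1 by linarith
  moreover have "real N * (p x / 2) \<le> real N * prob {\<omega>\<in>space M. \<bar>\<xi> 0 \<omega> - \<xi> 1 \<omega>\<bar> \<ge> 12 * D N}"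
    using tail by (intro mult_left_mono) auto
  ultimately show False using n0[OF Nn(1)] by linarith
qed

end

subsection \<open>Harmonic coefficients\<close>

lemma sum_inverse_squares_le:
  assumes "k \<ge> 1" shows "(\<Sum>m = k..L. 1 / (real m)\<^sup>2) \<le> 2 / real k"
proof (cases "k \<le> L")
  case True
  then have "(\<Sum>m = k..L. 1 / (real m)\<^sup>2) \<le> 2 / real k - 1 / real L"
  proof (induction L rule: dec_induct)
    case base
    have "1 / (real k)\<^sup>2 \<le> 1 / real k"
      using assms by (intro divide_left_mono) (auto simp: power2_eq_square)
    then show ?case by simp
  next
    case (step L)
    have L: "real L > 0" using step assms by simp
    have "1 / (real (Suc L))\<^sup>2 \<le> 1 / (real L * real (Suc L))"
      using L by (intro divide_left_mono) (auto simp: power2_eq_square)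
    also have "\<dots> = 1 / real L - 1 / real (Suc L)" using L by (simp add: field_simps)
    finally show ?case using step by simp
  qed
  also have "\<dots> \<le> 2 / real k" by simp
  finally show ?thesis .
qed simp

lemma harm_diff_bounds:
  "harm (n + i) - harm i \<le> real n / (real i + 1)" "real n / real (n + i) \<le> harm (n + i) - harm i"
proof (induction n)
  case (Suc n)
  {
    case 1
    have "harm (Suc n + i) - harm i = (harm (n + i) - harm i) + 1 / (real (n + i) + 1)"
      by (simp add: harm_Suc inverse_eq_divide add.commute)
    also have "\<dots> \<le> real n / (real i + 1) + 1 / (real i + 1)"
      using Suc by (intro add_mono divide_left_mono) auto
    finally show ?case by (simp add: add_divide_distrib)
  next
    case 2
    have "real (Suc n) / real (Suc n + i) = real n / real (Suc n + i) + 1 / (real (n + i) + 1)"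
      by (simp add: add_divide_distrib add.commute)
    also have "real n / real (Suc n + i) \<le> real n / real (n + i)"
      by (cases "n = 0") (auto intro!: divide_left_mono)
    also have "\<dots> \<le> harm (n + i) - harm i" by (rule Suc(2))
    finally show ?case by (simp add: harm_Suc inverse_eq_divide add.commute)
  }
qed auto

lemma sum_harm_diff: "(\<Sum>i<n. harm n - harm i) = real n"
proof (induction n)
  case (Suc n)
  have "(\<Sum>i<Suc n. harm (Suc n) - harm i :: real) = (\<Sum>i<Suc n. (harm n - harm i) + inverse (real (Suc n)))"
    by (intro sum.cong) (auto simp: harm_Suc)
  also have "\<dots> = (\<Sum>i<Suc n. harm n - harm i) + real (Suc n) * inverse (real (Suc n))"
    unfolding sum.distrib by simp
  also have "\<dots> = real n + 1" using Suc by simp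
  finally show ?case by simp
qed simp

lemma sum_harm_diff_square: "(\<Sum>i<n. (harm n - harm i)\<^sup>2) \<le> 2 * real n"
proof (induction n)
  case (Suc n)
  define r where "r = inverse (real (Suc n))"
  have r: "r * real (Suc n) = 1" "r \<ge> 0" by (auto simp: r_def)
  have "(\<Sum>i<Suc n. (harm (Suc n) - harm i)\<^sup>2 :: real) = (\<Sum>i<Suc n. (harm n - harm i)\<^sup>2 + 2 * r * (harm n - harm i) + r\<^sup>2)"
    by (intro sum.cong) (auto simp: harm_Suc r_def power2_eq_square algebra_simps)
  also have "\<dots> = (\<Sum>i<Suc n. (harm n - harm i)\<^sup>2) + 2 * r * (\<Sum>i<Suc n. harm n - harm i) + real (Suc n) * r\<^sup>2"
    unfolding sum.distrib sum_distrib_left by simp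
  also have "\<dots> = (\<Sum>i<n. (harm n - harm i)\<^sup>2) + 2 * r * real n + real (Suc n) * r\<^sup>2"
    using sum_harm_diff[of n] by simp
  finally have eq: "(\<Sum>i<Suc n. (harm (Suc n) - harm i)\<^sup>2 :: real) = (\<Sum>i<n. (harm n - harm i)\<^sup>2) + 2 * r * real n + real (Suc n) * r\<^sup>2" .
  have "real (Suc n) * r\<^sup>2 = (r * real (Suc n)) * r" by (simp only: power2_eq_square ac_simps)
  then have e: "real (Suc n) * r\<^sup>2 = r" by (simp only: r(1) mult_1)
  have "2 * r * real n + r \<le> 2 * (r * real (Suc n))" using r(2) by (simp add: algebra_simps)
  moreover have "2 * real (Suc n) = 2 * real n + 2" by simp
  ultimately show ?case using Suc r(1) unfolding eq e by linarith
qed simp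

text \<open>For i \<ge> n the difference is at most n/(i + 1). For i < n it is at most harm n - harm
  i + 1, because harm (n + i) - harm n \<le> 1; the logarithmic size near i = 0 is harmless since
  the squares of harm n - harm i sum to at most 2n.\<close>

lemma sum_harm_window_square:
  assumes n: "n \<ge> 1" shows "(\<Sum>i<L. (harm (n + i) - harm i)\<^sup>2) \<le> 8 * real n"
proof -
  define B where "B i = (harm (n + i) - harm i :: real)" for i
  have B0: "0 \<le> B i" for i unfolding B_def by (simp add: harm_mono)
  have small: "(\<Sum>i<n. (B i)\<^sup>2) \<le> 6 * real n"
  proof -
    have "(\<Sum>i<n. (B i)\<^sup>2) \<le> (\<Sum>i<n. 2 + 2 * (harm n - harm i)\<^sup>2)"
    proof (rule sum_mono)
      fix i assume "i \<in> {..<n}"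
      then have i: "i < n" by simp
      have "harm (i + n) - harm n \<le> real i / (real n + 1)" by (rule harm_diff_bounds)
      also have "\<dots> \<le> 1" using i by simp
      finally have "B i \<le> (harm n - harm i) + 1" by (simp add: B_def add.commute)
      then have "(B i)\<^sup>2 \<le> ((harm n - harm i) + 1)\<^sup>2" using B0 by (intro power_mono)
      also have "\<dots> \<le> 2 + 2 * (harm n - harm i)\<^sup>2"
        using zero_le_power2[of "(harm n - harm i) - (1::real)"] unfolding power2_sum power2_diff[of "harm n - harm i" 1] by simp
      finally show "(B i)\<^sup>2 \<le> 2 + 2 * (harm n - harm i)\<^sup>2" .
    qed
    also have "\<dots> = 2 * real n + 2 * (\<Sum>i<n. (harm n - harm i)\<^sup>2)"
      by (simp add: sum.distrib sum_distrib_left)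
    also have "\<dots> \<le> 6 * real n" using sum_harm_diff_square[of n] by simp
    finally show ?thesis .
  qed
  have large: "(\<Sum>i\<in>{n..<L}. (B i)\<^sup>2) \<le> 2 * real n"
  proof -
    have "(\<Sum>i\<in>{n..<L}. (B i)\<^sup>2) \<le> (\<Sum>i\<in>{n..<L}. (real n)\<^sup>2 * (1 / (real (Suc i))\<^sup>2))"
    proof (rule sum_mono)
      fix i
      have "B i \<le> real n / (real i + 1)" unfolding B_def by (rule harm_diff_bounds)
      then have "(B i)\<^sup>2 \<le> (real n / (real i + 1))\<^sup>2" using B0 by (intro power_mono)
      then show "(B i)\<^sup>2 \<le> (real n)\<^sup>2 * (1 / (real (Suc i))\<^sup>2)" by (simp add: power_divide add.commute)
    qed
    also have "\<dots> = (real n)\<^sup>2 * (\<Sum>m = Suc n..L. 1 / (real m)\<^sup>2)"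
      unfolding sum_distrib_left[symmetric]
      by (rule arg_cong[where f = "\<lambda>x. (real n)\<^sup>2 * x"], rule sum.reindex_bij_witness[of _ "\<lambda>m. m - 1" Suc]) auto
    also have "\<dots> \<le> (real n)\<^sup>2 * (2 / real (Suc n))" by (intro mult_left_mono sum_inverse_squares_le) auto
    also have "\<dots> \<le> 2 * real n" by (simp add: field_simps power2_eq_square)
    finally show ?thesis .
  qed
  have "(\<Sum>i<L. (B i)\<^sup>2) \<le> (\<Sum>i\<in>{..<n} \<union> {n..<L}. (B i)\<^sup>2)" by (intro sum_mono2) auto
  also have "\<dots> = (\<Sum>i<n. (B i)\<^sup>2) + (\<Sum>i\<in>{n..<L}. (B i)\<^sup>2)" by (intro sum.union_disjoint) auto
  also have "\<dots> \<le> 8 * real n" using small large by simp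
  finally show ?thesis unfolding B_def .
qed

text \<open>The differences behave like n/i for large i. If |r| > 1, about n |r| terms reach the cap
  1 and the remaining squares add up to the same order; if |r| \<le> 1, the square sum bound
  applies. Both regimes together are n \<open>qf r\<close>.\<close>

lemma sum_harm_window_min:
  assumes n: "n \<ge> 1"
  shows "(\<Sum>i<L. min (((harm (n + i) - harm i) * r)\<^sup>2) 1) \<le> 8 * real n * qf r"
proof (cases "\<bar>r\<bar> \<le> 1")
  case True
  have "(\<Sum>i<L. min (((harm (n + i) - harm i) * r)\<^sup>2) 1) \<le> (\<Sum>i<L. (harm (n + i) - harm i)\<^sup>2 * r\<^sup>2)"
    by (intro sum_mono) (auto simp: power_mult_distrib)
  also have "\<dots> = (\<Sum>i<L. (harm (n + i) - harm i)\<^sup>2) * r\<^sup>2" by (simp add: sum_distrib_right)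
  also have "\<dots> \<le> 8 * real n * r\<^sup>2" by (intro mult_right_mono sum_harm_window_square n) auto
  finally show ?thesis using True by (simp add: qf_eq_square)
next
  case False
  define s where "s = \<bar>r\<bar>"
  have s: "s > 1" "r\<^sup>2 = s\<^sup>2" using False by (auto simp: s_def)
  \<comment> \<open>The index where the bound n |r| / i on the uncapped term passes through
    1.\<close>
  define k where "k = nat \<lceil>real n * s\<rceil>"
  have ns: "real n * s \<ge> 1" using n s mult_mono[of 1 "real n" 1 s] by simp
  have k: "real n * s \<le> real k" "real k \<le> real n * s + 1" using ns unfolding k_def by linarith+
  define B where "B i = (harm (n + i) - harm i :: real)" for i
  have B0: "0 \<le> B i" for i unfolding B_def by (simp add: harm_mono)
  have "(\<Sum>i\<in>{k..<L}. min ((B i * r)\<^sup>2) 1) \<le> (\<Sum>i\<in>{k..<L}. (real n * s)\<^sup>2 * (1 / (real (Suc i))\<^sup>2))"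
  proof (rule sum_mono)
    fix i
    have "B i \<le> real n / (real i + 1)" unfolding B_def by (rule harm_diff_bounds)
    then have "(B i)\<^sup>2 \<le> (real n / (real i + 1))\<^sup>2" using B0 by (intro power_mono)
    then have "(B i)\<^sup>2 * s\<^sup>2 \<le> (real n / (real i + 1))\<^sup>2 * s\<^sup>2" by (intro mult_right_mono) auto
    then show "min ((B i * r)\<^sup>2) 1 \<le> (real n * s)\<^sup>2 * (1 / (real (Suc i))\<^sup>2)"
      using s by (simp add: power_divide power_mult_distrib add.commute)
  qed
  also have "\<dots> = (real n * s)\<^sup>2 * (\<Sum>m = Suc k..L. 1 / (real m)\<^sup>2)"
    unfolding sum_distrib_left[symmetric]
    by (rule arg_cong[where f = "\<lambda>x. (real n * s)\<^sup>2 * x"], rule sum.reindex_bij_witness[of _ "\<lambda>m. m - 1" Suc]) auto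
  also have "\<dots> \<le> (real n * s)\<^sup>2 * (2 / real (Suc k))" by (intro mult_left_mono sum_inverse_squares_le) auto
  also have "\<dots> \<le> (real n * s)\<^sup>2 * (2 / (real n * s))"
    using k ns by (intro mult_left_mono divide_left_mono) auto
  also have "\<dots> = 2 * (real n * s)" using ns by (simp add: power2_eq_square)
  finally have large: "(\<Sum>i\<in>{k..<L}. min ((B i * r)\<^sup>2) 1) \<le> 2 * (real n * s)" .
  have "(\<Sum>i<k. min ((B i * r)\<^sup>2) 1) \<le> (\<Sum>i<k. 1)" by (intro sum_mono) auto
  then have small: "(\<Sum>i<k. min ((B i * r)\<^sup>2) 1) \<le> 2 * (real n * s)" using k ns by simp
  have "(\<Sum>i<L. min ((B i * r)\<^sup>2) 1) \<le> (\<Sum>i\<in>{..<k} \<union> {k..<L}. min ((B i * r)\<^sup>2) 1)" by (intro sum_mono2) auto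
  also have "\<dots> = (\<Sum>i<k. min ((B i * r)\<^sup>2) 1) + (\<Sum>i\<in>{k..<L}. min ((B i * r)\<^sup>2) 1)" by (intro sum.union_disjoint) auto
  also have "\<dots> \<le> 8 * (real n * s)" using small large ns by simp
  also have "\<dots> = 8 * real n * qf r" using False by (simp add: qf_eq_abs s_def)
  finally show ?thesis unfolding B_def .
qed

text \<open>The partial sums of this sequence are the even function \<open>\<lambda>j. harm (nat \<bar>j\<bar>)\<close>, so that
  \<open>b_coeff harm_seq n\<close> is antisymmetric under the reflection \<open>j \<mapsto> - n - j\<close>.\<close>

definition harm_seq :: "int \<Rightarrow> real" where
  "harm_seq j = harm (nat \<bar>j\<bar>) - harm (nat \<bar>j - 1\<bar>)"

lemma b_coeff_harm_seq: "b_coeff harm_seq n j = harm (nat \<bar>j + int n\<bar>) - harm (nat \<bar>j\<bar>)"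
proof (induction n)
  case (Suc n)
  have "b_coeff harm_seq (Suc n) j = b_coeff harm_seq n j + harm_seq (j + int (Suc n))"
    by (simp add: b_coeff_def)
  also have "harm_seq (j + int (Suc n)) = harm (nat \<bar>j + int (Suc n)\<bar>) - harm (nat \<bar>j + int n\<bar>)"
    by (simp add: harm_seq_def)
  finally show ?case using Suc by simp
qed (simp add: b_coeff_def)

lemma b_coeff_harm_seq_reflect: "b_coeff harm_seq n (- int n - j) = - b_coeff harm_seq n j"
proof -
  have "\<bar>- int n - j + int n\<bar> = \<bar>j\<bar>" "\<bar>- int n - j\<bar> = \<bar>j + int n\<bar>" by linarith+
  then show ?thesis unfolding b_coeff_harm_seq by simp
qed

lemma b_coeff_harm_seq_ge:
  "real n / (real n + real j) \<le> b_coeff harm_seq n (int j)"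
proof -
  have "nat \<bar>int j + int n\<bar> = n + j" by linarith
  then show ?thesis unfolding b_coeff_harm_seq using harm_diff_bounds(2)[of n j] by simp
qed

text \<open>|j| and |j + n| differ by at most n, so the larger is at most n plus the smaller; the
  smaller one is the witness.\<close>

lemma b_coeff_harm_seq_abs_le:
  "\<exists>i \<in> {nat \<bar>j\<bar>, nat \<bar>j + int n\<bar>}. \<bar>b_coeff harm_seq n j\<bar> \<le> harm (n + i) - harm i"
proof (cases "nat \<bar>j\<bar> \<le> nat \<bar>j + int n\<bar>")
  case True
  have "nat \<bar>j + int n\<bar> \<le> n + nat \<bar>j\<bar>" by linarith
  then have "(harm (nat \<bar>j + int n\<bar>) :: real) \<le> harm (n + nat \<bar>j\<bar>)" by (rule harm_mono)
  then show ?thesis using True by (simp add: b_coeff_harm_seq harm_mono abs_if)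
next
  case False
  have "nat \<bar>j\<bar> \<le> n + nat \<bar>j + int n\<bar>" by linarith
  then have "(harm (nat \<bar>j\<bar>) :: real) \<le> harm (n + nat \<bar>j + int n\<bar>)" by (rule harm_mono)
  moreover have "(harm (nat \<bar>j + int n\<bar>) :: real) \<le> harm (nat \<bar>j\<bar>)" using False by (intro harm_mono) simp
  ultimately show ?thesis by (simp add: b_coeff_harm_seq)
qed

text \<open>The map j to |j + d| takes each value at most twice, once on either side of - d.\<close>

lemma sum_int_abs_le:
  fixes f :: "nat \<Rightarrow> real"
  assumes f: "\<And>i. 0 \<le> f i" and X: "\<And>L. (\<Sum>i<L. f i) \<le> X" and J: "finite J"
  shows "(\<Sum>j\<in>J. f (nat \<bar>j + d\<bar>)) \<le> 2 * X"
proof -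
  have half: "(\<Sum>j\<in>K. f (nat \<bar>j + d\<bar>)) \<le> X" if K: "finite K" "inj_on (\<lambda>j. nat \<bar>j + d\<bar>) K" for K
  proof -
    let ?I = "(\<lambda>j. nat \<bar>j + d\<bar>) ` K"
    obtain L where L: "?I \<subseteq> {..<L}" using finite_nat_bounded[OF finite_imageI[OF K(1)]] by blast
    have "(\<Sum>j\<in>K. f (nat \<bar>j + d\<bar>)) = sum f ?I" using K(2) by (simp add: sum.reindex)
    also have "\<dots> \<le> (\<Sum>i<L. f i)" using L f by (intro sum_mono2) auto
    finally show ?thesis using X[of L] by simp
  qed
  have "J = {j\<in>J. j + d \<ge> 0} \<union> {j\<in>J. j + d < 0}" by auto
  then have "(\<Sum>j\<in>J. f (nat \<bar>j + d\<bar>)) = (\<Sum>j\<in>{j\<in>J. j + d \<ge> 0} \<union> {j\<in>J. j + d < 0}. f (nat \<bar>j + d\<bar>))" by simp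
  also have "\<dots> = (\<Sum>j\<in>{j\<in>J. j + d \<ge> 0}. f (nat \<bar>j + d\<bar>)) + (\<Sum>j\<in>{j\<in>J. j + d < 0}. f (nat \<bar>j + d\<bar>))"
    using J by (intro sum.union_disjoint) auto
  also have "\<dots> \<le> X + X" using J by (intro add_mono half) (auto simp: inj_on_def)
  finally show ?thesis by simp
qed

text \<open>The factor 4 is 2 for the two candidate indices |j| and |j + n|, times 2 for the two
  signs.\<close>

lemma sum_b_coeff_harm_seq_le:
  fixes F :: "real \<Rightarrow> real"
  assumes F0: "\<And>u. 0 \<le> F u" and Fm: "\<And>u v. \<bar>u\<bar> \<le> \<bar>v\<bar> \<Longrightarrow> F u \<le> F v"
    and X: "\<And>L. (\<Sum>i<L. F (harm (n + i) - harm i)) \<le> X" and J: "finite J"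
  shows "(\<Sum>j\<in>J. F (b_coeff harm_seq n j)) \<le> 4 * X"
proof -
  let ?f = "\<lambda>i. F (harm (n + i) - harm i)"
  have "(\<Sum>j\<in>J. F (b_coeff harm_seq n j)) \<le> (\<Sum>j\<in>J. ?f (nat \<bar>j + 0\<bar>) + ?f (nat \<bar>j + int n\<bar>))"
  proof (rule sum_mono)
    fix j
    obtain i where i: "i \<in> {nat \<bar>j\<bar>, nat \<bar>j + int n\<bar>}" "\<bar>b_coeff harm_seq n j\<bar> \<le> harm (n + i) - harm i"
      using b_coeff_harm_seq_abs_le by blast
    have "F (b_coeff harm_seq n j) \<le> ?f i" using i(2) by (intro Fm) simp
    also have "\<dots> \<le> ?f (nat \<bar>j + 0\<bar>) + ?f (nat \<bar>j + int n\<bar>)"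
      using i(1) F0[of "harm (n + nat \<bar>j\<bar>) - harm (nat \<bar>j\<bar>)"] F0[of "harm (n + nat \<bar>j + int n\<bar>) - harm (nat \<bar>j + int n\<bar>)"] by auto
    finally show "F (b_coeff harm_seq n j) \<le> ?f (nat \<bar>j + 0\<bar>) + ?f (nat \<bar>j + int n\<bar>)" .
  qed
  also have "\<dots> = (\<Sum>j\<in>J. ?f (nat \<bar>j + 0\<bar>)) + (\<Sum>j\<in>J. ?f (nat \<bar>j + int n\<bar>))" by (rule sum.distrib)
  also have "\<dots> \<le> 2 * X + 2 * X"
    by (intro add_mono sum_int_abs_le[where f = ?f] F0 X J)
  finally show ?thesis by simp
qed

lemma sum_square_b_coeff_harm_seq:
  "n \<ge> 1 \<Longrightarrow> finite J \<Longrightarrow> (\<Sum>j\<in>J. (b_coeff harm_seq n j)\<^sup>2) \<le> 32 * real n"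
  using sum_b_coeff_harm_seq_le[of "\<lambda>u. u\<^sup>2" n "8 * real n" J] sum_harm_window_square[of n]
  by (simp add: abs_le_square_iff)

lemma sum_min_b_coeff_harm_seq:
  assumes "n \<ge> 1" "finite J" shows "(\<Sum>j\<in>J. min ((b_coeff harm_seq n j * r)\<^sup>2) 1) \<le> 32 * real n * qf r"
proof -
  have "(\<Sum>j\<in>J. min ((b_coeff harm_seq n j * r)\<^sup>2) 1) \<le> 4 * (8 * real n * qf r)"
  proof (rule sum_b_coeff_harm_seq_le[where F = "\<lambda>u. min ((u * r)\<^sup>2) 1"])
    show "min ((u * r)\<^sup>2) 1 \<le> min ((v * r)\<^sup>2) 1" if "\<bar>u\<bar> \<le> \<bar>v\<bar>" for u v
    proof -
      have "(u * r)\<^sup>2 \<le> (v * r)\<^sup>2" using that by (auto simp: abs_le_square_iff[symmetric] abs_mult mult_right_mono)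
      then show ?thesis by linarith
    qed
  qed (use assms sum_harm_window_min in auto)
  then show ?thesis by simp
qed

lemma abs_harm_seq: "\<bar>harm_seq j\<bar> = 1 / real (if j \<ge> 1 then nat j else Suc (nat (- j)))"
proof (cases "j \<ge> 1")
  case True
  then have "nat \<bar>j\<bar> = Suc (nat \<bar>j - 1\<bar>)" "Suc (nat \<bar>j - 1\<bar>) = nat j" by linarith+
  then show ?thesis using True by (simp add: harm_seq_def harm_Suc inverse_eq_divide)
next
  case False
  then have "nat \<bar>j - 1\<bar> = Suc (nat \<bar>j\<bar>)" "nat \<bar>j\<bar> = nat (- j)" by linarith+
  then show ?thesis using False by (simp add: harm_seq_def harm_Suc inverse_eq_divide)
qed

section \<open>Admissibility of the harmonic coefficients\<close>

context infinite_variance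
begin

text \<open>After exchanging sum and expectation, Z^2 is multiplied by the sum of 1/m^2 over m \<ge>
  |Z|, which is of order 1/|Z|. A first moment therefore bounds the whole series.\<close>

lemma sum_g_inverse_le:
  "(\<Sum>m = 1..L. g (1 / real m)) \<le> 2 * expectation (\<lambda>\<omega>. \<bar>Z \<omega>\<bar>) + 2 * H0 (b0 + 1)"
proof -
  have pt: "(\<Sum>m = 1..L. (Z \<omega>)\<^sup>2 * indicator {\<omega>. \<bar>Z \<omega>\<bar> \<le> real m} \<omega> / (real m)\<^sup>2) \<le> 2 * \<bar>Z \<omega>\<bar>" for \<omega>
  proof -
    define k where "k = max 1 (nat \<lceil>\<bar>Z \<omega>\<bar>\<rceil>)"
    have "\<bar>Z \<omega>\<bar> \<le> real (nat \<lceil>\<bar>Z \<omega>\<bar>\<rceil>)" by (rule real_nat_ceiling_ge)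
    also have "\<dots> \<le> real k" unfolding k_def by simp
    finally have k: "k \<ge> 1" "\<bar>Z \<omega>\<bar> \<le> real k" unfolding k_def by auto
    have "(\<Sum>m = 1..L. (Z \<omega>)\<^sup>2 * indicator {\<omega>. \<bar>Z \<omega>\<bar> \<le> real m} \<omega> / (real m)\<^sup>2)
       = (\<Sum>m = k..L. (Z \<omega>)\<^sup>2 * indicator {\<omega>. \<bar>Z \<omega>\<bar> \<le> real m} \<omega> / (real m)\<^sup>2)"
    proof (rule sum.mono_neutral_right)
      show "\<forall>m\<in>{1..L} - {k..L}. (Z \<omega>)\<^sup>2 * indicator {\<omega>. \<bar>Z \<omega>\<bar> \<le> real m} \<omega> / (real m)\<^sup>2 = 0"
      proof
        fix m assume "m \<in> {1..L} - {k..L}"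
        then have "m < k" "1 \<le> m" by auto
        then have "m < nat \<lceil>\<bar>Z \<omega>\<bar>\<rceil>" by (auto simp: k_def)
        then have "\<not> \<bar>Z \<omega>\<bar> \<le> real m" by linarith
        then show "(Z \<omega>)\<^sup>2 * indicator {\<omega>. \<bar>Z \<omega>\<bar> \<le> real m} \<omega> / (real m)\<^sup>2 = 0" by simp
      qed
    qed (use k in auto)
    also have "\<dots> \<le> (\<Sum>m = k..L. (Z \<omega>)\<^sup>2 * (1 / (real m)\<^sup>2))"
      by (intro sum_mono) (auto simp: indicator_def)
    also have "\<dots> = (Z \<omega>)\<^sup>2 * (\<Sum>m = k..L. 1 / (real m)\<^sup>2)" by (simp add: sum_distrib_left)
    also have "\<dots> \<le> (Z \<omega>)\<^sup>2 * (2 / real k)" by (intro mult_left_mono sum_inverse_squares_le k) auto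
    also have "\<dots> = 2 * (\<bar>Z \<omega>\<bar> * (\<bar>Z \<omega>\<bar> / real k))" by (simp add: power2_eq_square)
    also have "\<dots> \<le> 2 * (\<bar>Z \<omega>\<bar> * 1)" using k by (intro mult_left_mono) auto
    finally show ?thesis by simp
  qed
  have "(\<Sum>m = 1..L. g (1 / real m)) \<le> (\<Sum>m = 1..L. H0 (real m) / (real m)\<^sup>2 + H0 (b0 + 1) * (1 / (real m)\<^sup>2))"
  proof (rule sum_mono)
    fix m assume "m \<in> {1..L}"
    then have "g (1 / real m) = (1 / real m)\<^sup>2 * H (real m)" by (simp add: g_def)
    also have "\<dots> \<le> (1 / real m)\<^sup>2 * (H0 (real m) + H0 (b0 + 1))" by (intro mult_left_mono H_le_H0) auto
    finally show "g (1 / real m) \<le> H0 (real m) / (real m)\<^sup>2 + H0 (b0 + 1) * (1 / (real m)\<^sup>2)"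
      by (simp add: power_divide add_divide_distrib)
  qed
  also have "\<dots> = (\<Sum>m = 1..L. H0 (real m) / (real m)\<^sup>2) + H0 (b0 + 1) * (\<Sum>m = 1..L. 1 / (real m)\<^sup>2)"
    by (simp add: sum.distrib sum_distrib_left)
  also have "(\<Sum>m = 1..L. H0 (real m) / (real m)\<^sup>2)
      = expectation (\<lambda>\<omega>. \<Sum>m = 1..L. (Z \<omega>)\<^sup>2 * indicator {\<omega>. \<bar>Z \<omega>\<bar> \<le> real m} \<omega> / (real m)\<^sup>2)"
    unfolding trunc_moment_def using integrable_trunc by (subst Bochner_Integration.integral_sum) auto
  also have "\<dots> \<le> expectation (\<lambda>\<omega>. 2 * \<bar>Z \<omega>\<bar>)"
    using integrable_trunc integrable_Z pt by (intro integral_mono) auto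
  also have "\<dots> = 2 * expectation (\<lambda>\<omega>. \<bar>Z \<omega>\<bar>)" by simp
  also have "H0 (b0 + 1) * (\<Sum>m = 1..L. 1 / (real m)\<^sup>2) \<le> H0 (b0 + 1) * 2"
    using sum_inverse_squares_le[of 1 L] H0_nonneg by (intro mult_left_mono) auto
  finally show ?thesis by simp
qed

lemma g_harm_seq_summable: "(\<lambda>j. g (harm_seq j)) summable_on UNIV"
proof (rule summable_on_window(1))
  fix M :: nat
  define B where "B = 2 * expectation (\<lambda>\<omega>. \<bar>Z \<omega>\<bar>) + 2 * H0 (b0 + 1)"
  have g_abs: "g c = g \<bar>c\<bar>" for c by (simp add: g_def)
  have "{- int M..int M} = (\<lambda>m. 1 - int m) ` {1..Suc M} \<union> int ` {1..M}"
  proof (intro equalityI subsetI)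
    fix j assume j: "j \<in> {- int M..int M}"
    show "j \<in> (\<lambda>m. 1 - int m) ` {1..Suc M} \<union> int ` {1..M}"
    proof (cases "j \<ge> 1")
      case True then have "j = int (nat j)" "nat j \<in> {1..M}" using j by auto
      then show ?thesis by blast
    next
      case False then have "j = 1 - int (nat (1 - j))" "nat (1 - j) \<in> {1..Suc M}" using j by auto
      then show ?thesis by blast
    qed
  qed auto
  then have "(\<Sum>j = - int M..int M. g (harm_seq j)) =
     (\<Sum>j\<in>(\<lambda>m. 1 - int m) ` {1..Suc M}. g (harm_seq j)) + (\<Sum>j\<in>int ` {1..M}. g (harm_seq j))"
    by (simp only:) (rule sum.union_disjoint, auto)
  also have "(\<Sum>j\<in>int ` {1..M}. g (harm_seq j)) = (\<Sum>m = 1..M. g (1 / real m))"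
    by (subst sum.reindex) (auto simp: g_abs[of "harm_seq _"] abs_harm_seq intro!: sum.cong)
  also have "(\<Sum>j\<in>(\<lambda>m. 1 - int m) ` {1..Suc M}. g (harm_seq j)) = (\<Sum>m = 1..Suc M. g (1 / real m))"
  proof (subst sum.reindex)
    show "(\<Sum>m = 1..Suc M. ((\<lambda>j. g (harm_seq j)) \<circ> (\<lambda>m. 1 - int m)) m) = (\<Sum>m = 1..Suc M. g (1 / real m))"
    proof (rule sum.cong[OF refl])
      fix m assume "m \<in> {1..Suc M}"
      then have "\<not> 1 - int m \<ge> 1" "Suc (nat (- (1 - int m))) = m" by auto
      then have "\<bar>harm_seq (1 - int m)\<bar> = 1 / real m" unfolding abs_harm_seq by simp
      then show "((\<lambda>j. g (harm_seq j)) \<circ> (\<lambda>m. 1 - int m)) m = g (1 / real m)"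
        using g_abs[of "harm_seq (1 - int m)"] by simp
    qed
  qed (auto simp: inj_on_def)
  also have "(\<Sum>m = 1..Suc M. g (1 / real m)) + (\<Sum>m = 1..M. g (1 / real m)) \<le> B + B"
    unfolding B_def by (intro add_mono sum_g_inverse_le)
  finally show "(\<Sum>j = - int M..int M. g (harm_seq j)) \<le> B + B" .
qed (rule g_nonneg)

lemma b_coeff_harm_seq_square_summable: "(\<lambda>j. (b_coeff harm_seq n j)\<^sup>2) summable_on UNIV"
  by (rule b_coeff_square_summable, rule summable_on_le[OF g_harm_seq_summable]) (auto simp: g_ge_square)

lemma b_coeff_harm_seq_ge_half:
  assumes "1 \<le> j" "j \<le> int n" shows "b_coeff harm_seq n j \<ge> 1 / 2"
proof -
  have "1 / 2 \<le> real n / (real n + real (nat j))" using assms by (simp add: field_simps)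
  also have "\<dots> \<le> b_coeff harm_seq n (int (nat j))" by (rule b_coeff_harm_seq_ge)
  finally show ?thesis using assms by simp
qed

lemma admissible_harm_seq: "admissible H harm_seq"
  unfolding admissible_def
proof
  have "(\<lambda>j. if harm_seq j = 0 then 0 else (harm_seq j)\<^sup>2 * H (inverse \<bar>harm_seq j\<bar>)) = (\<lambda>j. g (harm_seq j))"
    by (auto simp: g_def fun_eq_iff)
  then show "(\<lambda>j. if harm_seq j = 0 then 0 else (harm_seq j)\<^sup>2 * H (inverse \<bar>harm_seq j\<bar>)) summable_on UNIV"
    using g_harm_seq_summable by simp
  have le: "real n / 4 \<le> (\<Sum>\<^sub>\<infinity>k. (b_coeff harm_seq n k)\<^sup>2)" for n
  proof -
    have "real n / 4 = (\<Sum>j\<in>{1..int n}. (1 / 2)\<^sup>2)" by (simp add: power2_eq_square)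
    also have "\<dots> \<le> (\<Sum>j\<in>{1..int n}. (b_coeff harm_seq n j)\<^sup>2)"
      by (intro sum_mono power_mono b_coeff_harm_seq_ge_half) auto
    also have "\<dots> \<le> (\<Sum>\<^sub>\<infinity>k. (b_coeff harm_seq n k)\<^sup>2)"
      by (intro sum_le_infsum b_coeff_harm_seq_square_summable) auto
    finally show ?thesis .
  qed
  have lim: "filterlim (\<lambda>n. real n / 4) at_top sequentially" by real_asymp
  show "filterlim (\<lambda>n. \<Sum>\<^sub>\<infinity>k. (b_coeff harm_seq n k)\<^sup>2) at_top sequentially"
    by (rule filterlim_at_top_mono[OF lim]) (rule always_eventually, rule allI, rule le)
qed

end

subsection \<open>Symmetrization of the self-normalized sum\<close>

text \<open>Compared with the Gaussian factor exp (- y^2/2) there is a gain of fourth order, which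
  produces the gap when a single y is not small. The restriction y^2 \<le> 2 keeps |y| below pi/2,
  so cosines are nonnegative and the bounds may be multiplied.\<close>

lemma cos_le_exp:
  fixes y :: real
  assumes y: "y\<^sup>2 \<le> 2"
  shows "0 \<le> cos y" "cos y \<le> exp (- y\<^sup>2 / 2 - y ^ 4 / 48)"
proof -
  have "\<bar>y\<bar>\<^sup>2 \<le> (3 / 2)\<^sup>2" using y by (simp add: power2_eq_square)
  then have "\<bar>y\<bar> \<le> 3 / 2" by (rule power2_le_imp_le) simp
  then have "\<bar>y\<bar> \<le> pi / 2" using pi_gt3 by linarith
  then show "0 \<le> cos y" by (intro cos_ge_zero) auto
  have "\<bar>Re (iexp y - (\<Sum>k \<le> 3. (\<i> * y)^k / fact k))\<bar> \<le> \<bar>y\<bar>^(Suc 3) / fact (Suc 3)"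
    by (rule order_trans[OF abs_Re_le_cmod iexp_approx1])
  moreover have "Re (\<Sum>k \<le> 3. (\<i> * complex_of_real y)^k / fact k) = 1 - y\<^sup>2 / 2"
    by (simp add: numeral_eq_Suc power2_eq_square)
  moreover have "Re (iexp y - w) = cos y - Re w" for w by (simp add: Re_exp)
  moreover have "\<bar>y\<bar>^(Suc 3) / fact (Suc 3) = \<bar>y\<bar> ^ 4 / 24" by (simp add: fact_numeral eval_nat_numeral)
  ultimately have "\<bar>cos y - (1 - y\<^sup>2 / 2)\<bar> \<le> \<bar>y\<bar> ^ 4 / 24"
    by (simp only:)
  moreover have "\<bar>y\<bar> ^ 4 = (y\<^sup>2)\<^sup>2" by (simp flip: power_mult add: power_even_abs)
  ultimately have 1: "cos y \<le> 1 - y\<^sup>2 / 2 + (y\<^sup>2)\<^sup>2 / 24" by linarith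
  define u where "u = y\<^sup>2"
  \<comment> \<open>The constant 48 makes the algebra close: v^2/4 \<ge> u^2/16 = u^2/24 + u^2/48,
    so 1 - v + v^2/4 dominates the Taylor bound 1 - u/2 + u^2/24.\<close>
  define v where "v = u / 2 + u\<^sup>2 / 48"
  have u: "0 \<le> u" "u \<le> 2" using y by (auto simp: u_def)
  have "u\<^sup>2 \<le> 2 * u" using u by (simp add: power2_eq_square mult_right_mono)
  then have v: "v / 2 \<le> 1" "v \<ge> u / 2" using u by (auto simp: v_def)
  have "1 - v / 2 \<le> exp (- (v / 2))" using exp_ge_add_one_self[of "- (v / 2)"] by simp
  then have "(1 - v / 2)\<^sup>2 \<le> (exp (- (v / 2)))\<^sup>2" using v by (intro power_mono) auto
  also have "\<dots> = exp (- v)" by (simp add: power2_eq_square exp_add[symmetric])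
  finally have 2: "1 - v + v\<^sup>2 / 4 \<le> exp (- v)" by (simp add: power2_diff power_divide)
  have "(u / 2)\<^sup>2 \<le> v\<^sup>2" using v u by (intro power_mono) auto
  then have 3: "1 - u / 2 + u\<^sup>2 / 24 \<le> 1 - v + v\<^sup>2 / 4" by (simp add: v_def power_divide)
  have "cos y \<le> exp (- v)" using 1 2 3 by (simp add: u_def)
  moreover have "- v = - y\<^sup>2 / 2 - y ^ 4 / 48" by (simp add: v_def u_def flip: power_mult)
  ultimately show "cos y \<le> exp (- y\<^sup>2 / 2 - y ^ 4 / 48)" by simp
qed

lemma exp_minus_lipschitz:
  fixes a b :: real
  assumes "0 \<le> a" "0 \<le> b" shows "exp (- a) \<le> exp (- b) + \<bar>b - a\<bar>"
proof (cases "a \<le> b")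
  case True
  have "exp (- a) * (1 - (b - a)) \<le> exp (- a) * exp (- (b - a))"
  proof (rule mult_left_mono)
    show "1 - (b - a) \<le> exp (- (b - a))" using exp_ge_add_one_self[of "- (b - a)"] by linarith
  qed simp
  also have "\<dots> = exp (- b)" by (simp add: exp_add[symmetric])
  finally have "exp (- a) \<le> exp (- b) + exp (- a) * (b - a)" by (simp add: algebra_simps)
  also have "exp (- a) * (b - a) \<le> 1 * (b - a)" using assms True by (intro mult_right_mono) auto
  finally show ?thesis using True by simp
next
  case False
  then have "exp (- a) \<le> exp (- b)" by simp
  then show ?thesis by linarith
qed

section \<open>Exchange of a coordinate with its reflection\<close>

definition refl_swap :: "nat \<Rightarrow> int \<Rightarrow> int \<Rightarrow> int" where
  "refl_swap n j k = (if k = j then - int n - j else if k = - int n - j then j else k)"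

lemma refl_swap_invol: "refl_swap n j (refl_swap n j k) = k"
  by (auto simp: refl_swap_def)

lemma bij_refl_swap: "bij (refl_swap n j)"
  by (rule involuntory_imp_bij) (rule refl_swap_invol)

text \<open>\<open>V_norm\<close> as a function of the coordinate sequence, so that coordinates can
  be exchanged inside it.\<close>

definition harm_norm :: "nat \<Rightarrow> (int \<Rightarrow> real) \<Rightarrow> real" where
  "harm_norm n x = sqrt (\<Sum>\<^sub>\<infinity>k. (b_coeff harm_seq n k)\<^sup>2 * (x k)\<^sup>2)"

definition sym_term :: "nat \<Rightarrow> int \<Rightarrow> (int \<Rightarrow> real) \<Rightarrow> real" where
  "sym_term n j x = b_coeff harm_seq n j * (x j - x (- int n - j)) / harm_norm n x"

text \<open>One representative of each pair {j, - n - j}. The strict inequality leaves out the fixed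
  point j = - n/2, where \<open>b_coeff harm_seq n\<close> vanishes.\<close>

definition half_window :: "nat \<Rightarrow> nat \<Rightarrow> int set" where
  "half_window n m = {j. - int n < 2 * j \<and> j \<le> int m}"

lemma finite_half_window [simp]: "finite (half_window n m)"
  by (rule finite_subset[of _ "{- int n..int m}"]) (auto simp: half_window_def)

lemma harm_norm_swap: "harm_norm n (\<lambda>k. x (refl_swap n j k)) = harm_norm n x"
proof -
  have "(b_coeff harm_seq n k)\<^sup>2 = (b_coeff harm_seq n (refl_swap n j k))\<^sup>2" for k
    using b_coeff_harm_seq_reflect[of n j] by (auto simp: refl_swap_def)
  then have "(\<Sum>\<^sub>\<infinity>k. (b_coeff harm_seq n k)\<^sup>2 * (x (refl_swap n j k))\<^sup>2)
     = (\<Sum>\<^sub>\<infinity>k. (\<lambda>i. (b_coeff harm_seq n i)\<^sup>2 * (x i)\<^sup>2) (refl_swap n j k))" by simp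
  also have "\<dots> = (\<Sum>\<^sub>\<infinity>i. (b_coeff harm_seq n i)\<^sup>2 * (x i)\<^sup>2)"
    using bij_refl_swap by (rule infsum_reindex_bij_betw)
  finally show ?thesis by (simp add: harm_norm_def)
qed

lemma sym_term_swap:
  assumes "- int n < 2 * i" "- int n < 2 * j"
  shows "sym_term n i (\<lambda>k. x (refl_swap n j k)) = (if i = j then - sym_term n i x else sym_term n i x)"
proof -
  have "refl_swap n j i = i" "refl_swap n j (- int n - i) = - int n - i" if "i \<noteq> j"
    using that assms by (auto simp: refl_swap_def)
  moreover have "refl_swap n j j = - int n - j" "refl_swap n j (- int n - j) = j" by (auto simp: refl_swap_def)
  ultimately show ?thesis
    by (cases "i = j") (simp_all add: sym_term_def harm_norm_swap right_diff_distrib diff_divide_distrib)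
qed

text \<open>The window from - (n + m) to m is invariant under j to - n - j, so it folds onto
  \<open>half_window\<close>; only the fixed point has no partner.\<close>

lemma sum_reflect_window:
  fixes f :: "int \<Rightarrow> real"
  assumes "\<And>j. 2 * j = - int n \<Longrightarrow> f j = 0"
  shows "(\<Sum>j = - int (n + m)..int m. f j) = (\<Sum>j\<in>half_window n m. f j + f (- int n - j))"
proof -
  let ?W = "{- int (n + m)..int m}"
  have "(\<Sum>j\<in>?W. f j) = (\<Sum>j\<in>half_window n m \<union> {j\<in>?W. 2 * j < - int n}. f j)"
  proof (rule sum.mono_neutral_right)
    show "\<forall>j\<in>?W - (half_window n m \<union> {j\<in>?W. 2 * j < - int n}). f j = 0"
    proof
      fix j assume "j \<in> ?W - (half_window n m \<union> {j\<in>?W. 2 * j < - int n})"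
      then have "2 * j = - int n" by (auto simp: half_window_def)
      then show "f j = 0" by (rule assms)
    qed
  qed (auto simp: half_window_def)
  also have "\<dots> = (\<Sum>j\<in>half_window n m. f j) + (\<Sum>j\<in>{j\<in>?W. 2 * j < - int n}. f j)"
  proof (rule sum.union_disjoint[OF finite_half_window])
    show "finite {j\<in>?W. 2 * j < - int n}" by (rule finite_subset[of _ ?W]) auto
  qed (auto simp: half_window_def)
  also have "(\<Sum>j\<in>{j\<in>?W. 2 * j < - int n}. f j) = (\<Sum>j\<in>half_window n m. f (- int n - j))"
    by (rule sum.reindex_bij_witness[of _ "\<lambda>j. - int n - j" "\<lambda>j. - int n - j"]) (auto simp: half_window_def)
  finally show ?thesis by (simp add: sum.distrib)
qed

lemma b_coeff_harm_seq_middle: "2 * j = - int n \<Longrightarrow> b_coeff harm_seq n j = 0"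
proof -
  assume "2 * j = - int n"
  then have "- int n - j = j" by linarith
  then show ?thesis using b_coeff_harm_seq_reflect[of n j] by simp
qed

lemma harm_norm_square: "(harm_norm n x)\<^sup>2 = (\<Sum>\<^sub>\<infinity>k. (b_coeff harm_seq n k)\<^sup>2 * (x k)\<^sup>2)"
  by (simp add: harm_norm_def infsum_nonneg)

lemma harm_norm_nonneg: "0 \<le> harm_norm n x"
  by (simp add: harm_norm_def infsum_nonneg)

lemma sum_pairs_le_harm_norm:
  assumes "(\<lambda>k. (b_coeff harm_seq n k)\<^sup>2 * (x k)\<^sup>2) summable_on UNIV"
  shows "(\<Sum>j\<in>half_window n m. (b_coeff harm_seq n j)\<^sup>2 * ((x j)\<^sup>2 + (x (- int n - j))\<^sup>2)) \<le> (harm_norm n x)\<^sup>2"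
proof -
  have "(\<Sum>j\<in>half_window n m. (b_coeff harm_seq n j)\<^sup>2 * ((x j)\<^sup>2 + (x (- int n - j))\<^sup>2))
     = (\<Sum>j = - int (n + m)..int m. (b_coeff harm_seq n j)\<^sup>2 * (x j)\<^sup>2)"
    by (subst sum_reflect_window) (auto simp: b_coeff_harm_seq_middle b_coeff_harm_seq_reflect distrib_left)
  also have "\<dots> \<le> (harm_norm n x)\<^sup>2" unfolding harm_norm_square by (intro sum_le_infsum assms) auto
  finally show ?thesis .
qed

text \<open>(a - b)^2 \<le> 2 (a^2 + b^2) for each pair. It holds for every sequence: without square
  summability, or with all weighted terms zero, the norm is 0 and division by it makes every term 0.
  The bound 2 is what \<open>cos_le_exp\<close> requires of each term.\<close>

lemma sum_sym_term_square_le: "(\<Sum>j\<in>half_window n m. (sym_term n j x)\<^sup>2) \<le> 2"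
proof (cases "(\<lambda>k. (b_coeff harm_seq n k)\<^sup>2 * (x k)\<^sup>2) summable_on UNIV \<and> harm_norm n x > 0")
  case True
  have sq2: "(a - b)\<^sup>2 \<le> 2 * (a\<^sup>2 + b\<^sup>2)" for a b :: real
    using zero_le_power2[of "a + b"] unfolding power2_sum power2_diff by auto
  have "(\<Sum>j\<in>half_window n m. (sym_term n j x)\<^sup>2)
     = (\<Sum>j\<in>half_window n m. (b_coeff harm_seq n j)\<^sup>2 * (x j - x (- int n - j))\<^sup>2) / (harm_norm n x)\<^sup>2"
    by (simp add: sym_term_def power_divide power_mult_distrib sum_divide_distrib)
  also have "\<dots> \<le> (\<Sum>j\<in>half_window n m. (b_coeff harm_seq n j)\<^sup>2 * (2 * ((x j)\<^sup>2 + (x (- int n - j))\<^sup>2))) / (harm_norm n x)\<^sup>2"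
    by (intro divide_right_mono sum_mono mult_left_mono sq2) auto
  also have "\<dots> = 2 * (\<Sum>j\<in>half_window n m. (b_coeff harm_seq n j)\<^sup>2 * ((x j)\<^sup>2 + (x (- int n - j))\<^sup>2)) / (harm_norm n x)\<^sup>2"
    by (simp only: mult.left_commute[of _ "2::real"] sum_distrib_left)
  also have "\<dots> \<le> 2 * (harm_norm n x)\<^sup>2 / (harm_norm n x)\<^sup>2"
    using True by (intro divide_right_mono mult_left_mono sum_pairs_le_harm_norm) auto
  finally show ?thesis using True by simp
next
  case False
  have "harm_norm n x = 0"
  proof (cases "(\<lambda>k. (b_coeff harm_seq n k)\<^sup>2 * (x k)\<^sup>2) summable_on UNIV")
    case True
    then show ?thesis using False harm_norm_nonneg[of n x] by simp
  next
    case False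
    then show ?thesis by (simp add: harm_norm_def infsum_not_exists)
  qed
  then show ?thesis by (simp add: sym_term_def)
qed

lemma sym_term_square_le: "- int n < 2 * j \<Longrightarrow> (sym_term n j x)\<^sup>2 \<le> 2"
proof -
  assume "- int n < 2 * j"
  then have "j \<in> half_window n (nat \<bar>j\<bar>)" by (auto simp: half_window_def)
  then have "(sym_term n j x)\<^sup>2 \<le> (\<Sum>j\<in>half_window n (nat \<bar>j\<bar>). (sym_term n j x)\<^sup>2)"
    by (intro member_le_sum) auto
  then show ?thesis using sum_sym_term_square_le[where n = n and m = "nat \<bar>j\<bar>" and x = x] by linarith
qed

lemma harm_norm_measurable [measurable]: "harm_norm n \<in> borel_measurable (PiM UNIV (\<lambda>_. borel))"
proof -
  have [measurable]: "(\<lambda>x. \<Sum>\<^sub>\<infinity>k. (b_coeff harm_seq n k)\<^sup>2 * (x k)\<^sup>2) \<in> borel_measurable (PiM UNIV (\<lambda>_::int. borel :: real measure))"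
    by (rule infsum_measurable_int) auto
  show ?thesis unfolding harm_norm_def[abs_def] by measurable
qed

lemma sym_term_measurable [measurable]: "sym_term n j \<in> borel_measurable (PiM UNIV (\<lambda>_. borel))"
  unfolding sym_term_def[abs_def] by measurable

section \<open>The symmetrized characteristic function and its bound\<close>

context iid_seq
begin

lemma path_measurable [measurable]: "(\<lambda>\<omega> k. \<xi> k \<omega>) \<in> M \<rightarrow>\<^sub>M PiM UNIV (\<lambda>_. borel)"
  by (rule measurable_PiM_single') auto

text \<open>The permuted and the original path both have the product law of copies of the
  distribution of \<open>\<xi> 0\<close>.\<close>

lemma expectation_permute:
  assumes "inj \<tau>" and [measurable]: "\<Phi> \<in> borel_measurable (PiM UNIV (\<lambda>_::int. borel :: real measure))"
  shows "expectation (\<lambda>\<omega>. \<Phi> (\<lambda>k. \<xi> (\<tau> k) \<omega>) :: real) = expectation (\<lambda>\<omega>. \<Phi> (\<lambda>k. \<xi> k \<omega>))"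
proof -
  have law: "distr M (PiM UNIV (\<lambda>_. borel)) (\<lambda>\<omega> k. \<xi> (\<sigma> k) \<omega>) = PiM UNIV (\<lambda>_. distr M borel (\<xi> 0))" if "inj \<sigma>" for \<sigma> :: "int \<Rightarrow> int"
  proof -
    have "indep_vars (\<lambda>_. borel) (\<lambda>k. \<xi> (\<sigma> k)) UNIV" using that by (intro indep_vars_reindex_inj[OF indep]) auto
    then have "distr M (PiM UNIV (\<lambda>_. borel)) (\<lambda>\<omega>. \<lambda>k\<in>UNIV. \<xi> (\<sigma> k) \<omega>) = PiM UNIV (\<lambda>k. distr M borel (\<xi> (\<sigma> k)))"
      by (subst (asm) indep_vars_iff_distr_eq_PiM) auto
    moreover have "(\<lambda>k. distr M borel (\<xi> (\<sigma> k))) = (\<lambda>_. distr M borel (\<xi> 0))" using ident by auto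
    ultimately show ?thesis by (simp add: restrict_UNIV)
  qed
  have m [measurable]: "(\<lambda>\<omega> k. \<xi> (\<tau> k) \<omega>) \<in> M \<rightarrow>\<^sub>M PiM UNIV (\<lambda>_. borel)"
    by (rule measurable_PiM_single') auto
  have "expectation (\<lambda>\<omega>. \<Phi> (\<lambda>k. \<xi> (\<tau> k) \<omega>)) = integral\<^sup>L (distr M (PiM UNIV (\<lambda>_. borel)) (\<lambda>\<omega> k. \<xi> (\<tau> k) \<omega>)) \<Phi>"
    by (subst integral_distr) auto
  also have "\<dots> = integral\<^sup>L (distr M (PiM UNIV (\<lambda>_. borel)) (\<lambda>\<omega> k. \<xi> (id k) \<omega>)) \<Phi>"
    unfolding law[OF assms(1)] law[OF inj_on_id] ..
  also have "\<dots> = expectation (\<lambda>\<omega>. \<Phi> (\<lambda>k. \<xi> k \<omega>))"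
    by (subst integral_distr) auto
  finally show ?thesis .
qed

text \<open>Swapping the variables at \<open>j\<close> and \<open>- n - j\<close> changes the sign of one term and keeps the others.\<close>

lemma expectation_cos_sum_sym_term:
  assumes "finite A" "finite B" "A \<inter> B = {}" "\<And>j. j \<in> A \<union> B \<Longrightarrow> - int n < 2 * j"
  shows "expectation (\<lambda>\<omega>. cos (\<Sum>j\<in>A. sym_term n j (\<lambda>k. \<xi> k \<omega>)) * (\<Prod>j\<in>B. cos (sym_term n j (\<lambda>k. \<xi> k \<omega>))))
       = expectation (\<lambda>\<omega>. \<Prod>j\<in>A \<union> B. cos (sym_term n j (\<lambda>k. \<xi> k \<omega>)))"
  using assms
proof (induction A arbitrary: B rule: finite_induct)
  case (insert j A)
  let ?s = "\<lambda>x. \<Sum>i\<in>A. sym_term n i x"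
  let ?p = "\<lambda>x. \<Prod>i\<in>B. cos (sym_term n i x)"
  define \<Phi> where "\<Phi> x = cos (sym_term n j x + ?s x) * ?p x" for x
  have [measurable]: "\<Phi> \<in> borel_measurable (PiM UNIV (\<lambda>_. borel))" unfolding \<Phi>_def[abs_def] by measurable
  have sw: "\<Phi> (\<lambda>k. x (refl_swap n j k)) = cos (- sym_term n j x + ?s x) * ?p x" for x
  proof -
    have "j \<notin> A" "j \<notin> B" using insert by auto
    have A: "(\<Sum>i\<in>A. sym_term n i (\<lambda>k. x (refl_swap n j k))) = ?s x"
      using insert \<open>j \<notin> A\<close> by (intro sum.cong refl, subst sym_term_swap) auto
    have B: "(\<Prod>i\<in>B. cos (sym_term n i (\<lambda>k. x (refl_swap n j k)))) = ?p x"
      using insert \<open>j \<notin> B\<close> by (intro prod.cong refl, subst sym_term_swap) auto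
    have "sym_term n j (\<lambda>k. x (refl_swap n j k)) = - sym_term n j x"
      using insert by (subst sym_term_swap) auto
    then show ?thesis unfolding \<Phi>_def A B by simp
  qed
  note sw' = sw[of "\<lambda>k. \<xi> k _"]
  have bd: "\<bar>cos z * ?p x\<bar> \<le> 1" for z x
  proof -
    have "\<bar>?p x\<bar> \<le> 1" unfolding abs_prod by (intro prod_le_1) auto
    then show ?thesis unfolding abs_mult by (intro mult_le_one) auto
  qed
  have int: "integrable M (\<lambda>\<omega>. cos (f (\<lambda>k. \<xi> k \<omega>)) * ?p (\<lambda>k. \<xi> k \<omega>))"
    if [measurable]: "f \<in> borel_measurable (PiM UNIV (\<lambda>_. borel))" for f
    by (rule integrable_const_bound[where B = 1]) (use bd in auto)
  \<comment> \<open>Averaging with the swapped copy uses cos (y + s) + cos (- y + s) = 2 cos s cos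
    y, which moves j from the argument of the cosine into the product.\<close>
  have "expectation (\<lambda>\<omega>. \<Phi> (\<lambda>k. \<xi> k \<omega>)) = (expectation (\<lambda>\<omega>. \<Phi> (\<lambda>k. \<xi> k \<omega>)) + expectation (\<lambda>\<omega>. \<Phi> (\<lambda>k. \<xi> (refl_swap n j k) \<omega>))) / 2"
    by (subst expectation_permute[OF bij_is_inj[OF bij_refl_swap]]) auto
  also have "\<dots> = expectation (\<lambda>\<omega>. \<Phi> (\<lambda>k. \<xi> k \<omega>) + \<Phi> (\<lambda>k. \<xi> (refl_swap n j k) \<omega>)) / 2"
  proof -
    have "integrable M (\<lambda>\<omega>. \<Phi> (\<lambda>k. \<xi> k \<omega>))" unfolding \<Phi>_def by (rule int) measurable
    moreover have "integrable M (\<lambda>\<omega>. \<Phi> (\<lambda>k. \<xi> (refl_swap n j k) \<omega>))" unfolding sw' by (rule int) measurable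
    ultimately show ?thesis by simp
  qed
  also have "\<dots> = expectation (\<lambda>\<omega>. (\<Phi> (\<lambda>k. \<xi> k \<omega>) + \<Phi> (\<lambda>k. \<xi> (refl_swap n j k) \<omega>)) / 2)" by simp
  also have "\<dots> = expectation (\<lambda>\<omega>. cos (?s (\<lambda>k. \<xi> k \<omega>)) * (\<Prod>i\<in>insert j B. cos (sym_term n i (\<lambda>k. \<xi> k \<omega>))))"
  proof (rule Bochner_Integration.integral_cong[OF refl])
    fix \<omega>
    have "cos (y + s) + cos (- y + s) = 2 * cos s * cos y" for y s :: real by (simp add: cos_add cos_diff)
    then show "(\<Phi> (\<lambda>k. \<xi> k \<omega>) + \<Phi> (\<lambda>k. \<xi> (refl_swap n j k) \<omega>)) / 2 = cos (?s (\<lambda>k. \<xi> k \<omega>)) * (\<Prod>i\<in>insert j B. cos (sym_term n i (\<lambda>k. \<xi> k \<omega>)))"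
      unfolding sw' \<Phi>_def distrib_right[symmetric] using insert by simp
  qed
  also have "\<dots> = expectation (\<lambda>\<omega>. \<Prod>i\<in>A \<union> insert j B. cos (sym_term n i (\<lambda>k. \<xi> k \<omega>)))"
    using insert by (intro insert.IH) auto
  finally show ?case using insert by (simp add: \<Phi>_def)
qed simp

lemma V_norm_eq_harm_norm: "V_norm \<xi> harm_seq n \<omega> = harm_norm n (\<lambda>k. \<xi> k \<omega>)"
  by (simp add: V_norm_def harm_norm_def)

lemma expectation_abs_mult:
  assumes "j \<noteq> k"
  shows "integrable M (\<lambda>\<omega>. \<bar>\<xi> j \<omega> * \<xi> k \<omega>\<bar>)"
    "expectation (\<lambda>\<omega>. \<bar>\<xi> j \<omega> * \<xi> k \<omega>\<bar>) = (expectation (\<lambda>\<omega>. \<bar>\<xi> 0 \<omega>\<bar>))\<^sup>2"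
proof -
  have "indep_var borel (\<lambda>\<omega>. (\<lambda>x. \<bar>x j\<bar>) (restrict (\<lambda>i. \<xi> i \<omega>) {j})) borel (\<lambda>\<omega>. (\<lambda>x. \<bar>x k\<bar>) (restrict (\<lambda>i. \<xi> i \<omega>) {k}))"
    using assms by (intro indep_var_blocks[OF indep]) auto
  then have iv: "indep_var borel (\<lambda>\<omega>. \<bar>\<xi> j \<omega>\<bar>) borel (\<lambda>\<omega>. \<bar>\<xi> k \<omega>\<bar>)" by simp
  have i: "integrable M (\<lambda>\<omega>. \<bar>\<xi> j \<omega>\<bar>)" for j using xi_integrable by auto
  show "integrable M (\<lambda>\<omega>. \<bar>\<xi> j \<omega> * \<xi> k \<omega>\<bar>)"
    unfolding abs_mult by (rule indep_var_integrable[OF iv i i])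
  show "expectation (\<lambda>\<omega>. \<bar>\<xi> j \<omega> * \<xi> k \<omega>\<bar>) = (expectation (\<lambda>\<omega>. \<bar>\<xi> 0 \<omega>\<bar>))\<^sup>2"
    unfolding abs_mult using indep_var_lebesgue_integral[OF iv i i] expectation_ident[of abs j] expectation_ident[of abs k]
    by (simp add: power2_eq_square)
qed

text \<open>The mean of the cosine is the mean of a product of cosines, bounded by exp (- U/2) with
  U the sum of squared symmetrized terms. U differs from 1 by the part of V^2 outside the window,
  which vanishes in the limit, and by cross terms of mean O(n), negligible against V^2 \<ge> K n for
  large K. On A the fourth-order gain of one term is subtracted.\<close>

lemma expectation_cos_S_le:
  assumes n: "n \<ge> 1" and K: "K > 0"
    and S: "AE \<omega> in M. bilateral_sums (\<lambda>j. b_coeff harm_seq n j * \<xi> j \<omega>) (S_proc \<xi> harm_seq n \<omega>)"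
    and V: "AE \<omega> in M. (\<lambda>k. (b_coeff harm_seq n k)\<^sup>2 * (\<xi> k \<omega>)\<^sup>2) summable_on UNIV"
    and A [measurable]: "A \<in> events"
    and big: "AE \<omega> in M. \<omega> \<in> A \<longrightarrow> (\<exists>j\<in>half_window n L. (sym_term n j (\<lambda>k. \<xi> k \<omega>))\<^sup>2 \<ge> 1 / 5)"
  shows "expectation (\<lambda>\<omega>. cos (S_proc \<xi> harm_seq n \<omega> / V_norm \<xi> harm_seq n \<omega>))
     \<le> exp (- 1 / 2) + prob {\<omega>\<in>space M. (V_norm \<xi> harm_seq n \<omega>)\<^sup>2 < K * real n}
        + 32 * (expectation (\<lambda>\<omega>. \<bar>\<xi> 0 \<omega>\<bar>))\<^sup>2 / K - exp (- 1) * (1 - exp (- 1 / 1200)) * prob A"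
proof -
  define b where "b = b_coeff harm_seq n"
  define y where "y j \<omega> = sym_term n j (\<lambda>k. \<xi> k \<omega>)" for j \<omega>
  define v where "v \<omega> = harm_norm n (\<lambda>k. \<xi> k \<omega>)" for \<omega>
  \<comment> \<open>1/1200 is (1/5)^2/48, the gain in the exponent from one term with square at
    least 1/5; exp (- 1) is the smallest value of exp (- U/2), as U \<le> 2.\<close>
  define c1 where "c1 = exp (- 1) * (1 - exp (- 1 / 1200 :: real))"
  define m1 where "m1 = expectation (\<lambda>\<omega>. \<bar>\<xi> 0 \<omega>\<bar>)"
  have ym [measurable]: "y j \<in> borel_measurable M" for j unfolding y_def by measurable
  have vm [measurable]: "v \<in> borel_measurable M" unfolding v_def by measurable
  have c1: "c1 \<ge> 0" by (simp add: c1_def)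
  define C where "C = {\<omega>\<in>space M. (v \<omega>)\<^sup>2 < K * real n}"
  have [measurable]: "C \<in> events" unfolding C_def by measurable
  define F where "F m \<omega> = (\<Sum>j\<in>half_window n m. y j \<omega>)" for m \<omega>
  define U where "U m \<omega> = (\<Sum>j\<in>half_window n m. (y j \<omega>)\<^sup>2)" for m \<omega>
  define P where "P m \<omega> = (\<Sum>j\<in>half_window n m. (b j)\<^sup>2 * ((\<xi> j \<omega>)\<^sup>2 + (\<xi> (- int n - j) \<omega>)\<^sup>2))" for m \<omega>
  define G where "G m \<omega> = (\<Sum>j\<in>half_window n m. (b j)\<^sup>2 * (\<xi> j \<omega> * \<xi> (- int n - j) \<omega>))" for m \<omega>
  \<comment> \<open>The fraction of V^2 lying outside the window. Paths with v = 0 belong to C, so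
    the default there does no harm.\<close>
  define T where "T m \<omega> = (if v \<omega> = 0 then 0 else 1 - P m \<omega> / (v \<omega>)\<^sup>2)" for m \<omega>
  have [measurable]: "F m \<in> borel_measurable M" "U m \<in> borel_measurable M" "P m \<in> borel_measurable M"
    "G m \<in> borel_measurable M" for m
    unfolding F_def U_def P_def G_def by measurable
  have [measurable]: "T m \<in> borel_measurable M" for m unfolding T_def by measurable
  have U: "0 \<le> U m \<omega>" "U m \<omega> \<le> 2" for m \<omega>
    unfolding U_def y_def by (auto intro!: sum_nonneg sum_sym_term_square_le)
  have P0: "0 \<le> P m \<omega>" for m \<omega> unfolding P_def by (intro sum_nonneg) auto
  have Flim: "AE \<omega> in M. (\<lambda>m. F m \<omega>) \<longlonglongrightarrow> S_proc \<xi> harm_seq n \<omega> / V_norm \<xi> harm_seq n \<omega>"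
    using S
  proof eventually_elim
    case (elim \<omega>)
    \<comment> \<open>The ends of a bilateral series are free, so the limit may be taken along
      windows invariant under the reflection.\<close>
    have "filterlim (\<lambda>m. (n + m, m)) (sequentially \<times>\<^sub>F sequentially) sequentially"
      by (intro filterlim_Pair filterlim_ident filterlim_at_top_mono[OF filterlim_ident]) auto
    from filterlim_compose[OF elim[unfolded bilateral_sums_def] this]
    have "(\<lambda>m. \<Sum>j = - int (n + m)..int m. b j * \<xi> j \<omega>) \<longlonglongrightarrow> S_proc \<xi> harm_seq n \<omega>"
      by (simp add: b_def)
    also have "(\<lambda>m. \<Sum>j = - int (n + m)..int m. b j * \<xi> j \<omega>) = (\<lambda>m. \<Sum>j\<in>half_window n m. b j * (\<xi> j \<omega> - \<xi> (- int n - j) \<omega>))"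
      by (subst sum_reflect_window) (auto simp: b_def b_coeff_harm_seq_middle b_coeff_harm_seq_reflect right_diff_distrib)
    finally have *: "(\<lambda>m. \<Sum>j\<in>half_window n m. b j * (\<xi> j \<omega> - \<xi> (- int n - j) \<omega>)) \<longlonglongrightarrow> S_proc \<xi> harm_seq n \<omega>" .
    have "F m \<omega> = inverse (v \<omega>) * (\<Sum>j\<in>half_window n m. b j * (\<xi> j \<omega> - \<xi> (- int n - j) \<omega>))" for m
      by (simp add: F_def y_def v_def sym_term_def b_def sum_distrib_left divide_inverse mult.commute)
    moreover have "S_proc \<xi> harm_seq n \<omega> / V_norm \<xi> harm_seq n \<omega> = inverse (v \<omega>) * S_proc \<xi> harm_seq n \<omega>"
      by (simp add: V_norm_eq_harm_norm v_def divide_inverse mult.commute)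
    ultimately show ?case using tendsto_mult_left[OF *, of "inverse (v \<omega>)"] by simp
  qed
  have Tlim: "AE \<omega> in M. (\<lambda>m. T m \<omega>) \<longlonglongrightarrow> 0" and Tb: "\<And>m. AE \<omega> in M. norm (T m \<omega>) \<le> 1"
  proof -
    show "AE \<omega> in M. norm (T m \<omega>) \<le> 1" for m
      using V
    proof eventually_elim
      case (elim \<omega>)
      have "P m \<omega> \<le> (v \<omega>)\<^sup>2" unfolding P_def v_def b_def by (rule sum_pairs_le_harm_norm[OF elim])
      then have "P m \<omega> / (v \<omega>)\<^sup>2 \<le> 1" if "v \<omega> \<noteq> 0" using that by simp
      moreover have "0 \<le> P m \<omega> / (v \<omega>)\<^sup>2" using P0 by simp
      ultimately show ?case by (auto simp: T_def)
    qed
    show "AE \<omega> in M. (\<lambda>m. T m \<omega>) \<longlonglongrightarrow> 0"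
      using V
    proof eventually_elim
      case (elim \<omega>)
      let ?f = "\<lambda>k. (b_coeff harm_seq n k)\<^sup>2 * (\<xi> k \<omega>)\<^sup>2"
      have Peq: "P m \<omega> = (\<Sum>j = - int (n + m)..int m. ?f j)" for m
        unfolding P_def b_def by (subst sum_reflect_window) (auto simp: b_coeff_harm_seq_middle b_coeff_harm_seq_reflect distrib_left)
      have "(\<lambda>m. P m \<omega>) \<longlonglongrightarrow> (v \<omega>)\<^sup>2"
      proof (rule real_tendsto_sandwich[where h = "\<lambda>_. (v \<omega>)\<^sup>2"])
        show "(\<lambda>m. \<Sum>j = - int m..int m. ?f j) \<longlonglongrightarrow> (v \<omega>)\<^sup>2"
          unfolding v_def harm_norm_square by (rule infsum_window[OF elim])
        show "\<forall>\<^sub>F m in sequentially. (\<Sum>j = - int m..int m. ?f j) \<le> P m \<omega>"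
          unfolding Peq by (intro always_eventually allI sum_mono2) auto
        show "\<forall>\<^sub>F m in sequentially. P m \<omega> \<le> (v \<omega>)\<^sup>2"
          unfolding P_def v_def b_def by (intro always_eventually allI sum_pairs_le_harm_norm elim)
      qed auto
      then have "(\<lambda>m. 1 - P m \<omega> / (v \<omega>)\<^sup>2) \<longlonglongrightarrow> 1 - (v \<omega>)\<^sup>2 / (v \<omega>)\<^sup>2" if "v \<omega> \<noteq> 0"
        using that by (intro tendsto_intros) auto
      then show ?case by (cases "v \<omega> = 0") (auto simp: T_def)
    qed
  qed
  have ETlim: "(\<lambda>m. expectation (T m)) \<longlonglongrightarrow> 0"
  proof -
    have "(\<lambda>m. expectation (T m)) \<longlonglongrightarrow> expectation (\<lambda>\<omega>. 0)"
      by (rule integral_dominated_convergence[where w = "\<lambda>_. 1"]) (use Tlim Tb in auto)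
    then show ?thesis by simp
  qed
  have intT: "integrable M (T m)" for m by (rule integrable_const_bound[OF Tb]) measurable
  have refl_ne: "j \<noteq> - int n - j" if "j \<in> half_window n m" for j m
    using that by (auto simp: half_window_def)
  have intG: "integrable M (\<lambda>\<omega>. \<bar>G m \<omega>\<bar>)" and EG: "expectation (\<lambda>\<omega>. \<bar>G m \<omega>\<bar>) \<le> 32 * real n * m1\<^sup>2" for m
  proof -
    have i: "integrable M (\<lambda>\<omega>. \<xi> j \<omega> * \<xi> (- int n - j) \<omega>)" if "j \<in> half_window n m" for j
      by (rule integrable_abs_cancel[OF expectation_abs_mult(1)[OF refl_ne[OF that]]]) measurable
    then show iG: "integrable M (\<lambda>\<omega>. \<bar>G m \<omega>\<bar>)" unfolding G_def by (intro integrable_abs Bochner_Integration.integrable_sum integrable_mult_right)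
    have "expectation (\<lambda>\<omega>. \<bar>G m \<omega>\<bar>) \<le> expectation (\<lambda>\<omega>. \<Sum>j\<in>half_window n m. (b j)\<^sup>2 * \<bar>\<xi> j \<omega> * \<xi> (- int n - j) \<omega>\<bar>)"
    proof (rule integral_mono[OF iG])
      show "integrable M (\<lambda>\<omega>. \<Sum>j\<in>half_window n m. (b j)\<^sup>2 * \<bar>\<xi> j \<omega> * \<xi> (- int n - j) \<omega>\<bar>)"
        using expectation_abs_mult(1)[OF refl_ne] by (intro Bochner_Integration.integrable_sum integrable_mult_right)
      show "\<bar>G m \<omega>\<bar> \<le> (\<Sum>j\<in>half_window n m. (b j)\<^sup>2 * \<bar>\<xi> j \<omega> * \<xi> (- int n - j) \<omega>\<bar>)" for \<omega>
        unfolding G_def by (rule order_trans[OF sum_abs]) (simp add: abs_mult)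
    qed
    also have "\<dots> = (\<Sum>j\<in>half_window n m. (b j)\<^sup>2 * expectation (\<lambda>\<omega>. \<bar>\<xi> j \<omega> * \<xi> (- int n - j) \<omega>\<bar>))"
      using expectation_abs_mult(1)[OF refl_ne] by (subst Bochner_Integration.integral_sum) auto
    also have "\<dots> = (\<Sum>j\<in>half_window n m. (b j)\<^sup>2 * m1\<^sup>2)"
      using expectation_abs_mult(2)[OF refl_ne] by (intro sum.cong) (auto simp: m1_def)
    also have "\<dots> = (\<Sum>j\<in>half_window n m. (b j)\<^sup>2) * m1\<^sup>2" by (simp add: sum_distrib_right)
    also have "\<dots> \<le> 32 * real n * m1\<^sup>2"
      unfolding b_def by (intro mult_right_mono sum_square_b_coeff_harm_seq n) auto
    finally show "expectation (\<lambda>\<omega>. \<bar>G m \<omega>\<bar>) \<le> 32 * real n * m1\<^sup>2" .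
  qed
  have step: "expectation (\<lambda>\<omega>. cos (F m \<omega>))
     \<le> exp (- 1 / 2) + (expectation (T m) + 64 * m1\<^sup>2 / K + prob C) / 2 - c1 * prob A" if m: "m \<ge> L" for m
  proof -
    let ?h = "half_window n m"
    have hw: "- int n < 2 * j" if "j \<in> ?h" for j using that by (simp add: half_window_def)
    have prodb: "0 \<le> (\<Prod>j\<in>?h. cos (y j \<omega>))" "(\<Prod>j\<in>?h. cos (y j \<omega>)) \<le> exp (- U m \<omega> / 2 - (\<Sum>j\<in>?h. y j \<omega> ^ 4) / 48)" for \<omega>
    proof -
      have c: "0 \<le> cos (y j \<omega>)" "cos (y j \<omega>) \<le> exp (- (y j \<omega>)\<^sup>2 / 2 - y j \<omega> ^ 4 / 48)" if "j \<in> ?h" for j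
        using cos_le_exp[of "y j \<omega>"] sym_term_square_le[OF hw[OF that]] by (auto simp: y_def)
      show "0 \<le> (\<Prod>j\<in>?h. cos (y j \<omega>))" using c by (intro prod_nonneg) auto
      have "(\<Prod>j\<in>?h. cos (y j \<omega>)) \<le> (\<Prod>j\<in>?h. exp (- (y j \<omega>)\<^sup>2 / 2 - y j \<omega> ^ 4 / 48))"
        using c by (intro prod_mono) auto
      also have "\<dots> = exp (\<Sum>j\<in>?h. - (y j \<omega>)\<^sup>2 / 2 - y j \<omega> ^ 4 / 48)" by (simp add: exp_sum)
      also have "(\<Sum>j\<in>?h. - (y j \<omega>)\<^sup>2 / 2 - y j \<omega> ^ 4 / 48) = - U m \<omega> / 2 - (\<Sum>j\<in>?h. y j \<omega> ^ 4) / 48"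
        by (simp add: U_def sum_subtractf sum_divide_distrib sum_negf)
      finally show "(\<Prod>j\<in>?h. cos (y j \<omega>)) \<le> exp (- U m \<omega> / 2 - (\<Sum>j\<in>?h. y j \<omega> ^ 4) / 48)" .
    qed
    have y4: "0 \<le> (\<Sum>j\<in>?h. y j \<omega> ^ 4)" for \<omega> by (intro sum_nonneg) simp
    have gain: "AE \<omega> in M. (\<Prod>j\<in>?h. cos (y j \<omega>)) \<le> exp (- U m \<omega> / 2) - c1 * indicator A \<omega>"
      using big
    proof eventually_elim
      case (elim \<omega>)
      show ?case
      proof (cases "\<omega> \<in> A")
        case True
        then obtain j where j: "j \<in> half_window n L" "(y j \<omega>)\<^sup>2 \<ge> 1 / 5" using elim by (auto simp: y_def)
        then have jm: "j \<in> ?h" using m by (auto simp: half_window_def)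
        have "1 / 25 \<le> y j \<omega> ^ 4"
        proof -
          have "(1 / 5)\<^sup>2 \<le> ((y j \<omega>)\<^sup>2)\<^sup>2" using j by (intro power_mono) auto
          then show ?thesis by (simp add: power_divide flip: power_mult)
        qed
        also have "\<dots> \<le> (\<Sum>j\<in>?h. y j \<omega> ^ 4)" using jm by (intro member_le_sum) auto
        finally have "exp (- U m \<omega> / 2 - (\<Sum>j\<in>?h. y j \<omega> ^ 4) / 48) \<le> exp (- U m \<omega> / 2 + - 1 / 1200)" by simp
        also have "\<dots> = exp (- U m \<omega> / 2) - exp (- U m \<omega> / 2) * (1 - exp (- 1 / 1200))"
          by (simp only: exp_add) (simp add: algebra_simps)
        also have "\<dots> \<le> exp (- U m \<omega> / 2) - c1"
        proof -
          have "exp (- 1) \<le> exp (- U m \<omega> / 2)" using U(2)[of m \<omega>] by simp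
          then have "c1 \<le> exp (- U m \<omega> / 2) * (1 - exp (- 1 / 1200))"
            unfolding c1_def by (intro mult_right_mono) auto
          then show ?thesis by simp
        qed
        finally show ?thesis using True prodb(2)[of \<omega>] by simp
      next
        case False
        have "exp (- U m \<omega> / 2 - (\<Sum>j\<in>?h. y j \<omega> ^ 4) / 48) \<le> exp (- U m \<omega> / 2)" using y4[of \<omega>] by simp
        with prodb(2)[of \<omega>] have "(\<Prod>j\<in>?h. cos (y j \<omega>)) \<le> exp (- U m \<omega> / 2)" by (rule order_trans)
        then show ?thesis using False by simp
      qed
    qed
    \<comment> \<open>Expanding the squares gives 1 - U = T + 2 G / v^2. Off C the denominator is at
      least K n; on C the bound |1 - U| \<le> 1 is paid for by the indicator.\<close>
    have Ubound: "AE \<omega> in M. exp (- U m \<omega> / 2) \<le> exp (- 1 / 2) + (T m \<omega> + 2 / (K * real n) * \<bar>G m \<omega>\<bar> + indicator C \<omega>) / 2"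
      using V Tb[of m] AE_space
    proof eventually_elim
      case (elim \<omega>)
      have e1: "exp (- (U m \<omega> / 2)) \<le> exp (- (1 / 2)) + \<bar>1 / 2 - U m \<omega> / 2\<bar>"
        using U by (intro exp_minus_lipschitz) auto
      have e2: "\<bar>1 - U m \<omega>\<bar> \<le> T m \<omega> + 2 / (K * real n) * \<bar>G m \<omega>\<bar> + indicator C \<omega>"
      proof -
        have Kn: "K * real n > 0" using K n by simp
        have T0: "T m \<omega> \<ge> 0"
        proof -
          have "P m \<omega> \<le> (v \<omega>)\<^sup>2" unfolding P_def v_def b_def by (rule sum_pairs_le_harm_norm[OF elim(1)])
          then show ?thesis by (auto simp: T_def)
        qed
        have g0: "0 \<le> 2 / (K * real n) * \<bar>G m \<omega>\<bar>" using Kn by (intro mult_nonneg_nonneg) auto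
        show ?thesis
        proof (cases "\<omega> \<in> C")
          case True
          have "\<bar>1 - U m \<omega>\<bar> \<le> 1" using U[of m \<omega>] by linarith
          then show ?thesis using True T0 g0 by simp
        next
          case False
          then have vK: "K * real n \<le> (v \<omega>)\<^sup>2" using elim(3) by (auto simp: C_def)
          then have v0: "(v \<omega>)\<^sup>2 > 0" "v \<omega> \<noteq> 0" using Kn by auto
          have "U m \<omega> = (\<Sum>j\<in>?h. (b j)\<^sup>2 * (\<xi> j \<omega> - \<xi> (- int n - j) \<omega>)\<^sup>2) / (v \<omega>)\<^sup>2"
            by (simp add: U_def y_def sym_term_def b_def v_def power_divide power_mult_distrib sum_divide_distrib)
          also have "(\<Sum>j\<in>?h. (b j)\<^sup>2 * (\<xi> j \<omega> - \<xi> (- int n - j) \<omega>)\<^sup>2) = P m \<omega> - 2 * G m \<omega>"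
            by (simp add: P_def G_def power2_diff sum_distrib_left sum_subtractf[symmetric] algebra_simps)
          finally have "1 - U m \<omega> = T m \<omega> + 2 * (G m \<omega> / (v \<omega>)\<^sup>2)" using v0 by (simp add: T_def diff_divide_distrib)
          then have "\<bar>1 - U m \<omega>\<bar> \<le> T m \<omega> + 2 * \<bar>G m \<omega> / (v \<omega>)\<^sup>2\<bar>" using T0 by linarith
          also have "\<bar>G m \<omega> / (v \<omega>)\<^sup>2\<bar> = \<bar>G m \<omega>\<bar> / (v \<omega>)\<^sup>2" by (simp add: abs_divide)
          also have "\<dots> \<le> \<bar>G m \<omega>\<bar> / (K * real n)" by (rule divide_left_mono[OF vK abs_ge_zero mult_pos_pos[OF v0(1) Kn]])
          finally show ?thesis using False by simp
        qed
      qed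
      have e3: "\<bar>1 / 2 - U m \<omega> / 2\<bar> = \<bar>1 - U m \<omega>\<bar> / 2"
        by (simp only: diff_divide_distrib[symmetric] abs_divide abs_numeral)
      have e4: "- U m \<omega> / 2 = - (U m \<omega> / 2)" "- 1 / 2 = - (1 / 2 :: real)" by simp_all
      show ?case unfolding e4
        by (rule order_trans[OF e1[unfolded e3] add_left_mono[OF divide_right_mono[OF e2]]]) simp
    qed
    have iC: "integrable M (indicator C :: _ \<Rightarrow> real)" "integrable M (indicator A :: _ \<Rightarrow> real)"
      by (auto intro!: integrable_const_bound[where B = 1])
    have "expectation (\<lambda>\<omega>. cos (F m \<omega>)) = expectation (\<lambda>\<omega>. \<Prod>j\<in>?h. cos (y j \<omega>))"
      using expectation_cos_sum_sym_term[of ?h "{}" n] hw by (simp add: F_def y_def)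
    also have "\<dots> \<le> expectation (\<lambda>\<omega>. exp (- 1 / 2) + (T m \<omega> + 2 / (K * real n) * \<bar>G m \<omega>\<bar> + indicator C \<omega>) / 2 - c1 * indicator A \<omega>)"
    proof (rule integral_mono_AE)
      show "integrable M (\<lambda>\<omega>. \<Prod>j\<in>?h. cos (y j \<omega>))"
        by (rule integrable_const_bound[where B = 1]) (auto simp: abs_prod intro!: prod_le_1)
      show "integrable M (\<lambda>\<omega>. exp (- 1 / 2) + (T m \<omega> + 2 / (K * real n) * \<bar>G m \<omega>\<bar> + indicator C \<omega>) / 2 - c1 * indicator A \<omega>)"
        using intT intG iC by auto
      show "AE \<omega> in M. (\<Prod>j\<in>?h. cos (y j \<omega>)) \<le> exp (- 1 / 2) + (T m \<omega> + 2 / (K * real n) * \<bar>G m \<omega>\<bar> + indicator C \<omega>) / 2 - c1 * indicator A \<omega>"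
        using gain Ubound by eventually_elim linarith
    qed
    also have "\<dots> = exp (- 1 / 2) + (expectation (T m) + 2 / (K * real n) * expectation (\<lambda>\<omega>. \<bar>G m \<omega>\<bar>) + prob C) / 2 - c1 * prob A"
      using intT intG iC by (simp add: prob_space)
    also have "2 / (K * real n) * expectation (\<lambda>\<omega>. \<bar>G m \<omega>\<bar>) \<le> 2 / (K * real n) * (32 * real n * m1\<^sup>2)"
      using K by (intro mult_left_mono EG) auto
    also have "\<dots> = 64 * m1\<^sup>2 / K" using K n by (simp add: field_simps)
    finally show ?thesis by simp
  qed
  have "(\<lambda>m. expectation (\<lambda>\<omega>. cos (F m \<omega>))) \<longlonglongrightarrow> expectation (\<lambda>\<omega>. cos (S_proc \<xi> harm_seq n \<omega> / V_norm \<xi> harm_seq n \<omega>))"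
  proof (rule integral_dominated_convergence[where w = "\<lambda>_. 1"])
    show "AE \<omega> in M. (\<lambda>m. cos (F m \<omega>)) \<longlonglongrightarrow> cos (S_proc \<xi> harm_seq n \<omega> / V_norm \<xi> harm_seq n \<omega>)"
      using Flim by eventually_elim (rule tendsto_cos)
  qed auto
  moreover have "(\<lambda>m. exp (- 1 / 2) + (expectation (T m) + 64 * m1\<^sup>2 / K + prob C) / 2 - c1 * prob A)
      \<longlonglongrightarrow> exp (- 1 / 2) + (0 + 64 * m1\<^sup>2 / K + prob C) / 2 - c1 * prob A"
    by (intro tendsto_intros ETlim) auto
  ultimately have le: "expectation (\<lambda>\<omega>. cos (S_proc \<xi> harm_seq n \<omega> / V_norm \<xi> harm_seq n \<omega>))
      \<le> exp (- 1 / 2) + (0 + 64 * m1\<^sup>2 / K + prob C) / 2 - c1 * prob A"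
    by (rule LIMSEQ_le) (use step in blast)
  have half: "(0 + 64 * z / K + p) / 2 \<le> p + 32 * z / K" if "0 \<le> p" for z p :: real
    using that by (simp add: add_divide_distrib)
  have "expectation (\<lambda>\<omega>. cos (S_proc \<xi> harm_seq n \<omega> / V_norm \<xi> harm_seq n \<omega>))
      \<le> exp (- 1 / 2) + prob C + 32 * m1\<^sup>2 / K - c1 * prob A"
    using le half[OF measure_nonneg[of M C], of "m1\<^sup>2"] by linarith
  then show ?thesis unfolding c1_def m1_def C_def v_def V_norm_eq_harm_norm .
qed

text \<open>On 1..n the coefficients are at least 1/2, so V^2 is at least a quarter of a sum of n
  independent squares. By infinite variance a level x exists at which the Laplace transform of one
  square beats the required exponent 4K, and an exponential Markov bound decays
  geometrically.\<close>

lemma prob_V_norm_small: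
  assumes V: "\<And>n. n \<ge> 1 \<Longrightarrow> AE \<omega> in M. (\<lambda>k. (b_coeff harm_seq n k)\<^sup>2 * (\<xi> k \<omega>)\<^sup>2) summable_on UNIV"
    and K: "K > 0"
  shows "(\<lambda>n. prob {\<omega>\<in>space M. (V_norm \<xi> harm_seq n \<omega>)\<^sup>2 < K * real n}) \<longlonglongrightarrow> 0"
proof -
  have "eventually (\<lambda>x. H0 x \<ge> 2 * (4 * K + 1) \<and> x > 0) at_top"
    using H0_filterlim by (intro eventually_conj) (auto simp: filterlim_at_top eventually_gt_at_top)
  then obtain x where x: "H0 x \<ge> 2 * (4 * K + 1)" "x > 0" by (auto simp: eventually_at_top_linorder)
  define l where "l = 1 / x\<^sup>2"
  have l: "l > 0" using x by (simp add: l_def)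
  have ie: "integrable M (\<lambda>\<omega>. exp (- l * (\<xi> k \<omega>)\<^sup>2))" for k
    using l by (intro integrable_const_bound[where B = 1]) auto
  define q where "q = expectation (\<lambda>\<omega>. exp (- l * (\<xi> 0 \<omega>)\<^sup>2))"
  have q0: "q \<ge> 0" unfolding q_def by (intro Bochner_Integration.integral_nonneg) simp
  have "q \<le> expectation (\<lambda>\<omega>. 1 - l / 2 * ((\<xi> 0 \<omega>)\<^sup>2 * indicator {\<omega>. \<bar>\<xi> 0 \<omega>\<bar> \<le> x} \<omega>))"
    unfolding q_def
  proof (rule integral_mono[OF ie])
    show "integrable M (\<lambda>\<omega>. 1 - l / 2 * ((\<xi> 0 \<omega>)\<^sup>2 * indicator {\<omega>. \<bar>\<xi> 0 \<omega>\<bar> \<le> x} \<omega>))"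
      by (intro Bochner_Integration.integrable_diff integrable_mult_right integrable_trunc) simp
    fix \<omega>
    show "exp (- l * (\<xi> 0 \<omega>)\<^sup>2) \<le> 1 - l / 2 * ((\<xi> 0 \<omega>)\<^sup>2 * indicator {\<omega>. \<bar>\<xi> 0 \<omega>\<bar> \<le> x} \<omega>)"
    proof (cases "\<bar>\<xi> 0 \<omega>\<bar> \<le> x")
      case True
      define s where "s = l * (\<xi> 0 \<omega>)\<^sup>2"
      have "(\<xi> 0 \<omega>)\<^sup>2 \<le> x\<^sup>2" using True x by (simp add: abs_le_square_iff[symmetric])
      then have s: "0 \<le> s" "s \<le> 1" using l x by (auto simp: s_def l_def field_simps)
      have "exp (- s) \<le> 1 / (1 + s)"
        using exp_ge_add_one_self[of s] s by (simp add: exp_minus inverse_eq_divide frac_le)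
      also have "1 / (1 + s) \<le> 1 - s / 2"
      proof -
        have "s * s \<le> 1 * s" using s by (intro mult_right_mono) auto
        then have "1 \<le> (1 - s / 2) * (1 + s)" by (simp add: algebra_simps)
        then show ?thesis using s by (simp add: divide_le_eq)
      qed
      finally show ?thesis using True by (simp add: s_def)
    qed (use l in simp)
  qed
  also have "\<dots> = 1 - l / 2 * H0 x"
    unfolding trunc_moment_def
    by (subst Bochner_Integration.integral_diff) (auto intro!: integrable_mult_right integrable_trunc simp: prob_space)
  also have "\<dots> \<le> 1 - l * (4 * K + 1)"
    using mult_left_mono[OF x(1), of "l / 2"] l by simp
  also have "\<dots> \<le> exp (- (l * (4 * K + 1)))" using exp_ge_add_one_self[of "- (l * (4 * K + 1))"] by simp
  finally have q: "q \<le> exp (- (l * (4 * K + 1)))" .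
  have bound: "prob {\<omega>\<in>space M. (V_norm \<xi> harm_seq n \<omega>)\<^sup>2 < K * real n} \<le> exp (- l) ^ n" if n: "n \<ge> 1" for n
  proof -
    let ?E = "\<lambda>\<omega>. \<Prod>k = 1..int n. exp (- l * (\<xi> k \<omega>)\<^sup>2)"
    have ind: "indep_vars (\<lambda>_. borel) (\<lambda>k \<omega>. exp (- l * (\<xi> k \<omega>)\<^sup>2)) {1..int n}"
      by (rule indep_vars_compose2[OF indep_vars_subset[OF indep subset_UNIV], where Y = "\<lambda>k u. exp (- l * u\<^sup>2)"]) measurable
    have iE: "integrable M ?E" by (rule indep_vars_integrable[OF _ ind ie]) auto
    have "expectation ?E = (\<Prod>k = 1..int n. expectation (\<lambda>\<omega>. exp (- l * (\<xi> k \<omega>)\<^sup>2)))"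
      by (rule indep_vars_lebesgue_integral[OF _ ind ie]) auto
    also have "\<dots> = (\<Prod>k = 1..int n. q)"
    proof (rule prod.cong[OF refl])
      fix k show "expectation (\<lambda>\<omega>. exp (- l * (\<xi> k \<omega>)\<^sup>2)) = q"
        unfolding q_def by (rule expectation_ident[of "\<lambda>u. exp (- l * u\<^sup>2)"]) measurable
    qed
    finally have EE: "expectation ?E = q ^ n" by simp
    have "prob {\<omega>\<in>space M. (V_norm \<xi> harm_seq n \<omega>)\<^sup>2 < K * real n} \<le> prob {\<omega>\<in>space M. ?E \<omega> \<ge> exp (- (4 * l * K * real n))}"
    proof (rule finite_measure_mono_AE)
      show "AE \<omega> in M. \<omega> \<in> {\<omega>\<in>space M. (V_norm \<xi> harm_seq n \<omega>)\<^sup>2 < K * real n} \<longrightarrow> \<omega> \<in> {\<omega>\<in>space M. ?E \<omega> \<ge> exp (- (4 * l * K * real n))}"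
        using V[OF n]
      proof eventually_elim
        case (elim \<omega>)
        have "(\<Sum>k = 1..int n. (\<xi> k \<omega>)\<^sup>2) = 4 * (\<Sum>k = 1..int n. (1 / 2)\<^sup>2 * (\<xi> k \<omega>)\<^sup>2)"
          by (simp add: sum_distrib_left power2_eq_square)
        also have "\<dots> \<le> 4 * (\<Sum>k = 1..int n. (b_coeff harm_seq n k)\<^sup>2 * (\<xi> k \<omega>)\<^sup>2)"
          by (intro mult_left_mono sum_mono mult_right_mono power_mono b_coeff_harm_seq_ge_half) auto
        also have "\<dots> \<le> 4 * (V_norm \<xi> harm_seq n \<omega>)\<^sup>2"
          unfolding V_norm_eq_harm_norm harm_norm_square by (intro mult_left_mono sum_le_infsum elim) auto
        finally have "l * (\<Sum>k = 1..int n. (\<xi> k \<omega>)\<^sup>2) \<le> l * (4 * (V_norm \<xi> harm_seq n \<omega>)\<^sup>2)"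
          using l by (intro mult_left_mono) auto
        moreover have "?E \<omega> = exp (- (l * (\<Sum>k = 1..int n. (\<xi> k \<omega>)\<^sup>2)))"
          by (simp add: exp_sum[symmetric] sum_distrib_left sum_negf)
        ultimately have Ege: "exp (- (l * (4 * (V_norm \<xi> harm_seq n \<omega>)\<^sup>2))) \<le> ?E \<omega>" by simp
        show ?case
        proof
          assume w: "\<omega> \<in> {\<omega>\<in>space M. (V_norm \<xi> harm_seq n \<omega>)\<^sup>2 < K * real n}"
          then have "4 * l * (V_norm \<xi> harm_seq n \<omega>)\<^sup>2 \<le> 4 * l * (K * real n)" using l by (intro mult_left_mono) auto
          then have "exp (- (4 * l * K * real n)) \<le> exp (- (l * (4 * (V_norm \<xi> harm_seq n \<omega>)\<^sup>2)))"
            by (simp add: mult.assoc mult.left_commute)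
          then have "exp (- (4 * l * K * real n)) \<le> ?E \<omega>" using Ege by (rule order_trans)
          then show "\<omega> \<in> {\<omega>\<in>space M. ?E \<omega> \<ge> exp (- (4 * l * K * real n))}" using w by (simp only: mem_Collect_eq)
        qed
      qed
    qed measurable
    also have "\<dots> \<le> expectation ?E / exp (- (4 * l * K * real n))"
      by (rule prob_ge_le_expectation[OF iE]) (auto intro!: prod_nonneg)
    also have "\<dots> \<le> exp (- (l * (4 * K + 1))) ^ n / exp (- (4 * l * K * real n))"
      unfolding EE using q q0 by (intro divide_right_mono power_mono) auto
    also have "\<dots> = exp (- l) ^ n"
      by (simp add: exp_of_nat_mult[symmetric] exp_diff[symmetric] algebra_simps)
    finally show ?thesis .
  qed
  show ?thesis
  proof (rule real_tendsto_sandwich[where f = "\<lambda>_. 0"])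
    show "\<forall>\<^sub>F n in sequentially. prob {\<omega>\<in>space M. (V_norm \<xi> harm_seq n \<omega>)\<^sup>2 < K * real n} \<le> exp (- l) ^ n"
      using bound by (auto simp: eventually_sequentially)
    show "(\<lambda>n. exp (- l) ^ n) \<longlonglongrightarrow> 0" using l by (intro LIMSEQ_power_zero) auto
  qed auto
qed

end

subsection \<open>The converse for self-normalization\<close>

text \<open>Roughly y - n integers from n onwards lie below y, and this is at least y/2 once y >
  2n.\<close>

lemma card_interval_ge:
  fixes y :: real
  assumes "2 * real n < y" "y \<le> real L"
  shows "y / 2 \<le> (\<Sum>j = n..L. if real j < y then 1 else 0)"
proof -
  have "y - real n \<le> real (nat \<lceil>y\<rceil> - n)" using assms by linarith
  also have "\<dots> = (\<Sum>j\<in>{n..<nat \<lceil>y\<rceil>}. if real j < y then 1 else 0)"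
  proof -
    have "real j < y" if "j \<in> {n..<nat \<lceil>y\<rceil>}" for j using that by (simp add: less_ceiling_iff nat_less_iff) linarith
    then show ?thesis by simp
  qed
  also have "\<dots> \<le> (\<Sum>j = n..L. if real j < y then 1 else 0)"
  proof (rule sum_mono2)
    have "nat \<lceil>y\<rceil> \<le> L" using assms by linarith
    then show "{n..<nat \<lceil>y\<rceil>} \<subseteq> {n..L}"
      by (meson atLeastLessThan_iff atLeastAtMost_iff less_imp_le less_le_trans subsetI)
  qed auto
  finally show ?thesis using assms by linarith
qed

text \<open>Term j uses up 1 of the total 5/4, so the other squared terms sum to at most x^2/4.
  Hence V^2 is at most 5/4 of the square of term j, its reflected partner is at most half as large,
  and the difference has square at least a quarter: (1/4)/(5/4) = 1/5.\<close>

lemma sym_term_square_ge: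
  assumes s: "(\<lambda>k. (b_coeff harm_seq n k)\<^sup>2 * (z k)\<^sup>2) summable_on UNIV"
    and x: "x > 0" and n: "n \<ge> 1" and j: "j \<ge> 1" and big: "\<bar>b_coeff harm_seq n j * z j\<bar> > x"
    and Y: "(\<Sum>\<^sub>\<infinity>k. min ((b_coeff harm_seq n k * (z k / x))\<^sup>2) 1) < 5 / 4"
  shows "(sym_term n j z)\<^sup>2 \<ge> 1 / 5"
proof -
  define b where "b = b_coeff harm_seq n"
  define e where "e k = (b k * z k)\<^sup>2" for k
  define q where "q k = min ((b k * (z k / x))\<^sup>2) 1" for k
  have qe: "q k = min (e k / x\<^sup>2) 1" for k by (simp add: q_def e_def power_divide)
  have se: "e summable_on UNIV" using s by (simp add: e_def[abs_def] b_def power_mult_distrib)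
  have sq: "q summable_on UNIV"
  proof (rule summable_on_le)
    show "(\<lambda>k. e k * (1 / x\<^sup>2)) summable_on UNIV" by (rule summable_on_cmult_left[OF se])
  qed (auto simp: qe e_def)
  have Yq: "infsum q UNIV < 5 / 4" using Y unfolding q_def[abs_def] b_def .
  have "x\<^sup>2 < \<bar>b j * z j\<bar>\<^sup>2" using big x by (intro power_strict_mono) (auto simp: b_def)
  then have ej: "x\<^sup>2 < e j" by (simp add: e_def)
  then have qj: "q j = 1" using x by (simp add: qe)
  have rest: "sum e J \<le> x\<^sup>2 / 4" if J: "finite J" "j \<notin> J" for J
  proof -
    have le: "sum q K < 1 / 4" if K: "finite K" "K \<subseteq> J" for K
    proof -
      have "sum q (insert j K) \<le> infsum q UNIV" using K sq by (intro sum_le_infsum) (auto simp: q_def)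
      moreover have "sum q (insert j K) = 1 + sum q K" using K J qj by (subst sum.insert) auto
      ultimately show ?thesis using Yq by linarith
    qed
    have "q k = e k / x\<^sup>2" if "k \<in> J" for k using le[of "{k}"] that by (auto simp: qe min_def split: if_splits)
    then have "sum e J / x\<^sup>2 < 1 / 4" using le[of J] J by (simp add: sum_divide_distrib)
    then show ?thesis using x by (simp add: divide_less_eq)
  qed
  have V: "(harm_norm n z)\<^sup>2 = infsum e UNIV"
    by (simp add: harm_norm_square e_def[abs_def] b_def power_mult_distrib)
  have Vle: "(harm_norm n z)\<^sup>2 \<le> e j + x\<^sup>2 / 4"
    unfolding V
  proof (rule summable_on_window(2))
    fix m
    have "(\<Sum>k = - int m..int m. e k) \<le> sum e (insert j ({- int m..int m} - {j}))" by (rule sum_mono2) (auto simp: e_def)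
    also have "\<dots> = e j + sum e ({- int m..int m} - {j})" by (subst sum.insert) auto
    also have "\<dots> \<le> e j + x\<^sup>2 / 4" using rest[of "{- int m..int m} - {j}"] by simp
    finally show "(\<Sum>k = - int m..int m. e k) \<le> e j + x\<^sup>2 / 4" .
  qed (simp add: e_def)
  have "sum e {j} \<le> infsum e UNIV" using se by (intro sum_le_infsum) (auto simp: e_def)
  then have "e j \<le> (harm_norm n z)\<^sup>2" unfolding V by simp
  then have Vpos: "(harm_norm n z)\<^sup>2 > 0" using ej zero_le_power2[of x] by linarith
  have "sum e {- int n - j} \<le> x\<^sup>2 / 4" using j by (intro rest) auto
  then have "(b j * z (- int n - j))\<^sup>2 \<le> e j / 4"
    using ej by (simp add: e_def b_def b_coeff_harm_seq_reflect power_mult_distrib)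
  also have "\<dots> = (\<bar>b j * z j\<bar> / 2)\<^sup>2" by (simp add: e_def power_divide)
  finally have "\<bar>b j * z (- int n - j)\<bar> \<le> \<bar>b j * z j\<bar> / 2"
    by (simp add: abs_le_square_iff[symmetric])
  then have "\<bar>b j * z j\<bar> / 2 \<le> \<bar>b j * z j - b j * z (- int n - j)\<bar>" by linarith
  then have "(\<bar>b j * z j\<bar> / 2)\<^sup>2 \<le> \<bar>b j * z j - b j * z (- int n - j)\<bar>\<^sup>2" by (intro power_mono) auto
  then have num: "e j / 4 \<le> (b j * (z j - z (- int n - j)))\<^sup>2" by (simp add: e_def power_divide right_diff_distrib)
  have "1 / 5 * (harm_norm n z)\<^sup>2 \<le> e j / 4" using Vle ej by linarith
  also note num
  finally have "1 / 5 \<le> (b j * (z j - z (- int n - j)))\<^sup>2 / (harm_norm n z)\<^sup>2"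
    using Vpos by (simp add: le_divide_eq)
  then show ?thesis by (simp add: sym_term_def b_def power_divide)
qed

context iid_seq
begin

text \<open>Let \<open>B j\<close> be the event that term j exceeds x. Independently of it, the
  capped squares of the other terms have mean at most 1/8, so with conditional probability at least
  1/2 they sum to less than 1/4, as \<open>sym_term_square_ge\<close> needs. The resulting events
  are disjoint in j, so their probabilities add up, and n \<le> j \<le> L already contribute a
  multiple of (n/x) \<open>tail (4 * x)\<close>.\<close>

lemma big_jump_event:
  assumes n: "n \<ge> 1" and x: "x > 0" and small: "32 * real n * Q (1 / x) \<le> 1 / 8"
    and V: "AE \<omega> in M. (\<lambda>k. (b_coeff harm_seq n k)\<^sup>2 * (\<xi> k \<omega>)\<^sup>2) summable_on UNIV"
  shows "\<exists>A L. A \<in> events \<and> prob A \<ge> real n / (16 * x) * tail (4 * x) \<and>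
    (AE \<omega> in M. \<omega> \<in> A \<longrightarrow> (\<exists>j\<in>half_window n L. (sym_term n j (\<lambda>k. \<xi> k \<omega>))\<^sup>2 \<ge> 1 / 5))"
proof (cases "tail (4 * x) = 0")
  case True
  then show ?thesis by (intro exI[of _ "{}"]) auto
next
  case False
  then have tpos: "tail (4 * x) > 0" using tail_nonneg[of "4 * x"] by simp
  have "filterlim (\<lambda>L::nat. 2 * x / real n * real L) at_top sequentially"
    using x n by (intro filterlim_tendsto_pos_mult_at_top[OF tendsto_const _ filterlim_real_sequentially]) auto
  \<comment> \<open>L cuts the union down to finitely many j at the cost of half the tail
    moment.\<close>
  from order_tendstoD(2)[OF tail_tendsto[OF this], of "tail (4 * x) / 2"]
  obtain L where L: "tail (2 * x / real n * real L) < tail (4 * x) / 2"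
    using tpos by (auto simp: eventually_sequentially)
  define b where "b = b_coeff harm_seq n"
  define q where "q i \<omega> = min ((b i * (\<xi> i \<omega> / x))\<^sup>2) 1" for i \<omega>
  define Y where "Y \<omega> = (\<Sum>\<^sub>\<infinity>i. q i \<omega>)" for \<omega>
  have [measurable]: "q i \<in> borel_measurable M" for i unfolding q_def by measurable
  have q0: "0 \<le> q i \<omega>" "q i \<omega> \<le> 1" for i \<omega> by (auto simp: q_def)
  have [measurable]: "Y \<in> borel_measurable M" unfolding Y_def by (rule infsum_measurable_int) (use q0 in auto)
  have iq: "integrable M (q i)" for i by (rule integrable_const_bound[where B = 1]) (use q0 in auto)
  define \<rho> where "\<rho> = 32 * real n * Q (1 / x)"
  have Eq: "(\<Sum>i\<in>J. expectation (q i)) \<le> \<rho>" if J: "finite J" for J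
  proof -
    have "expectation (q i) = expectation (\<lambda>\<omega>. min ((b i * (\<xi> 0 \<omega> / x))\<^sup>2) 1)" for i
      unfolding q_def by (rule expectation_ident[of "\<lambda>u. min ((b i * (u / x))\<^sup>2) 1"]) measurable
    moreover have i0: "integrable M (\<lambda>\<omega>. min ((b i * (\<xi> 0 \<omega> / x))\<^sup>2) 1)" for i
      by (rule integrable_const_bound[where B = 1]) auto
    ultimately have "(\<Sum>i\<in>J. expectation (q i)) = expectation (\<lambda>\<omega>. \<Sum>i\<in>J. min ((b i * (\<xi> 0 \<omega> / x))\<^sup>2) 1)" by simp
    also have "\<dots> \<le> expectation (\<lambda>\<omega>. 32 * real n * qf (1 / x * \<xi> 0 \<omega>))"
    proof (rule integral_mono)
      show "(\<Sum>i\<in>J. min ((b i * (\<xi> 0 \<omega> / x))\<^sup>2) 1) \<le> 32 * real n * qf (1 / x * \<xi> 0 \<omega>)" for \<omega>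
        using sum_min_b_coeff_harm_seq[OF n J, of "\<xi> 0 \<omega> / x"] by (simp add: b_def)
    qed (use i0 integrable_qf[of "1 / x"] in auto)
    also have "\<dots> = \<rho>" by (simp add: \<rho>_def Q_def)
    finally show ?thesis .
  qed
  define B where "B j = {\<omega>\<in>space M. \<bar>b j * \<xi> j \<omega>\<bar> > x}" for j
  have [measurable]: "B j \<in> events" for j unfolding B_def by measurable
  obtain N where N: "N \<in> null_sets M" "\<And>\<omega>. \<omega> \<in> space M - N \<Longrightarrow> (\<lambda>k. (b k)\<^sup>2 * (\<xi> k \<omega>)\<^sup>2) summable_on UNIV"
    using AE_E3[OF V] unfolding b_def by blast
  have [measurable]: "N \<in> events" using N(1) by auto
  have sumq: "(\<lambda>i. q i \<omega>) summable_on UNIV" if "\<omega> \<in> space M - N" for \<omega>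
  proof (rule summable_on_le)
    show "(\<lambda>k. (b k)\<^sup>2 * (\<xi> k \<omega>)\<^sup>2 * (1 / x\<^sup>2)) summable_on UNIV" by (rule summable_on_cmult_left[OF N(2)[OF that]])
  qed (auto simp: q_def power_mult_distrib power_divide)
  have qB: "q j \<omega> = 1" if "\<omega> \<in> B j" for j \<omega>
  proof -
    have "x\<^sup>2 < \<bar>b j * \<xi> j \<omega>\<bar>\<^sup>2" using that x by (intro power_strict_mono) (auto simp: B_def)
    then show ?thesis using x by (simp add: q_def power_divide power_mult_distrib)
  qed
  \<comment> \<open>The null set N is removed so that the weighted squares are summable at every
    point of \<open>A j\<close>, and not merely almost everywhere.\<close>
  define A where "A j = (B j \<inter> {\<omega>\<in>space M. Y \<omega> < 5 / 4}) - N" for j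
  have [measurable]: "A j \<in> events" for j unfolding A_def by measurable
  have PA: "prob (B j) / 2 \<le> prob (A j)" for j
  proof -
    \<comment> \<open>Finite versions of the contribution of the terms other than j on
      \<open>B j\<close>; independence factors their means, and Fatou carries the bound to the full
      series.\<close>
    define X where "X m \<omega> = (\<Sum>i\<in>{- int m..int m} - {j}. indicator (B j) \<omega> * q i \<omega>)" for m \<omega>
    have iind: "indep_var borel (indicator (B j) :: _ \<Rightarrow> real) borel (q i)" if "i \<noteq> j" for i
    proof -
      have "indep_var borel (\<lambda>\<omega>. (\<lambda>z. indicator {y. \<bar>b j * y\<bar> > x} (z j)) (restrict (\<lambda>k. \<xi> k \<omega>) {j}) :: real)
         borel (\<lambda>\<omega>. (\<lambda>z. min ((b i * (z i / x))\<^sup>2) 1) (restrict (\<lambda>k. \<xi> k \<omega>) {i}))"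
        using that by (intro indep_var_blocks[OF indep]) auto
      then have iv: "indep_var borel (\<lambda>\<omega>. indicator {y. \<bar>b j * y\<bar> > x} (\<xi> j \<omega>) :: real) borel (q i)"
        by (simp add: q_def[abs_def])
      have "integrable M (\<lambda>\<omega>. indicator {y. \<bar>b j * y\<bar> > x} (\<xi> j \<omega>) :: real)"
        by (rule integrable_const_bound[where B = 1]) auto
      \<comment> \<open>The indicator of \<open>B j\<close> agrees with a function of
        \<open>\<xi> j\<close> on \<open>space M\<close> only, so independence is transported
        through equality of distributions.\<close>
      have "distr M (borel \<Otimes>\<^sub>M borel) (\<lambda>\<omega>. (indicator {y. \<bar>b j * y\<bar> > x} (\<xi> j \<omega>) :: real, q i \<omega>))
          = distr M (borel \<Otimes>\<^sub>M borel) (\<lambda>\<omega>. (indicator (B j) \<omega> :: real, q i \<omega>))"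
        by (rule distr_cong) (auto simp: B_def indicator_def)
      moreover have "distr M borel (\<lambda>\<omega>. indicator {y. \<bar>b j * y\<bar> > x} (\<xi> j \<omega>) :: real) = distr M borel (indicator (B j))"
        by (rule distr_cong) (auto simp: B_def indicator_def)
      ultimately show ?thesis using iv unfolding indep_var_distribution_eq by simp
    qed
    have iB: "integrable M (indicator (B j) :: _ \<Rightarrow> real)" by (rule integrable_const_bound[where B = 1]) auto
    have iX: "integrable M (X m)" for m unfolding X_def[abs_def]
      by (rule Bochner_Integration.integrable_sum) (use indep_var_integrable[OF iind iB iq] in auto)
    have X0: "0 \<le> X m \<omega>" for m \<omega> unfolding X_def using q0 by (intro sum_nonneg) auto
    have EX: "expectation (\<lambda>\<omega>. \<bar>X m \<omega>\<bar>) \<le> prob (B j) * \<rho>" for m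
    proof -
      have "expectation (\<lambda>\<omega>. \<bar>X m \<omega>\<bar>) = expectation (X m)" using X0 by simp
      also have "\<dots> = (\<Sum>i\<in>{- int m..int m} - {j}. expectation (\<lambda>\<omega>. indicator (B j) \<omega> * q i \<omega>))"
        unfolding X_def[abs_def] using indep_var_integrable[OF iind iB iq] by (subst Bochner_Integration.integral_sum) auto
      also have "\<dots> = (\<Sum>i\<in>{- int m..int m} - {j}. prob (B j) * expectation (q i))"
        using indep_var_lebesgue_integral[OF iind iB iq] by (intro sum.cong) auto
      also have "\<dots> = prob (B j) * (\<Sum>i\<in>{- int m..int m} - {j}. expectation (q i))" by (simp add: sum_distrib_left)
      also have "\<dots> \<le> prob (B j) * \<rho>" by (intro mult_left_mono Eq) auto
      finally show ?thesis .
    qed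
    have Xlim: "AE \<omega> in M. (\<lambda>m. X m \<omega>) \<longlonglongrightarrow> indicator (B j) \<omega> * (Y \<omega> - q j \<omega>)"
    proof (rule AE_I'[OF N(1)], rule subsetI, rule ccontr)
      fix \<omega> assume w: "\<omega> \<in> {\<omega> \<in> space M. \<not> (\<lambda>m. X m \<omega>) \<longlonglongrightarrow> indicator (B j) \<omega> * (Y \<omega> - q j \<omega>)}" "\<omega> \<notin> N"
      have "(\<lambda>m. \<Sum>i = - int m..int m. q i \<omega>) \<longlonglongrightarrow> Y \<omega>"
        unfolding Y_def using w by (intro infsum_window sumq) auto
      then have "(\<lambda>m. indicator (B j) \<omega> * ((\<Sum>i = - int m..int m. q i \<omega>) - q j \<omega>)) \<longlonglongrightarrow> indicator (B j) \<omega> * (Y \<omega> - q j \<omega>)"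
        by (intro tendsto_intros)
      moreover have "\<forall>\<^sub>F m in sequentially. indicator (B j) \<omega> * ((\<Sum>i = - int m..int m. q i \<omega>) - q j \<omega>) = X m \<omega>"
        using eventually_ge_at_top[of "nat \<bar>j\<bar>"]
      proof eventually_elim
        case (elim m)
        then have "j \<in> {- int m..int m}" by auto
        then have "(\<Sum>i = - int m..int m. q i \<omega>) - q j \<omega> = (\<Sum>i\<in>{- int m..int m} - {j}. q i \<omega>)"
          by (subst sum.remove[of _ j]) auto
        then show ?case by (simp add: X_def sum_distrib_left)
      qed
      ultimately have "(\<lambda>m. X m \<omega>) \<longlonglongrightarrow> indicator (B j) \<omega> * (Y \<omega> - q j \<omega>)" by (rule Lim_transform_eventually)
      then show False using w by auto
    qed
    let ?Yj = "\<lambda>\<omega>. indicator (B j) \<omega> * (Y \<omega> - q j \<omega>)"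
    have iYj: "integrable M ?Yj" and EYj: "expectation (\<lambda>\<omega>. \<bar>?Yj \<omega>\<bar>) \<le> prob (B j) * \<rho>"
      using expectation_abs_limit_le[OF iX _ Xlim EX] by auto
    have "prob (B j) \<le> prob (A j \<union> ({\<omega>\<in>space M. \<bar>?Yj \<omega>\<bar> \<ge> 1 / 4} \<union> N))"
    proof (rule finite_measure_mono)
      have h: "\<bar>?Yj \<omega>\<bar> \<ge> 1 / 4" if "\<omega> \<in> B j" "\<not> Y \<omega> < 5 / 4" for \<omega>
        using that qB[OF that(1)] by simp
      show "B j \<subseteq> A j \<union> ({\<omega>\<in>space M. \<bar>?Yj \<omega>\<bar> \<ge> 1 / 4} \<union> N)"
      proof
        fix \<omega> assume w: "\<omega> \<in> B j"
        then have sp: "\<omega> \<in> space M" by (simp add: B_def)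
        show "\<omega> \<in> A j \<union> ({\<omega>\<in>space M. \<bar>?Yj \<omega>\<bar> \<ge> 1 / 4} \<union> N)"
        proof (cases "Y \<omega> < 5 / 4")
          case True
          then show ?thesis using w sp by (auto simp: A_def)
        next
          case False
          then show ?thesis using h[OF w False] sp by blast
        qed
      qed
    qed measurable
    also have "\<dots> \<le> prob (A j) + prob ({\<omega>\<in>space M. \<bar>?Yj \<omega>\<bar> \<ge> 1 / 4} \<union> N)"
      by (rule measure_Un_le) measurable
    also have "prob ({\<omega>\<in>space M. \<bar>?Yj \<omega>\<bar> \<ge> 1 / 4} \<union> N) \<le> prob {\<omega>\<in>space M. \<bar>?Yj \<omega>\<bar> \<ge> 1 / 4} + prob N"
      by (rule measure_Un_le) measurable
    also have "prob N = 0" using N(1) by (simp add: measure_eq_0_null_sets)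
    also have "prob {\<omega>\<in>space M. \<bar>?Yj \<omega>\<bar> \<ge> 1 / 4} \<le> expectation (\<lambda>\<omega>. \<bar>?Yj \<omega>\<bar>) / (1 / 4)"
      by (rule prob_ge_le_expectation) (use iYj in auto)
    also have "\<dots> \<le> prob (B j) / 2"
    proof -
      have "prob (B j) * \<rho> \<le> prob (B j) * (1 / 8)" using small by (intro mult_left_mono) (auto simp: \<rho>_def)
      then show ?thesis using EYj by simp
    qed
    finally show ?thesis by simp
  qed
  let ?J = "int ` {n..L}"
  \<comment> \<open>Two large terms would contribute 2 to Y, which is below 5/4 on these
    events.\<close>
  have disj: "disjoint_family_on A ?J"
    unfolding disjoint_family_on_def
  proof (intro ballI impI equals0I)
    fix i j \<omega> assume ij: "i \<noteq> j" and w: "\<omega> \<in> A i \<inter> A j"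
    have "\<omega> \<in> space M - N" using w by (auto simp: A_def)
    then have "(\<Sum>k\<in>{i, j}. q k \<omega>) \<le> Y \<omega>" unfolding Y_def using q0 by (intro sum_le_infsum sumq) auto
    moreover have "q i \<omega> = 1" "q j \<omega> = 1" using w by (auto simp: A_def intro!: qB)
    ultimately show False using ij w by (auto simp: A_def)
  qed
  have PB: "prob {\<omega>\<in>space M. \<bar>\<xi> 0 \<omega>\<bar> > 2 * x / real n * real j} \<le> prob (B (int j))" if j: "j \<in> {n..L}" for j
  proof -
    have "prob {\<omega>\<in>space M. \<bar>\<xi> 0 \<omega>\<bar> > 2 * x / real n * real j} = prob {\<omega>\<in>space M. \<bar>\<xi> (int j) \<omega>\<bar> > 2 * x / real n * real j}"
      by (rule prob_ident[of "\<lambda>u. \<bar>u\<bar> > 2 * x / real n * real j", symmetric]) measurable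
    also have "\<dots> \<le> prob (B (int j))"
    proof (rule finite_measure_mono)
      have jn: "real j \<ge> real n" "real n > 0" using j n by auto
      \<comment> \<open>For j \<ge> n the coefficient is at least n/(2j), so |\<xi> j| > 2 x j / n
        suffices for a large term.\<close>
      have "real n / (2 * real j) \<le> real n / (real n + real j)"
        using jn by (intro divide_left_mono) auto
      also have "\<dots> \<le> b (int j)" unfolding b_def by (rule b_coeff_harm_seq_ge)
      finally have bj: "real n / (2 * real j) \<le> b (int j)" .
      have bp: "real n / (2 * real j) > 0" using jn by simp
      show "{\<omega>\<in>space M. \<bar>\<xi> (int j) \<omega>\<bar> > 2 * x / real n * real j} \<subseteq> B (int j)"
      proof
        fix \<omega> assume w: "\<omega> \<in> {\<omega>\<in>space M. \<bar>\<xi> (int j) \<omega>\<bar> > 2 * x / real n * real j}"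
        have "x = real n / (2 * real j) * (2 * x / real n * real j)" using jn by simp
        also have "\<dots> < real n / (2 * real j) * \<bar>\<xi> (int j) \<omega>\<bar>" using w bp by (intro mult_strict_left_mono) auto
        also have "\<dots> \<le> b (int j) * \<bar>\<xi> (int j) \<omega>\<bar>" using bj by (intro mult_right_mono) auto
        also have "\<dots> \<le> \<bar>b (int j) * \<xi> (int j) \<omega>\<bar>" by (simp add: abs_mult mult_right_mono)
        finally show "\<omega> \<in> B (int j)" using w by (simp add: B_def)
      qed
    qed measurable
    finally show ?thesis .
  qed
  have sumP: "real n / (8 * x) * tail (4 * x) \<le> (\<Sum>j = n..L. prob {\<omega>\<in>space M. \<bar>\<xi> 0 \<omega>\<bar> > 2 * x / real n * real j})"
  proof -
    let ?c = "2 * x / real n * real L"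
    have cn: "real n / (4 * x) > 0" using n x by simp
    have ii: "integrable M (indicator {\<omega>\<in>space M. \<bar>\<xi> 0 \<omega>\<bar> > 2 * x / real n * real j} :: _ \<Rightarrow> real)" for j
      by (rule integrable_const_bound[where B = 1]) auto
    have "real n / (8 * x) * tail (4 * x) = real n / (4 * x) * (tail (4 * x) - tail (4 * x) / 2)" by simp
    also have "\<dots> \<le> real n / (4 * x) * (tail (4 * x) - tail ?c)" using L cn by (intro mult_left_mono) auto
    also have "\<dots> = expectation (\<lambda>\<omega>. real n / (4 * x) * (\<bar>\<xi> 0 \<omega>\<bar> * indicator {\<omega>. \<bar>\<xi> 0 \<omega>\<bar> > 4 * x} \<omega> - \<bar>\<xi> 0 \<omega>\<bar> * indicator {\<omega>. \<bar>\<xi> 0 \<omega>\<bar> > ?c} \<omega>))"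
      unfolding tail_def by (subst Bochner_Integration.integral_mult_right_zero, subst Bochner_Integration.integral_diff[OF integrable_tail integrable_tail]) (rule refl)
    also have "\<dots> \<le> expectation (\<lambda>\<omega>. \<Sum>j = n..L. indicator {\<omega>\<in>space M. \<bar>\<xi> 0 \<omega>\<bar> > 2 * x / real n * real j} \<omega>)"
    proof (rule integral_mono)
      show "integrable M (\<lambda>\<omega>. real n / (4 * x) * (\<bar>\<xi> 0 \<omega>\<bar> * indicator {\<omega>. \<bar>\<xi> 0 \<omega>\<bar> > 4 * x} \<omega> - \<bar>\<xi> 0 \<omega>\<bar> * indicator {\<omega>. \<bar>\<xi> 0 \<omega>\<bar> > ?c} \<omega>))"
        by (intro integrable_mult_right Bochner_Integration.integrable_diff integrable_tail)
      show "integrable M (\<lambda>\<omega>. \<Sum>j = n..L. indicator {\<omega>\<in>space M. \<bar>\<xi> 0 \<omega>\<bar> > 2 * x / real n * real j} \<omega> :: real)"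
        using ii by (rule Bochner_Integration.integrable_sum)
      fix \<omega> assume w: "\<omega> \<in> space M"
      let ?z = "\<bar>\<xi> 0 \<omega>\<bar>"
      have nn: "0 \<le> (\<Sum>j = n..L. indicator {\<omega>\<in>space M. \<bar>\<xi> 0 \<omega>\<bar> > 2 * x / real n * real j} \<omega> :: real)" by (intro sum_nonneg) auto
      show "real n / (4 * x) * (?z * indicator {\<omega>. \<bar>\<xi> 0 \<omega>\<bar> > 4 * x} \<omega> - ?z * indicator {\<omega>. \<bar>\<xi> 0 \<omega>\<bar> > ?c} \<omega>)
         \<le> (\<Sum>j = n..L. indicator {\<omega>\<in>space M. \<bar>\<xi> 0 \<omega>\<bar> > 2 * x / real n * real j} \<omega>)"
      proof (cases "?z > 4 * x \<and> ?z \<le> ?c")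
        case True
        \<comment> \<open>The indicator of index j is 1 exactly for j < y. The range 4 x < |\<xi> 0|
          means y > 2n, and the upper cut means y \<le> L, as the counting lemma requires.\<close>
        define y where "y = ?z * real n / (2 * x)"
        have y: "2 * real n < y" "y \<le> real L" using True x n by (auto simp: y_def field_simps)
        have "real n / (4 * x) * (?z * indicator {\<omega>. \<bar>\<xi> 0 \<omega>\<bar> > 4 * x} \<omega> - ?z * indicator {\<omega>. \<bar>\<xi> 0 \<omega>\<bar> > ?c} \<omega>) = y / 2"
          using True by (simp add: y_def)
        also have "\<dots> \<le> (\<Sum>j = n..L. if real j < y then 1 else 0)" by (rule card_interval_ge[OF y])
        also have "\<dots> = (\<Sum>j = n..L. indicator {\<omega>\<in>space M. \<bar>\<xi> 0 \<omega>\<bar> > 2 * x / real n * real j} \<omega>)"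
        proof (rule sum.cong[OF refl])
          fix j
          have "real j < y \<longleftrightarrow> ?z > 2 * x / real n * real j" using x n by (simp add: y_def field_simps)
          then show "(if real j < y then 1 else 0) = (indicator {\<omega>\<in>space M. \<bar>\<xi> 0 \<omega>\<bar> > 2 * x / real n * real j} \<omega> :: real)"
            using w by (simp add: indicator_def)
        qed
        finally show ?thesis .
      next
        case False
        then have "?z * indicator {\<omega>. \<bar>\<xi> 0 \<omega>\<bar> > 4 * x} \<omega> - ?z * indicator {\<omega>. \<bar>\<xi> 0 \<omega>\<bar> > ?c} \<omega> \<le> 0"
          by (auto simp: indicator_def)
        then have "real n / (4 * x) * (?z * indicator {\<omega>. \<bar>\<xi> 0 \<omega>\<bar> > 4 * x} \<omega> - ?z * indicator {\<omega>. \<bar>\<xi> 0 \<omega>\<bar> > ?c} \<omega>) \<le> 0"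
          using cn by (intro mult_nonneg_nonpos) auto
        then show ?thesis using nn by linarith
      qed
    qed
    also have "\<dots> = (\<Sum>j = n..L. prob {\<omega>\<in>space M. \<bar>\<xi> 0 \<omega>\<bar> > 2 * x / real n * real j})"
      using ii by (subst Bochner_Integration.integral_sum) auto
    finally show ?thesis .
  qed
  have "real n / (16 * x) * tail (4 * x) = (real n / (8 * x) * tail (4 * x)) / 2" by simp
  also have "\<dots> \<le> (\<Sum>j = n..L. prob (B (int j))) / 2"
    using sumP PB by (intro divide_right_mono order_trans[OF sumP] sum_mono) auto
  also have "\<dots> \<le> (\<Sum>j = n..L. prob (A (int j)))"
    unfolding sum_divide_distrib by (intro sum_mono PA)
  also have "\<dots> = (\<Sum>j\<in>?J. prob (A j))" by (simp add: sum.reindex)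
  also have "\<dots> = prob (\<Union>j\<in>?J. A j)"
    using disj by (intro finite_measure_finite_Union[symmetric]) auto
  finally have pA: "real n / (16 * x) * tail (4 * x) \<le> prob (\<Union>j\<in>?J. A j)" .
  have "\<exists>j\<in>half_window n L. (sym_term n j (\<lambda>k. \<xi> k \<omega>))\<^sup>2 \<ge> 1 / 5" if w: "\<omega> \<in> (\<Union>j\<in>?J. A j)" for \<omega>
  proof -
    obtain j where j: "j \<in> {n..L}" "\<omega> \<in> A (int j)" using w by auto
    have "(sym_term n (int j) (\<lambda>k. \<xi> k \<omega>))\<^sup>2 \<ge> 1 / 5"
    proof (rule sym_term_square_ge[OF _ x n])
      show "(\<lambda>k. (b_coeff harm_seq n k)\<^sup>2 * (\<xi> k \<omega>)\<^sup>2) summable_on UNIV"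
        using N(2)[of \<omega>] j(2) by (auto simp: A_def B_def b_def)
      show "x < \<bar>b_coeff harm_seq n (int j) * \<xi> (int j) \<omega>\<bar>" using j(2) by (auto simp: A_def B_def b_def)
      show "(\<Sum>\<^sub>\<infinity>k. min ((b_coeff harm_seq n k * (\<xi> k \<omega> / x))\<^sup>2) 1) < 5 / 4"
        using j(2) by (simp add: A_def Y_def q_def b_def)
      show "int j \<ge> 1" using j n by simp
    qed
    moreover have "int j \<in> half_window n L" using j n by (auto simp: half_window_def)
    ultimately show ?thesis by blast
  qed
  then show ?thesis using pA by (intro exI[of _ "\<Union>j\<in>?J. A j"] exI[of _ L]) auto
qed

text \<open>Where x^2 P(|\<xi>| > x) is comparable with \<open>H0 x\<close>, the tail moment makes
  up a fixed fraction of x \<open>Q (1 / x)\<close>. With n of order 1/\<open>Q (1 / x)\<close> the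
  event of \<open>big_jump_event\<close> then has probability bounded below independently of x, and
  the gap d in \<open>expectation_cos_S_le\<close> contradicts the limit exp (- 1/2).\<close>

lemma self_normalized_limit_imp_slowly_varying:
  assumes conv: "S_converges M \<xi> harm_seq"
    and V: "\<And>n. n \<ge> 1 \<Longrightarrow> AE \<omega> in M. (\<lambda>k. (b_coeff harm_seq n k)\<^sup>2 * (\<xi> k \<omega>)\<^sup>2) summable_on UNIV"
    and nrm: "converges_to_std_normal M (\<lambda>n \<omega>. S_proc \<xi> harm_seq n \<omega> / V_norm \<xi> harm_seq n \<omega>)"
  shows "slowly_varying H0"
proof (rule ccontr)
  assume nsv: "\<not> slowly_varying H0"
  define m1 where "m1 = expectation (\<lambda>\<omega>. \<bar>\<xi> 0 \<omega>\<bar>)"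
  have m1: "m1 \<ge> 0" unfolding m1_def by (intro Bochner_Integration.integral_nonneg) simp
  obtain e where e: "e > 0" "\<exists>\<^sub>F x in at_top. e * H0 x \<le> x\<^sup>2 * prob {\<omega>\<in>space M. \<bar>\<xi> 0 \<omega>\<bar> > x}"
    using not_slowly_varyingD[OF nsv] by blast
  \<comment> \<open>Reciprocal of the constant in x^2 \<open>Q (1 / x)\<close> \<le> (8/e + 1) x
    \<open>tail (4 * x)\<close>, established in \<open>qt\<close>.\<close>
  define c0 where "c0 = 1 / (8 / e + 1)"
  have c0: "c0 > 0" using e by (simp add: c0_def add_pos_pos)
  \<comment> \<open>8192 is 512 times 16: n \<ge> 1/(512 q), and the event has probability at least
    n/(16 x) times the tail moment.\<close>
  define d where "d = exp (- 1) * (1 - exp (- 1 / 1200)) * (c0 / 8192 :: real)"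
  have d: "d > 0" unfolding d_def using c0 by (intro mult_pos_pos) auto
  \<comment> \<open>Makes the cross term error at most d/4. Together with d/4 for small V, only half
    of the gap d is spent.\<close>
  define K where "K = 128 * m1\<^sup>2 / d + 1"
  have K: "K > 0" using d by (simp add: K_def add_nonneg_pos)
  have Kd: "32 * m1\<^sup>2 / K \<le> d / 4"
  proof -
    have "128 * m1\<^sup>2 \<le> K * d" using d by (simp add: K_def distrib_right)
    then show ?thesis using K by (simp add: divide_le_eq mult.commute)
  qed
  let ?E = "\<lambda>n. expectation (\<lambda>\<omega>. cos (S_proc \<xi> harm_seq n \<omega> / V_norm \<xi> harm_seq n \<omega>))"
  have "?E \<longlonglongrightarrow> exp (- 1 / 2)"
  proof -
    have "\<forall>t. (\<lambda>n. expectation (\<lambda>\<omega>. iexp (t * (S_proc \<xi> harm_seq n \<omega> / V_norm \<xi> harm_seq n \<omega>)))) \<longlonglongrightarrow> complex_of_real (exp (- t\<^sup>2 / 2))"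
      using nrm by (subst (asm) std_normal_iff_char) (auto simp: prob_space_axioms)
    from tendsto_Re[OF this[rule_format, of 1]]
    have lim: "(\<lambda>n. Re (expectation (\<lambda>\<omega>. iexp (1 * (S_proc \<xi> harm_seq n \<omega> / V_norm \<xi> harm_seq n \<omega>))))) \<longlonglongrightarrow> exp (- 1 / 2)" by simp
    have "Re (expectation (\<lambda>\<omega>. iexp (1 * (S_proc \<xi> harm_seq n \<omega> / V_norm \<xi> harm_seq n \<omega>)))) = ?E n" for n
    proof -
      have "integrable M (\<lambda>\<omega>. iexp (1 * (S_proc \<xi> harm_seq n \<omega> / V_norm \<xi> harm_seq n \<omega>)))"
        by (rule integrable_const_bound[where B = 1]) auto
      from integral_Re[OF this] show ?thesis by (simp add: Re_exp)
    qed
    then show ?thesis using lim by (simp only:)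
  qed
  then have "\<forall>\<^sub>F n in sequentially. ?E n > exp (- 1 / 2) - d / 2"
    using d by (intro order_tendstoD) auto
  moreover have "\<forall>\<^sub>F n in sequentially. prob {\<omega>\<in>space M. (V_norm \<xi> harm_seq n \<omega>)\<^sup>2 < K * real n} < d / 4"
    by (rule order_tendstoD(2)[OF prob_V_norm_small[OF V K]]) (use d in auto)
  ultimately have "\<forall>\<^sub>F n in sequentially. ?E n > exp (- 1 / 2) - d / 2 \<and> prob {\<omega>\<in>space M. (V_norm \<xi> harm_seq n \<omega>)\<^sup>2 < K * real n} < d / 4"
    by (rule eventually_conj)
  then obtain n0 where n0': "\<forall>n\<ge>n0. ?E n > exp (- 1 / 2) - d / 2 \<and> prob {\<omega>\<in>space M. (V_norm \<xi> harm_seq n \<omega>)\<^sup>2 < K * real n} < d / 4"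
    unfolding eventually_sequentially by (rule exE)
  have n0a: "?E n > exp (- 1 / 2) - d / 2" if "n \<ge> n0" for n
    using n0' that by blast
  have n0b: "prob {\<omega>\<in>space M. (V_norm \<xi> harm_seq n \<omega>)\<^sup>2 < K * real n} < d / 4" if "n \<ge> n0" for n
    using n0' that by blast
  \<comment> \<open>After x = X/4 the entries give x \<ge> 1, \<open>H x = H0 x\<close> and, since
    \<open>Q (1 / x)\<close> is at most m1/x, 1/(256 q) \<ge> n0 + 2.\<close>
  define X0 where "X0 = Max {4, 4 * (b0 + 1), 4 * (256 * (m1 + 1) * (real n0 + 2))}"
  obtain X where X: "X \<ge> X0" "e * H0 X \<le> X\<^sup>2 * prob {\<omega>\<in>space M. \<bar>\<xi> 0 \<omega>\<bar> > X}"
  proof (rule ccontr)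
    assume no: "\<not> thesis"
    have "\<forall>\<^sub>F x in at_top. \<not> e * H0 x \<le> x\<^sup>2 * prob {\<omega>\<in>space M. \<bar>\<xi> 0 \<omega>\<bar> > x}"
      by (rule eventually_at_top_linorderI[of X0]) (use no that in blast)
    then show False using e(2) unfolding frequently_def by (rule notE[rotated])
  qed
  define x where "x = X / 4"
  have Xx: "X = 4 * x" by (simp add: x_def)
  have x: "x \<ge> 1" "x \<ge> b0 + 1" "x \<ge> 256 * (m1 + 1) * (real n0 + 2)" using X(1) by (auto simp: X0_def x_def)
  have tl: "e * H0 (4 * x) \<le> 4 * (x * tail (4 * x))"
  proof -
    have "X * prob {\<omega>\<in>space M. \<bar>\<xi> 0 \<omega>\<bar> > X} = expectation (\<lambda>\<omega>. X * indicator {\<omega>\<in>space M. \<bar>\<xi> 0 \<omega>\<bar> > X} \<omega>)" by simp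
    also have "\<dots> \<le> tail X"
      unfolding tail_def
    proof (rule integral_mono[OF _ integrable_tail])
      show "integrable M (\<lambda>\<omega>. X * indicator {\<omega>\<in>space M. \<bar>\<xi> 0 \<omega>\<bar> > X} \<omega>)"
        by (intro integrable_mult_right integrable_const_bound[where B = 1]) auto
      show "X * indicator {\<omega>\<in>space M. \<bar>\<xi> 0 \<omega>\<bar> > X} \<omega> \<le> \<bar>\<xi> 0 \<omega>\<bar> * indicator {\<omega>. \<bar>\<xi> 0 \<omega>\<bar> > X} \<omega>" for \<omega>
        by (auto simp: indicator_def)
    qed
    finally have "X * (X * prob {\<omega>\<in>space M. \<bar>\<xi> 0 \<omega>\<bar> > X}) \<le> X * tail X" using x Xx by (intro mult_left_mono) auto
    then show ?thesis using X(2) unfolding Xx by (simp add: power2_eq_square mult.assoc)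
  qed
  have tx: "x * tail x \<le> H0 (4 * x) + x * tail (4 * x)"
  proof -
    have "expectation (\<lambda>\<omega>. x * (\<bar>\<xi> 0 \<omega>\<bar> * indicator {\<omega>. \<bar>\<xi> 0 \<omega>\<bar> > x} \<omega>))
       \<le> expectation (\<lambda>\<omega>. (\<xi> 0 \<omega>)\<^sup>2 * indicator {\<omega>. \<bar>\<xi> 0 \<omega>\<bar> \<le> 4 * x} \<omega> + x * (\<bar>\<xi> 0 \<omega>\<bar> * indicator {\<omega>. \<bar>\<xi> 0 \<omega>\<bar> > 4 * x} \<omega>))"
    proof (intro integral_mono integrable_mult_right integrable_tail Bochner_Integration.integrable_add integrable_trunc)
      fix \<omega>
      show "x * (\<bar>\<xi> 0 \<omega>\<bar> * indicator {\<omega>. \<bar>\<xi> 0 \<omega>\<bar> > x} \<omega>) \<le> (\<xi> 0 \<omega>)\<^sup>2 * indicator {\<omega>. \<bar>\<xi> 0 \<omega>\<bar> \<le> 4 * x} \<omega> + x * (\<bar>\<xi> 0 \<omega>\<bar> * indicator {\<omega>. \<bar>\<xi> 0 \<omega>\<bar> > 4 * x} \<omega>)"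
        using x mult_right_mono[of x "\<bar>\<xi> 0 \<omega>\<bar>" "\<bar>\<xi> 0 \<omega>\<bar>"] by (auto simp: indicator_def power2_eq_square)
    qed
    also have "\<dots> = H0 (4 * x) + x * tail (4 * x)"
      unfolding trunc_moment_def tail_def by (simp add: integrable_mult_right integrable_tail integrable_trunc)
    finally show ?thesis by (simp add: tail_def)
  qed
  define q where "q = Q (1 / x)"
  have q_eq: "x\<^sup>2 * q = H0 x + x * tail x" unfolding q_def using x by (intro Q_eq) auto
  have qt: "c0 * (x\<^sup>2 * q) \<le> x * tail (4 * x)"
  proof -
    have "x\<^sup>2 * q \<le> 2 * H0 (4 * x) + x * tail (4 * x)" using q_eq tx H0_mono[of x "4 * x"] x by simp
    also have "H0 (4 * x) \<le> 4 * (x * tail (4 * x)) / e" using tl e by (simp add: le_divide_eq mult.commute)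
    finally have "x\<^sup>2 * q \<le> (8 / e + 1) * (x * tail (4 * x))" by (simp add: algebra_simps)
    moreover have "8 / e + 1 > 0" using e by (simp add: add_pos_pos)
    ultimately show ?thesis unfolding c0_def by (simp add: divide_le_eq mult.commute)
  qed
  have qpos: "q > 0"
  proof -
    have "H0 x \<ge> 1" using H_ge_1[of x] H_eq_H0[OF x(2)] by simp
    then have "x\<^sup>2 * q > 0" using q_eq tail_nonneg[of x] x by (smt (verit) mult_nonneg_nonneg)
    then show ?thesis using x by (simp add: zero_less_mult_iff)
  qed
  have qle: "q \<le> m1 / x" using Q_le_abs[of "1 / x"] x by (simp add: q_def m1_def)
  \<comment> \<open>The largest n allowed by 32 n \<open>Q (1 / x)\<close> \<le> 1/8; rounding down
    loses at most a factor 2, since 1/(256 q) \<ge> 2.\<close>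
  define n where "n = nat \<lfloor>1 / (256 * q)\<rfloor>"
  have big: "1 / (256 * q) \<ge> real n0 + 2"
  proof -
    have "x * q \<le> m1" using qle x by (simp add: le_divide_eq mult.commute)
    have "256 * (m1 + 1) * (real n0 + 2) * q \<le> x * q" using x(3) qpos by (intro mult_right_mono) auto
    also have "\<dots> \<le> m1 + 1" using \<open>x * q \<le> m1\<close> by simp
    finally have "256 * (m1 + 1) * (real n0 + 2) * q \<le> m1 + 1" .
    moreover have "256 * (m1 + 1) * (real n0 + 2) * q = (m1 + 1) * (256 * q * (real n0 + 2))"
      by (simp only: ac_simps)
    ultimately have "(m1 + 1) * (256 * q * (real n0 + 2)) \<le> (m1 + 1) * 1" by (simp only: mult_1_right)
    then have "256 * q * (real n0 + 2) \<le> 1" using m1 by (subst (asm) mult_le_cancel_left_pos) auto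
    then show ?thesis using qpos by (simp add: le_divide_eq mult.commute)
  qed
  have nn: "real n \<le> 1 / (256 * q)" "real n \<ge> 1 / (256 * q) - 1" using big unfolding n_def by linarith+
  have n: "n \<ge> n0" "n \<ge> 1" using nn(2) big by linarith+
  have nlow: "real n \<ge> 1 / (512 * q)"
  proof -
    have "1 / (256 * q) = 2 * (1 / (512 * q))" by simp
    then show ?thesis using nn(2) big by linarith
  qed
  have small: "32 * real n * Q (1 / x) \<le> 1 / 8"
  proof -
    have "real n * (256 * q) \<le> 1" using nn(1) qpos by (simp add: le_divide_eq)
    then show ?thesis by (simp add: q_def)
  qed
  obtain A L where A: "A \<in> events" "prob A \<ge> real n / (16 * x) * tail (4 * x)"
    "AE \<omega> in M. \<omega> \<in> A \<longrightarrow> (\<exists>j\<in>half_window n L. (sym_term n j (\<lambda>k. \<xi> k \<omega>))\<^sup>2 \<ge> 1 / 5)"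
    using big_jump_event[OF n(2) _ small V[OF n(2)]] x by auto
  have "c0 / 8192 \<le> prob A"
  proof -
    have "c0 / 8192 = (1 / (512 * q)) * (c0 * q) / 16" using qpos by simp
    also have "\<dots> \<le> real n * (c0 * q) / 16"
      using nlow c0 qpos by (intro divide_right_mono mult_right_mono) auto
    also have "\<dots> = real n / (16 * x\<^sup>2) * (c0 * (x\<^sup>2 * q))" using x by simp
    also have "\<dots> \<le> real n / (16 * x\<^sup>2) * (x * tail (4 * x))" using qt by (intro mult_left_mono) auto
    also have "\<dots> = real n / (16 * x) * tail (4 * x)" using x by (simp add: power2_eq_square)
    finally show ?thesis using A(2) by linarith
  qed
  then have dA: "d \<le> exp (- 1) * (1 - exp (- 1 / 1200)) * prob A"
    unfolding d_def by (intro mult_left_mono) auto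
  have "?E n \<le> exp (- 1 / 2) + prob {\<omega>\<in>space M. (V_norm \<xi> harm_seq n \<omega>)\<^sup>2 < K * real n}
        + 32 * (expectation (\<lambda>\<omega>. \<bar>\<xi> 0 \<omega>\<bar>))\<^sup>2 / K - exp (- 1) * (1 - exp (- 1 / 1200)) * prob A"
    using conv n(2) by (intro expectation_cos_S_le[OF n(2) K _ V[OF n(2)] A(1,3)]) (auto simp: S_converges_def)
  then show False using dA n0a[OF n(1)] n0b[OF n(1)] Kd unfolding m1_def[symmetric] by linarith
qed

end

theorem theorem2p5:
  fixes M :: "'a measure" and \<xi> :: "int \<Rightarrow> 'a \<Rightarrow> real"
  assumes "prob_space M"
    and "prob_space.indep_vars M (\<lambda>_. borel) \<xi> UNIV"
    and "\<And>k. distr M borel (\<xi> k) = distr M borel (\<xi> 0)"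
    and "integrable M (\<xi> 0)"
    and "prob_space.expectation M (\<xi> 0) = 0"
    and "(\<integral>\<^sup>+\<omega>. ennreal ((\<xi> 0 \<omega>)\<^sup>2) \<partial>M) = \<infinity>"
  defines "H \<equiv> H_fun M (\<xi> 0)"
  defines "stmt1 \<equiv> slowly_varying (trunc_moment M (\<xi> 0))"
  defines "stmt2 \<equiv>
    (\<forall>a. admissible H a \<longrightarrow>
       S_converges M \<xi> a \<and>
       (\<forall>n\<ge>1. D_norm H a n < \<infinity>) \<and>
       converges_to_std_normal M (\<lambda>n \<omega>. S_proc \<xi> a n \<omega> / real_of_ereal (D_norm H a n)))"
  defines "stmt3 \<equiv>
    (\<forall>a. admissible H a \<longrightarrow>
       S_converges M \<xi> a \<and>
       (\<forall>n\<ge>1. AE \<omega> in M. (\<lambda>k. (b_coeff a n k)\<^sup>2 * (\<xi> k \<omega>)\<^sup>2) summable_on UNIV) \<and>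
       converges_to_std_normal M (\<lambda>n \<omega>. S_proc \<xi> a n \<omega> / V_norm \<xi> a n \<omega>))"
  shows "(stmt1 \<longleftrightarrow> stmt2) \<and> (stmt2 \<longleftrightarrow> stmt3)"
proof -
  have "iid_seq M \<xi>"
    using assms(1-6)
    by (simp add: iid_seq_def iid_seq_axioms_def infinite_variance_def infinite_variance_axioms_def)
  then interpret iid_seq M \<xi> .
  have 12: "stmt2" and 13: "stmt3" if stmt1
    using slowly_varying_imp_asymptotic_normality that unfolding stmt1_def stmt2_def stmt3_def H_def by blast+
  have 21: stmt1 if stmt2
    using normal_limit_imp_slowly_varying admissible_unit_seq that unfolding stmt1_def stmt2_def H_def by blast
  have 31: stmt1 if stmt3
    using self_normalized_limit_imp_slowly_varying admissible_harm_seq that unfolding stmt1_def stmt3_def H_def by blast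
  show ?thesis using 12 13 21 31 by blast
qed

end
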